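(* Let $R$ be a unital commutative ring and $G$ be a finite group. The shifted Burnside functor $RB_G$ is separable as a Green biset functor over $R$ if and only if $|G|\in R^{\times}$.
   Context: Biset functors. For finite groups $H,G$, an $(H,G)$-biset is a set with commuting left $H$-action and right $G$-action, equivalently an $(H\times G)$-set via $(h,g)u=hug^{-1}$. $RB(G)=R\otimes_{\mathbb{Z}}B(G)$ with $B(G)$ the Burnside group of $G$ (Grothendieck group of finite $G$-sets). The biset category $R\mathcal{C}$ has the finite groups as objects and $\mathrm{Hom}(G,H)=RB(H,G):=RB(H\times G)$; composition is the bilinear extension of $V\circ U=V\times_H U$ for a $(K,H)$-biset $V$ and an $(H,G)$-biset $U$; the identity of $G$ is the $(G,G)$-biset $G$. Biset functors over $R$ are $R$-linear functors $R\mathcal{C}\to R\text{-Mod}$. The direct product of groups and of bisets makes $R\mathcal{C}$ symmetric monoidal, with unit the trivial group $\mathbf{1}$; biset functors form an abelian symmetric monoidal category under Day convolution $\otimes$ with unit $RB=RB(-,\mathbf{1})$. A Green biset functor $A$ is a monoid for $\otimes$; equivalently it is a biset functor with bilinear products $A(H)\times A(K)\to A(H\times K)$, natural with respect to bisets, associative, and with identity element in $A(\mathbf{1})$. Separability. A Green biset functor $A$ is separable if the product morphism $\mu_A:A\otimes A\to A$ is a split epimorphism of $(A,A)$-bimodules, equivalently if $A$ is projective as an $(A,A)$-bimodule. The functor $RB_G$. For a finite group $H$, $RB_G(H)=RB(H\times G)$, and for a morphism $\alpha$ of $R\mathcal{C}$, $RB_G(\alpha)=RB(\alpha\times G)$,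 where $G$ is the identity $(G,G)$-biset. The product $RB_G(H)\times RB_G(K)\to RB_G(H\times K)$ sends (the class of) an $(H\times G)$-set $X$ and a $(K\times G)$-set $Y$ to the $(H\times K\times G)$-set $X\times Y$ with action $(h,k,g)(x,y)=((h,g)x,(k,g)y)$. The identity element in $RB_G(\mathbf{1})=RB(G)$ is the trivial one-point $G$-set. *)

theory Defs
  imports "HOL-Algebra.Module" "HOL-Algebra.Group_Action" "HOL-Algebra.IntRing"
    "HOL-Library.Nat_Bijection"
begin

section \<open>Modules given by generators and relations\<close>

text \<open>The fields \<open>mult\<close> and \<open>one\<close>, which the record type of modules inherits from rings, play
  no role in a module and are left undefined throughout.\<close>

definition free_module :: "('r, 'q) ring_scheme \<Rightarrow> 's set \<Rightarrow> ('r, 's \<Rightarrow> 'r) module" where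
  "free_module R S =
    \<lparr>carrier = {f. (\<forall>s\<in>S. f s \<in> carrier R) \<and> (\<forall>s. s \<notin> S \<longrightarrow> f s = \<zero>\<^bsub>R\<^esub>) \<and>
                   finite {s. f s \<noteq> \<zero>\<^bsub>R\<^esub>}},
     monoid.mult = undefined,
     one = undefined,
     zero = (\<lambda>s. \<zero>\<^bsub>R\<^esub>),
     add = (\<lambda>f g s. f s \<oplus>\<^bsub>R\<^esub> g s),
     smult = (\<lambda>r f s. r \<otimes>\<^bsub>R\<^esub> f s)\<rparr>"

definition free_gen :: "('r, 'q) ring_scheme \<Rightarrow> 's \<Rightarrow> 's \<Rightarrow> 'r" where
  "free_gen R s = (\<lambda>t. if t = s then \<one>\<^bsub>R\<^esub> else \<zero>\<^bsub>R\<^esub>)"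

definition submodule_span ::
    "('r, 'q) ring_scheme \<Rightarrow> ('r, 'm) module \<Rightarrow> 'm set \<Rightarrow> 'm set" where
  "submodule_span R M X = \<Inter>{N. submodule N R M \<and> X \<subseteq> N}"

definition quotient_module ::
    "('r, 'q) ring_scheme \<Rightarrow> ('r, 'm) module \<Rightarrow> 'm set \<Rightarrow> ('r, 'm set) module" where
  "quotient_module R M N =
    \<lparr>carrier = a_rcosets\<^bsub>M\<^esub> N,
     monoid.mult = undefined,
     one = undefined,
     zero = N,
     add = (\<lambda>C D. C <+>\<^bsub>M\<^esub> D),
     smult = (\<lambda>r C. \<Union>x\<in>C. N +>\<^bsub>M\<^esub> (r \<odot>\<^bsub>M\<^esub> x))\<rparr>"

text \<open>A relation is a pair \<open>(x, y)\<close> of elements of the free module, standing for \<open>x = y\<close>.\<close>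

definition relation_span ::
    "('r, 'q) ring_scheme \<Rightarrow> 's set \<Rightarrow> (('s \<Rightarrow> 'r) \<times> ('s \<Rightarrow> 'r)) set \<Rightarrow> ('s \<Rightarrow> 'r) set" where
  "relation_span R S E =
    submodule_span R (free_module R S) {x \<ominus>\<^bsub>free_module R S\<^esub> y | x y. (x, y) \<in> E}"

definition presented_module ::
    "('r, 'q) ring_scheme \<Rightarrow> 's set \<Rightarrow> (('s \<Rightarrow> 'r) \<times> ('s \<Rightarrow> 'r)) set \<Rightarrow>
      ('r, ('s \<Rightarrow> 'r) set) module" where
  "presented_module R S E = quotient_module R (free_module R S) (relation_span R S E)"

definition presented_gen ::
    "('r, 'q) ring_scheme \<Rightarrow> 's set \<Rightarrow> (('s \<Rightarrow> 'r) \<times> ('s \<Rightarrow> 'r)) set \<Rightarrow> 's \<Rightarrow> ('s \<Rightarrow> 'r) set" where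
  "presented_gen R S E s = relation_span R S E +>\<^bsub>free_module R S\<^esub> free_gen R s"

text \<open>The linear map on a presented module with prescribed values \<open>f s\<close> on the generators,
  evaluated on a representative of the coset \<open>C\<close>. It is independent of the representative
  as soon as \<open>f\<close> respects the relations.\<close>

definition lin_ext ::
    "('r, 'q) ring_scheme \<Rightarrow> ('r, 'n) module \<Rightarrow> ('s \<Rightarrow> 'n) \<Rightarrow> ('s \<Rightarrow> 'r) set \<Rightarrow> 'n" where
  "lin_ext R N f C =
    (let c = (SOME c. c \<in> C) in \<Oplus>\<^bsub>N\<^esub>s\<in>{s. c s \<noteq> \<zero>\<^bsub>R\<^esub>}. c s \<odot>\<^bsub>N\<^esub> f s)"

definition linear_map ::
    "('r, 'q) ring_scheme \<Rightarrow> ('r, 'm) module \<Rightarrow> ('r, 'n) module \<Rightarrow> ('m \<Rightarrow> 'n) \<Rightarrow> bool" where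
  "linear_map R M N f \<longleftrightarrow>
    f \<in> carrier M \<rightarrow> carrier N \<and>
    (\<forall>x\<in>carrier M. \<forall>y\<in>carrier M. f (x \<oplus>\<^bsub>M\<^esub> y) = f x \<oplus>\<^bsub>N\<^esub> f y) \<and>
    (\<forall>r\<in>carrier R. \<forall>x\<in>carrier M. f (r \<odot>\<^bsub>M\<^esub> x) = r \<odot>\<^bsub>N\<^esub> f x)"

text \<open>\<open>scalar_ext R B\<close> is \<open>R \<otimes>\<^sub>\<int> B\<close> for an abelian group \<open>B\<close>; the \<open>\<int>\<close>-balancing of the
  tensors follows from biadditivity.\<close>

definition scalar_ext_rels ::
    "('r, 'q) ring_scheme \<Rightarrow> ('b, 'p) ring_scheme \<Rightarrow>
      (('r \<times> 'b \<Rightarrow> 'r) \<times> ('r \<times> 'b \<Rightarrow> 'r)) set" where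
  "scalar_ext_rels R B =
    (let F = free_module R (carrier R \<times> carrier B); d = free_gen R in
      {(d (r \<oplus>\<^bsub>R\<^esub> s, b), d (r, b) \<oplus>\<^bsub>F\<^esub> d (s, b)) | r s b.
        r \<in> carrier R \<and> s \<in> carrier R \<and> b \<in> carrier B} \<union>
      {(d (r, b \<oplus>\<^bsub>B\<^esub> c), d (r, b) \<oplus>\<^bsub>F\<^esub> d (r, c)) | r b c.
        r \<in> carrier R \<and> b \<in> carrier B \<and> c \<in> carrier B} \<union>
      {(d (s \<otimes>\<^bsub>R\<^esub> r, b), s \<odot>\<^bsub>F\<^esub> d (r, b)) | r s b.
        r \<in> carrier R \<and> s \<in> carrier R \<and> b \<in> carrier B})"

definition scalar_ext ::
    "('r, 'q) ring_scheme \<Rightarrow> ('b, 'p) ring_scheme \<Rightarrow> ('r, ('r \<times> 'b \<Rightarrow> 'r) set) module" where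
  "scalar_ext R B = presented_module R (carrier R \<times> carrier B) (scalar_ext_rels R B)"

definition scalar_tensor ::
    "('r, 'q) ring_scheme \<Rightarrow> ('b, 'p) ring_scheme \<Rightarrow> 'r \<Rightarrow> 'b \<Rightarrow> ('r \<times> 'b \<Rightarrow> 'r) set" where
  "scalar_tensor R B r b =
    presented_gen R (carrier R \<times> carrier B) (scalar_ext_rels R B) (r, b)"


section \<open>Finite G-sets and Burnside groups\<close>

text \<open>A \<open>G\<close>-set is a pair \<open>(E, \<phi>)\<close> with \<open>group_action G E \<phi>\<close>. Constructions on \<open>G\<close>-sets may
  change the type of the points; the Burnside group is generated by the finite \<open>G\<close>-sets with
  points in \<open>\<nat>\<close>, which represent all isomorphism classes.\<close>

type_synonym ('g, 'x) gset = "'x set \<times> ('g \<Rightarrow> 'x \<Rightarrow> 'x)"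

definition gset_iso ::
    "('g, 'p) monoid_scheme \<Rightarrow> ('g, 'x) gset \<Rightarrow> ('g, 'y) gset \<Rightarrow> bool" where
  "gset_iso G X Y \<longleftrightarrow>
    (\<exists>f. bij_betw f (fst X) (fst Y) \<and>
      (\<forall>g\<in>carrier G. \<forall>x\<in>fst X. f (snd X g x) = snd Y g (f x)))"

definition gset_sum :: "('g, 'x) gset \<Rightarrow> ('g, 'y) gset \<Rightarrow> ('g, 'x + 'y) gset" where
  "gset_sum X Y =
    (Sum_Type.Plus (fst X) (fst Y),
     \<lambda>g. \<lambda>z\<in>Sum_Type.Plus (fst X) (fst Y). map_sum (snd X g) (snd Y g) z)"

definition fin_gsets :: "('g, 'p) monoid_scheme \<Rightarrow> ('g, nat) gset set" where
  "fin_gsets G = {(E, \<phi>). finite E \<and> group_action G E \<phi>}"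

text \<open>The relations identify isomorphic \<open>G\<close>-sets: taking \<open>Y\<close> to be empty, they give
  \<open>[Z] = [X] + [\<emptyset>]\<close> for \<open>Z \<cong> X\<close>, and \<open>[\<emptyset>] = [\<emptyset>] + [\<emptyset>]\<close>.\<close>

definition burnside_rels ::
    "('g, 'p) monoid_scheme \<Rightarrow> ((('g, nat) gset \<Rightarrow> int) \<times> (('g, nat) gset \<Rightarrow> int)) set" where
  "burnside_rels G =
    {(free_gen \<Z> Z, free_gen \<Z> X \<oplus>\<^bsub>free_module \<Z> (fin_gsets G)\<^esub> free_gen \<Z> Y) | X Y Z.
      X \<in> fin_gsets G \<and> Y \<in> fin_gsets G \<and> Z \<in> fin_gsets G \<and> gset_iso G Z (gset_sum X Y)}"

type_synonym 'g burnside_elt = "(('g, nat) gset \<Rightarrow> int) set"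

definition burnside :: "('g, 'p) monoid_scheme \<Rightarrow> (int, 'g burnside_elt) module" where
  "burnside G = presented_module \<Z> (fin_gsets G) (burnside_rels G)"

definition burnside_class ::
    "('g, 'p) monoid_scheme \<Rightarrow> ('g, 'x) gset \<Rightarrow> 'g burnside_elt" where
  "burnside_class G X =
    presented_gen \<Z> (fin_gsets G) (burnside_rels G)
      (SOME Y. Y \<in> fin_gsets G \<and> gset_iso G X Y)"

type_synonym ('r, 'g) rb_elt = "('r \<times> 'g burnside_elt \<Rightarrow> 'r) set"

definition RB ::
    "('r, 'q) ring_scheme \<Rightarrow> ('g, 'p) monoid_scheme \<Rightarrow> ('r, ('r, 'g) rb_elt) module" where
  "RB R G = scalar_ext R (burnside G)"

definition RB_class ::
    "('r, 'q) ring_scheme \<Rightarrow> ('g, 'p) monoid_scheme \<Rightarrow> ('g, 'x) gset \<Rightarrow> ('r, 'g) rb_elt" where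
  "RB_class R G X = scalar_tensor R (burnside G) \<one>\<^bsub>R\<^esub> (burnside_class G X)"

text \<open>Bilinear extension of an operation that takes a \<open>G\<close>-set and an \<open>H\<close>-set to a \<open>K\<close>-set,
  first to Burnside groups and then to \<open>RB\<close>. The groups \<open>G\<close> and \<open>H\<close> enter only through their
  types.\<close>

definition burnside_bilin ::
    "('k, 'p) monoid_scheme \<Rightarrow> (('g, nat) gset \<Rightarrow> ('h, nat) gset \<Rightarrow> ('k, 'x) gset) \<Rightarrow>
      'g burnside_elt \<Rightarrow> 'h burnside_elt \<Rightarrow> 'k burnside_elt" where
  "burnside_bilin K op b c =
    lin_ext \<Z> (burnside K)
      (\<lambda>X. lin_ext \<Z> (burnside K) (\<lambda>Y. burnside_class K (op X Y)) c) b"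

definition RB_bilin ::
    "('r, 'q) ring_scheme \<Rightarrow> ('k, 'p) monoid_scheme \<Rightarrow>
      (('g, nat) gset \<Rightarrow> ('h, nat) gset \<Rightarrow> ('k, 'x) gset) \<Rightarrow>
      ('r, 'g) rb_elt \<Rightarrow> ('r, 'h) rb_elt \<Rightarrow> ('r, 'k) rb_elt" where
  "RB_bilin R K op x y =
    lin_ext R (RB R K)
      (\<lambda>(r, b). lin_ext R (RB R K)
        (\<lambda>(s, c). scalar_tensor R (burnside K) (r \<otimes>\<^bsub>R\<^esub> s) (burnside_bilin K op b c)) y) x"


section \<open>Bisets\<close>

text \<open>An \<open>(H, G)\<close>-biset is an \<open>H \<times>\<times> G\<close>-set, with \<open>(h, g) u = h u g\<^sup>-\<^sup>1\<close>. So \<open>(h, \<one>) u = h u\<close>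
  and \<open>(\<one>, g) u = u g\<^sup>-\<^sup>1\<close>.\<close>

text \<open>The \<open>(H, G)\<close>-biset \<open>H\<close> with \<open>G\<close> acting on the right through \<open>f : G \<rightarrow> H\<close>.\<close>

definition hom_biset ::
    "('h, 'p) monoid_scheme \<Rightarrow> ('g \<Rightarrow> 'h) \<Rightarrow> ('h \<times> 'g, 'h) gset" where
  "hom_biset H f =
    (carrier H, \<lambda>(h, g). \<lambda>u\<in>carrier H. h \<otimes>\<^bsub>H\<^esub> u \<otimes>\<^bsub>H\<^esub> inv\<^bsub>H\<^esub> (f g))"

text \<open>\<open>V \<times>\<^sub>H U\<close> for a \<open>(K, H)\<close>-biset \<open>V\<close> and an \<open>(H, G)\<close>-biset \<open>U\<close>: its points are the orbits
  of the action \<open>h (v, u) = (v h\<^sup>-\<^sup>1, h u)\<close> of \<open>H\<close> on \<open>V \<times> U\<close>.\<close>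

definition biset_orbit ::
    "('k, 'p1) monoid_scheme \<Rightarrow> ('h, 'p2) monoid_scheme \<Rightarrow> ('g, 'p3) monoid_scheme \<Rightarrow>
      ('k \<times> 'h, 'x) gset \<Rightarrow> ('h \<times> 'g, 'y) gset \<Rightarrow> 'x \<times> 'y \<Rightarrow> ('x \<times> 'y) set" where
  "biset_orbit K H G V U =
    (\<lambda>(v, u). {(snd V (\<one>\<^bsub>K\<^esub>, h) v, snd U (h, \<one>\<^bsub>G\<^esub>) u) | h. h \<in> carrier H})"

definition biset_comp ::
    "('k, 'p1) monoid_scheme \<Rightarrow> ('h, 'p2) monoid_scheme \<Rightarrow> ('g, 'p3) monoid_scheme \<Rightarrow>
      ('k \<times> 'h, 'x) gset \<Rightarrow> ('h \<times> 'g, 'y) gset \<Rightarrow> ('k \<times> 'g, ('x \<times> 'y) set) gset" where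
  "biset_comp K H G V U =
    (biset_orbit K H G V U ` (fst V \<times> fst U),
     \<lambda>(k, g). \<lambda>C\<in>biset_orbit K H G V U ` (fst V \<times> fst U).
       map_prod (snd V (k, \<one>\<^bsub>H\<^esub>)) (snd U (\<one>\<^bsub>H\<^esub>, g)) ` C)"

text \<open>The same for an \<open>H\<close>-set \<open>X\<close>, that is, an \<open>(H, \<one>)\<close>-biset: the \<open>K\<close>-set \<open>V \<times>\<^sub>H X\<close>.\<close>

definition biset_apply_orbit ::
    "('k, 'p1) monoid_scheme \<Rightarrow> ('h, 'p2) monoid_scheme \<Rightarrow>
      ('k \<times> 'h, 'x) gset \<Rightarrow> ('h, 'y) gset \<Rightarrow> 'x \<times> 'y \<Rightarrow> ('x \<times> 'y) set" where
  "biset_apply_orbit K H V X =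
    (\<lambda>(v, x). {(snd V (\<one>\<^bsub>K\<^esub>, h) v, snd X h x) | h. h \<in> carrier H})"

definition biset_apply ::
    "('k, 'p1) monoid_scheme \<Rightarrow> ('h, 'p2) monoid_scheme \<Rightarrow>
      ('k \<times> 'h, 'x) gset \<Rightarrow> ('h, 'y) gset \<Rightarrow> ('k, ('x \<times> 'y) set) gset" where
  "biset_apply K H V X =
    (biset_apply_orbit K H V X ` (fst V \<times> fst X),
     \<lambda>k. \<lambda>C\<in>biset_apply_orbit K H V X ` (fst V \<times> fst X).
       map_prod (snd V (k, \<one>\<^bsub>H\<^esub>)) id ` C)"

text \<open>The direct product of an \<open>(H, G)\<close>-biset and an \<open>(H', G')\<close>-biset.\<close>

definition biset_times ::
    "('h \<times> 'g, 'x) gset \<Rightarrow> ('h' \<times> 'g', 'y) gset \<Rightarrow>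
      (('h \<times> 'h') \<times> ('g \<times> 'g'), 'x \<times> 'y) gset" where
  "biset_times U V =
    (fst U \<times> fst V,
     \<lambda>((h, h'), (g, g')). \<lambda>(u, v)\<in>fst U \<times> fst V. (snd U (h, g) u, snd V (h', g') v))"


section \<open>The biset category\<close>

text \<open>As objects we take the finite groups with elements in \<open>\<nat>\<close>. Every finite group is isomorphic
  to one of these, so this is an equivalent small subcategory of the category of all finite groups;
  it is made closed under direct products by means of the pairing bijection \<open>prod_encode\<close>.\<close>

type_synonym obj = "nat monoid"

definition fin_groups :: "obj set" where
  "fin_groups = {H. group H \<and> finite (carrier H)}"

definition obj_times :: "obj \<Rightarrow> obj \<Rightarrow> obj" (infixr \<open>\<boxtimes>\<close> 80) where
  "H \<boxtimes> K =
    \<lparr>carrier = prod_encode ` (carrier H \<times> carrier K),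
     monoid.mult = (\<lambda>x y. prod_encode (prod_decode x \<otimes>\<^bsub>H \<times>\<times> K\<^esub> prod_decode y)),
     one = prod_encode (\<one>\<^bsub>H\<^esub>, \<one>\<^bsub>K\<^esub>)\<rparr>"

definition obj_unit :: obj where
  "obj_unit = \<lparr>carrier = {0}, monoid.mult = (\<lambda>x y. 0), one = 0\<rparr>"

text \<open>A morphism from \<open>G\<close> to \<open>H\<close> is an element of \<open>RB R (H \<times>\<times> G)\<close>.\<close>

type_synonym 'r mor = "('r, nat \<times> nat) rb_elt"

definition RB_comp ::
    "('r, 'q) ring_scheme \<Rightarrow> ('k, 'p1) monoid_scheme \<Rightarrow> ('h, 'p2) monoid_scheme \<Rightarrow>
      ('g, 'p3) monoid_scheme \<Rightarrow>
      ('r, 'k \<times> 'h) rb_elt \<Rightarrow> ('r, 'h \<times> 'g) rb_elt \<Rightarrow> ('r, 'k \<times> 'g) rb_elt" where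
  "RB_comp R K H G = RB_bilin R (K \<times>\<times> G) (biset_comp K H G)"

definition RB_hom ::
    "('r, 'q) ring_scheme \<Rightarrow> 'g monoid \<Rightarrow> 'h monoid \<Rightarrow> ('g \<Rightarrow> 'h) \<Rightarrow> ('r, 'h \<times> 'g) rb_elt" where
  "RB_hom R G H f = RB_class R (H \<times>\<times> G) (hom_biset H f)"

definition RB_id :: "('r, 'q) ring_scheme \<Rightarrow> 'g monoid \<Rightarrow> ('r, 'g \<times> 'g) rb_elt" where
  "RB_id R G = RB_hom R G G id"

text \<open>The tensor product of morphisms \<open>\<alpha> : G \<rightarrow> H\<close> and \<open>\<beta> : G' \<rightarrow> H'\<close>, as a morphism
  \<open>G \<times> G' \<rightarrow> H \<times> H'\<close>, first for \<open>\<times>\<times>\<close> and then for \<open>\<boxtimes>\<close>.\<close>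

definition RB_times ::
    "('r, 'q) ring_scheme \<Rightarrow> 'g monoid \<Rightarrow> 'h monoid \<Rightarrow> 'g' monoid \<Rightarrow> 'h' monoid \<Rightarrow>
      ('r, 'h \<times> 'g) rb_elt \<Rightarrow> ('r, 'h' \<times> 'g') rb_elt \<Rightarrow>
      ('r, ('h \<times> 'h') \<times> ('g \<times> 'g')) rb_elt" where
  "RB_times R G H G' H' = RB_bilin R ((H \<times>\<times> H') \<times>\<times> (G \<times>\<times> G')) biset_times"

definition mor_times ::
    "('r, 'q) ring_scheme \<Rightarrow> obj \<Rightarrow> obj \<Rightarrow> obj \<Rightarrow> obj \<Rightarrow> 'r mor \<Rightarrow> 'r mor \<Rightarrow> 'r mor" where
  "mor_times R G H G' H' =
    RB_bilin R ((H \<boxtimes> H') \<times>\<times> (G \<boxtimes> G'))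
      (\<lambda>U V. (fst (biset_times U V),
              snd (biset_times U V) \<circ> map_prod prod_decode prod_decode))"

definition assoc_fwd :: "nat \<Rightarrow> nat" where
  "assoc_fwd x =
    (let (y, c) = prod_decode x; (a, b) = prod_decode y
     in prod_encode (a, prod_encode (b, c)))"

definition assoc_bwd :: "nat \<Rightarrow> nat" where
  "assoc_bwd x =
    (let (a, y) = prod_decode x; (b, c) = prod_decode y
     in prod_encode (prod_encode (a, b), c))"

definition assoc_mor :: "('r, 'q) ring_scheme \<Rightarrow> obj \<Rightarrow> obj \<Rightarrow> obj \<Rightarrow> 'r mor" where
  "assoc_mor R H K L = RB_hom R ((H \<boxtimes> K) \<boxtimes> L) (H \<boxtimes> (K \<boxtimes> L)) assoc_fwd"

definition assoc_inv_mor :: "('r, 'q) ring_scheme \<Rightarrow> obj \<Rightarrow> obj \<Rightarrow> obj \<Rightarrow> 'r mor" where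
  "assoc_inv_mor R H K L = RB_hom R (H \<boxtimes> (K \<boxtimes> L)) ((H \<boxtimes> K) \<boxtimes> L) assoc_bwd"

definition left_unit_mor :: "('r, 'q) ring_scheme \<Rightarrow> obj \<Rightarrow> 'r mor" where
  "left_unit_mor R H = RB_hom R (obj_unit \<boxtimes> H) H (snd \<circ> prod_decode)"

definition right_unit_mor :: "('r, 'q) ring_scheme \<Rightarrow> obj \<Rightarrow> 'r mor" where
  "right_unit_mor R H = RB_hom R (H \<boxtimes> obj_unit) H (fst \<circ> prod_decode)"


section \<open>Biset functors, Green biset functors and bimodules\<close>

text \<open>\<open>fmor M G H \<alpha>\<close> is the map \<open>M(G) \<rightarrow> M(H)\<close> induced by \<open>\<alpha> : G \<rightarrow> H\<close>.\<close>

record ('r, 'm) biset_fun =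
  fobj :: "obj \<Rightarrow> ('r, 'm) module"
  fmor :: "obj \<Rightarrow> obj \<Rightarrow> 'r mor \<Rightarrow> 'm \<Rightarrow> 'm"

definition biset_functor :: "('r, 'q) ring_scheme \<Rightarrow> ('r, 'm, 'z) biset_fun_scheme \<Rightarrow> bool" where
  "biset_functor R M \<longleftrightarrow>
    (\<forall>H\<in>fin_groups. module R (fobj M H)) \<and>
    (\<forall>G\<in>fin_groups. \<forall>H\<in>fin_groups.
      (\<forall>\<alpha>\<in>carrier (RB R (H \<times>\<times> G)). linear_map R (fobj M G) (fobj M H) (fmor M G H \<alpha>)) \<and>
      (\<forall>m\<in>carrier (fobj M G).
        linear_map R (RB R (H \<times>\<times> G)) (fobj M H) (\<lambda>\<alpha>. fmor M G H \<alpha> m))) \<and>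
    (\<forall>H\<in>fin_groups. \<forall>m\<in>carrier (fobj M H). fmor M H H (RB_id R H) m = m) \<and>
    (\<forall>G\<in>fin_groups. \<forall>H\<in>fin_groups. \<forall>K\<in>fin_groups.
      \<forall>\<beta>\<in>carrier (RB R (K \<times>\<times> H)). \<forall>\<alpha>\<in>carrier (RB R (H \<times>\<times> G)). \<forall>m\<in>carrier (fobj M G).
        fmor M G K (RB_comp R K H G \<beta> \<alpha>) m = fmor M H K \<beta> (fmor M G H \<alpha> m))"

text \<open>\<open>gmult A H K\<close> is the product \<open>A(H) \<times> A(K) \<rightarrow> A(H \<boxtimes> K)\<close>.\<close>

record ('r, 'm) green_fun = "('r, 'm) biset_fun" +
  gmult :: "obj \<Rightarrow> obj \<Rightarrow> 'm \<Rightarrow> 'm \<Rightarrow> 'm"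
  gunit :: "'m"

definition green_biset_functor ::
    "('r, 'q) ring_scheme \<Rightarrow> ('r, 'm, 'z) green_fun_scheme \<Rightarrow> bool" where
  "green_biset_functor R A \<longleftrightarrow>
    biset_functor R A \<and>
    (\<forall>H\<in>fin_groups. \<forall>K\<in>fin_groups.
      (\<forall>a\<in>carrier (fobj A H). linear_map R (fobj A K) (fobj A (H \<boxtimes> K)) (\<lambda>b. gmult A H K a b)) \<and>
      (\<forall>b\<in>carrier (fobj A K). linear_map R (fobj A H) (fobj A (H \<boxtimes> K)) (\<lambda>a. gmult A H K a b))) \<and>
    (\<forall>G\<in>fin_groups. \<forall>H\<in>fin_groups. \<forall>G'\<in>fin_groups. \<forall>H'\<in>fin_groups.
      \<forall>\<alpha>\<in>carrier (RB R (H \<times>\<times> G)). \<forall>\<beta>\<in>carrier (RB R (H' \<times>\<times> G')).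
      \<forall>a\<in>carrier (fobj A G). \<forall>b\<in>carrier (fobj A G').
        fmor A (G \<boxtimes> G') (H \<boxtimes> H') (mor_times R G H G' H' \<alpha> \<beta>) (gmult A G G' a b) =
        gmult A H H' (fmor A G H \<alpha> a) (fmor A G' H' \<beta> b)) \<and>
    (\<forall>H\<in>fin_groups. \<forall>K\<in>fin_groups. \<forall>L\<in>fin_groups.
      \<forall>a\<in>carrier (fobj A H). \<forall>b\<in>carrier (fobj A K). \<forall>c\<in>carrier (fobj A L).
        fmor A ((H \<boxtimes> K) \<boxtimes> L) (H \<boxtimes> (K \<boxtimes> L)) (assoc_mor R H K L)
          (gmult A (H \<boxtimes> K) L (gmult A H K a b) c) =
        gmult A H (K \<boxtimes> L) a (gmult A K L b c)) \<and>
    gunit A \<in> carrier (fobj A obj_unit) \<and>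
    (\<forall>H\<in>fin_groups. \<forall>a\<in>carrier (fobj A H).
      fmor A (obj_unit \<boxtimes> H) H (left_unit_mor R H) (gmult A obj_unit H (gunit A) a) = a \<and>
      fmor A (H \<boxtimes> obj_unit) H (right_unit_mor R H) (gmult A H obj_unit a (gunit A)) = a)"

text \<open>Morphisms \<open>A \<otimes> M \<rightarrow> M\<close> and \<open>M \<otimes> A \<rightarrow> M\<close> are given by products
  \<open>A(L) \<times> M(K) \<rightarrow> M(L \<boxtimes> K)\<close> and \<open>M(K) \<times> A(L) \<rightarrow> M(K \<boxtimes> L)\<close>; these are \<open>lact M L K\<close> and
  \<open>ract M K L\<close>.\<close>

record ('r, 'a, 'm) bimod = "('r, 'm) biset_fun" +
  lact :: "obj \<Rightarrow> obj \<Rightarrow> 'a \<Rightarrow> 'm \<Rightarrow> 'm"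
  ract :: "obj \<Rightarrow> obj \<Rightarrow> 'm \<Rightarrow> 'a \<Rightarrow> 'm"

definition bimod_hom ::
    "('r, 'q) ring_scheme \<Rightarrow> ('r, 'a, 'z) green_fun_scheme \<Rightarrow> ('r, 'a, 'm) bimod \<Rightarrow>
      ('r, 'a, 'n) bimod \<Rightarrow> (obj \<Rightarrow> 'm \<Rightarrow> 'n) \<Rightarrow> bool" where
  "bimod_hom R A M N f \<longleftrightarrow>
    (\<forall>H\<in>fin_groups. linear_map R (fobj M H) (fobj N H) (f H)) \<and>
    (\<forall>G\<in>fin_groups. \<forall>H\<in>fin_groups. \<forall>\<alpha>\<in>carrier (RB R (H \<times>\<times> G)). \<forall>m\<in>carrier (fobj M G).
      f H (fmor M G H \<alpha> m) = fmor N G H \<alpha> (f G m)) \<and>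
    (\<forall>L\<in>fin_groups. \<forall>K\<in>fin_groups. \<forall>a\<in>carrier (fobj A L). \<forall>m\<in>carrier (fobj M K).
      f (L \<boxtimes> K) (lact M L K a m) = lact N L K a (f K m) \<and>
      f (K \<boxtimes> L) (ract M K L m a) = ract N K L (f K m) a)"

text \<open>A split epimorphism of \<open>(A, A)\<close>-bimodules: a morphism with a right inverse.\<close>

definition bimod_split_epi ::
    "('r, 'q) ring_scheme \<Rightarrow> ('r, 'a, 'z) green_fun_scheme \<Rightarrow> ('r, 'a, 'm) bimod \<Rightarrow>
      ('r, 'a, 'n) bimod \<Rightarrow> (obj \<Rightarrow> 'm \<Rightarrow> 'n) \<Rightarrow> bool" where
  "bimod_split_epi R A M N f \<longleftrightarrow>
    bimod_hom R A M N f \<and>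
    (\<exists>s. bimod_hom R A N M s \<and> (\<forall>H\<in>fin_groups. \<forall>n\<in>carrier (fobj N H). f H (s H n) = n))"

definition regular_bimod :: "('r, 'a) green_fun \<Rightarrow> ('r, 'a, 'a) bimod" where
  "regular_bimod A = \<lparr>fobj = fobj A, fmor = fmor A, lact = gmult A, ract = gmult A\<rparr>"


section \<open>Day convolution\<close>

text \<open>\<open>(M \<otimes> N)(K)\<close> is the coend of \<open>RB(K, P \<boxtimes> Q) \<otimes>\<^sub>R M(P) \<otimes>\<^sub>R N(Q)\<close> over the objects \<open>P\<close> and \<open>Q\<close>.
  The generator \<open>(P, Q, \<phi>, m, n)\<close> stands for the class of \<open>\<phi> \<otimes> m \<otimes> n\<close>.\<close>

type_synonym ('r, 'm, 'n) day_gen = "obj \<times> obj \<times> 'r mor \<times> 'm \<times> 'n"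

type_synonym ('r, 'm, 'n) day_elt = "(('r, 'm, 'n) day_gen \<Rightarrow> 'r) set"

definition day_gens ::
    "('r, 'q) ring_scheme \<Rightarrow> ('r, 'm, 'z1) biset_fun_scheme \<Rightarrow> ('r, 'n, 'z2) biset_fun_scheme \<Rightarrow>
      obj \<Rightarrow> ('r, 'm, 'n) day_gen set" where
  "day_gens R M N K =
    {(P, Q, \<phi>, m, n). P \<in> fin_groups \<and> Q \<in> fin_groups \<and> \<phi> \<in> carrier (RB R (K \<times>\<times> (P \<boxtimes> Q))) \<and>
      m \<in> carrier (fobj M P) \<and> n \<in> carrier (fobj N Q)}"

text \<open>Trilinearity, and the coend relation
  \<open>\<phi> (\<alpha> \<times> \<beta>) \<otimes> m \<otimes> n = \<phi> \<otimes> M(\<alpha>)(m) \<otimes> N(\<beta>)(n)\<close> for \<open>\<alpha> : P \<rightarrow> P'\<close> and \<open>\<beta> : Q \<rightarrow> Q'\<close>.\<close>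

definition day_rels ::
    "('r, 'q) ring_scheme \<Rightarrow> ('r, 'm, 'z1) biset_fun_scheme \<Rightarrow> ('r, 'n, 'z2) biset_fun_scheme \<Rightarrow>
      obj \<Rightarrow> ((('r, 'm, 'n) day_gen \<Rightarrow> 'r) \<times> (('r, 'm, 'n) day_gen \<Rightarrow> 'r)) set" where
  "day_rels R M N K =
    (let F = free_module R (day_gens R M N K); d = free_gen R;
         Hom = (\<lambda>P Q. RB R (K \<times>\<times> (P \<boxtimes> Q))) in
      {(d (P, Q, \<phi> \<oplus>\<^bsub>Hom P Q\<^esub> \<psi>, m, n), d (P, Q, \<phi>, m, n) \<oplus>\<^bsub>F\<^esub> d (P, Q, \<psi>, m, n)) | P Q \<phi> \<psi> m n.
        (P, Q, \<phi>, m, n) \<in> day_gens R M N K \<and> \<psi> \<in> carrier (Hom P Q)} \<union>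
      {(d (P, Q, \<phi>, m \<oplus>\<^bsub>fobj M P\<^esub> m', n), d (P, Q, \<phi>, m, n) \<oplus>\<^bsub>F\<^esub> d (P, Q, \<phi>, m', n)) | P Q \<phi> m m' n.
        (P, Q, \<phi>, m, n) \<in> day_gens R M N K \<and> m' \<in> carrier (fobj M P)} \<union>
      {(d (P, Q, \<phi>, m, n \<oplus>\<^bsub>fobj N Q\<^esub> n'), d (P, Q, \<phi>, m, n) \<oplus>\<^bsub>F\<^esub> d (P, Q, \<phi>, m, n')) | P Q \<phi> m n n'.
        (P, Q, \<phi>, m, n) \<in> day_gens R M N K \<and> n' \<in> carrier (fobj N Q)} \<union>
      {(d (P, Q, r \<odot>\<^bsub>Hom P Q\<^esub> \<phi>, m, n), r \<odot>\<^bsub>F\<^esub> d (P, Q, \<phi>, m, n)) | P Q r \<phi> m n.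
        (P, Q, \<phi>, m, n) \<in> day_gens R M N K \<and> r \<in> carrier R} \<union>
      {(d (P, Q, \<phi>, r \<odot>\<^bsub>fobj M P\<^esub> m, n), r \<odot>\<^bsub>F\<^esub> d (P, Q, \<phi>, m, n)) | P Q r \<phi> m n.
        (P, Q, \<phi>, m, n) \<in> day_gens R M N K \<and> r \<in> carrier R} \<union>
      {(d (P, Q, \<phi>, m, r \<odot>\<^bsub>fobj N Q\<^esub> n), r \<odot>\<^bsub>F\<^esub> d (P, Q, \<phi>, m, n)) | P Q r \<phi> m n.
        (P, Q, \<phi>, m, n) \<in> day_gens R M N K \<and> r \<in> carrier R} \<union>
      {(d (P, Q, RB_comp R K (P' \<boxtimes> Q') (P \<boxtimes> Q) \<phi> (mor_times R P P' Q Q' \<alpha> \<beta>), m, n),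
        d (P', Q', \<phi>, fmor M P P' \<alpha> m, fmor N Q Q' \<beta> n)) | P Q P' Q' \<phi> \<alpha> \<beta> m n.
        P \<in> fin_groups \<and> Q \<in> fin_groups \<and> P' \<in> fin_groups \<and> Q' \<in> fin_groups \<and>
        \<phi> \<in> carrier (Hom P' Q') \<and>
        \<alpha> \<in> carrier (RB R (P' \<times>\<times> P)) \<and> \<beta> \<in> carrier (RB R (Q' \<times>\<times> Q)) \<and>
        m \<in> carrier (fobj M P) \<and> n \<in> carrier (fobj N Q)})"

definition day_class ::
    "('r, 'q) ring_scheme \<Rightarrow> ('r, 'm, 'z1) biset_fun_scheme \<Rightarrow> ('r, 'n, 'z2) biset_fun_scheme \<Rightarrow>
      obj \<Rightarrow> ('r, 'm, 'n) day_gen \<Rightarrow> ('r, 'm, 'n) day_elt" where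
  "day_class R M N K = presented_gen R (day_gens R M N K) (day_rels R M N K)"

definition day_obj ::
    "('r, 'q) ring_scheme \<Rightarrow> ('r, 'm, 'z1) biset_fun_scheme \<Rightarrow> ('r, 'n, 'z2) biset_fun_scheme \<Rightarrow>
      obj \<Rightarrow> ('r, ('r, 'm, 'n) day_elt) module" where
  "day_obj R M N K = presented_module R (day_gens R M N K) (day_rels R M N K)"

definition day_mor ::
    "('r, 'q) ring_scheme \<Rightarrow> ('r, 'm, 'z1) biset_fun_scheme \<Rightarrow> ('r, 'n, 'z2) biset_fun_scheme \<Rightarrow>
      obj \<Rightarrow> obj \<Rightarrow> 'r mor \<Rightarrow> ('r, 'm, 'n) day_elt \<Rightarrow> ('r, 'm, 'n) day_elt" where
  "day_mor R M N K L \<psi> =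
    lin_ext R (day_obj R M N L)
      (\<lambda>(P, Q, \<phi>, m, n). day_class R M N L (P, Q, RB_comp R L K (P \<boxtimes> Q) \<psi> \<phi>, m, n))"

text \<open>The bimodule \<open>A \<otimes> A\<close>: \<open>A\<close> acts on the left through the first factor and on the right through
  the second,
  \<open>a (\<phi> \<otimes> m \<otimes> n) = (L \<times> \<phi>) assoc \<otimes> a m \<otimes> n\<close> and
  \<open>(\<phi> \<otimes> m \<otimes> n) a = (\<phi> \<times> L) assoc\<^sup>-\<^sup>1 \<otimes> m \<otimes> n a\<close> for \<open>a \<in> A(L)\<close>.\<close>

definition tensor_square ::
    "('r, 'q) ring_scheme \<Rightarrow> ('r, 'a) green_fun \<Rightarrow> ('r, 'a, ('r, 'a, 'a) day_elt) bimod" where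
  "tensor_square R A =
    \<lparr>fobj = day_obj R A A,
     fmor = day_mor R A A,
     lact = (\<lambda>L K a. lin_ext R (day_obj R A A (L \<boxtimes> K))
       (\<lambda>(P, Q, \<phi>, m, n). day_class R A A (L \<boxtimes> K)
         (L \<boxtimes> P, Q,
          RB_comp R (L \<boxtimes> K) (L \<boxtimes> (P \<boxtimes> Q)) ((L \<boxtimes> P) \<boxtimes> Q)
            (mor_times R L L (P \<boxtimes> Q) K (RB_id R L) \<phi>) (assoc_mor R L P Q),
          gmult A L P a m, n))),
     ract = (\<lambda>K L x a. lin_ext R (day_obj R A A (K \<boxtimes> L))
       (\<lambda>(P, Q, \<phi>, m, n). day_class R A A (K \<boxtimes> L)
         (P, Q \<boxtimes> L,
          RB_comp R (K \<boxtimes> L) ((P \<boxtimes> Q) \<boxtimes> L) (P \<boxtimes> (Q \<boxtimes> L))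
            (mor_times R (P \<boxtimes> Q) K L L \<phi> (RB_id R L)) (assoc_inv_mor R P Q L),
          m, gmult A Q L n a)) x)\<rparr>"

text \<open>The product morphism \<open>\<mu>\<^sub>A : A \<otimes> A \<rightarrow> A\<close>, given by \<open>\<phi> \<otimes> a \<otimes> b \<mapsto> A(\<phi>)(a b)\<close>.\<close>

definition product_mor ::
    "('r, 'q) ring_scheme \<Rightarrow> ('r, 'a) green_fun \<Rightarrow> obj \<Rightarrow> ('r, 'a, 'a) day_elt \<Rightarrow> 'a" where
  "product_mor R A K =
    lin_ext R (fobj A K) (\<lambda>(P, Q, \<phi>, a, b). fmor A (P \<boxtimes> Q) K \<phi> (gmult A P Q a b))"

definition separable :: "('r, 'q) ring_scheme \<Rightarrow> ('r, 'a) green_fun \<Rightarrow> bool" where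
  "separable R A \<longleftrightarrow>
    green_biset_functor R A \<and>
    bimod_split_epi R A (tensor_square R A) (regular_bimod A) (product_mor R A)"


section \<open>The shifted Burnside functor\<close>

text \<open>\<open>RB(\<gamma>) : RB(H) \<rightarrow> RB(K)\<close> for \<open>\<gamma> \<in> RB(K, H)\<close>.\<close>

definition RB_apply ::
    "('r, 'q) ring_scheme \<Rightarrow> 'h monoid \<Rightarrow> 'k monoid \<Rightarrow>
      ('r, 'k \<times> 'h) rb_elt \<Rightarrow> ('r, 'h) rb_elt \<Rightarrow> ('r, 'k) rb_elt" where
  "RB_apply R H K = RB_bilin R K (biset_apply K H)"

definition shift_times ::
    "(nat \<times> 'g, 'x) gset \<Rightarrow> (nat \<times> 'g, 'y) gset \<Rightarrow> (nat \<times> 'g, 'x \<times> 'y) gset" where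
  "shift_times X Y =
    (fst X \<times> fst Y,
     \<lambda>(z, g). let (h, k) = prod_decode z
       in (\<lambda>(x, y)\<in>fst X \<times> fst Y. (snd X (h, g) x, snd Y (k, g) y)))"

definition RB_shift ::
    "('r, 'q) ring_scheme \<Rightarrow> 'g monoid \<Rightarrow> ('r, ('r, nat \<times> 'g) rb_elt) green_fun" where
  "RB_shift R G =
    \<lparr>fobj = (\<lambda>H. RB R (H \<times>\<times> G)),
     fmor = (\<lambda>H K \<alpha>. RB_apply R (H \<times>\<times> G) (K \<times>\<times> G) (RB_times R H K G G \<alpha> (RB_id R G))),
     gmult = (\<lambda>H K. RB_bilin R ((H \<boxtimes> K) \<times>\<times> G) shift_times),
     gunit = RB_class R (obj_unit \<times>\<times> G) ({()}, \<lambda>_. \<lambda>u\<in>{()}. u)\<rparr>"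

end

theory Submission
  imports Defs
begin

text \<open>By the Yoneda lemma \<open>RB\<^sub>G \<otimes> RB\<^sub>G\<close> is the functor \<open>RB\<close> shifted by \<open>G \<times> G\<close>, and the product morphism
  becomes restriction along the diagonal \<open>G \<rightarrow> G \<times> G\<close>. By the Mackey formula, induction along the
  diagonal followed by restriction is multiplication by the class \<open>c\<close> of \<open>G\<close> acting on itself by
  conjugation. The marks of \<open>c\<close> are orders of subgroups of \<open>G\<close>, so if \<open>|G|\<close> is invertible in \<open>R\<close>, then
  \<open>y c = 1\<close> for some \<open>y\<close>, and \<open>m \<mapsto> Ind (m y)\<close> is a section of bimodules.

  Conversely, the image \<open>e \<in> RB(G \<times> G)\<close> of the unit under a section restricts to the one-point set on the
  diagonal, and multiplying \<open>e\<close> by the class of the biset \<open>G\<close> on the left or on the right gives the same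
  element of \<open>RB(\<Gamma> \<times> G \<times> G)\<close>, where \<open>\<Gamma> \<cong> G\<close>: the same set on which \<open>\<Gamma>\<close> acts through the first or
  through the second factor. Comparing the points fixed by some \<open>(l, g, 1)\<close> with \<open>l \<noteq> 1\<close> shows that the points
  of \<open>e\<close> with a stabilizer meeting \<open>G \<times> 1\<close> nontrivially cancel. Elsewhere \<open>G \<times> 1\<close> acts freely, so the
  cardinality of \<open>e\<close>, which is \<open>1\<close>, is a multiple of \<open>|G|\<close>.\<close>

section \<open>Linear maps and presented modules\<close>

text \<open>The obstacle is that every operation involved (composition, external products, the
  shift, the two actions, induction, restriction) is built on sets and then extended bilinearly
  through chosen representatives. All of them are brought to one normal form: an external product
  \<open>RBX\<close> followed by the map \<open>RBT\<close> of a single transitive biset, encoded by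
  a subgroup \<open>L\<close> of \<open>K \<times>\<times> H\<close>. Whenever the Mackey formula
  for a composite has one double coset, composing such maps is composing relations, so axioms and
  naturality squares become equalities of subgroups. Restriction after induction along the diagonal
  falls outside this; there the double cosets assemble into the conjugation action, which is
  computed on sets. The elements of \<open>G\<close> have an arbitrary type, so \<open>G\<close> is
  not an object; the Yoneda argument is based on a copy \<open>\<Gamma>\<close>. In the converse the
  order of \<open>G\<close> may be a zero divisor in \<open>R\<close>, so the division by it is made
  on cardinalities, before passing to \<open>R\<close>.\<close>

lemma linear_mapD:
  assumes "linear_map R M N f"
  shows "x \<in> carrier M \<Longrightarrow> f x \<in> carrier N"
    and "x \<in> carrier M \<Longrightarrow> y \<in> carrier M \<Longrightarrow> f (x \<oplus>\<^bsub>M\<^esub> y) = f x \<oplus>\<^bsub>N\<^esub> f y"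
    and "r \<in> carrier R \<Longrightarrow> x \<in> carrier M \<Longrightarrow> f (r \<odot>\<^bsub>M\<^esub> x) = r \<odot>\<^bsub>N\<^esub> f x"
  using assms by (auto simp: linear_map_def)

lemma linear_mapI:
  assumes "\<And>x. x \<in> carrier M \<Longrightarrow> f x \<in> carrier N"
    and "\<And>x y. x \<in> carrier M \<Longrightarrow> y \<in> carrier M \<Longrightarrow> f (x \<oplus>\<^bsub>M\<^esub> y) = f x \<oplus>\<^bsub>N\<^esub> f y"
    and "\<And>r x. r \<in> carrier R \<Longrightarrow> x \<in> carrier M \<Longrightarrow> f (r \<odot>\<^bsub>M\<^esub> x) = r \<odot>\<^bsub>N\<^esub> f x"
  shows "linear_map R M N f"
  using assms by (auto simp: linear_map_def)

lemma linear_map_zero: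
  assumes "module R M" "module R N" "linear_map R M N f"
  shows "f \<zero>\<^bsub>M\<^esub> = \<zero>\<^bsub>N\<^esub>"
proof -
  interpret M: module R M by fact
  interpret N: module R N by fact
  have "f (\<zero>\<^bsub>R\<^esub> \<odot>\<^bsub>M\<^esub> \<zero>\<^bsub>M\<^esub>) = \<zero>\<^bsub>R\<^esub> \<odot>\<^bsub>N\<^esub> f \<zero>\<^bsub>M\<^esub>"
    by (intro linear_mapD[OF assms(3)]) auto
  thus ?thesis
    using linear_mapD(1)[OF assms(3)] by simp
qed

lemma linear_map_comp:
  "linear_map R M N f \<Longrightarrow> linear_map R N P g \<Longrightarrow> linear_map R M P (\<lambda>x. g (f x))"
  by (auto simp: linear_map_def Pi_iff)

lemma linear_map_cong:
  assumes "module R M" "linear_map R M N f" "\<And>x. x \<in> carrier M \<Longrightarrow> f x = g x"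
  shows "linear_map R M N g"
proof -
  interpret M: module R M by fact
  show ?thesis
    using assms(2,3) by (auto simp: linear_map_def Pi_iff)
qed

lemma linear_map_add:
  assumes "module R N" "linear_map R M N f" "linear_map R M N g"
  shows "linear_map R M N (\<lambda>x. f x \<oplus>\<^bsub>N\<^esub> g x)"
proof -
  interpret N: module R N by fact
  show ?thesis
    using assms(2,3) by (auto simp: linear_map_def Pi_iff N.smult_r_distr N.M.a_ac)
qed

lemma linear_map_smult:
  assumes "module R N" "linear_map R M N f" "r \<in> carrier R"
  shows "linear_map R M N (\<lambda>x. r \<odot>\<^bsub>N\<^esub> f x)"
proof -
  interpret N: module R N by fact
  show ?thesis
    using assms(2,3)
    by (auto simp: linear_map_def Pi_iff N.smult_r_distr N.R.m_comm simp flip: N.smult_assoc1)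
qed

lemma linear_map_id: "linear_map R M M (\<lambda>x. x)"
  by (auto simp: linear_map_def)

lemma linear_map_finsum:
  assumes "module R M" "module R N" "linear_map R M N f" "finite A" "g \<in> A \<rightarrow> carrier M"
  shows "f (finsum M g A) = finsum N (\<lambda>a. f (g a)) A"
proof -
  interpret M: module R M by fact
  interpret N: module R N by fact
  show ?thesis using assms(4,5)
  proof (induction A rule: finite_induct)
    case empty
    show ?case using linear_map_zero[OF assms(1-3)] by simp
  next
    case (insert a A)
    hence "(\<lambda>a. f (g a)) \<in> A \<rightarrow> carrier N" "f (g a) \<in> carrier N" "g \<in> A \<rightarrow> carrier M"
      using linear_mapD(1)[OF assms(3)] by (auto simp: Pi_iff)
    with insert show ?case
      by (simp add: linear_mapD(2)[OF assms(3)] Pi_iff)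
  qed
qed

section \<open>Free modules and linear combinations of generators\<close>

lemma free_module_simps:
  "carrier (free_module R S) = {f. (\<forall>s\<in>S. f s \<in> carrier R) \<and> (\<forall>s. s \<notin> S \<longrightarrow> f s = \<zero>\<^bsub>R\<^esub>) \<and>
                   finite {s. f s \<noteq> \<zero>\<^bsub>R\<^esub>}}"
  "\<zero>\<^bsub>free_module R S\<^esub> = (\<lambda>s. \<zero>\<^bsub>R\<^esub>)"
  "f \<oplus>\<^bsub>free_module R S\<^esub> g = (\<lambda>s. f s \<oplus>\<^bsub>R\<^esub> g s)"
  "r \<odot>\<^bsub>free_module R S\<^esub> f = (\<lambda>s. r \<otimes>\<^bsub>R\<^esub> f s)"
  by (simp_all add: free_module_def)

context
  fixes R :: "('r, 'q) ring_scheme"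
  assumes R: "cring R"
begin

interpretation R: cring R by (fact R)

lemma free_module_carrierD:
  assumes "f \<in> carrier (free_module R S)"
  shows "f s \<in> carrier R" "s \<notin> S \<Longrightarrow> f s = \<zero>\<^bsub>R\<^esub>" "finite {s. f s \<noteq> \<zero>\<^bsub>R\<^esub>}" "{s. f s \<noteq> \<zero>\<^bsub>R\<^esub>} \<subseteq> S"
proof -
  show "f s \<in> carrier R"
    using assms by (cases "s \<in> S") (auto simp: free_module_simps)
qed (use assms in \<open>auto simp: free_module_simps\<close>)

lemma free_module_module: "module R (free_module R S)"
proof -
  let ?F = "free_module R S"
  have fin_add: "finite {s. f s \<oplus>\<^bsub>R\<^esub> g s \<noteq> \<zero>\<^bsub>R\<^esub>}"
    if "finite {s. f s \<noteq> \<zero>\<^bsub>R\<^esub>}" "finite {s. g s \<noteq> \<zero>\<^bsub>R\<^esub>}" for f g :: "'b \<Rightarrow> 'r"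
    by (rule finite_subset[OF _ finite_UnI[OF that]]) auto
  have fin_smult: "finite {s. r \<otimes>\<^bsub>R\<^esub> f s \<noteq> \<zero>\<^bsub>R\<^esub>}"
    if "finite {s. f s \<noteq> \<zero>\<^bsub>R\<^esub>}" "r \<in> carrier R" for f :: "'b \<Rightarrow> 'r" and r
    by (rule finite_subset[OF _ that(1)]) (use that in auto)
  have add: "f \<oplus>\<^bsub>?F\<^esub> g \<in> carrier ?F" if "f \<in> carrier ?F" "g \<in> carrier ?F" for f g
    using that fin_add by (auto simp: free_module_simps)
  have smult: "r \<odot>\<^bsub>?F\<^esub> f \<in> carrier ?F" if "f \<in> carrier ?F" "r \<in> carrier R" for f r
    using that fin_smult by (auto simp: free_module_simps)
  have neg: "(\<lambda>s. \<ominus>\<^bsub>R\<^esub> f s) \<in> carrier ?F" if "f \<in> carrier ?F" for f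
  proof -
    have "(\<lambda>s. \<ominus>\<^bsub>R\<^esub> f s) = (\<ominus>\<^bsub>R\<^esub> \<one>\<^bsub>R\<^esub>) \<odot>\<^bsub>?F\<^esub> f"
      using free_module_carrierD(1)[OF that]
      by (auto simp: free_module_simps R.l_minus)
    thus ?thesis using smult[OF that] by simp
  qed
  have D: "f s \<in> carrier R" if "f \<in> carrier ?F" for f s
    using free_module_carrierD(1)[OF that] .
  show ?thesis
  proof (rule moduleI)
    show "abelian_group ?F"
    proof (rule abelian_groupI)
      fix f assume f: "f \<in> carrier ?F"
      show "\<exists>g\<in>carrier ?F. g \<oplus>\<^bsub>?F\<^esub> f = \<zero>\<^bsub>?F\<^esub>"
        by (rule bexI[OF _ neg[OF f]]) (use D[OF f] in \<open>auto simp: free_module_simps R.l_neg\<close>)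
    next
      show "\<zero>\<^bsub>?F\<^esub> \<in> carrier ?F" by (simp add: free_module_simps)
    qed (use add D in \<open>simp_all add: fun_eq_iff free_module_simps(2-4) R.a_ac\<close>)
  qed (use R smult D in \<open>simp_all add: fun_eq_iff free_module_simps(2-4) R.l_distr R.r_distr R.m_assoc\<close>)
qed

lemma free_gen_carrier: "s \<in> S \<Longrightarrow> free_gen R s \<in> carrier (free_module R S)"
  by (auto simp: free_module_simps free_gen_def intro: finite_subset[of _ "{s}"])

text \<open>The linear map on the free module of which \<open>lin_ext\<close> takes the value at a
  chosen representative. Naming it separates linearity, which only asks for values in
  \<open>N\<close>, from independence of the representative, which involves the relations.\<close>

definition comb :: "('r, 'n) module \<Rightarrow> ('s \<Rightarrow> 'n) \<Rightarrow> ('s \<Rightarrow> 'r) \<Rightarrow> 'n" where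
  "comb N f c = (\<Oplus>\<^bsub>N\<^esub>s\<in>{s. c s \<noteq> \<zero>\<^bsub>R\<^esub>}. c s \<odot>\<^bsub>N\<^esub> f s)"

text \<open>Two combinations have different supports; summing both over a common finite index set
  makes them comparable termwise.\<close>

lemma comb_superset:
  assumes "module R N" "f \<in> S \<rightarrow> carrier N" "c \<in> carrier (free_module R S)"
    and "finite A" "A \<subseteq> S" "{s. c s \<noteq> \<zero>\<^bsub>R\<^esub>} \<subseteq> A"
  shows "comb N f c = (\<Oplus>\<^bsub>N\<^esub>s\<in>A. c s \<odot>\<^bsub>N\<^esub> f s)"
proof -
  interpret N: module R N by fact
  note c = free_module_carrierD[OF assms(3)]
  show ?thesis
    unfolding comb_def
    by (rule N.M.add.finprod_mono_neutral_cong_left)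
       (use assms c in \<open>auto simp: Pi_iff subset_iff intro!: N.smult_closed\<close>)
qed

lemma comb_linear:
  assumes "module R N" "f \<in> S \<rightarrow> carrier N"
  shows "linear_map R (free_module R S) N (comb N f)"
proof -
  interpret N: module R N by fact
  interpret F: module R "free_module R S" by (rule free_module_module)
  note D = free_module_carrierD
  show ?thesis
  proof (rule linear_mapI)
    fix c assume "c \<in> carrier (free_module R S)"
    note c = D[OF this]
    show "comb N f c \<in> carrier N"
      unfolding comb_def using c assms(2)
      by (intro N.M.finsum_closed) (auto simp: Pi_iff subset_iff)
  next
    fix c d assume cd: "c \<in> carrier (free_module R S)" "d \<in> carrier (free_module R S)"
    note c = D[OF cd(1)] and d = D[OF cd(2)]
    let ?A = "{s. c s \<noteq> \<zero>\<^bsub>R\<^esub>} \<union> {s. d s \<noteq> \<zero>\<^bsub>R\<^esub>}"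
    have A: "finite ?A" "?A \<subseteq> S" using c d by auto
    have f: "f s \<in> carrier N" if "s \<in> ?A" for s using A(2) that assms(2) by auto
    have "comb N f (c \<oplus>\<^bsub>free_module R S\<^esub> d) = (\<Oplus>\<^bsub>N\<^esub>s\<in>?A. (c s \<oplus>\<^bsub>R\<^esub> d s) \<odot>\<^bsub>N\<^esub> f s)"
      by (subst comb_superset[OF assms F.M.a_closed[OF cd] A]) (auto simp: free_module_simps)
    also have "\<dots> = (\<Oplus>\<^bsub>N\<^esub>s\<in>?A. c s \<odot>\<^bsub>N\<^esub> f s \<oplus>\<^bsub>N\<^esub> d s \<odot>\<^bsub>N\<^esub> f s)"
      by (rule N.M.finsum_cong') (use c d f in \<open>auto simp: N.smult_l_distr\<close>)
    also have "\<dots> = (\<Oplus>\<^bsub>N\<^esub>s\<in>?A. c s \<odot>\<^bsub>N\<^esub> f s) \<oplus>\<^bsub>N\<^esub> (\<Oplus>\<^bsub>N\<^esub>s\<in>?A. d s \<odot>\<^bsub>N\<^esub> f s)"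
      by (rule N.M.finsum_addf) (use c d f in auto)
    also have "\<dots> = comb N f c \<oplus>\<^bsub>N\<^esub> comb N f d"
      by (subst (1 2) comb_superset[OF assms _ A]) (use cd in auto)
    finally show "comb N f (c \<oplus>\<^bsub>free_module R S\<^esub> d) = comb N f c \<oplus>\<^bsub>N\<^esub> comb N f d" .
  next
    fix r c assume rc: "r \<in> carrier R" "c \<in> carrier (free_module R S)"
    note c = D[OF rc(2)]
    let ?A = "{s. c s \<noteq> \<zero>\<^bsub>R\<^esub>}"
    have f: "f s \<in> carrier N" if "s \<in> ?A" for s using c(4) that assms(2) by auto
    have "comb N f (r \<odot>\<^bsub>free_module R S\<^esub> c) = (\<Oplus>\<^bsub>N\<^esub>s\<in>?A. (r \<otimes>\<^bsub>R\<^esub> c s) \<odot>\<^bsub>N\<^esub> f s)"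
      by (subst comb_superset[OF assms F.smult_closed[OF rc] c(3,4)])
         (use rc in \<open>auto simp: free_module_simps\<close>)
    also have "\<dots> = (\<Oplus>\<^bsub>N\<^esub>s\<in>?A. r \<odot>\<^bsub>N\<^esub> (c s \<odot>\<^bsub>N\<^esub> f s))"
      by (rule N.M.finsum_cong') (use c f rc in \<open>auto simp: N.smult_assoc1\<close>)
    also have "\<dots> = r \<odot>\<^bsub>N\<^esub> comb N f c"
      unfolding comb_def by (rule N.finsum_smult_ldistr[symmetric]) (use c f rc in auto)
    finally show "comb N f (r \<odot>\<^bsub>free_module R S\<^esub> c) = r \<odot>\<^bsub>N\<^esub> comb N f c" .
  qed
qed

lemma comb_gen:
  assumes "module R N" "f \<in> S \<rightarrow> carrier N" "s \<in> S"
  shows "comb N f (free_gen R s) = f s"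
proof -
  interpret N: module R N by fact
  have "comb N f (free_gen R s) = (\<Oplus>\<^bsub>N\<^esub>t\<in>{s}. free_gen R s t \<odot>\<^bsub>N\<^esub> f t)"
    by (rule comb_superset[OF assms(1,2) free_gen_carrier]) (use assms(3) in \<open>auto simp: free_gen_def\<close>)
  also have "\<dots> = f s"
  proof -
    have f: "f s \<in> carrier N" using assms(2,3) by auto
    have "free_gen R s s = \<one>\<^bsub>R\<^esub>" by (simp add: free_gen_def)
    with f show ?thesis by (subst N.M.finsum_insert) simp_all
  qed
  finally show ?thesis .
qed

lemma comb_free_gen:
  assumes "c \<in> carrier (free_module R S)"
  shows "comb (free_module R S) (free_gen R) c = c"
proof -
  interpret F: module R "free_module R S" by (rule free_module_module)
  note c = free_module_carrierD[OF assms]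
  \<comment> \<open>A partial sum over \<open>A\<close> is the function cut down to
    \<open>A\<close>; in this form the claim survives adding one index.\<close>
  have *: "(\<Oplus>\<^bsub>free_module R S\<^esub>s\<in>A. c s \<odot>\<^bsub>free_module R S\<^esub> free_gen R s) =
    (\<lambda>s. if s \<in> A then c s else \<zero>\<^bsub>R\<^esub>)" if "finite A" "A \<subseteq> S" for A
    using that
  proof (induction A rule: finite_induct)
    case empty
    show ?case by (simp add: free_module_simps)
  next
    case (insert a A)
    have g: "c s \<odot>\<^bsub>free_module R S\<^esub> free_gen R s \<in> carrier (free_module R S)" if "s \<in> S" for s
      by (rule F.smult_closed[OF c(1) free_gen_carrier[OF that]])
    have "(\<Oplus>\<^bsub>free_module R S\<^esub>s\<in>insert a A. c s \<odot>\<^bsub>free_module R S\<^esub> free_gen R s) =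
      (c a \<odot>\<^bsub>free_module R S\<^esub> free_gen R a) \<oplus>\<^bsub>free_module R S\<^esub>
      (\<Oplus>\<^bsub>free_module R S\<^esub>s\<in>A. c s \<odot>\<^bsub>free_module R S\<^esub> free_gen R s)"
      by (rule F.M.finsum_insert[OF insert.hyps]) (use insert.prems g in \<open>simp_all add: Pi_iff subset_iff\<close>)
    also have "\<dots> = (\<lambda>s. c a \<otimes>\<^bsub>R\<^esub> free_gen R a s \<oplus>\<^bsub>R\<^esub> (if s \<in> A then c s else \<zero>\<^bsub>R\<^esub>))"
      using insert.IH insert.prems by (simp add: free_module_simps(2-4))
    also have "\<dots> = (\<lambda>s. if s \<in> insert a A then c s else \<zero>\<^bsub>R\<^esub>)"
      using insert.hyps(2) c(1) by (intro ext) (simp add: free_gen_def)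
    finally show ?case .
  qed
  have "comb (free_module R S) (free_gen R) c = (\<lambda>s. if s \<in> {s. c s \<noteq> \<zero>\<^bsub>R\<^esub>} then c s else \<zero>\<^bsub>R\<^esub>)"
    unfolding comb_def by (rule *[OF c(3,4)])
  thus ?thesis by (simp add: fun_eq_iff)
qed

lemma comb_comp:
  assumes "module R N" "module R P" "f \<in> S \<rightarrow> carrier N" "linear_map R N P g"
    "c \<in> carrier (free_module R S)"
  shows "g (comb N f c) = comb P (\<lambda>s. g (f s)) c"
proof -
  interpret N: module R N by fact
  interpret P: module R P by fact
  note c = free_module_carrierD[OF assms(5)]
  have f: "f s \<in> carrier N" if "c s \<noteq> \<zero>\<^bsub>R\<^esub>" for s using c(4) that assms(3) by auto
  have "g (comb N f c) = (\<Oplus>\<^bsub>P\<^esub>s\<in>{s. c s \<noteq> \<zero>\<^bsub>R\<^esub>}. g (c s \<odot>\<^bsub>N\<^esub> f s))"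
    unfolding comb_def
    by (rule linear_map_finsum[OF assms(1,2,4)]) (use c f in auto)
  also have "\<dots> = comb P (\<lambda>s. g (f s)) c"
    unfolding comb_def
    by (rule P.M.finsum_cong')
       (use c f in \<open>auto simp: linear_mapD(3)[OF assms(4)] intro!: P.smult_closed linear_mapD(1)[OF assms(4)]\<close>)
  finally show ?thesis .
qed

lemma comb_cong:
  assumes "module R N" "f \<in> S \<rightarrow> carrier N" "\<And>s. s \<in> S \<Longrightarrow> f s = g s" "c \<in> carrier (free_module R S)"
  shows "comb N f c = comb N g c"
proof -
  interpret N: module R N by fact
  note c = free_module_carrierD[OF assms(4)]
  show ?thesis unfolding comb_def
    by (rule N.M.finsum_cong') (use c assms in \<open>auto simp: subset_iff Pi_iff\<close>)
qed

end

section \<open>Quotient modules, spans and kernels\<close>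

lemma submodule_imp_abelian_subgroup:
  assumes "module R M" "submodule N R M"
  shows "abelian_subgroup N M"
proof -
  interpret M: module R M by fact
  interpret N: submodule N R M by fact
  show ?thesis
    by (intro abelian_subgroupI3 additive_subgroup.intro N.subgroup_axioms M.M.abelian_group_axioms)
qed

context
  fixes R :: "('r, 'q) ring_scheme" and M :: "('r, 'm) module" and N
  assumes M: "module R M" and N: "submodule N R M"
begin

interpretation M: module R M by (fact M)
interpretation N: abelian_subgroup N M by (rule submodule_imp_abelian_subgroup[OF M N])

lemma quotient_module_simps:
  "carrier (quotient_module R M N) = (\<lambda>x. N +>\<^bsub>M\<^esub> x) ` carrier M"
  "\<zero>\<^bsub>quotient_module R M N\<^esub> = N"
  "C \<oplus>\<^bsub>quotient_module R M N\<^esub> D = C <+>\<^bsub>M\<^esub> D"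
  by (auto simp: quotient_module_def A_RCOSETS_def RCOSETS_def a_r_coset_def)

lemma quotient_module_add:
  assumes "x \<in> carrier M" "y \<in> carrier M"
  shows "(N +>\<^bsub>M\<^esub> x) \<oplus>\<^bsub>quotient_module R M N\<^esub> (N +>\<^bsub>M\<^esub> y) = N +>\<^bsub>M\<^esub> (x \<oplus>\<^bsub>M\<^esub> y)"
  using N.a_rcos_sum assms by (simp add: quotient_module_simps)

text \<open>The scalar action is defined as a union of cosets over all representatives; closure of
  \<open>N\<close> under scalars makes all of them the same coset, so the union is that
  coset.\<close>

lemma quotient_module_smult:
  assumes "r \<in> carrier R" "x \<in> carrier M"
  shows "r \<odot>\<^bsub>quotient_module R M N\<^esub> (N +>\<^bsub>M\<^esub> x) = N +>\<^bsub>M\<^esub> (r \<odot>\<^bsub>M\<^esub> x)"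
proof -
  have eq: "N +>\<^bsub>M\<^esub> (r \<odot>\<^bsub>M\<^esub> y) = N +>\<^bsub>M\<^esub> (r \<odot>\<^bsub>M\<^esub> x)" if y: "y \<in> N +>\<^bsub>M\<^esub> x" for y
  proof -
    obtain n where n: "n \<in> N" "y = n \<oplus>\<^bsub>M\<^esub> x" using y by (auto simp: a_r_coset_def')
    have nM: "n \<in> carrier M" using n(1) N.a_subset by auto
    have "r \<odot>\<^bsub>M\<^esub> y = (r \<odot>\<^bsub>M\<^esub> n) \<oplus>\<^bsub>M\<^esub> (r \<odot>\<^bsub>M\<^esub> x)"
      using n(2) nM assms by (simp add: M.smult_r_distr)
    moreover have "r \<odot>\<^bsub>M\<^esub> n \<in> N" using N assms(1) n(1) by (rule submodule.smult_closed)
    ultimately have "r \<odot>\<^bsub>M\<^esub> y \<in> N +>\<^bsub>M\<^esub> (r \<odot>\<^bsub>M\<^esub> x)" by (auto simp: a_r_coset_def')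
    thus ?thesis using N.a_repr_independence' assms by (metis M.smult_closed)
  qed
  have "x \<in> N +>\<^bsub>M\<^esub> x" using N.a_rcos_self assms(2) .
  hence "(\<Union>y\<in>N +>\<^bsub>M\<^esub> x. N +>\<^bsub>M\<^esub> (r \<odot>\<^bsub>M\<^esub> y)) = N +>\<^bsub>M\<^esub> (r \<odot>\<^bsub>M\<^esub> x)"
    using eq by blast
  thus ?thesis by (simp add: quotient_module_def)
qed

lemma quotient_module_zero: "N = N +>\<^bsub>M\<^esub> \<zero>\<^bsub>M\<^esub>"
  using M.M.a_coset_add_zero[OF N.a_subset] by simp

lemma quotient_module_module: "module R (quotient_module R M N)"
proof (rule moduleI)
  show "abelian_group (quotient_module R M N)"
  proof (rule abelian_groupI)
    show "\<zero>\<^bsub>quotient_module R M N\<^esub> \<in> carrier (quotient_module R M N)"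
      unfolding quotient_module_simps using quotient_module_zero by (metis M.M.zero_closed image_eqI)
  next
    fix C assume "C \<in> carrier (quotient_module R M N)"
    then obtain x where x: "x \<in> carrier M" "C = N +>\<^bsub>M\<^esub> x" by (auto simp: quotient_module_simps)
    show "\<zero>\<^bsub>quotient_module R M N\<^esub> \<oplus>\<^bsub>quotient_module R M N\<^esub> C = C"
      unfolding quotient_module_simps(2)
      by (subst quotient_module_zero) (use x in \<open>simp add: quotient_module_add\<close>)
    have "(N +>\<^bsub>M\<^esub> (\<ominus>\<^bsub>M\<^esub> x)) \<oplus>\<^bsub>quotient_module R M N\<^esub> C = \<zero>\<^bsub>quotient_module R M N\<^esub>"
      using x quotient_module_zero
      by (simp add: quotient_module_add M.M.l_neg quotient_module_simps(2))
    moreover have "N +>\<^bsub>M\<^esub> (\<ominus>\<^bsub>M\<^esub> x) \<in> carrier (quotient_module R M N)"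
      using x by (simp add: quotient_module_simps(1))
    ultimately show "\<exists>D\<in>carrier (quotient_module R M N).
        D \<oplus>\<^bsub>quotient_module R M N\<^esub> C = \<zero>\<^bsub>quotient_module R M N\<^esub>" by blast
  qed (auto simp: quotient_module_simps(1) quotient_module_add M.M.a_ac)
qed (auto simp: quotient_module_simps(1) quotient_module_add quotient_module_smult
       M.smult_l_distr M.smult_r_distr M.smult_assoc1 M.R.is_cring)

lemma quotient_module_eq:
  assumes "x \<in> carrier M" "y \<in> carrier M" "x \<ominus>\<^bsub>M\<^esub> y \<in> N"
  shows "N +>\<^bsub>M\<^esub> x = N +>\<^bsub>M\<^esub> y"
proof -
  have "x = (x \<ominus>\<^bsub>M\<^esub> y) \<oplus>\<^bsub>M\<^esub> y"
    using assms by (simp add: a_minus_def M.M.a_assoc M.M.l_neg)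
  hence "x \<in> N +>\<^bsub>M\<^esub> y" using assms(3) by (auto simp: a_r_coset_def')
  thus ?thesis using N.a_repr_independence' assms by metis
qed

lemma quotient_module_eqD:
  assumes "x \<in> carrier M" "y \<in> carrier M" "N +>\<^bsub>M\<^esub> x = N +>\<^bsub>M\<^esub> y"
  shows "x \<ominus>\<^bsub>M\<^esub> y \<in> N"
proof -
  have "x \<in> N +>\<^bsub>M\<^esub> y" using N.a_rcos_self assms by metis
  then obtain n where n: "n \<in> N" "x = n \<oplus>\<^bsub>M\<^esub> y" by (auto simp: a_r_coset_def')
  have "n \<in> carrier M" using n(1) N.a_subset by auto
  hence "x \<ominus>\<^bsub>M\<^esub> y = n" using n assms by (simp add: a_minus_def M.M.a_assoc M.M.r_neg)
  thus ?thesis using n by simp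
qed

lemma quotient_module_repr:
  assumes "C \<in> carrier (quotient_module R M N)" "c \<in> C"
  shows "c \<in> carrier M" "C = N +>\<^bsub>M\<^esub> c"
proof -
  obtain x where x: "x \<in> carrier M" "C = N +>\<^bsub>M\<^esub> x"
    using assms(1) by (auto simp: quotient_module_simps)
  show "c \<in> carrier M" using x assms(2) N.a_subset by (auto simp: a_r_coset_def')
  show "C = N +>\<^bsub>M\<^esub> c" using N.a_repr_independence' x assms(2) by metis
qed

lemma quotient_module_self: "x \<in> carrier M \<Longrightarrow> x \<in> N +>\<^bsub>M\<^esub> x"
  by (rule N.a_rcos_self)

end

lemma submodule_span_submodule:
  assumes "module R M" "X \<subseteq> carrier M"
  shows "submodule (submodule_span R M X) R M"
proof -
  interpret M: module R M by fact
  show ?thesis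
  proof (rule M.submoduleI)
    show "submodule_span R M X \<subseteq> carrier M"
      using M.carrier_is_submodule assms(2) by (auto simp: submodule_span_def)
  next
    show "\<zero>\<^bsub>M\<^esub> \<in> submodule_span R M X"
      unfolding submodule_span_def
      by (auto dest!: submodule_imp_abelian_subgroup[OF assms(1)]
          intro: additive_subgroup.zero_closed abelian_subgroup.axioms(1))
  qed (auto simp: submodule_span_def dest: M.submoduleE)
qed

lemma submodule_span_superset: "X \<subseteq> submodule_span R M X"
  by (auto simp: submodule_span_def)

lemma submodule_span_least: "submodule N R M \<Longrightarrow> X \<subseteq> N \<Longrightarrow> submodule_span R M X \<subseteq> N"
  by (auto simp: submodule_span_def)

lemma linear_map_kernel_submodule:
  assumes "module R M" "module R N" "linear_map R M N f"
  shows "submodule {x \<in> carrier M. f x = \<zero>\<^bsub>N\<^esub>} R M"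
proof -
  interpret M: module R M by fact
  interpret N: module R N by fact
  note f = linear_mapD[OF assms(3)]
  show ?thesis
  proof (rule M.submoduleI)
    fix a assume a: "a \<in> {x \<in> carrier M. f x = \<zero>\<^bsub>N\<^esub>}"
    have "\<ominus>\<^bsub>M\<^esub> a = (\<ominus>\<^bsub>R\<^esub> \<one>\<^bsub>R\<^esub>) \<odot>\<^bsub>M\<^esub> a" using a by (simp add: M.smult_l_minus)
    hence "f (\<ominus>\<^bsub>M\<^esub> a) = (\<ominus>\<^bsub>R\<^esub> \<one>\<^bsub>R\<^esub>) \<odot>\<^bsub>N\<^esub> f a" using a f(3) by simp
    thus "\<ominus>\<^bsub>M\<^esub> a \<in> {x \<in> carrier M. f x = \<zero>\<^bsub>N\<^esub>}" using a by simp
  qed (auto simp: f linear_map_zero[OF assms])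
qed

lemma linear_map_minus:
  assumes "module R M" "module R N" "linear_map R M N f" "x \<in> carrier M" "y \<in> carrier M"
  shows "f (x \<ominus>\<^bsub>M\<^esub> y) = f x \<ominus>\<^bsub>N\<^esub> f y"
proof -
  interpret M: module R M by fact
  interpret N: module R N by fact
  note f = linear_mapD[OF assms(3)]
  have "\<ominus>\<^bsub>M\<^esub> y = (\<ominus>\<^bsub>R\<^esub> \<one>\<^bsub>R\<^esub>) \<odot>\<^bsub>M\<^esub> y" using assms by (simp add: M.smult_l_minus)
  hence "f (\<ominus>\<^bsub>M\<^esub> y) = \<ominus>\<^bsub>N\<^esub> f y" using f assms(4,5) by (simp add: N.smult_l_minus)
  thus ?thesis using f(2) assms(4,5) by (simp add: a_minus_def)
qed

section \<open>Presented modules and linear extension from generators\<close>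

context
  fixes R :: "('r, 'q) ring_scheme" and S :: "'s set" and E :: "(('s \<Rightarrow> 'r) \<times> ('s \<Rightarrow> 'r)) set"
  assumes R: "cring R"
    and E: "E \<subseteq> carrier (free_module R S) \<times> carrier (free_module R S)"
begin

interpretation F: module R "free_module R S" by (rule free_module_module[OF R])

definition presented_proj :: "('s \<Rightarrow> 'r) \<Rightarrow> ('s \<Rightarrow> 'r) set" where
  "presented_proj c = relation_span R S E +>\<^bsub>free_module R S\<^esub> c"

lemma relation_span_submodule: "submodule (relation_span R S E) R (free_module R S)"
  unfolding relation_span_def
  by (rule submodule_span_submodule[OF F.module_axioms]) (use E in auto)

lemma presented_module_module: "module R (presented_module R S E)"
  unfolding presented_module_def
  by (rule quotient_module_module[OF F.module_axioms relation_span_submodule])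

lemma presented_gen_eq_proj: "presented_gen R S E s = presented_proj (free_gen R s)"
  by (simp add: presented_gen_def presented_proj_def)

lemma presented_proj_linear:
  "linear_map R (free_module R S) (presented_module R S E) presented_proj"
  unfolding presented_module_def presented_proj_def
  by (rule linear_mapI)
     (auto simp: quotient_module_simps(1)[OF F.module_axioms relation_span_submodule]
       quotient_module_add[OF F.module_axioms relation_span_submodule]
       quotient_module_smult[OF F.module_axioms relation_span_submodule])

lemma presented_gen_closed: "s \<in> S \<Longrightarrow> presented_gen R S E s \<in> carrier (presented_module R S E)"
  unfolding presented_gen_eq_proj
  by (rule linear_mapD(1)[OF presented_proj_linear free_gen_carrier[OF R]])

lemma presented_rel: "(x, y) \<in> E \<Longrightarrow> presented_proj x = presented_proj y"
  unfolding presented_proj_def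
  by (rule quotient_module_eq[OF F.module_axioms relation_span_submodule])
     (use E submodule_span_superset in \<open>auto simp: relation_span_def\<close>, fast)

text \<open>The kernel of \<open>g\<close> is a submodule containing the differences of related
  pairs, hence it contains their span; so \<open>g\<close> takes one value on each coset.\<close>

lemma presented_factor:
  assumes "module R N" "linear_map R (free_module R S) N g" "\<And>x y. (x, y) \<in> E \<Longrightarrow> g x = g y"
    and "c \<in> carrier (free_module R S)" "d \<in> carrier (free_module R S)"
    and "presented_proj c = presented_proj d"
  shows "g c = g d"
proof -
  interpret N: module R N by fact
  note g = linear_mapD[OF assms(2)]
  let ?K = "{x \<in> carrier (free_module R S). g x = \<zero>\<^bsub>N\<^esub>}"
  have "relation_span R S E \<subseteq> ?K"
    unfolding relation_span_def
  proof (rule submodule_span_least)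
    show "submodule ?K R (free_module R S)"
      by (rule linear_map_kernel_submodule[OF F.module_axioms assms(1,2)])
    show "{x \<ominus>\<^bsub>free_module R S\<^esub> y |x y. (x, y) \<in> E} \<subseteq> ?K"
    proof safe
      fix x y assume xy: "(x, y) \<in> E"
      hence c: "x \<in> carrier (free_module R S)" "y \<in> carrier (free_module R S)" using E by auto
      show "x \<ominus>\<^bsub>free_module R S\<^esub> y \<in> carrier (free_module R S)" using c by simp
      show "g (x \<ominus>\<^bsub>free_module R S\<^esub> y) = \<zero>\<^bsub>N\<^esub>"
        unfolding linear_map_minus[OF F.module_axioms assms(1,2) c] assms(3)[OF xy]
        using g(1)[OF c(2)] by (simp add: a_minus_def N.M.r_neg)
    qed
  qed
  moreover have "c \<ominus>\<^bsub>free_module R S\<^esub> d \<in> relation_span R S E"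
    by (rule quotient_module_eqD[OF F.module_axioms relation_span_submodule])
       (use assms(4-6) in \<open>auto simp: presented_proj_def\<close>)
  ultimately have "g c \<ominus>\<^bsub>N\<^esub> g d = \<zero>\<^bsub>N\<^esub>"
    using linear_map_minus[OF F.module_axioms assms(1,2,4,5)] by auto
  hence "(g c \<ominus>\<^bsub>N\<^esub> g d) \<oplus>\<^bsub>N\<^esub> g d = g d" using g(1)[OF assms(5)] by simp
  thus ?thesis using g(1)[OF assms(4)] g(1)[OF assms(5)]
    by (simp add: a_minus_def N.M.a_assoc N.M.l_neg)
qed

text \<open>\<open>lin_ext\<close> evaluates at a representative picked from the coset alone. One
  \<open>c\<close> therefore serves every \<open>N\<close> and every \<open>f\<close> of the given
  type, so different extensions can be compared on the same representative.\<close>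

lemma presented_repr:
  assumes "C \<in> carrier (presented_module R S E)"
  obtains c where "c \<in> carrier (free_module R S)" "C = presented_proj c"
    "\<And>(N :: ('r, 'n) module) f. lin_ext R N f C = comb R N f c"
proof -
  have C: "C \<in> carrier (quotient_module R (free_module R S) (relation_span R S E))"
    using assms by (simp add: presented_module_def)
  define c where "c = (SOME c. c \<in> C)"
  obtain x where x: "x \<in> carrier (free_module R S)" "C = relation_span R S E +>\<^bsub>free_module R S\<^esub> x"
    using C by (auto simp: quotient_module_simps(1)[OF F.module_axioms relation_span_submodule])
  have "x \<in> C"
    using quotient_module_self[OF F.module_axioms relation_span_submodule x(1)] x(2) by simp
  hence c: "c \<in> C" unfolding c_def by (rule someI[of "\<lambda>c. c \<in> C"])
  note r = quotient_module_repr[OF F.module_axioms relation_span_submodule C c]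
  show ?thesis
    by (rule that[OF r(1)])
       (use r(2) in \<open>auto simp: presented_proj_def lin_ext_def comb_def[OF R] Let_def c_def\<close>)
qed

definition compatible :: "('r, 'n) module \<Rightarrow> ('s \<Rightarrow> 'n) \<Rightarrow> bool" where
  "compatible N f \<longleftrightarrow> f \<in> S \<rightarrow> carrier N \<and> (\<forall>(x, y)\<in>E. comb R N f x = comb R N f y)"

lemma lin_ext_proj:
  assumes "module R N" "compatible N f" "c \<in> carrier (free_module R S)"
  shows "lin_ext R N f (presented_proj c) = comb R N f c"
proof -
  have f: "f \<in> S \<rightarrow> carrier N" using assms(2) by (simp add: compatible_def)
  obtain d where d: "d \<in> carrier (free_module R S)" "presented_proj c = presented_proj d"
      "lin_ext R N f (presented_proj c) = comb R N f d"
    by (rule presented_repr[OF linear_mapD(1)[OF presented_proj_linear assms(3)]]) blast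
  have "comb R N f d = comb R N f c"
    by (rule presented_factor[OF assms(1) comb_linear[OF R assms(1) f] _ d(1) assms(3) d(2)[symmetric]])
       (use assms(2) in \<open>auto simp: compatible_def\<close>)
  thus ?thesis using d(3) by simp
qed

lemma presented_surj:
  assumes "C \<in> carrier (presented_module R S E)"
  obtains c where "c \<in> carrier (free_module R S)" "C = presented_proj c"
  using presented_repr[OF assms] by metis

lemma lin_ext_linear:
  assumes "module R N" "compatible N f"
  shows "linear_map R (presented_module R S E) N (lin_ext R N f)"
proof -
  have f: "f \<in> S \<rightarrow> carrier N" using assms(2) by (simp add: compatible_def)
  note l = linear_mapD[OF comb_linear[OF R assms(1) f]]
  note p = linear_mapD[OF presented_proj_linear]
  show ?thesis
  proof (rule linear_mapI)
    fix C assume "C \<in> carrier (presented_module R S E)"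
    then obtain c where c: "c \<in> carrier (free_module R S)" "C = presented_proj c"
      by (rule presented_surj)
    show "lin_ext R N f C \<in> carrier N"
      using c l(1) by (simp add: lin_ext_proj[OF assms])
    fix r assume r: "r \<in> carrier R"
    have "r \<odot>\<^bsub>presented_module R S E\<^esub> C = presented_proj (r \<odot>\<^bsub>free_module R S\<^esub> c)"
      using p(3)[OF r c(1)] c(2) by simp
    thus "lin_ext R N f (r \<odot>\<^bsub>presented_module R S E\<^esub> C) = r \<odot>\<^bsub>N\<^esub> lin_ext R N f C"
      using c r l(3) F.smult_closed[OF r c(1)] by (simp add: lin_ext_proj[OF assms])
  next
    fix C D assume C: "C \<in> carrier (presented_module R S E)" and D: "D \<in> carrier (presented_module R S E)"
    obtain c where c: "c \<in> carrier (free_module R S)" "C = presented_proj c"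
      using C by (rule presented_surj)
    obtain d where d: "d \<in> carrier (free_module R S)" "D = presented_proj d"
      using D by (rule presented_surj)
    have "C \<oplus>\<^bsub>presented_module R S E\<^esub> D = presented_proj (c \<oplus>\<^bsub>free_module R S\<^esub> d)"
      using p(2)[OF c(1) d(1)] c(2) d(2) by simp
    thus "lin_ext R N f (C \<oplus>\<^bsub>presented_module R S E\<^esub> D) = lin_ext R N f C \<oplus>\<^bsub>N\<^esub> lin_ext R N f D"
      using c d l(2) F.M.a_closed[OF c(1) d(1)] by (simp add: lin_ext_proj[OF assms])
  qed
qed

lemma lin_ext_gen:
  assumes "module R N" "compatible N f" "s \<in> S"
  shows "lin_ext R N f (presented_gen R S E s) = f s"
proof -
  have f: "f \<in> S \<rightarrow> carrier N" using assms(2) by (simp add: compatible_def)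
  show ?thesis
    unfolding presented_gen_eq_proj lin_ext_proj[OF assms(1,2) free_gen_carrier[OF R assms(3)]]
    by (rule comb_gen[OF R assms(1) f assms(3)])
qed

lemma presented_proj_comb:
  assumes "c \<in> carrier (free_module R S)"
  shows "presented_proj c = comb R (presented_module R S E) (presented_gen R S E) c"
proof -
  have g: "free_gen R \<in> S \<rightarrow> carrier (free_module R S)"
    by (intro funcsetI free_gen_carrier[OF R])
  have "presented_proj c = presented_proj (comb R (free_module R S) (free_gen R) c)"
    by (simp only: comb_free_gen[OF R assms])
  also have "\<dots> = comb R (presented_module R S E) (\<lambda>s. presented_proj (free_gen R s)) c"
    by (rule comb_comp[OF R F.module_axioms presented_module_module g presented_proj_linear assms])
  also have "\<dots> = comb R (presented_module R S E) (presented_gen R S E) c"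
    by (simp only: comb_def[OF R] presented_gen_eq_proj)
  finally show ?thesis .
qed

text \<open>No compatibility of \<open>f\<close> with the relations is assumed: \<open>lin_ext\<close> always evaluates \<open>f\<close> on
  some representative.\<close>

lemma lin_ext_transport:
  assumes "module R N" "module R P" "f \<in> S \<rightarrow> carrier N" "linear_map R N P k"
    and "linear_map R (presented_module R S E) P h"
    and "\<And>s. s \<in> S \<Longrightarrow> k (f s) = h (presented_gen R S E s)"
    and "C \<in> carrier (presented_module R S E)"
  shows "k (lin_ext R N f C) = h C" "lin_ext R N f C \<in> carrier N"
proof -
  obtain c where c: "c \<in> carrier (free_module R S)" "C = presented_proj c"
    "lin_ext R N f C = comb R N f c"
    using presented_repr[OF assms(7)] by metis
  have g: "presented_gen R S E \<in> S \<rightarrow> carrier (presented_module R S E)"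
    by (intro funcsetI presented_gen_closed)
  have "k (lin_ext R N f C) = comb R P (\<lambda>s. k (f s)) c"
    unfolding c(3) by (rule comb_comp[OF R assms(1-4) c(1)])
  also have "\<dots> = comb R P (\<lambda>s. h (presented_gen R S E s)) c"
    by (rule comb_cong[OF R assms(2) _ assms(6) c(1)])
       (use assms(3) linear_mapD(1)[OF assms(4)] in auto)
  also have "\<dots> = h C"
    unfolding c(2) presented_proj_comb[OF c(1)]
    by (rule comb_comp[OF R presented_module_module assms(2) g assms(5) c(1), symmetric])
  finally show "k (lin_ext R N f C) = h C" .
  show "lin_ext R N f C \<in> carrier N"
    unfolding c(3) by (rule linear_mapD(1)[OF comb_linear[OF R assms(1,3)] c(1)])
qed

lemma presented_ext:
  assumes "module R N" "linear_map R (presented_module R S E) N g"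
    "linear_map R (presented_module R S E) N h"
    and "\<And>s. s \<in> S \<Longrightarrow> g (presented_gen R S E s) = h (presented_gen R S E s)"
    and "C \<in> carrier (presented_module R S E)"
  shows "g C = h C"
proof -
  have gen: "presented_gen R S E \<in> S \<rightarrow> carrier (presented_module R S E)"
    by (intro funcsetI presented_gen_closed)
  \<comment> \<open>Both maps are compared with the same value of \<open>lin_ext\<close>, so the
    representative chosen in it does not matter.\<close>
  have "g (lin_ext R (presented_module R S E) (presented_gen R S E) C) = g C"
    by (rule lin_ext_transport(1)[OF presented_module_module assms(1) gen assms(2,2) _ assms(5)]) simp
  moreover have "g (lin_ext R (presented_module R S E) (presented_gen R S E) C) = h C"
    by (rule lin_ext_transport(1)[OF presented_module_module assms(1) gen assms(2,3) assms(4) assms(5)])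
  ultimately show ?thesis by simp
qed

end

section \<open>Finite G-sets and correspondences\<close>

definition fin_gset :: "'g monoid \<Rightarrow> ('g, 'x) gset \<Rightarrow> bool" where
  "fin_gset G X \<longleftrightarrow> finite (fst X) \<and> group_action G (fst X) (snd X)"

lemma fin_gsets_iff: "X \<in> fin_gsets G \<longleftrightarrow> fin_gset G X"
  by (auto simp: fin_gsets_def fin_gset_def split: prod.splits)

lemma fin_gset_group: "fin_gset G X \<Longrightarrow> group G"
  by (auto simp: fin_gset_def group_action_def group_hom_def)

lemma fin_gset_finite: "fin_gset G X \<Longrightarrow> finite (fst X)"
  by (auto simp: fin_gset_def)

lemma act_closed: "fin_gset G X \<Longrightarrow> g \<in> carrier G \<Longrightarrow> x \<in> fst X \<Longrightarrow> snd X g x \<in> fst X"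
  by (auto simp: fin_gset_def intro: group_action.element_image)

lemma act_one: "fin_gset G X \<Longrightarrow> x \<in> fst X \<Longrightarrow> snd X \<one>\<^bsub>G\<^esub> x = x"
  using group_action.id_eq_one[of G "fst X" "snd X"] unfolding fin_gset_def by (metis restrict_apply')

lemma act_mult:
  "fin_gset G X \<Longrightarrow> g \<in> carrier G \<Longrightarrow> h \<in> carrier G \<Longrightarrow> x \<in> fst X \<Longrightarrow>
    snd X (g \<otimes>\<^bsub>G\<^esub> h) x = snd X g (snd X h x)"
  by (auto simp: fin_gset_def intro: group_action.composition_rule)

lemma act_inv_cancel:
  assumes "fin_gset G X" "g \<in> carrier G" "x \<in> fst X"
  shows "snd X (inv\<^bsub>G\<^esub> g) (snd X g x) = x" "snd X g (snd X (inv\<^bsub>G\<^esub> g) x) = x"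
proof -
  interpret group G using fin_gset_group[OF assms(1)] .
  show "snd X (inv\<^bsub>G\<^esub> g) (snd X g x) = x" "snd X g (snd X (inv\<^bsub>G\<^esub> g) x) = x"
    using assms act_one[OF assms(1,3)] by (simp_all flip: act_mult)
qed

lemma act_eq_iff:
  assumes "fin_gset G X" "g \<in> carrier G" "x \<in> fst X" "y \<in> fst X"
  shows "snd X g x = y \<longleftrightarrow> x = snd X (inv\<^bsub>G\<^esub> g) y"
  using act_inv_cancel[OF assms(1,2)] assms(3,4) by metis

text \<open>The extensionality condition comes from \<open>BijGroup\<close>, whose elements are
  bijections that are \<open>undefined\<close> outside the set; the action maps must literally be
  such functions.\<close>

lemma fin_gsetI:
  assumes "group G" "finite (fst X)"
    and closed: "\<And>g x. g \<in> carrier G \<Longrightarrow> x \<in> fst X \<Longrightarrow> snd X g x \<in> fst X"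
    and one: "\<And>x. x \<in> fst X \<Longrightarrow> snd X \<one>\<^bsub>G\<^esub> x = x"
    and mult: "\<And>g h x. g \<in> carrier G \<Longrightarrow> h \<in> carrier G \<Longrightarrow> x \<in> fst X \<Longrightarrow>
      snd X (g \<otimes>\<^bsub>G\<^esub> h) x = snd X g (snd X h x)"
    and ext: "\<And>g. g \<in> carrier G \<Longrightarrow> snd X g \<in> extensional (fst X)"
  shows "fin_gset G X"
proof -
  interpret group G by fact
  have bij: "snd X g \<in> Bij (fst X)" if g: "g \<in> carrier G" for g
  proof -
    have "snd X (inv\<^bsub>G\<^esub> g) (snd X g x) = x" "snd X g (snd X (inv\<^bsub>G\<^esub> g) x) = x" if "x \<in> fst X" for x
      using g that one by (simp_all flip: mult)
    hence "bij_betw (snd X g) (fst X) (fst X)"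
      by (intro bij_betw_byWitness[where f' = "snd X (inv\<^bsub>G\<^esub> g)"]) (use g closed in auto)
    thus ?thesis using ext[OF g] by (simp add: Bij_def)
  qed
  have "snd X \<in> hom G (BijGroup (fst X))"
  proof (rule homI)
    fix g h assume gh: "g \<in> carrier G" "h \<in> carrier G"
    have "snd X (g \<otimes>\<^bsub>G\<^esub> h) = compose (fst X) (snd X g) (snd X h)"
      by (rule extensionalityI[OF ext]) (use gh mult in \<open>auto simp: compose_eq\<close>)
    thus "snd X (g \<otimes>\<^bsub>G\<^esub> h) = snd X g \<otimes>\<^bsub>BijGroup (fst X)\<^esub> snd X h"
      using bij gh by (simp add: BijGroup_def)
  qed (use bij in \<open>simp add: BijGroup_def\<close>)
  thus ?thesis
    using assms(1,2) group_BijGroup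
    by (auto simp: fin_gset_def group_action_def group_hom_def group_hom_axioms_def)
qed

lemma gset_iso_refl: "gset_iso G X X"
  by (auto simp: gset_iso_def intro!: exI[of _ id])

lemma gset_iso_trans: "gset_iso G X Y \<Longrightarrow> gset_iso G Y Z \<Longrightarrow> gset_iso G X Z"
  unfolding gset_iso_def
proof safe
  fix f f'
  assume f: "bij_betw f (fst X) (fst Y)" "\<forall>g\<in>carrier G. \<forall>x\<in>fst X. f (snd X g x) = snd Y g (f x)"
    and f': "bij_betw f' (fst Y) (fst Z)" "\<forall>g\<in>carrier G. \<forall>x\<in>fst Y. f' (snd Y g x) = snd Z g (f' x)"
  have "\<forall>g\<in>carrier G. \<forall>x\<in>fst X. (f' \<circ> f) (snd X g x) = snd Z g ((f' \<circ> f) x)"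
    using f f' bij_betwE[OF f(1)] by simp
  with bij_betw_trans[OF f(1) f'(1)]
  show "\<exists>f. bij_betw f (fst X) (fst Z) \<and> (\<forall>g\<in>carrier G. \<forall>x\<in>fst X. f (snd X g x) = snd Z g (f x))"
    by blast
qed

lemma gset_iso_sym:
  assumes "gset_iso G X Y" "fin_gset G X"
  shows "gset_iso G Y X"
proof -
  obtain f where f: "bij_betw f (fst X) (fst Y)"
      "\<And>g x. g \<in> carrier G \<Longrightarrow> x \<in> fst X \<Longrightarrow> f (snd X g x) = snd Y g (f x)"
    using assms(1) by (auto simp: gset_iso_def)
  let ?i = "inv_into (fst X) f"
  have i: "bij_betw ?i (fst Y) (fst X)" by (rule bij_betw_inv_into[OF f(1)])
  have "?i (snd Y g y) = snd X g (?i y)" if "g \<in> carrier G" "y \<in> fst Y" for g y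
  proof -
    have x: "?i y \<in> fst X" using i that by (auto simp: bij_betw_def)
    have "f (snd X g (?i y)) = snd Y g y"
      using f(2)[OF that(1) x] that(2) f(1) by (simp add: bij_betw_inv_into_right)
    thus ?thesis using act_closed[OF assms(2) that(1) x] f(1)
      by (metis bij_betw_inv_into_left)
  qed
  thus ?thesis using i by (auto simp: gset_iso_def)
qed

lemma gset_iso_transport:
  assumes "fin_gset G X" "bij_betw f (fst X) B"
  obtains Y where "fin_gset G Y" "gset_iso G X Y" "fst Y = B"
proof -
  let ?i = "inv_into (fst X) f"
  define Y where "Y = (B, \<lambda>g. \<lambda>y\<in>B. f (snd X g (?i y)))"
  have fi: "f x \<in> B" "?i (f x) = x" if "x \<in> fst X" for x
    using that assms(2) by (auto simp: bij_betw_def)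
  have iB: "?i y \<in> fst X" "f (?i y) = y" if "y \<in> B" for y
    using that assms(2) by (auto simp: bij_betw_def f_inv_into_f inv_into_into)
  have fB: "finite B" using assms bij_betw_finite fin_gset_finite by blast
  interpret group G using fin_gset_group[OF assms(1)] .
  have "fin_gset G Y"
    by (rule fin_gsetI)
       (use fB is_group assms(1) fi iB in
        \<open>auto simp: Y_def act_closed act_one act_mult\<close>)
  moreover have "gset_iso G X Y"
    unfolding gset_iso_def
    by (rule exI[of _ f]) (use assms fi act_closed[OF assms(1)] in \<open>auto simp: Y_def\<close>)
  ultimately show ?thesis using that by (auto simp: Y_def)
qed

lemma gset_iso_nat:
  assumes "fin_gset G X"
  obtains Y :: "('g, nat) gset" where "Y \<in> fin_gsets G" "gset_iso G X Y"
proof -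
  obtain f :: "'a \<Rightarrow> nat" where "bij_betw f (fst X) {0..<card (fst X)}"
    using ex_bij_betw_finite_nat[OF fin_gset_finite[OF assms]] by blast
  from gset_iso_transport[OF assms this] that show ?thesis by (metis fin_gsets_iff)
qed

lemma fin_gset_sum:
  assumes "fin_gset G X" "fin_gset G Y"
  shows "fin_gset G (gset_sum X Y)"
  by (rule fin_gsetI)
     (use assms fin_gset_group[OF assms(1)] in
      \<open>auto simp: gset_sum_def fin_gset_finite act_closed act_one act_mult\<close>)

definition gprod :: "('g, 'x) gset \<Rightarrow> ('h, 'y) gset \<Rightarrow> ('g \<times> 'h, 'x \<times> 'y) gset" where
  "gprod X Y = (fst X \<times> fst Y, \<lambda>(g, h). \<lambda>(x, y)\<in>fst X \<times> fst Y. (snd X g x, snd Y h y))"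

lemma gprod_simps:
  "fst (gprod X Y) = fst X \<times> fst Y"
  "x \<in> fst X \<Longrightarrow> y \<in> fst Y \<Longrightarrow> snd (gprod X Y) (g, h) (x, y) = (snd X g x, snd Y h y)"
  by (auto simp: gprod_def)

lemma fin_gset_gprod:
  assumes "fin_gset G X" "fin_gset H Y"
  shows "fin_gset (G \<times>\<times> H) (gprod X Y)"
proof (rule fin_gsetI)
  show "group (G \<times>\<times> H)"
    using assms by (intro DirProd_group fin_gset_group)
qed (use assms in \<open>auto simp: gprod_def fin_gset_finite act_closed act_one act_mult\<close>)

text \<open>A subgroup \<open>L\<close> of \<open>K \<times>\<times> H\<close> is regarded as the transitive \<open>(K, H)\<close>-biset \<open>(K \<times>\<times> H)/L\<close>.
  \<open>corr K L X Y j\<close> says that \<open>j : X \<rightarrow> Y\<close> exhibits the \<open>K\<close>-set \<open>Y\<close> as the result of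
  applying this biset to the \<open>H\<close>-set \<open>X\<close>.\<close>

definition corr ::
    "'k monoid \<Rightarrow> ('k \<times> 'h) set \<Rightarrow> ('h, 'x) gset \<Rightarrow> ('k, 'y) gset \<Rightarrow> ('x \<Rightarrow> 'y) \<Rightarrow> bool" where
  "corr K L X Y j \<longleftrightarrow>
    (\<forall>x\<in>fst X. j x \<in> fst Y) \<and>
    (\<forall>y\<in>fst Y. \<exists>k\<in>carrier K. \<exists>x\<in>fst X. y = snd Y k (j x)) \<and>
    (\<forall>x\<in>fst X. \<forall>x'\<in>fst X. \<forall>k\<in>carrier K.
      snd Y k (j x) = j x' \<longleftrightarrow> (\<exists>h. (k, h) \<in> L \<and> snd X h x = x'))"

lemma corrD:
  assumes "corr K L X Y j"
  shows "x \<in> fst X \<Longrightarrow> j x \<in> fst Y"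
    and "y \<in> fst Y \<Longrightarrow> \<exists>k\<in>carrier K. \<exists>x\<in>fst X. y = snd Y k (j x)"
    and "x \<in> fst X \<Longrightarrow> x' \<in> fst X \<Longrightarrow> k \<in> carrier K \<Longrightarrow>
      snd Y k (j x) = j x' \<longleftrightarrow> (\<exists>h. (k, h) \<in> L \<and> snd X h x = x')"
  using assms by (auto simp: corr_def)

lemma corrI:
  assumes "\<And>x. x \<in> fst X \<Longrightarrow> j x \<in> fst Y"
    and "\<And>y. y \<in> fst Y \<Longrightarrow> \<exists>k\<in>carrier K. \<exists>x\<in>fst X. y = snd Y k (j x)"
    and "\<And>x x' k. x \<in> fst X \<Longrightarrow> x' \<in> fst X \<Longrightarrow> k \<in> carrier K \<Longrightarrow>
      snd Y k (j x) = j x' \<longleftrightarrow> (\<exists>h. (k, h) \<in> L \<and> snd X h x = x')"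
  shows "corr K L X Y j"
  using assms by (auto simp: corr_def)

text \<open>Every point of \<open>Y\<close> has the form \<open>k (j x)\<close>, and whether two
  such points coincide is decided by \<open>L\<close> and \<open>X\<close> alone. So
  \<open>k (j x) \<mapsto> k (j' x)\<close> is well defined and bijective: \<open>L\<close> and
  \<open>X\<close> determine the applied set.\<close>

lemma corr_gset_iso:
  assumes Y: "fin_gset K Y" and Y': "fin_gset K Y'"
    and j: "corr K L X Y j" and j': "corr K L X Y' j'"
  shows "gset_iso K Y Y'"
proof -
  interpret group K using fin_gset_group[OF Y] .
  note jD = corrD[OF j] and jD' = corrD[OF j']
  have eq: "snd Y k (j x) = snd Y l (j x') \<longleftrightarrow> snd Y' k (j' x) = snd Y' l (j' x')"
    if "k \<in> carrier K" "l \<in> carrier K" "x \<in> fst X" "x' \<in> fst X" for k l x x'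
  proof -
    have "snd Z k (i x) = snd Z l (i x') \<longleftrightarrow> (\<exists>h. (inv\<^bsub>K\<^esub> l \<otimes>\<^bsub>K\<^esub> k, h) \<in> L \<and> snd X h x = x')"
      if Z: "fin_gset K Z" "corr K L X Z i" for Z :: "('a, 'z) gset" and i
    proof -
      note D = corrD[OF Z(2)]
      have "snd Z k (i x) = snd Z l (i x') \<longleftrightarrow> snd Z (inv\<^bsub>K\<^esub> l) (snd Z k (i x)) = i x'"
        using Z(1) D(1) \<open>k \<in> carrier K\<close> \<open>l \<in> carrier K\<close> \<open>x \<in> fst X\<close> \<open>x' \<in> fst X\<close>
        by (subst act_eq_iff[OF Z(1)]) (auto simp: act_closed)
      also have "\<dots> \<longleftrightarrow> snd Z (inv\<^bsub>K\<^esub> l \<otimes>\<^bsub>K\<^esub> k) (i x) = i x'"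
        using Z(1) D(1) \<open>k \<in> carrier K\<close> \<open>l \<in> carrier K\<close> \<open>x \<in> fst X\<close> by (simp add: act_mult)
      also have "\<dots> \<longleftrightarrow> (\<exists>h. (inv\<^bsub>K\<^esub> l \<otimes>\<^bsub>K\<^esub> k, h) \<in> L \<and> snd X h x = x')"
        using D(3) \<open>k \<in> carrier K\<close> \<open>l \<in> carrier K\<close> \<open>x \<in> fst X\<close> \<open>x' \<in> fst X\<close> by simp
      finally show ?thesis .
    qed
    thus ?thesis using Y Y' j j' by (smt (verit, best))
  qed
  have "\<forall>y\<in>fst Y. \<exists>p. fst p \<in> carrier K \<and> snd p \<in> fst X \<and> y = snd Y (fst p) (j (snd p))"
    using jD(2) by fastforce
  then obtain p where p: "\<And>y. y \<in> fst Y \<Longrightarrow> fst (p y) \<in> carrier K"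
    "\<And>y. y \<in> fst Y \<Longrightarrow> snd (p y) \<in> fst X" "\<And>y. y \<in> fst Y \<Longrightarrow> y = snd Y (fst (p y)) (j (snd (p y)))"
    by metis
  \<comment> \<open>\<open>p\<close> picks one expression of each point; \<open>eq\<close> makes the
    value independent of that choice.\<close>
  define f where "f y = snd Y' (fst (p y)) (j' (snd (p y)))" for y
  have f: "f (snd Y k (j x)) = snd Y' k (j' x)" if "k \<in> carrier K" "x \<in> fst X" for k x
  proof -
    have y: "snd Y k (j x) \<in> fst Y" using that Y jD(1) by (simp add: act_closed)
    show ?thesis
      unfolding f_def using p[OF y] that eq[OF p(1)[OF y] that(1) p(2)[OF y] that(2)] by simp
  qed
  have "bij_betw f (fst Y) (fst Y')"
    unfolding bij_betw_def
  proof safe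
    show "inj_on f (fst Y)"
      by (rule inj_onI) (metis f_def p eq)
  next
    fix y assume "y \<in> fst Y"
    thus "f y \<in> fst Y'" using p Y' jD'(1) by (simp add: f_def act_closed)
  next
    fix y assume "y \<in> fst Y'"
    then obtain k x where "k \<in> carrier K" "x \<in> fst X" "y = snd Y' k (j' x)" using jD'(2) by blast
    thus "y \<in> f ` fst Y" using f act_closed[OF Y] jD(1) by (metis image_eqI)
  qed
  moreover have "f (snd Y k y) = snd Y' k (f y)" if "k \<in> carrier K" "y \<in> fst Y" for k y
  proof -
    let ?l = "fst (p y)" and ?x = "snd (p y)"
    have "snd Y k y = snd Y (k \<otimes>\<^bsub>K\<^esub> ?l) (j ?x)"
      using p[OF that(2)] that Y jD(1) by (simp add: act_mult)
    hence "f (snd Y k y) = snd Y' (k \<otimes>\<^bsub>K\<^esub> ?l) (j' ?x)"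
      using f p[OF that(2)] that by simp
    thus ?thesis using p[OF that(2)] that Y' jD'(1) by (simp add: act_mult f_def)
  qed
  ultimately show ?thesis by (auto simp: gset_iso_def)
qed

section \<open>Subgroups as transitive bisets: existence of the applied set and compatibility with
  the constructions\<close>

definition grel :: "'k monoid \<Rightarrow> 'h monoid \<Rightarrow> ('k \<times> 'h) set \<Rightarrow> bool" where
  "grel K H L \<longleftrightarrow> group K \<and> finite (carrier K) \<and> group H \<and> finite (carrier H) \<and> subgroup L (K \<times>\<times> H)"

lemma grelD:
  assumes "grel K H L"
  shows "group K" "finite (carrier K)" "group H" "finite (carrier H)"
    and "(k, h) \<in> L \<Longrightarrow> k \<in> carrier K" "(k, h) \<in> L \<Longrightarrow> h \<in> carrier H"
    and "(\<one>\<^bsub>K\<^esub>, \<one>\<^bsub>H\<^esub>) \<in> L"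
    and "(k, h) \<in> L \<Longrightarrow> (k', h') \<in> L \<Longrightarrow> (k \<otimes>\<^bsub>K\<^esub> k', h \<otimes>\<^bsub>H\<^esub> h') \<in> L"
    and "(k, h) \<in> L \<Longrightarrow> (inv\<^bsub>K\<^esub> k, inv\<^bsub>H\<^esub> h) \<in> L"
proof -
  have s: "subgroup L (K \<times>\<times> H)" and g: "group K" "group H" using assms by (auto simp: grel_def)
  show "group K" "finite (carrier K)" "group H" "finite (carrier H)" using assms by (auto simp: grel_def)
  show c: "k \<in> carrier K" "h \<in> carrier H" if "(k, h) \<in> L" for k h
    using subgroup.subset[OF s] that by auto
  show "(\<one>\<^bsub>K\<^esub>, \<one>\<^bsub>H\<^esub>) \<in> L" using subgroup.one_closed[OF s] by simp
  show "(k, h) \<in> L \<Longrightarrow> (k', h') \<in> L \<Longrightarrow> (k \<otimes>\<^bsub>K\<^esub> k', h \<otimes>\<^bsub>H\<^esub> h') \<in> L"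
    using subgroup.m_closed[OF s] by fastforce
  show "(inv\<^bsub>K\<^esub> k, inv\<^bsub>H\<^esub> h) \<in> L" if "(k, h) \<in> L"
    using subgroup.m_inv_closed[OF s that] inv_DirProd[OF g c[OF that]] by simp
qed

lemma grelI:
  assumes "group K" "finite (carrier K)" "group H" "finite (carrier H)"
    and "\<And>k h. (k, h) \<in> L \<Longrightarrow> k \<in> carrier K \<and> h \<in> carrier H"
    and "(\<one>\<^bsub>K\<^esub>, \<one>\<^bsub>H\<^esub>) \<in> L"
    and "\<And>k h k' h'. (k, h) \<in> L \<Longrightarrow> (k', h') \<in> L \<Longrightarrow> (k \<otimes>\<^bsub>K\<^esub> k', h \<otimes>\<^bsub>H\<^esub> h') \<in> L"
    and "\<And>k h. (k, h) \<in> L \<Longrightarrow> (inv\<^bsub>K\<^esub> k, inv\<^bsub>H\<^esub> h) \<in> L"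
  shows "grel K H L"
proof -
  interpret KH: group "K \<times>\<times> H" using assms by (intro DirProd_group)
  have "subgroup L (K \<times>\<times> H)"
  proof (rule KH.subgroupI)
    show "inv\<^bsub>K \<times>\<times> H\<^esub> a \<in> L" if "a \<in> L" for a
      using that assms(5,8) inv_DirProd[OF assms(1,3)] by (cases a) fastforce
  qed (use assms(5-7) in \<open>auto, fastforce?\<close>)
  thus ?thesis using assms by (simp add: grel_def)
qed

text \<open>The model that gives existence: \<open>K \<times> X\<close> modulo the action
  \<open>(l, h) (k, x) = (k l\<^sup>-\<^sup>1, h x)\<close> of \<open>L\<close>. This is the biset
  \<open>(K \<times>\<times> H)/L\<close> tensored over \<open>H\<close> with
  \<open>X\<close>.\<close>

definition gT_orbit ::
    "'k monoid \<Rightarrow> ('k \<times> 'h) set \<Rightarrow> ('h, 'x) gset \<Rightarrow> 'k \<times> 'x \<Rightarrow> ('k \<times> 'x) set" where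
  "gT_orbit K L X = (\<lambda>(k, x). {(k \<otimes>\<^bsub>K\<^esub> inv\<^bsub>K\<^esub> l, snd X h x) | l h. (l, h) \<in> L})"

definition gT :: "'k monoid \<Rightarrow> ('k \<times> 'h) set \<Rightarrow> ('h, 'x) gset \<Rightarrow> ('k, ('k \<times> 'x) set) gset" where
  "gT K L X =
    (gT_orbit K L X ` (carrier K \<times> fst X),
     \<lambda>k. \<lambda>C\<in>gT_orbit K L X ` (carrier K \<times> fst X). map_prod (\<lambda>l. k \<otimes>\<^bsub>K\<^esub> l) id ` C)"

context
  fixes K :: "'k monoid" and H :: "'h monoid" and L and X :: "('h, 'x) gset"
  assumes L: "grel K H L" and X: "fin_gset H X"
begin

interpretation K: group K using grelD[OF L] by blast
interpretation H: group H using grelD[OF L] by blast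

lemma gT_orbit_mem:
  assumes "k \<in> carrier K" "x \<in> fst X" "(k', x') \<in> gT_orbit K L X (k, x)"
  shows "gT_orbit K L X (k', x') = gT_orbit K L X (k, x)"
proof -
  note D = grelD[OF L]
  have sub: "k' \<in> carrier K \<and> x' \<in> fst X \<and> gT_orbit K L X (k', x') \<subseteq> gT_orbit K L X (k, x)"
    if kx: "k \<in> carrier K" "x \<in> fst X" "(k', x') \<in> gT_orbit K L X (k, x)" for k x k' x'
  proof -
    obtain l h where lh: "(l, h) \<in> L" "k' = k \<otimes>\<^bsub>K\<^esub> inv\<^bsub>K\<^esub> l" "x' = snd X h x"
      using kx(3) by (auto simp: gT_orbit_def)
    have c: "l \<in> carrier K" "h \<in> carrier H" using D(5,6) lh(1) by auto
    have "gT_orbit K L X (k', x') \<subseteq> gT_orbit K L X (k, x)"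
    proof
      fix p assume "p \<in> gT_orbit K L X (k', x')"
      then obtain m g where mg: "(m, g) \<in> L" "p = (k' \<otimes>\<^bsub>K\<^esub> inv\<^bsub>K\<^esub> m, snd X g x')"
        by (auto simp: gT_orbit_def)
      have c': "m \<in> carrier K" "g \<in> carrier H" using D(5,6) mg(1) by auto
      have "p = (k \<otimes>\<^bsub>K\<^esub> inv\<^bsub>K\<^esub> (m \<otimes>\<^bsub>K\<^esub> l), snd X (g \<otimes>\<^bsub>H\<^esub> h) x)"
        using mg(2) lh(2,3) c c' kx X by (simp add: act_mult K.inv_mult_group K.m_assoc)
      moreover have "(m \<otimes>\<^bsub>K\<^esub> l, g \<otimes>\<^bsub>H\<^esub> h) \<in> L" using D(8) mg(1) lh(1) by blast
      ultimately show "p \<in> gT_orbit K L X (k, x)" by (auto simp: gT_orbit_def)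
    qed
    thus ?thesis using lh(2,3) c kx X by (simp add: act_closed)
  qed
  obtain l h where lh: "(l, h) \<in> L" "k' = k \<otimes>\<^bsub>K\<^esub> inv\<^bsub>K\<^esub> l" "x' = snd X h x"
    using assms(3) by (auto simp: gT_orbit_def)
  have c: "l \<in> carrier K" "h \<in> carrier H" using D(5,6) lh(1) by auto
  have "(k, x) = (k' \<otimes>\<^bsub>K\<^esub> inv\<^bsub>K\<^esub> (inv\<^bsub>K\<^esub> l), snd X (inv\<^bsub>H\<^esub> h) x')"
    using lh c assms X by (simp add: K.m_assoc act_inv_cancel)
  hence "(k, x) \<in> gT_orbit K L X (k', x')"
    using D(9)[OF lh(1)] by (auto simp: gT_orbit_def)
  thus ?thesis using sub sub[OF assms] by blast
qed

lemma gT_orbit_self: "k \<in> carrier K \<Longrightarrow> x \<in> fst X \<Longrightarrow> (k, x) \<in> gT_orbit K L X (k, x)"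
  using grelD(7)[OF L] act_one[OF X] by (force simp: gT_orbit_def)

lemma gT_act:
  assumes "k \<in> carrier K" "l \<in> carrier K" "x \<in> fst X"
  shows "snd (gT K L X) k (gT_orbit K L X (l, x)) = gT_orbit K L X (k \<otimes>\<^bsub>K\<^esub> l, x)"
proof -
  have "map_prod (\<lambda>l. k \<otimes>\<^bsub>K\<^esub> l) id ` gT_orbit K L X (l, x) = gT_orbit K L X (k \<otimes>\<^bsub>K\<^esub> l, x)"
    using assms grelD(5)[OF L] by (force simp: gT_orbit_def K.m_assoc image_iff)
  thus ?thesis using assms by (simp add: gT_def)
qed

lemma fin_gset_gT: "fin_gset K (gT K L X)"
proof (rule fin_gsetI[OF K.is_group])
  show "finite (fst (gT K L X))"
    using grelD(2)[OF L] fin_gset_finite[OF X] by (simp add: gT_def)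
next
  fix k C assume "k \<in> carrier K" "C \<in> fst (gT K L X)"
  then show "snd (gT K L X) k C \<in> fst (gT K L X)"
    using gT_act by (auto simp: gT_def)
next
  fix C assume "C \<in> fst (gT K L X)"
  then obtain l x where C: "l \<in> carrier K" "x \<in> fst X" "C = gT_orbit K L X (l, x)" by (auto simp: gT_def)
  show "snd (gT K L X) \<one>\<^bsub>K\<^esub> C = C" using C by (simp add: gT_act)
  fix g h assume "g \<in> carrier K" "h \<in> carrier K"
  thus "snd (gT K L X) (g \<otimes>\<^bsub>K\<^esub> h) C = snd (gT K L X) g (snd (gT K L X) h C)"
    using C by (simp add: gT_act K.m_assoc)
qed (simp add: gT_def)

lemma corr_gT: "corr K L X (gT K L X) (\<lambda>x. gT_orbit K L X (\<one>\<^bsub>K\<^esub>, x))"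
proof (rule corrI)
  fix C assume "C \<in> fst (gT K L X)"
  then obtain l x where C: "l \<in> carrier K" "x \<in> fst X" "C = gT_orbit K L X (l, x)" by (auto simp: gT_def)
  have "C = snd (gT K L X) l (gT_orbit K L X (\<one>\<^bsub>K\<^esub>, x))" using C by (simp add: gT_act)
  thus "\<exists>k\<in>carrier K. \<exists>x\<in>fst X. C = snd (gT K L X) k (gT_orbit K L X (\<one>\<^bsub>K\<^esub>, x))" using C by blast
next
  fix x x' k assume x: "x \<in> fst X" "x' \<in> fst X" "k \<in> carrier K"
  have "gT_orbit K L X (k, x) = gT_orbit K L X (\<one>\<^bsub>K\<^esub>, x') \<longleftrightarrow> (\<one>\<^bsub>K\<^esub>, x') \<in> gT_orbit K L X (k, x)"
    using gT_orbit_mem[OF x(3,1)] gT_orbit_self[OF K.one_closed x(2)] by auto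
  also have "\<dots> \<longleftrightarrow> (\<exists>l h. (l, h) \<in> L \<and> \<one>\<^bsub>K\<^esub> = k \<otimes>\<^bsub>K\<^esub> inv\<^bsub>K\<^esub> l \<and> x' = snd X h x)"
    by (auto simp: gT_orbit_def)
  also have "\<dots> \<longleftrightarrow> (\<exists>h. (k, h) \<in> L \<and> snd X h x = x')"
    using x grelD(5)[OF L] by (metis K.inv_closed K.inv_inv K.inv_unique' K.r_inv K.inv_equality)
  finally show "snd (gT K L X) k (gT_orbit K L X (\<one>\<^bsub>K\<^esub>, x)) = gT_orbit K L X (\<one>\<^bsub>K\<^esub>, x') \<longleftrightarrow>
    (\<exists>h. (k, h) \<in> L \<and> snd X h x = x')"
    using x by (simp add: gT_act)
qed (auto simp: gT_def)

end

lemma corr_Id: "fin_gset H X \<Longrightarrow> corr H (Id_on (carrier H)) X X (\<lambda>x. x)"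
  by (intro corrI) (auto simp: act_one intro!: bexI[of _ "\<one>\<^bsub>H\<^esub>"]
    intro: monoid.one_closed[OF group.is_monoid[OF fin_gset_group[of _ X]]])

lemma corr_iso:
  assumes "corr K L X Y j" "fin_gset H X'" "grel K H L"
    and "bij_betw f (fst X') (fst X)" "\<And>g x. g \<in> carrier H \<Longrightarrow> x \<in> fst X' \<Longrightarrow> f (snd X' g x) = snd X g (f x)"
  shows "corr K L X' Y (\<lambda>x. j (f x))"
proof (rule corrI)
  note D = corrD[OF assms(1)]
  have f: "f x \<in> fst X" if "x \<in> fst X'" for x using assms(4) that by (auto simp: bij_betw_def)
  show "j (f x) \<in> fst Y" if "x \<in> fst X'" for x using D(1) f that by blast
  show "\<exists>k\<in>carrier K. \<exists>x\<in>fst X'. y = snd Y k (j (f x))" if "y \<in> fst Y" for y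
    using D(2)[OF that] assms(4) unfolding bij_betw_def by (metis imageE)
  fix x x' k assume x: "x \<in> fst X'" "x' \<in> fst X'" "k \<in> carrier K"
  have "snd X h (f x) = f x' \<longleftrightarrow> snd X' h x = x'" if "(k, h) \<in> L" for h
  proof -
    have h: "h \<in> carrier H" using grelD(6)[OF assms(3) that] .
    show ?thesis
      using assms(5)[OF h x(1)] act_closed[OF assms(2) h x(1)] x(2) assms(4)
      by (metis bij_betw_def inj_on_eq_iff)
  qed
  thus "snd Y k (j (f x)) = j (f x') \<longleftrightarrow> (\<exists>h. (k, h) \<in> L \<and> snd X' h x = x')"
    using D(3)[OF f[OF x(1)] f[OF x(2)] x(3)] by blast
qed

text \<open>Applying \<open>L\<close> commutes with disjoint unions, which is what makes it additive
  on classes.\<close>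

lemma corr_sum:
  assumes "corr K L X Y j" "corr K L X' Y' j'" "fin_gset H X" "fin_gset H X'" "fin_gset K Y" "fin_gset K Y'"
    "grel K H L"
  shows "corr K L (gset_sum X X') (gset_sum Y Y') (map_sum j j')"
proof (rule corrI)
  note D = corrD[OF assms(1)] and D' = corrD[OF assms(2)]
  note sum = gset_sum_def
  show "map_sum j j' x \<in> fst (gset_sum Y Y')" if "x \<in> fst (gset_sum X X')" for x
    using that D(1) D'(1) by (auto simp: sum)
  show "\<exists>k\<in>carrier K. \<exists>x\<in>fst (gset_sum X X'). y = snd (gset_sum Y Y') k (map_sum j j' x)"
    if "y \<in> fst (gset_sum Y Y')" for y
  proof (cases y)
    case (Inl z)
    then obtain k x where "k \<in> carrier K" "x \<in> fst X" "z = snd Y k (j x)"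
      using D(2)[of z] \<open>y \<in> _\<close> by (auto simp: sum)
    thus ?thesis using Inl D(1) by (intro bexI[of _ k] bexI[of _ "Inl x"]) (auto simp: sum)
  next
    case (Inr z)
    then obtain k x where "k \<in> carrier K" "x \<in> fst X'" "z = snd Y' k (j' x)"
      using D'(2)[of z] \<open>y \<in> _\<close> by (auto simp: sum)
    thus ?thesis using Inr D'(1) by (intro bexI[of _ k] bexI[of _ "Inr x"]) (auto simp: sum)
  qed
  fix x x' k assume x: "x \<in> fst (gset_sum X X')" "x' \<in> fst (gset_sum X X')" "k \<in> carrier K"
  show "snd (gset_sum Y Y') k (map_sum j j' x) = map_sum j j' x' \<longleftrightarrow>
    (\<exists>h. (k, h) \<in> L \<and> snd (gset_sum X X') h x = x')"
    using x D(1) D'(1) D(3)[OF _ _ x(3)] D'(3)[OF _ _ x(3)]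
    by (cases x; cases x') (auto simp: sum)
qed

lemma corr_prod:
  assumes "corr K L X Y j" "corr K' L' X' Y' j'" "grel K H L" "grel K' H' L'"
  shows "corr (K \<times>\<times> K') {((k, k'), (h, h')) | k h k' h'. (k, h) \<in> L \<and> (k', h') \<in> L'}
    (gprod X X') (gprod Y Y') (map_prod j j')"
proof (rule corrI)
  note D = corrD[OF assms(1)] and D' = corrD[OF assms(2)]
  show "map_prod j j' x \<in> fst (gprod Y Y')" if "x \<in> fst (gprod X X')" for x
    using that D(1) D'(1) by (auto simp: gprod_simps)
  show "\<exists>k\<in>carrier (K \<times>\<times> K'). \<exists>x\<in>fst (gprod X X'). y = snd (gprod Y Y') k (map_prod j j' x)"
    if y: "y \<in> fst (gprod Y Y')" for y
  proof -
    obtain a b where ab: "y = (a, b)" "a \<in> fst Y" "b \<in> fst Y'" using y by (auto simp: gprod_simps)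
    obtain k x where k: "k \<in> carrier K" "x \<in> fst X" "a = snd Y k (j x)" using D(2)[OF ab(2)] by blast
    obtain k' x' where k': "k' \<in> carrier K'" "x' \<in> fst X'" "b = snd Y' k' (j' x')" using D'(2)[OF ab(3)] by blast
    show ?thesis using k k' ab D(1) D'(1)
      by (intro bexI[of _ "(k, k')"] bexI[of _ "(x, x')"]) (auto simp: gprod_simps)
  qed
  fix x x' k assume x: "x \<in> fst (gprod X X')" "x' \<in> fst (gprod X X')" "k \<in> carrier (K \<times>\<times> K')"
  obtain a b a' b' k1 k2 where e: "x = (a, b)" "x' = (a', b')" "k = (k1, k2)" by (metis surj_pair)
  have "a \<in> fst X" "a' \<in> fst X" "b \<in> fst X'" "b' \<in> fst X'" "k1 \<in> carrier K" "k2 \<in> carrier K'"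
    using x e by (auto simp: gprod_simps)
  thus "snd (gprod Y Y') k (map_prod j j' x) = map_prod j j' x' \<longleftrightarrow>
    (\<exists>h. (k, h) \<in> {((k, k'), (h, h')) | k h k' h'. (k, h) \<in> L \<and> (k', h') \<in> L'} \<and> snd (gprod X X') h x = x')"
    using D(1) D'(1) D(3)[of a a' k1] D'(3)[of b b' k2] by (auto simp: e gprod_simps)
qed

definition gfull :: "'h monoid \<Rightarrow> ('k \<times> 'h) set \<Rightarrow> ('h \<times> 'g) set \<Rightarrow> bool" where
  "gfull H L M \<longleftrightarrow> (\<forall>h\<in>carrier H. \<exists>k h1 h2 g. (k, h1) \<in> L \<and> (h2, g) \<in> M \<and> h = h1 \<otimes>\<^bsub>H\<^esub> h2)"

text \<open>If \<open>H\<close> is the product of the projections of \<open>L\<close> and \<open>M\<close>, then the Mackey formula for the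
  composite of the two bisets has a single term.\<close>

lemma corr_comp:
  assumes "corr H M X Y i" "corr K L Y Z j" "grel H G M" "grel K H L"
    and "fin_gset G X" "fin_gset H Y" "fin_gset K Z" "gfull H L M"
  shows "corr K (L O M) X Z (\<lambda>x. j (i x))"
proof (rule corrI)
  note D = corrD[OF assms(1)] and D' = corrD[OF assms(2)]
  note gM = grelD[OF assms(3)] and gL = grelD[OF assms(4)]
  interpret K: group K by (rule gL(1))
  show "j (i x) \<in> fst Z" if "x \<in> fst X" for x using that D(1) D'(1) by blast
  fix x x' k assume x: "x \<in> fst X" "x' \<in> fst X" "k \<in> carrier K"
  show "snd Z k (j (i x)) = j (i x') \<longleftrightarrow> (\<exists>g. (k, g) \<in> L O M \<and> snd X g x = x')"
  proof -
    have "snd Z k (j (i x)) = j (i x') \<longleftrightarrow> (\<exists>h. (k, h) \<in> L \<and> snd Y h (i x) = i x')"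
      by (rule D'(3)[OF D(1)[OF x(1)] D(1)[OF x(2)] x(3)])
    also have "\<dots> \<longleftrightarrow> (\<exists>h. (k, h) \<in> L \<and> (\<exists>g. (h, g) \<in> M \<and> snd X g x = x'))"
      using D(3)[OF x(1,2) gL(6)] by blast
    finally show ?thesis by blast
  qed
next
  note D = corrD[OF assms(1)] and D' = corrD[OF assms(2)]
  note gM = grelD[OF assms(3)] and gL = grelD[OF assms(4)]
  interpret K: group K by (rule gL(1))
  fix z assume "z \<in> fst Z"
  then obtain k y where ky: "k \<in> carrier K" "y \<in> fst Y" "z = snd Z k (j y)" using D'(2) by blast
  obtain h x where hx: "h \<in> carrier H" "x \<in> fst X" "y = snd Y h (i x)" using D(2) ky(2) by blast
  \<comment> \<open>Of the two factors of \<open>h\<close>, \<open>h2\<close> is pushed through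
    \<open>M\<close> into \<open>X\<close> and \<open>h1\<close> is pushed through \<open>L\<close>
    into \<open>K\<close>; what remains is a translate of the image of a point of
    \<open>X\<close>.\<close>
  obtain l h1 h2 g where lg: "(l, h1) \<in> L" "(h2, g) \<in> M" "h = h1 \<otimes>\<^bsub>H\<^esub> h2"
    using assms(8) hx(1) unfolding gfull_def by blast
  have c: "l \<in> carrier K" "h1 \<in> carrier H" "h2 \<in> carrier H" "g \<in> carrier G"
    using gL(5,6) gM(5,6) lg by auto
  have gx: "snd X g x \<in> fst X" using act_closed[OF assms(5) c(4) hx(2)] .
  have "snd Y h2 (i x) = i (snd X g x)" using D(3)[OF hx(2) gx c(3)] lg(2) by blast
  hence y: "y = snd Y h1 (i (snd X g x))"
    using hx(3) lg(3) c act_mult[OF assms(6) c(2,3) D(1)[OF hx(2)]] by simp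
  have "snd Z l (j (i (snd X g x))) = j y"
    using D'(3)[OF D(1)[OF gx] ky(2) c(1)] lg(1) y by blast
  hence "z = snd Z (k \<otimes>\<^bsub>K\<^esub> l) (j (i (snd X g x)))"
    using ky c act_mult[OF assms(7) ky(1) c(1) D'(1)[OF D(1)[OF gx]]] by simp
  thus "\<exists>k\<in>carrier K. \<exists>x\<in>fst X. z = snd Z k (j (i x))"
    using gx c(1) ky(1) K.m_closed by blast
qed

section \<open>Burnside groups with coefficients\<close>

text \<open>The additive group of an \<open>R\<close>-module seen over the integers. It is the
  target of maps on Burnside groups before scalars are extended.\<close>

definition int_mod :: "('n, 'p) ring_scheme \<Rightarrow> (int, 'n) module" where
  "int_mod N = \<lparr>carrier = carrier N, monoid.mult = undefined, one = undefined,
    zero = zero N, add = add N, smult = (\<lambda>n x. add_pow N n x)\<rparr>"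

lemma int_mod_simps:
  "carrier (int_mod N) = carrier N" "zero (int_mod N) = zero N" "add (int_mod N) = add N"
  "n \<odot>\<^bsub>int_mod N\<^esub> x = [n] \<cdot>\<^bsub>N\<^esub> x"
  by (simp_all add: int_mod_def)

lemma int_mod_module:
  assumes "abelian_group N"
  shows "module \<Z> (int_mod N)"
proof -
  interpret N: abelian_group N by fact
  show ?thesis
  proof (rule moduleI[OF int_is_cring])
    show "abelian_group (int_mod N)"
    proof (rule abelian_groupI)
      fix x assume "x \<in> carrier (int_mod N)"
      thus "\<exists>y\<in>carrier (int_mod N). y \<oplus>\<^bsub>int_mod N\<^esub> x = \<zero>\<^bsub>int_mod N\<^esub>"
        by (intro bexI[of _ "\<ominus>\<^bsub>N\<^esub> x"]) (simp_all add: int_mod_simps N.l_neg)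
    qed (simp_all add: int_mod_simps N.a_ac)
  qed (auto simp: int_mod_simps N.add.int_pow_mult N.add.int_pow_distrib N.add.int_pow_pow mult.commute)
qed

lemma linear_map_int:
  assumes "module \<Z> B" "module \<Z> N"
    and "\<And>x. x \<in> carrier B \<Longrightarrow> h x \<in> carrier N"
    and "\<And>x y. x \<in> carrier B \<Longrightarrow> y \<in> carrier B \<Longrightarrow> h (x \<oplus>\<^bsub>B\<^esub> y) = h x \<oplus>\<^bsub>N\<^esub> h y"
  shows "linear_map \<Z> B N h"
proof -
  interpret B: module \<Z> B by fact
  interpret N: module \<Z> N by fact
  have z: "h \<zero>\<^bsub>B\<^esub> = \<zero>\<^bsub>N\<^esub>"
    using assms(4)[OF B.M.zero_closed B.M.zero_closed] assms(3)[OF B.M.zero_closed] by simp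
  show ?thesis
  proof (rule linear_mapI)
    fix r :: int and x assume x: "x \<in> carrier B"
    note hx = assms(3)[OF x]
    have sc: "n \<odot>\<^bsub>B\<^esub> x \<in> carrier B" "n \<odot>\<^bsub>N\<^esub> h x \<in> carrier N" for n
      by (rule B.smult_closed[OF UNIV_I x], rule N.smult_closed[OF UNIV_I hx])
    have d: "(m + n) \<odot>\<^bsub>B\<^esub> x = (m \<odot>\<^bsub>B\<^esub> x) \<oplus>\<^bsub>B\<^esub> (n \<odot>\<^bsub>B\<^esub> x)"
      "(m + n) \<odot>\<^bsub>N\<^esub> h x = (m \<odot>\<^bsub>N\<^esub> h x) \<oplus>\<^bsub>N\<^esub> (n \<odot>\<^bsub>N\<^esub> h x)" for m n
      using B.smult_l_distr[OF UNIV_I UNIV_I x, of m n] N.smult_l_distr[OF UNIV_I UNIV_I hx, of m n]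
      by simp_all
    have one: "1 \<odot>\<^bsub>B\<^esub> x = x" "1 \<odot>\<^bsub>N\<^esub> h x = h x"
      using B.smult_one[OF x] N.smult_one[OF hx] by simp_all
    have zero: "0 \<odot>\<^bsub>B\<^esub> x = \<zero>\<^bsub>B\<^esub>" "0 \<odot>\<^bsub>N\<^esub> h x = \<zero>\<^bsub>N\<^esub>"
      using B.smult_l_null[OF x] N.smult_l_null[OF hx] by simp_all
    have nat: "h (int n \<odot>\<^bsub>B\<^esub> x) = int n \<odot>\<^bsub>N\<^esub> h x" for n
    proof (induction n)
      case 0
      show ?case using zero z by simp
    next
      case (Suc n)
      thus ?case using assms(4)[OF sc(1)[of "int n"] x] one d[of "int n" 1] by (simp add: add.commute)
    qed
    show "h (r \<odot>\<^bsub>B\<^esub> x) = r \<odot>\<^bsub>N\<^esub> h x"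
    proof (cases "r \<ge> 0")
      case True
      thus ?thesis using nat[of "nat r"] by simp
    next
      case False
      \<comment> \<open>For negative \<open>r\<close> both sides are compared after adding the
        multiple by the natural number \<open>m\<close> with \<open>r + m = 0\<close>; cancellation
        then reduces to the natural case.\<close>
      define m where "m = int (nat (- r))"
      have m: "r + m = 0" using False by (simp add: m_def)
      have "h (r \<odot>\<^bsub>B\<^esub> x) \<oplus>\<^bsub>N\<^esub> (m \<odot>\<^bsub>N\<^esub> h x) = \<zero>\<^bsub>N\<^esub>"
        using assms(4)[OF sc(1)[of r] sc(1)[of m]] d(1)[of r m] z zero(1) m nat[of "nat (- r)"]
        by (simp add: m_def)
      moreover have "(r \<odot>\<^bsub>N\<^esub> h x) \<oplus>\<^bsub>N\<^esub> (m \<odot>\<^bsub>N\<^esub> h x) = \<zero>\<^bsub>N\<^esub>"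
        using d(2)[of r m] zero(2) m by simp
      ultimately show ?thesis
        using N.M.add.right_cancel[OF sc(2)[of m] assms(3)[OF sc(1)[of r]] sc(2)[of r]] by simp
    qed
  qed (use assms in auto)
qed

text \<open>Gives linearity of a nested extension in its inner argument while the coefficients of
  the outer representative are held fixed.\<close>

lemma comb_linear_param:
  assumes "cring R" "module R M" "module R N" "\<And>s. s \<in> S \<Longrightarrow> linear_map R M N (g s)"
    "c \<in> carrier (free_module R S)"
  shows "linear_map R M N (\<lambda>y. comb R N (\<lambda>s. g s y) c)"
proof -
  interpret R: cring R by fact
  interpret M: module R M by fact
  interpret N: module R N by fact
  note c = free_module_carrierD[OF assms(1,5)]
  let ?A = "{s. c s \<noteq> \<zero>\<^bsub>R\<^esub>}"
  have g: "linear_map R M N (g s)" if "s \<in> ?A" for s using c(4) that assms(4) by auto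
  note gD = linear_mapD[OF g]
  show ?thesis
    unfolding comb_def[OF assms(1)]
  proof (rule linear_mapI)
    fix x assume x: "x \<in> carrier M"
    show "(\<Oplus>\<^bsub>N\<^esub>s\<in>?A. c s \<odot>\<^bsub>N\<^esub> g s x) \<in> carrier N"
      using gD(1)[OF _ x] c by (intro N.M.finsum_closed) auto
    fix y assume y: "y \<in> carrier M"
    have "(\<Oplus>\<^bsub>N\<^esub>s\<in>?A. c s \<odot>\<^bsub>N\<^esub> g s (x \<oplus>\<^bsub>M\<^esub> y)) = (\<Oplus>\<^bsub>N\<^esub>s\<in>?A. c s \<odot>\<^bsub>N\<^esub> g s x \<oplus>\<^bsub>N\<^esub> c s \<odot>\<^bsub>N\<^esub> g s y)"
      by (rule N.M.finsum_cong') (use gD c x y in \<open>auto simp: N.smult_r_distr\<close>)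
    also have "\<dots> = (\<Oplus>\<^bsub>N\<^esub>s\<in>?A. c s \<odot>\<^bsub>N\<^esub> g s x) \<oplus>\<^bsub>N\<^esub> (\<Oplus>\<^bsub>N\<^esub>s\<in>?A. c s \<odot>\<^bsub>N\<^esub> g s y)"
      by (rule N.M.finsum_addf) (use gD c x y in auto)
    finally show "(\<Oplus>\<^bsub>N\<^esub>s\<in>?A. c s \<odot>\<^bsub>N\<^esub> g s (x \<oplus>\<^bsub>M\<^esub> y)) =
      (\<Oplus>\<^bsub>N\<^esub>s\<in>?A. c s \<odot>\<^bsub>N\<^esub> g s x) \<oplus>\<^bsub>N\<^esub> (\<Oplus>\<^bsub>N\<^esub>s\<in>?A. c s \<odot>\<^bsub>N\<^esub> g s y)" .
  next
    fix r x assume rx: "r \<in> carrier R" "x \<in> carrier M"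
    have "c s \<odot>\<^bsub>N\<^esub> g s (r \<odot>\<^bsub>M\<^esub> x) = r \<odot>\<^bsub>N\<^esub> (c s \<odot>\<^bsub>N\<^esub> g s x)" if "s \<in> ?A" for s
      using gD(1,3)[OF that] rx c(1)
      by (simp add: R.m_comm flip: N.smult_assoc1)
    hence "(\<Oplus>\<^bsub>N\<^esub>s\<in>?A. c s \<odot>\<^bsub>N\<^esub> g s (r \<odot>\<^bsub>M\<^esub> x)) = (\<Oplus>\<^bsub>N\<^esub>s\<in>?A. r \<odot>\<^bsub>N\<^esub> (c s \<odot>\<^bsub>N\<^esub> g s x))"
      by (intro N.M.finsum_cong') (use gD(1) c rx in auto)
    also have "\<dots> = r \<odot>\<^bsub>N\<^esub> (\<Oplus>\<^bsub>N\<^esub>s\<in>?A. c s \<odot>\<^bsub>N\<^esub> g s x)"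
      by (rule N.finsum_smult_ldistr[symmetric]) (use gD(1) c rx in auto)
    finally show "(\<Oplus>\<^bsub>N\<^esub>s\<in>?A. c s \<odot>\<^bsub>N\<^esub> g s (r \<odot>\<^bsub>M\<^esub> x)) = r \<odot>\<^bsub>N\<^esub> (\<Oplus>\<^bsub>N\<^esub>s\<in>?A. c s \<odot>\<^bsub>N\<^esub> g s x)" .
  qed
qed

text \<open>The outer function \<open>\<lambda>s. lin_ext R N (f s) y\<close> must respect
  \<open>E\<close> for every \<open>y\<close>, not only for generators. Both sides of such a
  relation are linear in \<open>y\<close>, so they agree once they agree on the generators of the
  second module, where \<open>f'\<close> applies.\<close>

lemma lin_ext_bilinear:
  assumes R: "cring R" and N: "module R N"
    and E: "E \<subseteq> carrier (free_module R S) \<times> carrier (free_module R S)"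
    and F: "F \<subseteq> carrier (free_module R T) \<times> carrier (free_module R T)"
    and f: "\<And>s. s \<in> S \<Longrightarrow> compatible R T F N (f s)"
    and f': "\<And>t. t \<in> T \<Longrightarrow> compatible R S E N (\<lambda>s. f s t)"
  shows "y \<in> carrier (presented_module R T F) \<Longrightarrow>
      linear_map R (presented_module R S E) N (\<lambda>x. lin_ext R N (\<lambda>s. lin_ext R N (f s) y) x)"
    and "x \<in> carrier (presented_module R S E) \<Longrightarrow>
      linear_map R (presented_module R T F) N (\<lambda>y. lin_ext R N (\<lambda>s. lin_ext R N (f s) y) x)"
    and "s \<in> S \<Longrightarrow> t \<in> T \<Longrightarrow>
      lin_ext R N (\<lambda>s. lin_ext R N (f s) (presented_gen R T F t)) (presented_gen R S E s) = f s t"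
proof -
  note lin = lin_ext_linear[OF R F N f]
  note modT = presented_module_module[OF R F]
  have clin: "linear_map R (presented_module R T F) N (\<lambda>y. comb R N (\<lambda>s. lin_ext R N (f s) y) c)"
    if "c \<in> carrier (free_module R S)" for c
    by (rule comb_linear_param[OF R modT N lin that])
  have comp: "compatible R S E N (\<lambda>s. lin_ext R N (f s) y)" if y: "y \<in> carrier (presented_module R T F)" for y
    unfolding compatible_def[OF R E]
  proof (intro conjI)
    show "(\<lambda>s. lin_ext R N (f s) y) \<in> S \<rightarrow> carrier N"
      using linear_mapD(1)[OF lin y] by (rule funcsetI)
    show "\<forall>(a, b)\<in>E. comb R N (\<lambda>s. lin_ext R N (f s) y) a = comb R N (\<lambda>s. lin_ext R N (f s) y) b"
    proof clarify
    fix a b assume ab: "(a, b) \<in> E"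
    hence c: "a \<in> carrier (free_module R S)" "b \<in> carrier (free_module R S)" using E by auto
    note l = clin[OF c(1)] clin[OF c(2)]
    show "comb R N (\<lambda>s. lin_ext R N (f s) y) a = comb R N (\<lambda>s. lin_ext R N (f s) y) b"
    proof (rule presented_ext[OF R F N l _ y])
      fix t assume t: "t \<in> T"
      have ft: "(\<lambda>s. f s t) \<in> S \<rightarrow> carrier N" using f'[OF t] by (simp add: compatible_def[OF R E])
      have "comb R N (\<lambda>s. lin_ext R N (f s) (presented_gen R T F t)) c = comb R N (\<lambda>s. f s t) c"
        if "c \<in> carrier (free_module R S)" for c
        by (rule comb_cong[OF R N ft _ that, symmetric])
           (simp add: lin_ext_gen[OF R F N f t])
      from this[OF c(1)] this[OF c(2)]
      show "comb R N (\<lambda>s. lin_ext R N (f s) (presented_gen R T F t)) a =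
        comb R N (\<lambda>s. lin_ext R N (f s) (presented_gen R T F t)) b"
        using f'[OF t] ab by (auto simp: compatible_def[OF R E])
    qed
    qed
  qed
  show "linear_map R (presented_module R S E) N (\<lambda>x. lin_ext R N (\<lambda>s. lin_ext R N (f s) y) x)"
    if "y \<in> carrier (presented_module R T F)" for y
    by (rule lin_ext_linear[OF R E N comp[OF that]])
  show "linear_map R (presented_module R T F) N (\<lambda>y. lin_ext R N (\<lambda>s. lin_ext R N (f s) y) x)"
    if "x \<in> carrier (presented_module R S E)" for x
  proof -
    obtain c where c: "c \<in> carrier (free_module R S)" "x = presented_proj R S E c"
      using presented_surj[OF R E \<open>x \<in> _\<close>] by metis
    show ?thesis
      by (rule linear_map_cong[OF modT clin[OF c(1)]])
         (simp_all add: c(2) lin_ext_proj[OF R E N comp c(1)])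
  qed
  show "lin_ext R N (\<lambda>s. lin_ext R N (f s) (presented_gen R T F t)) (presented_gen R S E s) = f s t"
    if "s \<in> S" "t \<in> T"
    by (simp add: lin_ext_gen[OF R E N comp[OF presented_gen_closed[OF R F that(2)]] that(1)]
        lin_ext_gen[OF R F N f[OF that(1)] that(2)])
qed

subsection \<open>Burnside groups\<close>

lemma burnside_rels_carrier:
  "burnside_rels G \<subseteq> carrier (free_module \<Z> (fin_gsets G)) \<times> carrier (free_module \<Z> (fin_gsets G))"
proof -
  interpret F: module \<Z> "free_module \<Z> (fin_gsets G)" by (rule free_module_module[OF int_is_cring])
  show ?thesis
    by (auto simp: burnside_rels_def intro!: free_gen_carrier[OF int_is_cring] F.M.a_closed)
qed

lemmas int_burnside = int_is_cring burnside_rels_carrier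

lemma burnside_module: "module \<Z> (burnside G)"
  unfolding burnside_def by (rule presented_module_module[OF int_burnside])

definition gset_additive :: "'g monoid \<Rightarrow> ('n, 'p) ring_scheme \<Rightarrow> (('g, nat) gset \<Rightarrow> 'n) \<Rightarrow> bool" where
  "gset_additive G N f \<longleftrightarrow> (\<forall>X\<in>fin_gsets G. f X \<in> carrier N) \<and>
    (\<forall>X\<in>fin_gsets G. \<forall>Y\<in>fin_gsets G. \<forall>Z\<in>fin_gsets G.
      gset_iso G Z (gset_sum X Y) \<longrightarrow> f Z = f X \<oplus>\<^bsub>N\<^esub> f Y)"

lemma gset_additive_compatible:
  assumes N: "module \<Z> N" and add: "gset_additive G N f"
  shows "compatible \<Z> (fin_gsets G) (burnside_rels G) N f"
proof -
  let ?F = "free_module \<Z> (fin_gsets G)"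
  have f: "f \<in> fin_gsets G \<rightarrow> carrier N"
    using add by (auto simp: gset_additive_def)
  note l = linear_mapD[OF comb_linear[OF int_is_cring N f]]
  show ?thesis
    unfolding compatible_def[OF int_burnside]
  proof (intro conjI f, clarify)
    fix a b assume "(a, b) \<in> burnside_rels G"
    then obtain X Y Z where *: "a = free_gen \<Z> Z" "b = free_gen \<Z> X \<oplus>\<^bsub>?F\<^esub> free_gen \<Z> Y"
      "X \<in> fin_gsets G" "Y \<in> fin_gsets G" "Z \<in> fin_gsets G" "gset_iso G Z (gset_sum X Y)"
      by (auto simp: burnside_rels_def)
    have "comb \<Z> N f b = f X \<oplus>\<^bsub>N\<^esub> f Y"
      unfolding *(2) l(2)[OF free_gen_carrier[OF int_is_cring *(3)] free_gen_carrier[OF int_is_cring *(4)]]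
      by (simp only: comb_gen[OF int_is_cring N f *(3)] comb_gen[OF int_is_cring N f *(4)])
    moreover have "comb \<Z> N f a = f Z"
      unfolding *(1) by (rule comb_gen[OF int_is_cring N f *(5)])
    ultimately show "comb \<Z> N f a = comb \<Z> N f b"
      using add * by (simp add: gset_additive_def)
  qed
qed

lemma burnside_gen_add:
  assumes "X \<in> fin_gsets G" "Y \<in> fin_gsets G" "Z \<in> fin_gsets G" "gset_iso G Z (gset_sum X Y)"
  shows "presented_gen \<Z> (fin_gsets G) (burnside_rels G) Z =
    presented_gen \<Z> (fin_gsets G) (burnside_rels G) X \<oplus>\<^bsub>burnside G\<^esub>
    presented_gen \<Z> (fin_gsets G) (burnside_rels G) Y"
proof -
  let ?F = "free_module \<Z> (fin_gsets G)"
  have "(free_gen \<Z> Z, free_gen \<Z> X \<oplus>\<^bsub>?F\<^esub> free_gen \<Z> Y) \<in> burnside_rels G"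
    unfolding burnside_rels_def using assms by blast
  from presented_rel[OF int_burnside this]
  show ?thesis
    unfolding presented_gen_eq_proj[OF int_burnside] burnside_def
    by (simp only: linear_mapD(2)[OF presented_proj_linear[OF int_burnside]
          free_gen_carrier[OF int_is_cring assms(1)] free_gen_carrier[OF int_is_cring assms(2)]])
qed

definition empty_gset :: "('g, 'x) gset" where
  "empty_gset = ({}, \<lambda>_. \<lambda>x\<in>{}. x)"

lemma fin_gset_empty: "group G \<Longrightarrow> fin_gset G empty_gset"
  by (rule fin_gsetI) (auto simp: empty_gset_def)

lemma gset_iso_sum_empty: "gset_iso G X (gset_sum X empty_gset)"
  unfolding gset_iso_def
  by (rule exI[of _ Inl]) (auto simp: gset_sum_def empty_gset_def bij_betw_def Plus_def)

text \<open>The relation \<open>[\<emptyset>] = [\<emptyset>] + [\<emptyset>]\<close> makes the class of the empty set vanish.\<close>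

lemma gset_additive_iso:
  assumes "abelian_group N" "gset_additive G N f" "X \<in> fin_gsets G" "Y \<in> fin_gsets G" "gset_iso G X Y"
  shows "f X = f Y"
proof -
  interpret N: abelian_group N by fact
  have e: "empty_gset \<in> fin_gsets G"
    using fin_gset_empty[OF fin_gset_group] assms(3) unfolding fin_gsets_iff by blast
  have c: "f Z \<in> carrier N" if "Z \<in> fin_gsets G" for Z using assms(2) that by (simp add: gset_additive_def)
  have "f empty_gset = f empty_gset \<oplus>\<^bsub>N\<^esub> f empty_gset"
    using assms(2) e gset_iso_sum_empty[of G empty_gset] unfolding gset_additive_def by blast
  hence z: "f empty_gset = \<zero>\<^bsub>N\<^esub>" using c[OF e] by simp
  have "f X = f Y \<oplus>\<^bsub>N\<^esub> f empty_gset"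
    using assms(2-4) e gset_iso_trans[OF assms(5) gset_iso_sum_empty] unfolding gset_additive_def by blast
  thus ?thesis using z c[OF assms(4)] by simp
qed

lemma gset_additive_gen:
  "gset_additive G (burnside G) (presented_gen \<Z> (fin_gsets G) (burnside_rels G))"
  unfolding gset_additive_def
  using presented_gen_closed[OF int_burnside, folded burnside_def] burnside_gen_add by blast

text \<open>\<open>burnside_class\<close> picks an isomorphic set of natural numbers by choice; the
  choice is harmless because isomorphic sets give equal generators.\<close>

lemma burnside_class_eq_gen:
  assumes "fin_gset G X" "Y \<in> fin_gsets G" "gset_iso G X Y"
  shows "burnside_class G X = presented_gen \<Z> (fin_gsets G) (burnside_rels G) Y"
proof -
  interpret B: module \<Z> "burnside G" by (rule burnside_module)
  define Z where "Z = (SOME Y. Y \<in> fin_gsets G \<and> gset_iso G X Y)"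
  have Z: "Z \<in> fin_gsets G" "gset_iso G X Z"
    using someI[of "\<lambda>Y. Y \<in> fin_gsets G \<and> gset_iso G X Y"] assms(2,3) by (auto simp: Z_def)
  have "gset_iso G Z Y" using gset_iso_trans[OF gset_iso_sym[OF Z(2) assms(1)] assms(3)] .
  from gset_additive_iso[OF B.M.abelian_group_axioms gset_additive_gen Z(1) assms(2) this]
  show ?thesis by (simp add: burnside_class_def Z_def)
qed

lemma burnside_class_nat:
  fixes G :: "'g monoid"
  shows "X \<in> fin_gsets G \<Longrightarrow> burnside_class G X = presented_gen \<Z> (fin_gsets G) (burnside_rels G) X"
  by (rule burnside_class_eq_gen[OF _ _ gset_iso_refl]) (simp_all add: fin_gsets_iff)

lemma burnside_class_closed: "fin_gset G X \<Longrightarrow> burnside_class G X \<in> carrier (burnside G)"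
  using gset_iso_nat[of G X] burnside_class_eq_gen presented_gen_closed[OF int_burnside]
  unfolding burnside_def by metis

lemma burnside_class_iso:
  assumes "fin_gset G X" "fin_gset G Y" "gset_iso G X Y"
  shows "burnside_class G X = burnside_class G Y"
proof -
  obtain Z :: "('a, nat) gset" where Z: "Z \<in> fin_gsets G" "gset_iso G Y Z"
    using gset_iso_nat[OF assms(2)] by blast
  show ?thesis
    using burnside_class_eq_gen[OF assms(1) Z(1) gset_iso_trans[OF assms(3) Z(2)]]
      burnside_class_eq_gen[OF assms(2) Z] by simp
qed

lemma gset_iso_sum:
  assumes "gset_iso G X X'" "gset_iso G Y Y'"
  shows "gset_iso G (gset_sum X Y) (gset_sum X' Y')"
proof -
  obtain f where f: "bij_betw f (fst X) (fst X')" "\<forall>g\<in>carrier G. \<forall>x\<in>fst X. f (snd X g x) = snd X' g (f x)"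
    using assms(1) by (auto simp: gset_iso_def)
  obtain f' where f': "bij_betw f' (fst Y) (fst Y')" "\<forall>g\<in>carrier G. \<forall>x\<in>fst Y. f' (snd Y g x) = snd Y' g (f' x)"
    using assms(2) by (auto simp: gset_iso_def)
  have "bij_betw (map_sum f f') (fst X <+> fst Y) (fst X' <+> fst Y')"
    unfolding bij_betw_def
  proof
    have "inj_on f (fst X)" "inj_on f' (fst Y)" using f(1) f'(1) by (simp_all add: bij_betw_def)
    thus "inj_on (map_sum f f') (fst X <+> fst Y)"
      by (intro inj_onI) (elim PlusE; simp; blast dest: inj_onD)
    have "f ` fst X = fst X'" "f' ` fst Y = fst Y'" using f(1) f'(1) by (simp_all add: bij_betw_def)
    moreover have "map_sum f f' ` Inl ` fst X = Inl ` f ` fst X" "map_sum f f' ` Inr ` fst Y = Inr ` f' ` fst Y"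
      by (simp_all only: image_image map_sum.simps)
    ultimately show "map_sum f f' ` (fst X <+> fst Y) = fst X' <+> fst Y'"
      by (simp only: Plus_def image_Un)
  qed
  thus ?thesis
    unfolding gset_iso_def
    by (intro exI[of _ "map_sum f f'"])
       (use f f' bij_betwE[OF f(1)] bij_betwE[OF f'(1)] in \<open>auto simp: gset_sum_def\<close>)
qed

lemma burnside_class_sum:
  assumes "fin_gset G X" "fin_gset G Y"
  shows "burnside_class G (gset_sum X Y) = burnside_class G X \<oplus>\<^bsub>burnside G\<^esub> burnside_class G Y"
proof -
  obtain X' :: "('a, nat) gset" where X': "X' \<in> fin_gsets G" "gset_iso G X X'"
    using gset_iso_nat[OF assms(1)] by blast
  obtain Y' :: "('a, nat) gset" where Y': "Y' \<in> fin_gsets G" "gset_iso G Y Y'"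
    using gset_iso_nat[OF assms(2)] by blast
  have s: "fin_gset G (gset_sum X Y)" by (rule fin_gset_sum[OF assms])
  obtain Z :: "('a, nat) gset" where Z: "Z \<in> fin_gsets G" "gset_iso G (gset_sum X Y) Z"
    using gset_iso_nat[OF s] by blast
  have "gset_iso G Z (gset_sum X' Y')"
    by (rule gset_iso_trans[OF gset_iso_sym[OF Z(2) s] gset_iso_sum[OF X'(2) Y'(2)]])
  from burnside_gen_add[OF X'(1) Y'(1) Z(1) this]
  show ?thesis
    using burnside_class_eq_gen[OF s Z] burnside_class_eq_gen[OF assms(1) X']
      burnside_class_eq_gen[OF assms(2) Y'] by simp
qed

lemma burnside_ext:
  fixes G :: "'g monoid"
  assumes "module \<Z> N" "linear_map \<Z> (burnside G) N g" "linear_map \<Z> (burnside G) N h"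
    and "\<And>X. X \<in> fin_gsets G \<Longrightarrow> g (burnside_class G X) = h (burnside_class G X)"
    and "b \<in> carrier (burnside G)"
  shows "g b = h b"
  by (rule presented_ext[OF int_burnside assms(1) assms(2,3)[unfolded burnside_def]
        _ assms(5)[unfolded burnside_def]])
     (use assms(4) in \<open>simp add: burnside_class_nat\<close>)

definition gset_biadditive ::
    "'g monoid \<Rightarrow> 'h monoid \<Rightarrow> 'k monoid \<Rightarrow> (('g, nat) gset \<Rightarrow> ('h, nat) gset \<Rightarrow> ('k, 'x) gset) \<Rightarrow> bool" where
  "gset_biadditive G H K op \<longleftrightarrow>
    (\<forall>X\<in>fin_gsets G. \<forall>Y\<in>fin_gsets H. fin_gset K (op X Y)) \<and>
    (\<forall>Y\<in>fin_gsets H. gset_additive G (burnside K) (\<lambda>X. burnside_class K (op X Y))) \<and>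
    (\<forall>X\<in>fin_gsets G. gset_additive H (burnside K) (\<lambda>Y. burnside_class K (op X Y)))"

subsection \<open>Scalar extension\<close>

context
  fixes R :: "('r, 'q) ring_scheme"
  assumes R: "cring R"
begin

interpretation R: cring R by (rule R)

lemma scalar_ext_rels_carrier:
  assumes "abelian_group B"
  shows "scalar_ext_rels R B \<subseteq>
    carrier (free_module R (carrier R \<times> carrier B)) \<times> carrier (free_module R (carrier R \<times> carrier B))"
proof -
  interpret F: module R "free_module R (carrier R \<times> carrier B)" by (rule free_module_module[OF R])
  interpret B: abelian_group B by fact
  show ?thesis
    unfolding scalar_ext_rels_def Let_def
    by (auto intro!: free_gen_carrier[OF R] F.M.a_closed F.smult_closed)
qed

context
  fixes B :: "('b, 'p) ring_scheme"
  assumes B: "abelian_group B"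
begin

interpretation B: abelian_group B by (rule B)

lemma scalar_ext_module: "module R (scalar_ext R B)"
  unfolding scalar_ext_def by (rule presented_module_module[OF R scalar_ext_rels_carrier[OF B]])

lemma scalar_tensor_closed:
  "r \<in> carrier R \<Longrightarrow> b \<in> carrier B \<Longrightarrow> scalar_tensor R B r b \<in> carrier (scalar_ext R B)"
  unfolding scalar_ext_def scalar_tensor_def
  by (rule presented_gen_closed[OF R scalar_ext_rels_carrier[OF B]]) simp

lemma scalar_tensor_add:
  assumes "r \<in> carrier R" "b \<in> carrier B" "c \<in> carrier B"
  shows "scalar_tensor R B r (b \<oplus>\<^bsub>B\<^esub> c) =
      scalar_tensor R B r b \<oplus>\<^bsub>scalar_ext R B\<^esub> scalar_tensor R B r c"
proof -
  let ?F = "free_module R (carrier R \<times> carrier B)" and ?d = "free_gen R"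
  note pl = linear_mapD[OF presented_proj_linear[OF R scalar_ext_rels_carrier[OF B]]]
  have d: "?d (r, b) \<in> carrier ?F" if "r \<in> carrier R" "b \<in> carrier B" for r b
    by (rule free_gen_carrier[OF R]) (use that in simp)
  have "(?d (r, b \<oplus>\<^bsub>B\<^esub> c), ?d (r, b) \<oplus>\<^bsub>?F\<^esub> ?d (r, c)) \<in> scalar_ext_rels R B"
    unfolding scalar_ext_rels_def Let_def using assms by blast
  from presented_rel[OF R scalar_ext_rels_carrier[OF B] this]
  show ?thesis
    unfolding scalar_tensor_def scalar_ext_def presented_gen_eq_proj[OF R scalar_ext_rels_carrier[OF B]]
    by (simp only: pl(2)[OF d[OF assms(1,2)] d[OF assms(1,3)]])
qed

lemma scalar_tensor_smult:
  assumes "r \<in> carrier R" "s \<in> carrier R" "b \<in> carrier B"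
  shows "scalar_tensor R B (s \<otimes>\<^bsub>R\<^esub> r) b = s \<odot>\<^bsub>scalar_ext R B\<^esub> scalar_tensor R B r b"
proof -
  let ?F = "free_module R (carrier R \<times> carrier B)" and ?d = "free_gen R"
  note pl = linear_mapD[OF presented_proj_linear[OF R scalar_ext_rels_carrier[OF B]]]
  have d: "?d (r, b) \<in> carrier ?F"
    by (rule free_gen_carrier[OF R]) (use assms in simp)
  have "(?d (s \<otimes>\<^bsub>R\<^esub> r, b), s \<odot>\<^bsub>?F\<^esub> ?d (r, b)) \<in> scalar_ext_rels R B"
    unfolding scalar_ext_rels_def Let_def using assms by blast
  from presented_rel[OF R scalar_ext_rels_carrier[OF B] this]
  show ?thesis
    unfolding scalar_tensor_def scalar_ext_def presented_gen_eq_proj[OF R scalar_ext_rels_carrier[OF B]]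
    by (simp only: pl(3)[OF assms(2) d])
qed

text \<open>The universal property of \<open>R \<otimes> B\<close>: an additive map \<open>h\<close>
  into an \<open>R\<close>-module, extended by \<open>(r, b) \<mapsto> r h(b)\<close>, respects the
  biadditivity relations.\<close>

lemma scalar_ext_compatible:
  assumes "module R N"
    and h: "\<And>b. b \<in> carrier B \<Longrightarrow> h b \<in> carrier N"
      "\<And>b c. b \<in> carrier B \<Longrightarrow> c \<in> carrier B \<Longrightarrow> h (b \<oplus>\<^bsub>B\<^esub> c) = h b \<oplus>\<^bsub>N\<^esub> h c"
    and f: "\<And>r b. r \<in> carrier R \<Longrightarrow> b \<in> carrier B \<Longrightarrow> f (r, b) = r \<odot>\<^bsub>N\<^esub> h b"
  shows "compatible R (carrier R \<times> carrier B) (scalar_ext_rels R B) N f"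
proof -
  interpret N: module R N by fact
  let ?S = "carrier R \<times> carrier B"
  let ?F = "free_module R ?S" and ?d = "free_gen R"
  interpret F: module R ?F by (rule free_module_module[OF R])
  have fS: "f \<in> ?S \<rightarrow> carrier N" using h(1) f by auto
  note l = linear_mapD[OF comb_linear[OF R assms(1) fS]]
  have d: "?d (r, b) \<in> carrier ?F" if "r \<in> carrier R" "b \<in> carrier B" for r b
    by (rule free_gen_carrier[OF R]) (use that in simp)
  have g: "comb R N f (?d (r, b)) = r \<odot>\<^bsub>N\<^esub> h b" if "r \<in> carrier R" "b \<in> carrier B" for r b
    using comb_gen[OF R assms(1) fS, of "(r, b)"] that f by simp
  show ?thesis
    unfolding compatible_def[OF R scalar_ext_rels_carrier[OF B]]
  proof (intro conjI fS, clarify)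
    fix a b assume "(a, b) \<in> scalar_ext_rels R B"
    then consider
      (1) r s c where "a = ?d (r \<oplus>\<^bsub>R\<^esub> s, c)" "b = ?d (r, c) \<oplus>\<^bsub>?F\<^esub> ?d (s, c)"
        "r \<in> carrier R" "s \<in> carrier R" "c \<in> carrier B"
    | (2) r c e where "a = ?d (r, c \<oplus>\<^bsub>B\<^esub> e)" "b = ?d (r, c) \<oplus>\<^bsub>?F\<^esub> ?d (r, e)"
        "r \<in> carrier R" "c \<in> carrier B" "e \<in> carrier B"
    | (3) r s c where "a = ?d (s \<otimes>\<^bsub>R\<^esub> r, c)" "b = s \<odot>\<^bsub>?F\<^esub> ?d (r, c)"
        "r \<in> carrier R" "s \<in> carrier R" "c \<in> carrier B"
      unfolding scalar_ext_rels_def Let_def by blast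
    thus "comb R N f a = comb R N f b"
    proof cases
      case 1
      thus ?thesis using d h(1) by (simp add: l(2) g N.smult_l_distr)
    next
      case 2
      thus ?thesis using d h by (simp add: l(2) g N.smult_r_distr)
    next
      case 3
      thus ?thesis using d h(1) by (simp add: l(3) g N.smult_assoc1)
    qed
  qed
qed

end

lemma burnside_abelian: "abelian_group (burnside G)"
proof -
  interpret module \<Z> "burnside G" by (rule burnside_module)
  show ?thesis by (rule M.abelian_group_axioms)
qed

lemma RB_module: "module R (RB R G)"
  unfolding RB_def by (rule scalar_ext_module[OF burnside_abelian])

lemma RB_class_closed: "fin_gset G X \<Longrightarrow> RB_class R G X \<in> carrier (RB R G)"
  unfolding RB_def RB_class_def
  by (rule scalar_tensor_closed[OF burnside_abelian]) (auto simp: burnside_class_closed)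

lemma RB_class_iso:
  "fin_gset G X \<Longrightarrow> fin_gset G Y \<Longrightarrow> gset_iso G X Y \<Longrightarrow> RB_class R G X = RB_class R G Y"
  unfolding RB_class_def by (simp add: burnside_class_iso)

lemma RB_class_sum:
  "fin_gset G X \<Longrightarrow> fin_gset G Y \<Longrightarrow>
    RB_class R G (gset_sum X Y) = RB_class R G X \<oplus>\<^bsub>RB R G\<^esub> RB_class R G Y"
  unfolding RB_class_def RB_def
  by (simp add: burnside_class_sum burnside_class_closed scalar_tensor_add[OF burnside_abelian])

text \<open>The classes of sets generate \<open>RB\<close> as an \<open>R\<close>-module: tensors
  reduce to \<open>1 \<otimes> b\<close>, and additivity reduces \<open>b\<close> to classes.
  Identities between linear maps on \<open>RB\<close> are checked on sets through this.\<close>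

lemma RB_ext_eq:
  fixes G :: "'g monoid"
  assumes "module R N" "linear_map R (RB R G) N g" "linear_map R (RB R G) N h"
    and "\<And>X. X \<in> fin_gsets G \<Longrightarrow> g (RB_class R G X) = h (RB_class R G X)"
    and "x \<in> carrier (RB R G)"
  shows "g x = h x"
proof -
  interpret N: module R N by fact
  let ?t = "scalar_tensor R (burnside G)"
  note sr = scalar_tensor_add[OF burnside_abelian, of _ _ G] scalar_tensor_smult[OF burnside_abelian, of _ _ _ G] and sc = scalar_tensor_closed[OF burnside_abelian, of _ _ G]
  have l: "linear_map \<Z> (burnside G) (int_mod N) (\<lambda>b. g (?t \<one>\<^bsub>R\<^esub> b))"
    if "linear_map R (RB R G) N g" for g
    using linear_mapD[OF that] sc
    by (intro linear_map_int[OF burnside_module int_mod_module[OF N.M.abelian_group_axioms]])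
       (auto simp: RB_def sr(1) int_mod_simps)
  have one: "g (?t \<one>\<^bsub>R\<^esub> b) = h (?t \<one>\<^bsub>R\<^esub> b)" if "b \<in> carrier (burnside G)" for b
    by (rule burnside_ext[OF int_mod_module[OF N.M.abelian_group_axioms] l[OF assms(2)] l[OF assms(3)] _ that])
       (use assms(4) in \<open>simp add: RB_class_def\<close>)
  show ?thesis
  proof (rule presented_ext[OF R scalar_ext_rels_carrier[OF burnside_abelian] assms(1)
        assms(2,3)[unfolded RB_def scalar_ext_def] _ assms(5)[unfolded RB_def scalar_ext_def]])
    fix p assume "p \<in> carrier R \<times> carrier (burnside G)"
    then obtain r b where p: "p = (r, b)" "r \<in> carrier R" "b \<in> carrier (burnside G)" by auto
    have "?t r b = r \<odot>\<^bsub>RB R G\<^esub> ?t \<one>\<^bsub>R\<^esub> b"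
      using sr(2)[OF R.one_closed p(2) p(3)] p(2) by (simp add: RB_def)
    thus "g (presented_gen R (carrier R \<times> carrier (burnside G)) (scalar_ext_rels R (burnside G)) p) =
      h (presented_gen R (carrier R \<times> carrier (burnside G)) (scalar_ext_rels R (burnside G)) p)"
      using one[OF p(3)] linear_mapD(3)[OF assms(2) p(2)] linear_mapD(3)[OF assms(3) p(2)]
        sc[OF R.one_closed p(3)]
      by (simp add: scalar_tensor_def p(1) RB_def)
  qed
qed

text \<open>The universal property of \<open>RB\<close>. The extension is made first to the Burnside
  group over the integers, then to \<open>R \<otimes> B(G)\<close>.\<close>

lemma RB_ext_exists:
  assumes "module R N" "gset_additive G N f"
  shows "\<exists>h. linear_map R (RB R G) N h \<and> (\<forall>X\<in>fin_gsets G. h (RB_class R G X) = f X)"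
proof -
  interpret N: module R N by fact
  let ?b = "lin_ext \<Z> (int_mod N) f"
  have "gset_additive G (int_mod N) f"
    using assms(2) by (simp add: gset_additive_def int_mod_simps)
  note c = gset_additive_compatible[OF int_mod_module[OF N.M.abelian_group_axioms] this]
  note b = linear_mapD[OF lin_ext_linear[OF int_burnside int_mod_module[OF N.M.abelian_group_axioms] c],
      folded burnside_def, unfolded int_mod_simps]
  have bg: "?b (burnside_class G X) = f X" if "X \<in> fin_gsets G" for X
    using lin_ext_gen[OF int_burnside int_mod_module[OF N.M.abelian_group_axioms] c that]
    by (simp add: burnside_class_nat[OF that])
  let ?h = "lin_ext R N (\<lambda>(r, b). r \<odot>\<^bsub>N\<^esub> ?b b)"
  have c': "compatible R (carrier R \<times> carrier (burnside G)) (scalar_ext_rels R (burnside G)) N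
      (\<lambda>(r, b). r \<odot>\<^bsub>N\<^esub> ?b b)"
    by (rule scalar_ext_compatible[OF burnside_abelian assms(1) b(1,2)]) auto
  note e = scalar_ext_rels_carrier[OF burnside_abelian, of G]
  have "linear_map R (RB R G) N ?h"
    unfolding RB_def scalar_ext_def by (rule lin_ext_linear[OF R e assms(1) c'])
  moreover have "?h (RB_class R G X) = f X" if X: "X \<in> fin_gsets G" for X
  proof -
    have X': "burnside_class G X \<in> carrier (burnside G)" using X by (simp add: burnside_class_closed fin_gsets_iff)
    have "?h (RB_class R G X) = \<one>\<^bsub>R\<^esub> \<odot>\<^bsub>N\<^esub> ?b (burnside_class G X)"
      using lin_ext_gen[OF R e assms(1) c', of "(\<one>\<^bsub>R\<^esub>, burnside_class G X)"] X'
      by (simp add: RB_class_def scalar_tensor_def)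
    thus ?thesis using bg[OF X] b(1)[OF X'] by simp
  qed
  ultimately show ?thesis by blast
qed

text \<open>Bilinearity comes in two layers, as in the definition: over the integers on Burnside
  groups (\<open>bb\<close>), then over \<open>R\<close> on tensors (\<open>l\<close>).\<close>

lemma RB_bilin_linear:
  assumes "gset_biadditive G H K op"
  shows "y \<in> carrier (RB R H) \<Longrightarrow> linear_map R (RB R G) (RB R K) (\<lambda>x. RB_bilin R K op x y)"
    and "x \<in> carrier (RB R G) \<Longrightarrow> linear_map R (RB R H) (RB R K) (\<lambda>y. RB_bilin R K op x y)"
    and "X \<in> fin_gsets G \<Longrightarrow> Y \<in> fin_gsets H \<Longrightarrow>
      RB_bilin R K op (RB_class R G X) (RB_class R H Y) = RB_class R K (op X Y)"
proof -
  let ?b = "burnside_bilin K op" and ?t = "scalar_tensor R (burnside K)"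
  let ?eG = "scalar_ext_rels R (burnside G)" and ?eH = "scalar_ext_rels R (burnside H)"
  let ?SG = "carrier R \<times> carrier (burnside G)" and ?SH = "carrier R \<times> carrier (burnside H)"
  let ?f = "\<lambda>(r, b) (s, c). ?t (r \<otimes>\<^bsub>R\<^esub> s) (?b b c)"
  interpret K: module R "RB R K" by (rule RB_module)
  note bb = lin_ext_bilinear[OF int_is_cring burnside_module[of K] burnside_rels_carrier[of G] burnside_rels_carrier[of H],
      of "\<lambda>X Y. burnside_class K (op X Y)", folded burnside_def burnside_bilin_def,
      OF gset_additive_compatible[OF burnside_module] gset_additive_compatible[OF burnside_module]]
  have ad: "Y \<in> fin_gsets H \<Longrightarrow> gset_additive G (burnside K) (\<lambda>X. burnside_class K (op X Y))"
    "X \<in> fin_gsets G \<Longrightarrow> gset_additive H (burnside K) (\<lambda>Y. burnside_class K (op X Y))" for X Y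
    using assms by (auto simp: gset_biadditive_def)
  note b1 = linear_mapD[OF bb(1)[OF ad(2) ad(1)]] and b2 = linear_mapD[OF bb(2)[OF ad(2) ad(1)]]
  have bc: "?b b c \<in> carrier (burnside K)" if "b \<in> carrier (burnside G)" "c \<in> carrier (burnside H)" for b c
    using b1(1) that by blast
  note tr = scalar_tensor_add[OF burnside_abelian, of _ _ K, folded RB_def]
  note tc = scalar_tensor_closed[OF burnside_abelian, of _ _ K, folded RB_def]
  have ts: "?t (r \<otimes>\<^bsub>R\<^esub> s) b = r \<odot>\<^bsub>RB R K\<^esub> ?t s b"
    if "r \<in> carrier R" "s \<in> carrier R" "b \<in> carrier (burnside K)" for r s b
    using scalar_tensor_smult[OF burnside_abelian that(2,1,3), folded RB_def] .
  have c1: "compatible R ?SH ?eH (RB R K) (?f p)" if pS: "p \<in> ?SG" for p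
  proof -
    obtain r b where p: "p = (r, b)" "r \<in> carrier R" "b \<in> carrier (burnside G)"
      using pS by auto
    show ?thesis
      by (rule scalar_ext_compatible[OF burnside_abelian RB_module, where h = "\<lambda>c. ?t r (?b b c)"])
         (use p bc b2(2) tc tr ts in \<open>auto simp: R.m_comm[of r]\<close>)
  qed
  have c2: "compatible R ?SG ?eG (RB R K) (\<lambda>p. ?f p q)" if qS: "q \<in> ?SH" for q
  proof -
    obtain s c where q: "q = (s, c)" "s \<in> carrier R" "c \<in> carrier (burnside H)"
      using qS by auto
    show ?thesis
      by (rule scalar_ext_compatible[OF burnside_abelian RB_module, where h = "\<lambda>b. ?t s (?b b c)"])
         (use q bc b1(2) tc tr ts in auto)
  qed
  have bil: "RB_bilin R K op x y = lin_ext R (RB R K) (\<lambda>p. lin_ext R (RB R K) (?f p) y) x" for x y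
    by (simp add: RB_bilin_def case_prod_unfold)
  note l = lin_ext_bilinear[OF R RB_module[of K] scalar_ext_rels_carrier[OF burnside_abelian[of G]]
      scalar_ext_rels_carrier[OF burnside_abelian[of H]], of ?f, folded bil, folded scalar_ext_def RB_def,
      OF c1 c2]
  show "y \<in> carrier (RB R H) \<Longrightarrow> linear_map R (RB R G) (RB R K) (\<lambda>x. RB_bilin R K op x y)"
    by (rule l(1))
  show "x \<in> carrier (RB R G) \<Longrightarrow> linear_map R (RB R H) (RB R K) (\<lambda>y. RB_bilin R K op x y)"
    by (rule l(2))
  assume X: "X \<in> fin_gsets G" and Y: "Y \<in> fin_gsets H"
  have "?b (burnside_class G X) (burnside_class H Y) = burnside_class K (op X Y)"
    using bb(3)[OF ad(2) ad(1) X Y] by (simp add: burnside_class_nat X Y burnside_bilin_def)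
  thus "RB_bilin R K op (RB_class R G X) (RB_class R H Y) = RB_class R K (op X Y)"
    using l(3)[of "(\<one>\<^bsub>R\<^esub>, burnside_class G X)" "(\<one>\<^bsub>R\<^esub>, burnside_class H Y)"] X Y
    by (simp add: bil RB_class_def scalar_tensor_def burnside_class_closed fin_gsets_iff)
qed

end

section \<open>The calculus of transitive bisets\<close>

definition prel :: "('k \<times> 'h) set \<Rightarrow> ('k' \<times> 'h') set \<Rightarrow> (('k \<times> 'k') \<times> ('h \<times> 'h')) set" where
  "prel L L' = {((k, k'), (h, h')) | k h k' h'. (k, h) \<in> L \<and> (k', h') \<in> L'}"

lemma prel_iff [simp]: "((k, k'), (h, h')) \<in> prel L L' \<longleftrightarrow> (k, h) \<in> L \<and> (k', h') \<in> L'"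
  by (auto simp: prel_def)

definition fgroup :: "'g monoid \<Rightarrow> bool" where
  "fgroup G \<longleftrightarrow> group G \<and> finite (carrier G)"

lemma fgroupD: "fgroup G \<Longrightarrow> group G" "fgroup G \<Longrightarrow> finite (carrier G)"
  by (auto simp: fgroup_def)

lemma fgroup_prod: "fgroup G \<Longrightarrow> fgroup H \<Longrightarrow> fgroup (G \<times>\<times> H)"
  by (auto simp: fgroup_def DirProd_group)

lemma grel_fgroup: "grel K H L \<Longrightarrow> fgroup K" "grel K H L \<Longrightarrow> fgroup H"
  by (auto simp: fgroup_def grel_def)

lemma grel_Id:
  assumes "fgroup H"
  shows "grel H H (Id_on (carrier H))"
proof -
  interpret group H using fgroupD(1)[OF assms] .
  show ?thesis by (rule grelI) (use fgroupD[OF assms] in \<open>auto intro: Id_onI\<close>)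
qed

lemma grel_comp:
  assumes "grel K H L" "grel H G M"
  shows "grel K G (L O M)"
proof -
  note D = grelD[OF assms(1)] and D' = grelD[OF assms(2)]
  show ?thesis
  proof (rule grelI[OF D(1,2) D'(3,4)])
    show "k \<in> carrier K \<and> g \<in> carrier G" if "(k, g) \<in> L O M" for k g using that D(5) D'(6) by blast
    show "(\<one>\<^bsub>K\<^esub>, \<one>\<^bsub>G\<^esub>) \<in> L O M" using D(7) D'(7) by blast
    show "(k \<otimes>\<^bsub>K\<^esub> k', g \<otimes>\<^bsub>G\<^esub> g') \<in> L O M" if "(k, g) \<in> L O M" "(k', g') \<in> L O M" for k g k' g'
      using that D(8) D'(8) by blast
    show "(inv\<^bsub>K\<^esub> k, inv\<^bsub>G\<^esub> g) \<in> L O M" if "(k, g) \<in> L O M" for k g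
      using that D(9) D'(9) by blast
  qed
qed

lemma grel_prel:
  assumes "grel K H L" "grel K' H' L'"
  shows "grel (K \<times>\<times> K') (H \<times>\<times> H') (prel L L')"
proof -
  note D = grelD[OF assms(1)] and D' = grelD[OF assms(2)]
  have g: "group (K \<times>\<times> K')" "group (H \<times>\<times> H')" using D(1,3) D'(1,3) by (auto intro: DirProd_group)
  show ?thesis
    by (rule grelI[OF g(1) _ g(2)])
       (use D D' inv_DirProd[OF D(1) D'(1)] inv_DirProd[OF D(3) D'(3)] in \<open>auto simp: prel_def\<close>)
qed

lemma gset_iso_corr:
  assumes "corr K L X Y j" "gset_iso H X' X" "fin_gset H X'" "grel K H L"
  shows "\<exists>j'. corr K L X' Y j'"
  using corr_iso[OF assms(1,3,4)] assms(2) unfolding gset_iso_def by blast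

lemma corr_gset_iso':
  assumes "fin_gset K Y" "fin_gset K Y'" "corr K L X Y j" "corr K L X' Y' j'" "gset_iso H X X'"
    "fin_gset H X" "grel K H L"
  shows "gset_iso K Y Y'"
  using gset_iso_corr[OF assms(4,5,6,7)] corr_gset_iso[OF assms(1,2,3)] by blast

lemma gset_iso_gprod:
  assumes "gset_iso G X X'" "gset_iso H Y Y'"
  shows "gset_iso (G \<times>\<times> H) (gprod X Y) (gprod X' Y')"
proof -
  obtain f where f: "bij_betw f (fst X) (fst X')" "\<forall>g\<in>carrier G. \<forall>x\<in>fst X. f (snd X g x) = snd X' g (f x)"
    using assms(1) by (auto simp: gset_iso_def)
  obtain f' where f': "bij_betw f' (fst Y) (fst Y')" "\<forall>g\<in>carrier H. \<forall>x\<in>fst Y. f' (snd Y g x) = snd Y' g (f' x)"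
    using assms(2) by (auto simp: gset_iso_def)
  show ?thesis
    unfolding gset_iso_def
    by (intro exI[of _ "map_prod f f'"] conjI)
       (use f f' bij_betwE[OF f(1)] bij_betwE[OF f'(1)] in
         \<open>auto simp: gprod_simps intro: bij_betw_map_prod\<close>)
qed

lemma gset_iso_gprod_sum_left:
  "gset_iso (G \<times>\<times> H) (gprod (gset_sum X X') Y) (gset_sum (gprod X Y) (gprod X' Y))"
proof -
  let ?f = "\<lambda>(z, y). case z of Inl x \<Rightarrow> Inl (x, y) | Inr x \<Rightarrow> Inr (x, y)"
  have "bij_betw ?f ((fst X <+> fst X') \<times> fst Y) (fst X \<times> fst Y <+> fst X' \<times> fst Y)"
    by (rule bij_betw_byWitness[where f' = "case_sum (\<lambda>(x, y). (Inl x, y)) (\<lambda>(x, y). (Inr x, y))"]) auto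
  thus "gset_iso (G \<times>\<times> H) (gprod (gset_sum X X') Y) (gset_sum (gprod X Y) (gprod X' Y))"
    unfolding gset_iso_def
    by (intro exI[of _ ?f]) (auto simp: gprod_def gset_sum_def split: sum.splits)
qed

lemma gset_iso_gprod_sum_right:
  "gset_iso (G \<times>\<times> H) (gprod Y (gset_sum X X')) (gset_sum (gprod Y X) (gprod Y X'))"
proof -
  let ?f = "\<lambda>(y, z). case z of Inl x \<Rightarrow> Inl (y, x) | Inr x \<Rightarrow> Inr (y, x)"
  have "bij_betw ?f (fst Y \<times> (fst X <+> fst X')) (fst Y \<times> fst X <+> fst Y \<times> fst X')"
    by (rule bij_betw_byWitness[where f' = "case_sum (\<lambda>(y, x). (y, Inl x)) (\<lambda>(y, x). (y, Inr x))"]) auto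
  thus "gset_iso (G \<times>\<times> H) (gprod Y (gset_sum X X')) (gset_sum (gprod Y X) (gprod Y X'))"
    unfolding gset_iso_def
    by (intro exI[of _ ?f]) (auto simp: gprod_def gset_sum_def split: sum.splits)
qed

text \<open>The common shape of the bilinear operations: an external product, followed by one fixed
  transitive biset given by \<open>L\<close>.\<close>

definition gset_op ::
    "'g monoid \<Rightarrow> 'h monoid \<Rightarrow> 'k monoid \<Rightarrow> ('k \<times> ('g \<times> 'h)) set \<Rightarrow>
      (('g, nat) gset \<Rightarrow> ('h, nat) gset \<Rightarrow> ('k, 'x) gset) \<Rightarrow> bool" where
  "gset_op G H K L op \<longleftrightarrow> grel K (G \<times>\<times> H) L \<and>
    (\<forall>X Y. fin_gset G X \<longrightarrow> fin_gset H Y \<longrightarrow>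
      fin_gset K (op X Y) \<and> (\<exists>j. corr K L (gprod X Y) (op X Y) j))"

lemma gset_opD:
  assumes "gset_op G H K L op"
  shows "grel K (G \<times>\<times> H) L"
    and "fin_gset G X \<Longrightarrow> fin_gset H Y \<Longrightarrow> fin_gset K (op X Y)"
    and "fin_gset G X \<Longrightarrow> fin_gset H Y \<Longrightarrow> \<exists>j. corr K L (gprod X Y) (op X Y) j"
  using assms unfolding gset_op_def by blast+

text \<open>External products distribute over disjoint unions and applying \<open>L\<close>
  preserves these; uniqueness of the applied set turns this into additivity in each
  argument.\<close>

lemma gset_op_biadditive:
  assumes op: "gset_op G H K L op"
  shows "gset_biadditive G H K op"
proof -
  note D = gset_opD[OF op]
  have key: "burnside_class K (op Z Y) = burnside_class K (op X X') \<oplus>\<^bsub>burnside K\<^esub> burnside_class K (op W W')"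
    if that: "fin_gset G Z" "fin_gset H Y" "fin_gset G X" "fin_gset H X'" "fin_gset G W" "fin_gset H W'"
      "gset_iso (G \<times>\<times> H) (gprod Z Y) (gset_sum (gprod X X') (gprod W W'))" for Z Y X X' W W'
  proof -
    note F = that and gp = fin_gset_gprod
    obtain i j k where c: "corr K L (gprod Z Y) (op Z Y) i" "corr K L (gprod X X') (op X X') j"
      "corr K L (gprod W W') (op W W') k"
      using D(3)[OF F(1,2)] D(3)[OF F(3,4)] D(3)[OF F(5,6)] by blast
    have s: "corr K L (gset_sum (gprod X X') (gprod W W')) (gset_sum (op X X') (op W W')) (map_sum j k)"
      by (rule corr_sum[OF c(2,3) gp[OF that(3,4)] gp[OF that(5,6)] D(2)[OF that(3,4)] D(2)[OF that(5,6)] D(1)])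
    have "gset_iso K (op Z Y) (gset_sum (op X X') (op W W'))"
      by (rule corr_gset_iso'[OF D(2)[OF that(1,2)] fin_gset_sum[OF D(2)[OF that(3,4)] D(2)[OF that(5,6)]]
            c(1) s that(7) gp[OF that(1,2)] D(1)])
    from burnside_class_iso[OF D(2)[OF that(1,2)] fin_gset_sum[OF D(2)[OF that(3,4)] D(2)[OF that(5,6)]] this]
    show ?thesis using burnside_class_sum[OF D(2)[OF that(3,4)] D(2)[OF that(5,6)]] by simp
  qed
  have 1: "gset_additive G (burnside K) (\<lambda>X. burnside_class K (op X Y))" if Y: "fin_gset H Y" for Y
    unfolding gset_additive_def fin_gsets_iff
  proof (intro conjI ballI allI impI)
    fix X assume "X \<in> fin_gsets G"
    thus "burnside_class K (op X Y) \<in> carrier (burnside K)"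
      using burnside_class_closed[OF D(2)[OF _ Y]] by (simp add: fin_gsets_iff)
  next
    fix X W Z assume X: "X \<in> fin_gsets G" "W \<in> fin_gsets G" "Z \<in> fin_gsets G" "gset_iso G Z (gset_sum X W)"
    have "gset_iso (G \<times>\<times> H) (gprod Z Y) (gset_sum (gprod X Y) (gprod W Y))"
      using gset_iso_trans[OF gset_iso_gprod[OF X(4) gset_iso_refl[of H Y]] gset_iso_gprod_sum_left] .
    from key[OF _ Y _ Y _ Y this] X
    show "burnside_class K (op Z Y) = burnside_class K (op X Y) \<oplus>\<^bsub>burnside K\<^esub> burnside_class K (op W Y)"
      by (simp add: fin_gsets_iff)
  qed
  have 2: "gset_additive H (burnside K) (\<lambda>Y. burnside_class K (op X Y))" if Y: "fin_gset G X" for X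
    unfolding gset_additive_def fin_gsets_iff
  proof (intro conjI ballI allI impI)
    fix Z assume "Z \<in> fin_gsets H"
    thus "burnside_class K (op X Z) \<in> carrier (burnside K)"
      using burnside_class_closed[OF D(2)[OF Y]] by (simp add: fin_gsets_iff)
  next
    fix V W Z assume X: "V \<in> fin_gsets H" "W \<in> fin_gsets H" "Z \<in> fin_gsets H" "gset_iso H Z (gset_sum V W)"
    have "gset_iso (G \<times>\<times> H) (gprod X Z) (gset_sum (gprod X V) (gprod X W))"
      by (rule gset_iso_trans[OF gset_iso_gprod[OF gset_iso_refl X(4)] gset_iso_gprod_sum_right])
    from key[OF Y _ Y _ Y _ this] X
    show "burnside_class K (op X Z) = burnside_class K (op X V) \<oplus>\<^bsub>burnside K\<^esub> burnside_class K (op X W)"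
      by (simp add: fin_gsets_iff)
  qed
  show ?thesis
    using 1 2 D(2) by (simp add: gset_biadditive_def fin_gsets_iff)
qed

lemma gset_op_gprod:
  assumes "fgroup G" "fgroup H"
  shows "gset_op G H (G \<times>\<times> H) (Id_on (carrier (G \<times>\<times> H))) gprod"
  unfolding gset_op_def
  using grel_Id[OF fgroup_prod[OF assms]] fin_gset_gprod corr_Id[OF fin_gset_gprod] by blast

text \<open>The map \<open>RB(H) \<rightarrow> RB(K)\<close> of the transitive biset
  \<open>(K \<times>\<times> H)/L\<close>. Graphs of homomorphisms and their converses give
  restriction, induction, inflation, deflation and transport along isomorphisms.\<close>

definition RBT ::
    "('r, 'q) ring_scheme \<Rightarrow> 'k monoid \<Rightarrow> 'h monoid \<Rightarrow> ('k \<times> 'h) set \<Rightarrow> ('r, 'h) rb_elt \<Rightarrow> ('r, 'k) rb_elt" where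
  "RBT R K H L = (SOME h. linear_map R (RB R H) (RB R K) h \<and>
    (\<forall>X\<in>fin_gsets H. h (RB_class R H X) = RB_class R K (gT K L X)))"

definition RBX ::
    "('r, 'q) ring_scheme \<Rightarrow> 'g monoid \<Rightarrow> 'h monoid \<Rightarrow> ('r, 'g) rb_elt \<Rightarrow> ('r, 'h) rb_elt \<Rightarrow>
      ('r, 'g \<times> 'h) rb_elt" where
  "RBX R G H = RB_bilin R (G \<times>\<times> H) gprod"

context
  fixes R :: "('r, 'q) ring_scheme"
  assumes R: "cring R"
begin

interpretation R: cring R by (rule R)

lemma gT_additive:
  assumes L: "grel K H L"
  shows "gset_additive H (RB R K) (\<lambda>X. RB_class R K (gT K L X))"
  unfolding gset_additive_def
proof (intro conjI ballI allI impI)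
  fix X assume "X \<in> fin_gsets H"
  thus "RB_class R K (gT K L X) \<in> carrier (RB R K)"
    using RB_class_closed[OF R fin_gset_gT[OF L]] by (simp add: fin_gsets_iff)
next
  fix X Y Z :: "('b, nat) gset"
  assume "X \<in> fin_gsets H" "Y \<in> fin_gsets H" "Z \<in> fin_gsets H" and iso: "gset_iso H Z (gset_sum X Y)"
  hence f: "fin_gset H X" "fin_gset H Y" "fin_gset H Z" by (simp_all add: fin_gsets_iff)
  note T = fin_gset_gT[OF L f(1)] fin_gset_gT[OF L f(2)] fin_gset_gT[OF L f(3)]
  have "gset_iso K (gT K L Z) (gset_sum (gT K L X) (gT K L Y))"
    by (rule corr_gset_iso'[OF T(3) fin_gset_sum[OF T(1,2)] corr_gT[OF L f(3)]
          corr_sum[OF corr_gT[OF L f(1)] corr_gT[OF L f(2)] f(1,2) T(1,2) L] iso f(3) L])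
  from RB_class_iso[OF R T(3) fin_gset_sum[OF T(1,2)] this] RB_class_sum[OF R T(1,2)]
  show "RB_class R K (gT K L Z) = RB_class R K (gT K L X) \<oplus>\<^bsub>RB R K\<^esub> RB_class R K (gT K L Y)" by simp
qed

lemma RBT_spec:
  assumes L: "grel K H L"
  shows "linear_map R (RB R H) (RB R K) (RBT R K H L)"
    and "X \<in> fin_gsets H \<Longrightarrow> RBT R K H L (RB_class R H X) = RB_class R K (gT K L X)"
  using someI_ex[OF RB_ext_exists[OF R RB_module[OF R] gT_additive[OF L]]]
  unfolding RBT_def by blast+

lemma RBT_closed: "grel K H L \<Longrightarrow> x \<in> carrier (RB R H) \<Longrightarrow> RBT R K H L x \<in> carrier (RB R K)"
  using linear_mapD(1)[OF RBT_spec(1)] .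

lemma RBT_class:
  assumes "corr K L X Y j" "grel K H L" "fin_gset H X" "fin_gset K Y"
  shows "RBT R K H L (RB_class R H X) = RB_class R K Y"
proof -
  obtain X' :: "('b, nat) gset" where X': "X' \<in> fin_gsets H" "gset_iso H X X'"
    using gset_iso_nat[OF assms(3)] by blast
  have f: "fin_gset H X'" using X' by (simp add: fin_gsets_iff)
  have "gset_iso K Y (gT K L X')"
    by (rule corr_gset_iso'[OF assms(4) fin_gset_gT[OF assms(2) f] assms(1) corr_gT[OF assms(2) f] X'(2) assms(3,2)])
  thus ?thesis
    using RB_class_iso[OF R assms(3) f X'(2)] RBT_spec(2)[OF assms(2) X'(1)]
      RB_class_iso[OF R assms(4) fin_gset_gT[OF assms(2) f]] by simp
qed

context
  fixes G :: "'g monoid" and H :: "'h monoid" and K :: "'k monoid" and L op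
  assumes op: "gset_op G H K L (op :: _ \<Rightarrow> _ \<Rightarrow> ('k, 'x) gset)"
begin

lemmas RB_bilin_op = RB_bilin_linear[OF R gset_op_biadditive[OF op]]

end

lemma RBX_linear:
  assumes "fgroup G" "fgroup H"
  shows "y \<in> carrier (RB R H) \<Longrightarrow> linear_map R (RB R G) (RB R (G \<times>\<times> H)) (\<lambda>x. RBX R G H x y)"
    and "x \<in> carrier (RB R G) \<Longrightarrow> linear_map R (RB R H) (RB R (G \<times>\<times> H)) (\<lambda>y. RBX R G H x y)"
  unfolding RBX_def using RB_bilin_op[OF gset_op_gprod[OF assms]] by blast+

lemma RBX_closed:
  "fgroup G \<Longrightarrow> fgroup H \<Longrightarrow> x \<in> carrier (RB R G) \<Longrightarrow> y \<in> carrier (RB R H) \<Longrightarrow>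
    RBX R G H x y \<in> carrier (RB R (G \<times>\<times> H))"
  using linear_mapD(1)[OF RBX_linear(1)] .

lemma RBX_class:
  fixes G :: "'g monoid" and H :: "'h monoid"
  assumes "fgroup G" "fgroup H" "fin_gset G X" "fin_gset H Y"
  shows "RBX R G H (RB_class R G X) (RB_class R H Y) = RB_class R (G \<times>\<times> H) (gprod X Y)"
proof -
  obtain X' :: "('g, nat) gset" where X': "X' \<in> fin_gsets G" "gset_iso G X X'"
    using gset_iso_nat[OF assms(3)] by blast
  obtain Y' :: "('h, nat) gset" where Y': "Y' \<in> fin_gsets H" "gset_iso H Y Y'"
    using gset_iso_nat[OF assms(4)] by blast
  have f: "fin_gset G X'" "fin_gset H Y'" using X' Y' by (simp_all add: fin_gsets_iff)
  have "RBX R G H (RB_class R G X') (RB_class R H Y') = RB_class R (G \<times>\<times> H) (gprod X' Y')"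
    unfolding RBX_def by (rule RB_bilin_op(3)[OF gset_op_gprod[OF assms(1,2)] X'(1) Y'(1)])
  thus ?thesis
    using RB_class_iso[OF R assms(3) f(1) X'(2)] RB_class_iso[OF R assms(4) f(2) Y'(2)]
      RB_class_iso[OF R fin_gset_gprod[OF assms(3,4)] fin_gset_gprod[OF f] gset_iso_gprod[OF X'(2) Y'(2)]]
    by simp
qed

lemma RB_bilinear_eq:
  fixes G :: "'g monoid" and H :: "'h monoid"
  assumes "module R N"
    and "\<And>y. y \<in> carrier (RB R H) \<Longrightarrow> linear_map R (RB R G) N (\<lambda>x. f x y)"
    and "\<And>x. x \<in> carrier (RB R G) \<Longrightarrow> linear_map R (RB R H) N (\<lambda>y. f x y)"
    and "\<And>y. y \<in> carrier (RB R H) \<Longrightarrow> linear_map R (RB R G) N (\<lambda>x. g x y)"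
    and "\<And>x. x \<in> carrier (RB R G) \<Longrightarrow> linear_map R (RB R H) N (\<lambda>y. g x y)"
    and "\<And>X Y. X \<in> fin_gsets G \<Longrightarrow> Y \<in> fin_gsets H \<Longrightarrow>
      f (RB_class R G X) (RB_class R H Y) = g (RB_class R G X) (RB_class R H Y)"
    and xy: "x \<in> carrier (RB R G)" "y \<in> carrier (RB R H)"
  shows "f x y = g x y"
proof (rule RB_ext_eq[OF R assms(1) assms(2)[OF xy(2)] assms(4)[OF xy(2)] _ xy(1)])
  fix X assume X: "X \<in> fin_gsets G"
  hence c: "RB_class R G X \<in> carrier (RB R G)" using RB_class_closed[OF R] by (simp add: fin_gsets_iff)
  show "f (RB_class R G X) y = g (RB_class R G X) y"
    by (rule RB_ext_eq[OF R assms(1) assms(3)[OF c] assms(5)[OF c] assms(6)[OF X] xy(2)])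
qed

text \<open>The normal form for bilinear operations. From here on an operation is known by its
  subgroup \<open>L\<close>, and its construction on points can be forgotten.\<close>

lemma RB_bilin_eq:
  assumes op: "gset_op G H K L op" and "fgroup G" "fgroup H"
    and "x \<in> carrier (RB R G)" "y \<in> carrier (RB R H)"
  shows "RB_bilin R K op x y = RBT R K (G \<times>\<times> H) L (RBX R G H x y)"
proof (rule RB_bilinear_eq[OF RB_module[OF R] RB_bilin_op(1,2)[OF op] _ _ _ assms(4,5)])
  note D = gset_opD[OF op]
  show "linear_map R (RB R G) (RB R K) (\<lambda>x. RBT R K (G \<times>\<times> H) L (RBX R G H x y))" if "y \<in> carrier (RB R H)" for y
    by (rule linear_map_comp[OF RBX_linear(1)[OF assms(2,3) that] RBT_spec(1)[OF D(1)]])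
  show "linear_map R (RB R H) (RB R K) (\<lambda>y. RBT R K (G \<times>\<times> H) L (RBX R G H x y))" if "x \<in> carrier (RB R G)" for x
    by (rule linear_map_comp[OF RBX_linear(2)[OF assms(2,3) that] RBT_spec(1)[OF D(1)]])
  fix X Y assume X: "X \<in> fin_gsets G" and Y: "Y \<in> fin_gsets H"
  hence f: "fin_gset G X" "fin_gset H Y" by (simp_all add: fin_gsets_iff)
  obtain j where "corr K L (gprod X Y) (op X Y) j" using D(3)[OF f] by blast
  from RBT_class[OF this D(1) fin_gset_gprod[OF f] D(2)[OF f]]
  show "RB_bilin R K op (RB_class R G X) (RB_class R H Y) =
    RBT R K (G \<times>\<times> H) L (RBX R G H (RB_class R G X) (RB_class R H Y))"
    using RB_bilin_op(3)[OF op X Y] RBX_class[OF assms(2,3) f] by simp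
qed

lemma RBT_RBT:
  fixes G :: "'g monoid"
  assumes L: "grel K H L" and M: "grel H G M" and full: "gfull H L M" and x: "x \<in> carrier (RB R G)"
  shows "RBT R K H L (RBT R H G M x) = RBT R K G (L O M) x"
proof (rule RB_ext_eq[OF R RB_module[OF R] linear_map_comp[OF RBT_spec(1)[OF M] RBT_spec(1)[OF L]]
      RBT_spec(1)[OF grel_comp[OF L M]] _ x])
  fix X assume "X \<in> fin_gsets G"
  hence X: "fin_gset G X" by (simp add: fin_gsets_iff)
  let ?Y = "gT H M X"
  note Y = fin_gset_gT[OF M X]
  note cM = corr_gT[OF M X] and cL = corr_gT[OF L Y]
  have "RBT R H G M (RB_class R G X) = RB_class R H ?Y" by (rule RBT_class[OF cM M X Y])
  moreover have "RBT R K H L (RB_class R H ?Y) = RB_class R K (gT K L ?Y)"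
    by (rule RBT_class[OF cL L Y fin_gset_gT[OF L Y]])
  moreover have "RBT R K G (L O M) (RB_class R G X) = RB_class R K (gT K L ?Y)"
    by (rule RBT_class[OF corr_comp[OF cM cL M L X Y fin_gset_gT[OF L Y] full] grel_comp[OF L M] X fin_gset_gT[OF L Y]])
  ultimately show "RBT R K H L (RBT R H G M (RB_class R G X)) = RBT R K G (L O M) (RB_class R G X)" by simp
qed

lemma RBX_RBT:
  fixes G :: "'g monoid" and H :: "'h monoid"
  assumes L: "grel K G L" and L': "grel K' H L'" and x: "x \<in> carrier (RB R G)" and y: "y \<in> carrier (RB R H)"
  shows "RBX R K K' (RBT R K G L x) (RBT R K' H L' y) = RBT R (K \<times>\<times> K') (G \<times>\<times> H) (prel L L') (RBX R G H x y)"
proof (rule RB_bilinear_eq[OF RB_module[OF R] _ _ _ _ _ x y])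
  note f = grel_fgroup[OF L] grel_fgroup[OF L']
  note P = grel_prel[OF L L']
  show "linear_map R (RB R G) (RB R (K \<times>\<times> K')) (\<lambda>x. RBX R K K' (RBT R K G L x) (RBT R K' H L' y))"
    if "y \<in> carrier (RB R H)" for y
    by (rule linear_map_comp[OF RBT_spec(1)[OF L] RBX_linear(1)[OF f(1,3) RBT_closed[OF L' that]]])
  show "linear_map R (RB R H) (RB R (K \<times>\<times> K')) (\<lambda>y. RBX R K K' (RBT R K G L x) (RBT R K' H L' y))"
    if "x \<in> carrier (RB R G)" for x
    by (rule linear_map_comp[OF RBT_spec(1)[OF L'] RBX_linear(2)[OF f(1,3) RBT_closed[OF L that]]])
  show "linear_map R (RB R G) (RB R (K \<times>\<times> K')) (\<lambda>x. RBT R (K \<times>\<times> K') (G \<times>\<times> H) (prel L L') (RBX R G H x y))"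
    if "y \<in> carrier (RB R H)" for y
    by (rule linear_map_comp[OF RBX_linear(1)[OF f(2,4) that] RBT_spec(1)[OF P]])
  show "linear_map R (RB R H) (RB R (K \<times>\<times> K')) (\<lambda>y. RBT R (K \<times>\<times> K') (G \<times>\<times> H) (prel L L') (RBX R G H x y))"
    if "x \<in> carrier (RB R G)" for x
    by (rule linear_map_comp[OF RBX_linear(2)[OF f(2,4) that] RBT_spec(1)[OF P]])
  fix X Y assume "X \<in> fin_gsets G" "Y \<in> fin_gsets H"
  hence X: "fin_gset G X" "fin_gset H Y" by (simp_all add: fin_gsets_iff)
  note T = fin_gset_gT[OF L X(1)] fin_gset_gT[OF L' X(2)]
  note c = corr_gT[OF L X(1)] corr_gT[OF L' X(2)]
  show "RBX R K K' (RBT R K G L (RB_class R G X)) (RBT R K' H L' (RB_class R H Y)) =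
    RBT R (K \<times>\<times> K') (G \<times>\<times> H) (prel L L') (RBX R G H (RB_class R G X) (RB_class R H Y))"
    unfolding RBT_class[OF c(1) L X(1) T(1)] RBT_class[OF c(2) L' X(2) T(2)] RBX_class[OF f(1,3) T]
      RBX_class[OF f(2,4) X]
    by (rule RBT_class[OF corr_prod[OF c L L', folded prel_def] P fin_gset_gprod[OF X] fin_gset_gprod[OF T], symmetric])
qed

lemma RBT_Id:
  fixes H :: "'h monoid"
  assumes H: "fgroup H" and x: "x \<in> carrier (RB R H)"
  shows "RBT R H H (Id_on (carrier H)) x = x"
  by (rule RB_ext_eq[OF R RB_module[OF R] RBT_spec(1)[OF grel_Id[OF H]] linear_map_id _ x])
     (rule RBT_class[OF corr_Id grel_Id[OF H]]; simp add: fin_gsets_iff)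

end

text \<open>In finite groups closure under products yields inverses: right multiplication by
  \<open>x\<close> is an injective, hence surjective, self-map of \<open>L\<close>, so some
  \<open>y\<close> in \<open>L\<close> satisfies \<open>y x = 1\<close>.\<close>

lemma grel_finiteI:
  assumes "fgroup K" "fgroup H"
    and sub: "\<And>k h. (k, h) \<in> L \<Longrightarrow> k \<in> carrier K \<and> h \<in> carrier H"
    and one: "(\<one>\<^bsub>K\<^esub>, \<one>\<^bsub>H\<^esub>) \<in> L"
    and mult: "\<And>k h k' h'. (k, h) \<in> L \<Longrightarrow> (k', h') \<in> L \<Longrightarrow> (k \<otimes>\<^bsub>K\<^esub> k', h \<otimes>\<^bsub>H\<^esub> h') \<in> L"
  shows "grel K H L"
proof -
  interpret K: group K using fgroupD[OF assms(1)] by simp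
  interpret H: group H using fgroupD[OF assms(2)] by simp
  interpret P: group "K \<times>\<times> H" by (intro DirProd_group K.is_group H.is_group)
  have fin: "finite (carrier (K \<times>\<times> H))" using fgroupD(2)[OF assms(1)] fgroupD(2)[OF assms(2)] by simp
  have inv: "inv\<^bsub>K \<times>\<times> H\<^esub> x \<in> L" if x: "x \<in> L" for x
  proof -
    have c: "y \<in> carrier (K \<times>\<times> H)" if "y \<in> L" for y using sub that by (cases y) auto
    have eq: "(\<lambda>y. y \<otimes>\<^bsub>K \<times>\<times> H\<^esub> x) ` L = L"
    proof (rule endo_inj_surj)
      show "finite L" using fin c by (meson finite_subset subsetI)
      show "(\<lambda>y. y \<otimes>\<^bsub>K \<times>\<times> H\<^esub> x) ` L \<subseteq> L" using mult x by (cases x) auto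
      show "inj_on (\<lambda>y. y \<otimes>\<^bsub>K \<times>\<times> H\<^esub> x) L"
        by (rule inj_on_subset[OF P.inj_on_multc[OF c[OF x]]]) (rule subsetI[OF c])
    qed
    have "\<one>\<^bsub>K \<times>\<times> H\<^esub> \<in> (\<lambda>y. y \<otimes>\<^bsub>K \<times>\<times> H\<^esub> x) ` L"
      unfolding eq using one by simp
    then obtain y where y: "\<one>\<^bsub>K \<times>\<times> H\<^esub> = y \<otimes>\<^bsub>K \<times>\<times> H\<^esub> x" "y \<in> L" by (rule imageE)
    show ?thesis using P.inv_equality[OF y(1)[symmetric] c[OF x] c[OF y(2)]] y(2) by simp
  qed
  show ?thesis
    by (rule grelI[OF K.is_group fgroupD(2)[OF assms(1)] H.is_group fgroupD(2)[OF assms(2)] sub one mult])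
       (use inv sub inv_DirProd[OF K.is_group H.is_group] in fastforce)+
qed

text \<open>One surjective projection already gives the whole middle group; the other relation
  contributes its identity element.\<close>

lemma gfull_left:
  assumes "grel K H L" "carrier H \<subseteq> Domain M"
  shows "gfull H L M"
  unfolding gfull_def
proof
  interpret H: group H using grelD(3)[OF assms(1)] .
  fix h assume h: "h \<in> carrier H"
  then obtain g where "(h, g) \<in> M" using assms(2) by blast
  thus "\<exists>k h1 h2 g. (k, h1) \<in> L \<and> (h2, g) \<in> M \<and> h = h1 \<otimes>\<^bsub>H\<^esub> h2"
    using grelD(7)[OF assms(1)] H.l_one[OF h] by metis
qed

lemma gfull_right:
  assumes "grel H G M" "carrier H \<subseteq> Range L"
  shows "gfull H L M"
  unfolding gfull_def
proof
  interpret H: group H using grelD(1)[OF assms(1)] .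
  fix h assume h: "h \<in> carrier H"
  then obtain k where "(k, h) \<in> L" using assms(2) by blast
  thus "\<exists>k h1 h2 g. (k, h1) \<in> L \<and> (h2, g) \<in> M \<and> h = h1 \<otimes>\<^bsub>H\<^esub> h2"
    using grelD(7)[OF assms(1)] H.r_one[OF h] by metis
qed

lemma Domain_prel: "carrier G \<subseteq> Domain M \<Longrightarrow> carrier H \<subseteq> Domain N \<Longrightarrow> carrier (G \<times>\<times> H) \<subseteq> Domain (prel M N)"
  by (auto simp: prel_def subset_iff Domain_iff)

lemma Domain_Id: "carrier G \<subseteq> Domain (Id_on (carrier G))"
  by auto

lemma Domain_relcomp:
  assumes "carrier K \<subseteq> Domain L" "grel K H L" "carrier H \<subseteq> Domain M"
  shows "carrier K \<subseteq> Domain (L O M)"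
proof
  fix k assume "k \<in> carrier K"
  then obtain h where h: "(k, h) \<in> L" using assms(1) by blast
  moreover have "h \<in> carrier H" by (rule grelD(6)[OF assms(2) h])
  then obtain g where "(h, g) \<in> M" using assms(3) by blast
  ultimately show "k \<in> Domain (L O M)" by blast
qed

text \<open>Restriction along \<open>p\<close> is the case where \<open>L\<close> is the graph of
  \<open>p\<close>: the points stay and only the acting group changes.\<close>

lemma corr_res:
  assumes "fin_gset K Y" "bij_betw f (fst X) (fst Y)"
    and "\<And>k x. k \<in> carrier K \<Longrightarrow> x \<in> fst X \<Longrightarrow> snd X (p k) x \<in> fst X"
    and "\<And>k x. k \<in> carrier K \<Longrightarrow> x \<in> fst X \<Longrightarrow> f (snd X (p k) x) = snd Y k (f x)"
    and "\<And>k h. k \<in> carrier K \<Longrightarrow> (k, h) \<in> L \<longleftrightarrow> h = p k"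
  shows "corr K L X Y f"
proof (rule corrI)
  interpret group K using fin_gset_group[OF assms(1)] .
  show "f x \<in> fst Y" if "x \<in> fst X" for x using that assms(2) by (auto simp: bij_betw_def)
  show "\<exists>k\<in>carrier K. \<exists>x\<in>fst X. y = snd Y k (f x)" if "y \<in> fst Y" for y
  proof -
    have "y \<in> f ` fst X" using that assms(2) by (simp add: bij_betw_def)
    then obtain x where "x \<in> fst X" "y = f x" by blast
    thus ?thesis using act_one[OF assms(1) that] by (intro bexI[of _ "\<one>\<^bsub>K\<^esub>"] bexI[of _ x]) auto
  qed
  fix x x' k assume x: "x \<in> fst X" "x' \<in> fst X" "k \<in> carrier K"
  have "snd Y k (f x) = f x' \<longleftrightarrow> snd X (p k) x = x'"
    using assms(4)[OF x(3,1)] assms(3)[OF x(3,1)] x(2) assms(2) by (metis bij_betw_def inj_on_eq_iff)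
  thus "snd Y k (f x) = f x' \<longleftrightarrow> (\<exists>h. (k, h) \<in> L \<and> snd X h x = x')" using assms(5)[OF x(3)] by auto
qed

text \<open>Two commuting actions on \<open>P\<close>: the \<open>H\<close>-orbits inherit the
  action of \<open>K\<close>. Both tensor products, \<open>biset_comp\<close> and
  \<open>biset_apply\<close>, are instances, with the middle group as \<open>H\<close> and the outer
  group as \<open>K\<close>.\<close>

lemma quotient_gset:
  fixes a :: "'h \<Rightarrow> 'x \<Rightarrow> 'x" and b :: "'k \<Rightarrow> 'x \<Rightarrow> 'x" and Y :: "('k, 'x set) gset"
  assumes K: "group K" and H: "group H" and "finite P"
    and ac: "\<And>h p. h \<in> carrier H \<Longrightarrow> p \<in> P \<Longrightarrow> a h p \<in> P" and a1: "\<And>p. p \<in> P \<Longrightarrow> a \<one>\<^bsub>H\<^esub> p = p"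
    and am: "\<And>h h' p. h \<in> carrier H \<Longrightarrow> h' \<in> carrier H \<Longrightarrow> p \<in> P \<Longrightarrow> a (h \<otimes>\<^bsub>H\<^esub> h') p = a h (a h' p)"
    and bc: "\<And>k p. k \<in> carrier K \<Longrightarrow> p \<in> P \<Longrightarrow> b k p \<in> P" and b1: "\<And>p. p \<in> P \<Longrightarrow> b \<one>\<^bsub>K\<^esub> p = p"
    and bm: "\<And>h h' p. h \<in> carrier K \<Longrightarrow> h' \<in> carrier K \<Longrightarrow> p \<in> P \<Longrightarrow> b (h \<otimes>\<^bsub>K\<^esub> h') p = b h (b h' p)"
    and ab: "\<And>h k p. h \<in> carrier H \<Longrightarrow> k \<in> carrier K \<Longrightarrow> p \<in> P \<Longrightarrow> a h (b k p) = b k (a h p)"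
    and orb: "\<And>p. p \<in> P \<Longrightarrow> orb p = {a h p | h. h \<in> carrier H}"
    and Y: "Y = (orb ` P, \<lambda>k. \<lambda>C\<in>orb ` P. b k ` C)"
  shows "fin_gset K Y"
    and "p \<in> P \<Longrightarrow> k \<in> carrier K \<Longrightarrow> snd Y k (orb p) = orb (b k p)"
    and "p \<in> P \<Longrightarrow> p' \<in> P \<Longrightarrow> orb p = orb p' \<longleftrightarrow> (\<exists>h\<in>carrier H. a h p = p')"
proof -
  interpret K: group K by fact
  interpret H: group H by fact
  show act: "snd Y k (orb p) = orb (b k p)" if "p \<in> P" "k \<in> carrier K" for p k
  proof -
    have "snd Y k (orb p) = b k ` {a h p | h. h \<in> carrier H}" using that by (simp add: Y orb)
    also have "\<dots> = {a h (b k p) | h. h \<in> carrier H}" using ab that by (auto simp: image_iff) (metis)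
    finally show ?thesis using orb bc that by simp
  qed
  show "orb p = orb p' \<longleftrightarrow> (\<exists>h\<in>carrier H. a h p = p')" if "p \<in> P" "p' \<in> P" for p p'
  proof
    assume eq: "orb p = orb p'"
    have "p' \<in> orb p'" unfolding orb[OF that(2)] using a1[OF that(2)] by force
    hence "p' \<in> orb p" by (simp only: eq)
    thus "\<exists>h\<in>carrier H. a h p = p'" unfolding orb[OF that(1)] by auto
  next
    have sub: "orb q' \<subseteq> orb q" if "q \<in> P" "h \<in> carrier H" "a h q = q'" for q q' h
      using that ac am[of _ h q, symmetric] unfolding orb[OF that(1)] orb[OF ac[OF that(2,1), unfolded that(3)]]
      by force
    assume "\<exists>h\<in>carrier H. a h p = p'"
    then obtain h where h: "h \<in> carrier H" "a h p = p'" by blast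
    have "a (inv\<^bsub>H\<^esub> h) p' = p" using am[of "inv\<^bsub>H\<^esub> h" h p] a1 h that by simp
    with sub[OF that(1) h] sub[OF that(2) _ this] h(1) show "orb p = orb p'" by auto
  qed
  show "fin_gset K Y"
  proof (rule fin_gsetI[OF K])
    show "finite (fst Y)" using \<open>finite P\<close> by (simp add: Y)
    show "snd Y g x \<in> fst Y" if "g \<in> carrier K" "x \<in> fst Y" for g x
      using that act bc by (auto simp: Y)
    show "snd Y \<one>\<^bsub>K\<^esub> x = x" if "x \<in> fst Y" for x
    proof -
      obtain p where "p \<in> P" "x = orb p" using \<open>x \<in> fst Y\<close> by (auto simp: Y)
      thus ?thesis using act b1 by simp
    qed
    show "snd Y (g \<otimes>\<^bsub>K\<^esub> h) x = snd Y g (snd Y h x)" if "g \<in> carrier K" "h \<in> carrier K" "x \<in> fst Y" for g h x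
    proof -
      obtain p where "p \<in> P" "x = orb p" using \<open>x \<in> fst Y\<close> by (auto simp: Y)
      thus ?thesis using that act bm bc by simp
    qed
    show "snd Y g \<in> extensional (fst Y)" for g by (simp add: Y)
  qed
qed

subsection \<open>Products of objects\<close>

lemma obj_times_simps:
  "carrier (H \<boxtimes> K) = prod_encode ` (carrier H \<times> carrier K)"
  "prod_encode (a, b) \<otimes>\<^bsub>H \<boxtimes> K\<^esub> prod_encode (c, d) = prod_encode (a \<otimes>\<^bsub>H\<^esub> c, b \<otimes>\<^bsub>K\<^esub> d)"
  "\<one>\<^bsub>H \<boxtimes> K\<^esub> = prod_encode (\<one>\<^bsub>H\<^esub>, \<one>\<^bsub>K\<^esub>)"
  by (simp_all add: obj_times_def)

lemma obj_times_mem [simp]: "prod_encode (a, b) \<in> carrier (H \<boxtimes> K) \<longleftrightarrow> a \<in> carrier H \<and> b \<in> carrier K"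
  by (auto simp: obj_times_simps)

lemma fgroup_box:
  assumes "fgroup H" "fgroup K"
  shows "fgroup (H \<boxtimes> K)"
proof -
  interpret H: group H using fgroupD[OF assms(1)] by simp
  interpret K: group K using fgroupD[OF assms(2)] by simp
  have "group (H \<boxtimes> K)"
  proof (rule groupI)
    fix x assume "x \<in> carrier (H \<boxtimes> K)"
    then obtain a b where x: "x = prod_encode (a, b)" "a \<in> carrier H" "b \<in> carrier K" by (auto simp: obj_times_simps)
    show "\<exists>y\<in>carrier (H \<boxtimes> K). y \<otimes>\<^bsub>H \<boxtimes> K\<^esub> x = \<one>\<^bsub>H \<boxtimes> K\<^esub>"
      by (rule bexI[of _ "prod_encode (inv\<^bsub>H\<^esub> a, inv\<^bsub>K\<^esub> b)"]) (use x in \<open>auto simp: obj_times_simps\<close>)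
  qed (auto simp: obj_times_simps H.m_assoc K.m_assoc)
  thus ?thesis using assms by (simp add: fgroup_def obj_times_simps)
qed

lemma fin_groups_iff: "H \<in> fin_groups \<longleftrightarrow> fgroup H"
  by (simp add: fin_groups_def fgroup_def)

lemma fgroup_unit: "fgroup obj_unit"
proof -
  have "group obj_unit" by (rule groupI) (auto simp: obj_unit_def)
  thus ?thesis by (simp add: fgroup_def obj_unit_def)
qed

text \<open>Objects have natural numbers as elements while \<open>G\<close> has an arbitrary type;
  the copy \<open>\<Gamma>\<close> stands in for \<open>G\<close> wherever an object is
  needed.\<close>

lemma obj_of_group:
  assumes "fgroup G"
  obtains \<Gamma> :: obj and \<iota> where "fgroup \<Gamma>" "\<iota> \<in> hom G \<Gamma>" "bij_betw \<iota> (carrier G) (carrier \<Gamma>)"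
proof -
  interpret group G using fgroupD[OF assms] by simp
  obtain \<iota> :: "'a \<Rightarrow> nat" where \<iota>: "bij_betw \<iota> (carrier G) {0..<card (carrier G)}"
    using ex_bij_betw_finite_nat[OF fgroupD(2)[OF assms]] by blast
  let ?i = "inv_into (carrier G) \<iota>" and ?N = "{0..<card (carrier G)}"
  define \<Gamma> where "\<Gamma> = \<lparr>carrier = ?N, monoid.mult = \<lambda>x y. \<iota> (?i x \<otimes>\<^bsub>G\<^esub> ?i y), one = \<iota> \<one>\<^bsub>G\<^esub>\<rparr>"
  have i: "?i (\<iota> x) = x" "\<iota> x \<in> ?N" if "x \<in> carrier G" for x
    using bij_betw_inv_into_left[OF \<iota> that] bij_betwE[OF \<iota>] that by blast+
  have i': "\<iota> (?i x) = x" "?i x \<in> carrier G" if "x \<in> ?N" for x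
    using bij_betw_inv_into_right[OF \<iota> that] bij_betwE[OF bij_betw_inv_into[OF \<iota>]] that by blast+
  have "group \<Gamma>"
  proof (rule groupI)
    fix x assume x: "x \<in> carrier \<Gamma>"
    show "\<exists>y\<in>carrier \<Gamma>. y \<otimes>\<^bsub>\<Gamma>\<^esub> x = \<one>\<^bsub>\<Gamma>\<^esub>"
      by (rule bexI[of _ "\<iota> (inv\<^bsub>G\<^esub> (?i x))"]) (use x i i' in \<open>auto simp: \<Gamma>_def\<close>)
  next
    fix x y z assume "x \<in> carrier \<Gamma>" "y \<in> carrier \<Gamma>" "z \<in> carrier \<Gamma>"
    thus "x \<otimes>\<^bsub>\<Gamma>\<^esub> y \<otimes>\<^bsub>\<Gamma>\<^esub> z = x \<otimes>\<^bsub>\<Gamma>\<^esub> (y \<otimes>\<^bsub>\<Gamma>\<^esub> z)"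
      using i i' by (simp add: \<Gamma>_def m_assoc)
  qed (use i i' in \<open>simp_all add: \<Gamma>_def\<close>)
  hence "fgroup \<Gamma>" by (simp add: fgroup_def \<Gamma>_def)
  moreover have "\<iota> \<in> hom G \<Gamma>" using i by (auto simp: hom_def \<Gamma>_def)
  ultimately show ?thesis using that \<iota> by (simp add: \<Gamma>_def)
qed

subsection \<open>The operations on bisets as correspondences\<close>

text \<open>Tensoring over \<open>H\<close> is restriction to
  \<open>K \<times> H \<times> G\<close>, embedded diagonally in \<open>H\<close>, followed by
  passing to \<open>H\<close>-orbits. As one transitive biset this is the subgroup given here;
  \<open>apply_rel\<close> is its analogue with \<open>G\<close> trivial.\<close>

definition comp_rel :: "'k monoid \<Rightarrow> 'h monoid \<Rightarrow> 'g monoid \<Rightarrow> (('k \<times> 'g) \<times> (('k \<times> 'h) \<times> ('h \<times> 'g))) set" where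
  "comp_rel K H G = {((k, g), ((k, h), (h, g))) | k h g. k \<in> carrier K \<and> h \<in> carrier H \<and> g \<in> carrier G}"

definition apply_rel :: "'k monoid \<Rightarrow> 'h monoid \<Rightarrow> ('k \<times> (('k \<times> 'h) \<times> 'h)) set" where
  "apply_rel K H = {(k, ((k, h), h)) | k h. k \<in> carrier K \<and> h \<in> carrier H}"

definition times_rel ::
    "'g monoid \<Rightarrow> 'h monoid \<Rightarrow> 'g' monoid \<Rightarrow> 'h' monoid \<Rightarrow>
      ((('h \<times> 'h') \<times> ('g \<times> 'g')) \<times> (('h \<times> 'g) \<times> ('h' \<times> 'g'))) set" where
  "times_rel G H G' H' = {(((h, h'), (g, g')), ((h, g), (h', g'))) | h h' g g'.
    h \<in> carrier H \<and> h' \<in> carrier H' \<and> g \<in> carrier G \<and> g' \<in> carrier G'}"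

definition mor_times_rel ::
    "obj \<Rightarrow> obj \<Rightarrow> obj \<Rightarrow> obj \<Rightarrow> ((nat \<times> nat) \<times> ((nat \<times> nat) \<times> (nat \<times> nat))) set" where
  "mor_times_rel G H G' H' = {((prod_encode (h, h'), prod_encode (g, g')), ((h, g), (h', g'))) | h h' g g'.
    h \<in> carrier H \<and> h' \<in> carrier H' \<and> g \<in> carrier G \<and> g' \<in> carrier G'}"

definition shift_rel ::
    "obj \<Rightarrow> obj \<Rightarrow> 'g monoid \<Rightarrow> ((nat \<times> 'g) \<times> ((nat \<times> 'g) \<times> (nat \<times> 'g))) set" where
  "shift_rel H K G = {((prod_encode (h, k), g), ((h, g), (k, g))) | h k g.
    h \<in> carrier H \<and> k \<in> carrier K \<and> g \<in> carrier G}"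

lemma biset_assoc_act:
  assumes "fin_gset (K \<times>\<times> H) V" "v \<in> fst V" "group K" "group H" "k \<in> carrier K" "h \<in> carrier H"
  shows "snd V (\<one>\<^bsub>K\<^esub>, h) (snd V (k, \<one>\<^bsub>H\<^esub>) v) = snd V (k, h) v"
    "snd V (k, \<one>\<^bsub>H\<^esub>) (snd V (\<one>\<^bsub>K\<^esub>, h) v) = snd V (k, h) v"
proof -
  interpret K: group K by fact
  interpret H: group H by fact
  show "snd V (\<one>\<^bsub>K\<^esub>, h) (snd V (k, \<one>\<^bsub>H\<^esub>) v) = snd V (k, h) v"
    "snd V (k, \<one>\<^bsub>H\<^esub>) (snd V (\<one>\<^bsub>K\<^esub>, h) v) = snd V (k, h) v"
    using assms by (subst act_mult[OF assms(1), symmetric]; simp)+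
qed

lemma biset_act_mult:
  assumes "fin_gset (K \<times>\<times> H) V" "v \<in> fst V" "group K" "group H"
  shows "k \<in> carrier K \<Longrightarrow> k' \<in> carrier K \<Longrightarrow>
      snd V (k \<otimes>\<^bsub>K\<^esub> k', \<one>\<^bsub>H\<^esub>) v = snd V (k, \<one>\<^bsub>H\<^esub>) (snd V (k', \<one>\<^bsub>H\<^esub>) v)"
    and "h \<in> carrier H \<Longrightarrow> h' \<in> carrier H \<Longrightarrow>
      snd V (\<one>\<^bsub>K\<^esub>, h \<otimes>\<^bsub>H\<^esub> h') v = snd V (\<one>\<^bsub>K\<^esub>, h) (snd V (\<one>\<^bsub>K\<^esub>, h') v)"
    and "snd V (\<one>\<^bsub>K\<^esub>, \<one>\<^bsub>H\<^esub>) v = v"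
proof -
  interpret K: group K by fact
  interpret H: group H by fact
  show "k \<in> carrier K \<Longrightarrow> k' \<in> carrier K \<Longrightarrow>
      snd V (k \<otimes>\<^bsub>K\<^esub> k', \<one>\<^bsub>H\<^esub>) v = snd V (k, \<one>\<^bsub>H\<^esub>) (snd V (k', \<one>\<^bsub>H\<^esub>) v)"
    "h \<in> carrier H \<Longrightarrow> h' \<in> carrier H \<Longrightarrow>
      snd V (\<one>\<^bsub>K\<^esub>, h \<otimes>\<^bsub>H\<^esub> h') v = snd V (\<one>\<^bsub>K\<^esub>, h) (snd V (\<one>\<^bsub>K\<^esub>, h') v)"
    using assms by (subst act_mult[OF assms(1), symmetric]; simp)+
  show "snd V (\<one>\<^bsub>K\<^esub>, \<one>\<^bsub>H\<^esub>) v = v" using act_one[OF assms(1,2)] by simp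
qed

lemma gset_op_comp:
  assumes K: "fgroup K" and H: "fgroup H" and G: "fgroup G"
  shows "gset_op (K \<times>\<times> H) (H \<times>\<times> G) (K \<times>\<times> G) (comp_rel K H G) (biset_comp K H G)"
  unfolding gset_op_def
proof (intro conjI allI impI)
  note gK = fgroupD(1)[OF K] and gH = fgroupD(1)[OF H] and gG = fgroupD(1)[OF G]
  interpret K: group K by (rule gK)
  interpret H: group H by (rule gH)
  interpret G: group G by (rule gG)
  show "grel (K \<times>\<times> G) ((K \<times>\<times> H) \<times>\<times> H \<times>\<times> G) (comp_rel K H G)"
    by (rule grel_finiteI) (auto simp: comp_rel_def intro!: fgroup_prod K H G)
  fix V :: "('a \<times> 'b, 'x) gset" and U :: "('b \<times> 'c, 'y) gset"
  assume V: "fin_gset (K \<times>\<times> H) V" and U: "fin_gset (H \<times>\<times> G) U"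
  \<comment> \<open>\<open>?a\<close> is the action of the middle group that is divided out,
    \<open>?b\<close> the action of the outer groups that survives.\<close>
  let ?P = "fst V \<times> fst U" and ?a = "\<lambda>h (v, u). (snd V (\<one>\<^bsub>K\<^esub>, h) v, snd U (h, \<one>\<^bsub>G\<^esub>) u)"
    and ?b = "\<lambda>(k, g). map_prod (snd V (k, \<one>\<^bsub>H\<^esub>)) (snd U (\<one>\<^bsub>H\<^esub>, g))"
  have Vc: "snd V (k, h) v \<in> fst V" if "k \<in> carrier K" "h \<in> carrier H" "v \<in> fst V" for k h v
    using act_closed[OF V] that by simp
  have Uc: "snd U (h, g) u \<in> fst U" if "h \<in> carrier H" "g \<in> carrier G" "u \<in> fst U" for h g u
    using act_closed[OF U] that by simp
  note Va = biset_assoc_act[OF V _ gK gH] biset_act_mult[OF V _ gK gH]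
  note Ua = biset_assoc_act[OF U _ gH gG] biset_act_mult[OF U _ gH gG]
  have "biset_comp K H G V U = (biset_orbit K H G V U ` ?P, \<lambda>k. \<lambda>C\<in>biset_orbit K H G V U ` ?P. ?b k ` C)"
    by (auto simp: biset_comp_def fun_eq_iff split: prod.splits)
  note q = quotient_gset[OF DirProd_group[OF gK gG] gH _ _ _ _ _ _ _ _ _ this, of ?a]
  have fin: "finite ?P" using V U by (simp add: fin_gset_finite)
  note q1 = q(1)[OF fin] and q2 = q(2)[OF fin] and q3 = q(3)[OF fin]
  show "fin_gset (K \<times>\<times> G) (biset_comp K H G V U)"
    by (rule q1) (auto simp: Vc Uc Va Ua biset_orbit_def)
  have act: "snd (biset_comp K H G V U) kg (biset_orbit K H G V U p) = biset_orbit K H G V U (?b kg p)"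
    if "p \<in> ?P" "kg \<in> carrier (K \<times>\<times> G)" for p kg
    by (rule q2[OF _ _ _ _ _ _ _ _ that]) (auto simp: Vc Uc Va Ua biset_orbit_def)
  have eq: "biset_orbit K H G V U p = biset_orbit K H G V U p' \<longleftrightarrow> (\<exists>h\<in>carrier H. ?a h p = p')"
    if "p \<in> ?P" "p' \<in> ?P" for p p'
    by (rule q3[OF _ _ _ _ _ _ _ _ that]) (auto simp: Vc Uc Va Ua biset_orbit_def)
  have "corr (K \<times>\<times> G) (comp_rel K H G) (gprod V U) (biset_comp K H G V U) (biset_orbit K H G V U)"
  proof (rule corrI)
    fix C assume "C \<in> fst (biset_comp K H G V U)"
    then obtain p where p: "p \<in> ?P" "C = biset_orbit K H G V U p" by (auto simp: biset_comp_def)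
    have "C = snd (biset_comp K H G V U) (\<one>\<^bsub>K\<^esub>, \<one>\<^bsub>G\<^esub>) (biset_orbit K H G V U p)"
      using p act[OF p(1)] by (auto simp: Va Ua)
    thus "\<exists>k\<in>carrier (K \<times>\<times> G). \<exists>x\<in>fst (gprod V U). C = snd (biset_comp K H G V U) k (biset_orbit K H G V U x)"
      using p by (intro bexI[of _ "(\<one>\<^bsub>K\<^esub>, \<one>\<^bsub>G\<^esub>)"] bexI[of _ p]) (auto simp: gprod_simps)
  next
    fix p p' kg assume "p \<in> fst (gprod V U)" "p' \<in> fst (gprod V U)" "kg \<in> carrier (K \<times>\<times> G)"
    moreover obtain v u v' u' k g where e: "p = (v, u)" "p' = (v', u')" "kg = (k, g)" by (metis surj_pair)
    ultimately have c: "v \<in> fst V" "u \<in> fst U" "v' \<in> fst V" "u' \<in> fst U" "k \<in> carrier K" "g \<in> carrier G"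
      by (auto simp: gprod_simps)
    show "snd (biset_comp K H G V U) kg (biset_orbit K H G V U p) = biset_orbit K H G V U p' \<longleftrightarrow>
      (\<exists>h. (kg, h) \<in> comp_rel K H G \<and> snd (gprod V U) h p = p')"
      using c by (subst act) (auto simp: e eq Vc Uc Va Ua comp_rel_def gprod_simps)
  qed (auto simp: gprod_simps biset_comp_def)
  thus "\<exists>j. corr (K \<times>\<times> G) (comp_rel K H G) (gprod V U) (biset_comp K H G V U) j" by blast
qed

text \<open>Covers the operations that keep the points of the external product and only restrict the
  action along \<open>k \<mapsto> (p k, q k)\<close>: the products of morphisms and the product of
  \<open>RB_G\<close>.\<close>

lemma gset_op_res:
  assumes "fgroup K" "grel K (G \<times>\<times> H) L"
    and "\<And>X Y. fst (op X Y) = fst X \<times> fst Y"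
    and "\<And>X Y k. k \<in> carrier K \<Longrightarrow> snd (op X Y) k \<in> extensional (fst X \<times> fst Y)"
    and p: "\<And>k. k \<in> carrier K \<Longrightarrow> p k \<in> carrier G" "\<And>k. k \<in> carrier K \<Longrightarrow> q k \<in> carrier H"
    and "\<And>X Y k x y. k \<in> carrier K \<Longrightarrow> x \<in> fst X \<Longrightarrow> y \<in> fst Y \<Longrightarrow>
      snd (op X Y) k (x, y) = (snd X (p k) x, snd Y (q k) y)"
    and L: "\<And>k h. k \<in> carrier K \<Longrightarrow> (k, h) \<in> L \<longleftrightarrow> h = (p k, q k)"
  shows "gset_op G H K L op"
  unfolding gset_op_def
proof (intro conjI allI impI)
  show "grel K (G \<times>\<times> H) L" by fact
  note D = grelD[OF this]
  interpret K: group K by (rule D(1))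
  have one: "p \<one>\<^bsub>K\<^esub> = \<one>\<^bsub>G\<^esub>" "q \<one>\<^bsub>K\<^esub> = \<one>\<^bsub>H\<^esub>" using D(7) L[OF K.one_closed] by auto
  have mult: "p (k \<otimes>\<^bsub>K\<^esub> k') = p k \<otimes>\<^bsub>G\<^esub> p k'" "q (k \<otimes>\<^bsub>K\<^esub> k') = q k \<otimes>\<^bsub>H\<^esub> q k'"
    if "k \<in> carrier K" "k' \<in> carrier K" for k k'
    using D(8)[of k "(p k, q k)" k' "(p k', q k')"] L[OF that(1)] L[OF that(2)] L[OF K.m_closed[OF that]] by auto
  fix X :: "('b, nat) gset" and Y :: "('c, nat) gset" assume X: "fin_gset G X" and Y: "fin_gset H Y"
  show fin: "fin_gset K (op X Y)"
    by (rule fin_gsetI[OF K.is_group])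
       (auto simp: assms(3,4,7) p one mult fin_gset_finite[OF X] fin_gset_finite[OF Y] act_closed[OF X]
         act_closed[OF Y] act_one[OF X] act_one[OF Y] act_mult[OF X] act_mult[OF Y])
  have "corr K L (gprod X Y) (op X Y) (\<lambda>x. x)"
    by (rule corr_res[OF fin, where p = "\<lambda>k. (p k, q k)"])
       (auto simp: assms(3,7) p L gprod_simps bij_betw_def act_closed[OF X] act_closed[OF Y])
  thus "\<exists>j. corr K L (gprod X Y) (op X Y) j" by blast
qed

lemma grel_times:
  assumes "fgroup G" "fgroup H" "fgroup G'" "fgroup H'"
  shows "grel ((H \<times>\<times> H') \<times>\<times> (G \<times>\<times> G')) ((H \<times>\<times> G) \<times>\<times> (H' \<times>\<times> G')) (times_rel G H G' H')"
proof -
  interpret G: group G using fgroupD[OF assms(1)] by simp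
  interpret H: group H using fgroupD[OF assms(2)] by simp
  interpret G': group G' using fgroupD[OF assms(3)] by simp
  interpret H': group H' using fgroupD[OF assms(4)] by simp
  show ?thesis by (rule grel_finiteI) (auto simp: times_rel_def intro!: fgroup_prod assms)
qed

lemma gset_op_times:
  assumes "fgroup G" "fgroup H" "fgroup G'" "fgroup H'"
  shows "gset_op (H \<times>\<times> G) (H' \<times>\<times> G') ((H \<times>\<times> H') \<times>\<times> (G \<times>\<times> G')) (times_rel G H G' H') biset_times"
  by (rule gset_op_res[OF _ grel_times[OF assms], where p = "\<lambda>((h, h'), (g, g')). (h, g)" and q = "\<lambda>((h, h'), (g, g')). (h', g')"])
     (use assms in \<open>auto simp: biset_times_def times_rel_def intro!: fgroup_prod\<close>)

lemma grel_mor_times: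
  assumes "fgroup G" "fgroup H" "fgroup G'" "fgroup H'"
  shows "grel ((H \<boxtimes> H') \<times>\<times> (G \<boxtimes> G')) ((H \<times>\<times> G) \<times>\<times> (H' \<times>\<times> G')) (mor_times_rel G H G' H')"
proof -
  interpret G: group G using fgroupD[OF assms(1)] by simp
  interpret H: group H using fgroupD[OF assms(2)] by simp
  interpret G': group G' using fgroupD[OF assms(3)] by simp
  interpret H': group H' using fgroupD[OF assms(4)] by simp
  show ?thesis
    by (rule grel_finiteI)
       (auto simp: mor_times_rel_def obj_times_simps(2,3) intro!: fgroup_prod fgroup_box assms)
qed

definition mor_times_op ::
    "(nat \<times> nat, 'x) gset \<Rightarrow> (nat \<times> nat, 'y) gset \<Rightarrow> (nat \<times> nat, 'x \<times> 'y) gset" where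
  "mor_times_op U V = (fst (biset_times U V), snd (biset_times U V) \<circ> map_prod prod_decode prod_decode)"

lemma gset_op_mor_times:
  assumes "fgroup G" "fgroup H" "fgroup G'" "fgroup H'"
  shows "gset_op (H \<times>\<times> G) (H' \<times>\<times> G') ((H \<boxtimes> H') \<times>\<times> (G \<boxtimes> G')) (mor_times_rel G H G' H') mor_times_op"
  by (rule gset_op_res[OF _ grel_mor_times[OF assms], where p = "\<lambda>(x, y). (fst (prod_decode x), fst (prod_decode y))"
        and q = "\<lambda>(x, y). (snd (prod_decode x), snd (prod_decode y))"])
     (use assms in \<open>auto simp: mor_times_op_def biset_times_def mor_times_rel_def obj_times_simps(1)
        intro!: fgroup_prod fgroup_box\<close>)

lemma grel_shift:
  assumes "fgroup H" "fgroup K" "fgroup G"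
  shows "grel ((H \<boxtimes> K) \<times>\<times> G) ((H \<times>\<times> G) \<times>\<times> (K \<times>\<times> G)) (shift_rel H K G)"
proof -
  interpret H: group H using fgroupD[OF assms(1)] by simp
  interpret K: group K using fgroupD[OF assms(2)] by simp
  interpret G: group G using fgroupD[OF assms(3)] by simp
  show ?thesis
    by (rule grel_finiteI)
       (auto simp: shift_rel_def obj_times_simps(2,3) intro!: fgroup_prod fgroup_box assms)
qed

lemma gset_op_shift:
  assumes "fgroup H" "fgroup K" "fgroup G"
  shows "gset_op (H \<times>\<times> G) (K \<times>\<times> G) ((H \<boxtimes> K) \<times>\<times> G) (shift_rel H K G) shift_times"
  by (rule gset_op_res[OF _ grel_shift[OF assms], where p = "\<lambda>(x, g). (fst (prod_decode x), g)" and q = "\<lambda>(x, g). (snd (prod_decode x), g)"])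
     (use assms in \<open>auto simp: shift_times_def shift_rel_def obj_times_simps(1) split: prod.splits
        intro!: fgroup_prod fgroup_box\<close>)

lemma grel_comp_rel:
  assumes "fgroup K" "fgroup H" "fgroup G"
  shows "grel (K \<times>\<times> G) ((K \<times>\<times> H) \<times>\<times> (H \<times>\<times> G)) (comp_rel K H G)"
  using gset_opD(1)[OF gset_op_comp[OF assms]] .

lemma gset_op_apply:
  assumes K: "fgroup K" and H: "fgroup H"
  shows "gset_op (K \<times>\<times> H) H K (apply_rel K H) (biset_apply K H)"
  unfolding gset_op_def
proof (intro conjI allI impI)
  note gK = fgroupD(1)[OF K] and gH = fgroupD(1)[OF H]
  interpret K: group K by (rule gK)
  interpret H: group H by (rule gH)
  show "grel K ((K \<times>\<times> H) \<times>\<times> H) (apply_rel K H)"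
    by (rule grel_finiteI) (auto simp: apply_rel_def intro!: fgroup_prod K H)
  fix V :: "('a \<times> 'b, 'x) gset" and U :: "('b, 'y) gset"
  assume V: "fin_gset (K \<times>\<times> H) V" and U: "fin_gset H U"
  let ?P = "fst V \<times> fst U" and ?a = "\<lambda>h (v, u). (snd V (\<one>\<^bsub>K\<^esub>, h) v, snd U h u)"
    and ?b = "\<lambda>k. map_prod (snd V (k, \<one>\<^bsub>H\<^esub>)) (\<lambda>u. u)"
  have Vc: "snd V (k, h) v \<in> fst V" if "k \<in> carrier K" "h \<in> carrier H" "v \<in> fst V" for k h v
    using act_closed[OF V] that by simp
  have Uc: "snd U h u \<in> fst U" if "h \<in> carrier H" "u \<in> fst U" for h u
    using act_closed[OF U] that by simp
  note Va = biset_assoc_act[OF V _ gK gH] biset_act_mult[OF V _ gK gH]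
  note Ua = act_one[OF U] act_mult[OF U]
  have "biset_apply K H V U = (biset_apply_orbit K H V U ` ?P, \<lambda>k. \<lambda>C\<in>biset_apply_orbit K H V U ` ?P. ?b k ` C)"
    by (simp add: biset_apply_def id_def)
  note q = quotient_gset[OF gK gH _ _ _ _ _ _ _ _ _ this, of ?a]
  have fin: "finite ?P" using V U by (simp add: fin_gset_finite)
  note q1 = q(1)[OF fin] and q2 = q(2)[OF fin] and q3 = q(3)[OF fin]
  show "fin_gset K (biset_apply K H V U)"
    by (rule q1) (auto simp: Vc Uc Va Ua biset_apply_orbit_def)
  have act: "snd (biset_apply K H V U) k (biset_apply_orbit K H V U p) = biset_apply_orbit K H V U (?b k p)"
    if "p \<in> ?P" "k \<in> carrier K" for p k
    by (rule q2[OF _ _ _ _ _ _ _ _ that]) (auto simp: Vc Uc Va Ua biset_apply_orbit_def)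
  have eq: "biset_apply_orbit K H V U p = biset_apply_orbit K H V U p' \<longleftrightarrow> (\<exists>h\<in>carrier H. ?a h p = p')"
    if "p \<in> ?P" "p' \<in> ?P" for p p'
    by (rule q3[OF _ _ _ _ _ _ _ _ that]) (auto simp: Vc Uc Va Ua biset_apply_orbit_def)
  have "corr K (apply_rel K H) (gprod V U) (biset_apply K H V U) (biset_apply_orbit K H V U)"
  proof (rule corrI)
    fix C assume "C \<in> fst (biset_apply K H V U)"
    then obtain p where p: "p \<in> ?P" "C = biset_apply_orbit K H V U p" by (auto simp: biset_apply_def)
    have "C = snd (biset_apply K H V U) \<one>\<^bsub>K\<^esub> (biset_apply_orbit K H V U p)"
      using p act[OF p(1)] by (auto simp: Va)
    thus "\<exists>k\<in>carrier K. \<exists>x\<in>fst (gprod V U). C = snd (biset_apply K H V U) k (biset_apply_orbit K H V U x)"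
      using p by (intro bexI[of _ "\<one>\<^bsub>K\<^esub>"] bexI[of _ p]) (auto simp: gprod_simps)
  next
    fix p p' k assume "p \<in> fst (gprod V U)" "p' \<in> fst (gprod V U)" and k: "k \<in> carrier K"
    moreover obtain v u v' u' where e: "p = (v, u)" "p' = (v', u')" by (metis surj_pair)
    ultimately have c: "v \<in> fst V" "u \<in> fst U" "v' \<in> fst V" "u' \<in> fst U"
      by (auto simp: gprod_simps)
    show "snd (biset_apply K H V U) k (biset_apply_orbit K H V U p) = biset_apply_orbit K H V U p' \<longleftrightarrow>
      (\<exists>h. (k, h) \<in> apply_rel K H \<and> snd (gprod V U) h p = p')"
      using c k by (subst act) (auto simp: e eq Vc Uc Va Ua apply_rel_def gprod_simps)
  qed (auto simp: gprod_simps biset_apply_def)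
  thus "\<exists>j. corr K (apply_rel K H) (gprod V U) (biset_apply K H V U) j" by blast
qed

subsection \<open>Full pairs\<close>

text \<open>The second relation supplies all elements \<open>(1, b)\<close>, so \<open>L\<close>
  only has to reach every element of \<open>A\<close>; a wrong coordinate \<open>y0\<close> in
  \<open>B\<close> is corrected from the right.\<close>

lemma gfull_prel_Id_right:
  assumes "grel K (A \<times>\<times> B) L" "grel A J N" "fgroup B" "\<And>x. x \<in> carrier A \<Longrightarrow> \<exists>k y. (k, (x, y)) \<in> L"
  shows "gfull (A \<times>\<times> B) L (prel N (Id_on (carrier B)))"
  unfolding gfull_def
proof
  interpret A: group A using grelD(1)[OF assms(2)] .
  interpret B: group B using fgroupD(1)[OF assms(3)] .
  fix z assume z: "z \<in> carrier (A \<times>\<times> B)"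
  then obtain x y where xy: "z = (x, y)" "x \<in> carrier A" "y \<in> carrier B" by auto
  obtain k y0 where k: "(k, (x, y0)) \<in> L" using assms(4)[OF xy(2)] by blast
  have y0: "y0 \<in> carrier B" using grelD(6)[OF assms(1) k] by simp
  have "((\<one>\<^bsub>A\<^esub>, inv\<^bsub>B\<^esub> y0 \<otimes>\<^bsub>B\<^esub> y), (\<one>\<^bsub>J\<^esub>, inv\<^bsub>B\<^esub> y0 \<otimes>\<^bsub>B\<^esub> y)) \<in> prel N (Id_on (carrier B))"
    using grelD(7)[OF assms(2)] y0 xy(3) by auto
  moreover have "z = (x, y0) \<otimes>\<^bsub>A \<times>\<times> B\<^esub> (\<one>\<^bsub>A\<^esub>, inv\<^bsub>B\<^esub> y0 \<otimes>\<^bsub>B\<^esub> y)"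
    using xy y0 by (simp add: B.m_assoc[symmetric])
  ultimately show "\<exists>k h1 h2 g. (k, h1) \<in> L \<and> (h2, g) \<in> prel N (Id_on (carrier B)) \<and> z = h1 \<otimes>\<^bsub>A \<times>\<times> B\<^esub> h2"
    using k by blast
qed

lemma gfull_prel_Id_left:
  assumes "grel K (A \<times>\<times> B) L" "grel B J N" "fgroup A" "\<And>y. y \<in> carrier B \<Longrightarrow> \<exists>k x. (k, (x, y)) \<in> L"
  shows "gfull (A \<times>\<times> B) L (prel (Id_on (carrier A)) N)"
  unfolding gfull_def
proof
  interpret B: group B using grelD(1)[OF assms(2)] .
  interpret A: group A using fgroupD(1)[OF assms(3)] .
  fix z assume z: "z \<in> carrier (A \<times>\<times> B)"
  then obtain x y where xy: "z = (x, y)" "x \<in> carrier A" "y \<in> carrier B" by auto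
  obtain k x0 where k: "(k, (x0, y)) \<in> L" using assms(4)[OF xy(3)] by blast
  have x0: "x0 \<in> carrier A" using grelD(6)[OF assms(1) k] by simp
  have "((inv\<^bsub>A\<^esub> x0 \<otimes>\<^bsub>A\<^esub> x, \<one>\<^bsub>B\<^esub>), (inv\<^bsub>A\<^esub> x0 \<otimes>\<^bsub>A\<^esub> x, \<one>\<^bsub>J\<^esub>)) \<in> prel (Id_on (carrier A)) N"
    using grelD(7)[OF assms(2)] x0 xy(2) by auto
  moreover have "z = (x0, y) \<otimes>\<^bsub>A \<times>\<times> B\<^esub> (inv\<^bsub>A\<^esub> x0 \<otimes>\<^bsub>A\<^esub> x, \<one>\<^bsub>B\<^esub>)"
    using xy x0 by (simp add: A.m_assoc[symmetric])
  ultimately show "\<exists>k h1 h2 g. (k, h1) \<in> L \<and> (h2, g) \<in> prel (Id_on (carrier A)) N \<and> z = h1 \<otimes>\<^bsub>A \<times>\<times> B\<^esub> h2"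
    using k by blast
qed

subsection \<open>Rearrangement of external products\<close>

definition triv :: "unit monoid" where
  "triv = \<lparr>carrier = {()}, monoid.mult = (\<lambda>_ _. ()), one = ()\<rparr>"

text \<open>Over the trivial group the point is a unit for \<open>RBX\<close> up to regrouping, so
  that fixed classes such as identities can enter the calculus as \<open>RBT\<close> of a
  point.\<close>

definition pt_gset :: "('g, unit) gset" where
  "pt_gset = ({()}, \<lambda>_. \<lambda>u\<in>{()}. u)"

lemma fgroup_triv: "fgroup triv"
proof -
  have "group triv" by (rule groupI) (auto simp: triv_def)
  thus ?thesis by (simp add: fgroup_def triv_def)
qed

lemma triv_carrier [simp]: "carrier triv = {()}"
  by (simp add: triv_def)

lemma fin_gset_pt: "group G \<Longrightarrow> fin_gset G pt_gset"
  by (rule fin_gsetI) (auto simp: pt_gset_def)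

definition assoc_rel ::
    "'g monoid \<Rightarrow> 'h monoid \<Rightarrow> 'k monoid \<Rightarrow> ((('g \<times> 'h) \<times> 'k) \<times> ('g \<times> ('h \<times> 'k))) set" where
  "assoc_rel G H K = {(((g, h), k), (g, (h, k))) | g h k. g \<in> carrier G \<and> h \<in> carrier H \<and> k \<in> carrier K}"

definition swap_rel :: "'g monoid \<Rightarrow> 'h monoid \<Rightarrow> (('h \<times> 'g) \<times> ('g \<times> 'h)) set" where
  "swap_rel G H = {((h, g), (g, h)) | g h. g \<in> carrier G \<and> h \<in> carrier H}"

definition unit_rel :: "'g monoid \<Rightarrow> ((unit \<times> 'g) \<times> 'g) set" where
  "unit_rel G = {(((), g), g) | g. g \<in> carrier G}"

lemma grel_assoc:
  assumes "fgroup G" "fgroup H" "fgroup K"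
  shows "grel ((G \<times>\<times> H) \<times>\<times> K) (G \<times>\<times> (H \<times>\<times> K)) (assoc_rel G H K)"
proof -
  interpret G: group G using fgroupD[OF assms(1)] by simp
  interpret H: group H using fgroupD[OF assms(2)] by simp
  interpret K: group K using fgroupD[OF assms(3)] by simp
  show ?thesis by (rule grel_finiteI) (auto simp: assoc_rel_def intro!: fgroup_prod assms)
qed

lemma grel_swap:
  assumes "fgroup G" "fgroup H"
  shows "grel (H \<times>\<times> G) (G \<times>\<times> H) (swap_rel G H)"
proof -
  interpret G: group G using fgroupD[OF assms(1)] by simp
  interpret H: group H using fgroupD[OF assms(2)] by simp
  show ?thesis by (rule grel_finiteI) (auto simp: swap_rel_def intro!: fgroup_prod assms)
qed

lemma grel_unit:
  assumes "fgroup G"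
  shows "grel (triv \<times>\<times> G) G (unit_rel G)"
proof -
  interpret G: group G using fgroupD[OF assms(1)] by simp
  show ?thesis
    by (rule grel_finiteI) (auto simp: unit_rel_def triv_def intro!: fgroup_prod assms fgroup_triv[unfolded triv_def])
qed

context
  fixes R :: "('r, 'q) ring_scheme"
  assumes R: "cring R"
begin

lemma RBX_linear_left:
  assumes "fgroup G" "fgroup H" "linear_map R M (RB R G) f" "y \<in> carrier (RB R H)"
  shows "linear_map R M (RB R (G \<times>\<times> H)) (\<lambda>x. RBX R G H (f x) y)"
  by (rule linear_map_comp[OF assms(3) RBX_linear(1)[OF R assms(1,2,4)]])

lemma RBX_linear_right:
  assumes "fgroup G" "fgroup H" "linear_map R M (RB R H) f" "x \<in> carrier (RB R G)"
  shows "linear_map R M (RB R (G \<times>\<times> H)) (\<lambda>y. RBX R G H x (f y))"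
  by (rule linear_map_comp[OF assms(3) RBX_linear(2)[OF R assms(1,2,4)]])

lemma RBT_linear:
  assumes "grel K H L" "linear_map R M (RB R H) f"
  shows "linear_map R M (RB R K) (\<lambda>x. RBT R K H L (f x))"
  by (rule linear_map_comp[OF assms(2) RBT_spec(1)[OF R assms(1)]])

lemma RBT_res_class:
  assumes "fin_gset K Y" "fin_gset H X" "grel K H L" "bij_betw f (fst X) (fst Y)"
    and "\<And>k x. k \<in> carrier K \<Longrightarrow> x \<in> fst X \<Longrightarrow> f (snd X (p k) x) = snd Y k (f x)"
    and "\<And>k h. k \<in> carrier K \<Longrightarrow> (k, h) \<in> L \<longleftrightarrow> h = p k"
  shows "RBT R K H L (RB_class R H X) = RB_class R K Y"
proof (rule RBT_class[OF R corr_res[OF assms(1,4) _ assms(5,6)] assms(3,2,1)])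
  fix k x assume "k \<in> carrier K" "x \<in> fst X"
  moreover from this have "p k \<in> carrier H" using grelD(6)[OF assms(3)] assms(6) by blast
  ultimately show "snd X (p k) x \<in> fst X" using act_closed[OF assms(2)] by blast
qed

lemma RBX_assoc:
  fixes G :: "'g monoid" and H :: "'h monoid" and K :: "'k monoid"
  assumes f: "fgroup G" "fgroup H" "fgroup K"
    and x: "x \<in> carrier (RB R G)" "y \<in> carrier (RB R H)" "z \<in> carrier (RB R K)"
  shows "RBX R (G \<times>\<times> H) K (RBX R G H x y) z =
    RBT R ((G \<times>\<times> H) \<times>\<times> K) (G \<times>\<times> (H \<times>\<times> K)) (assoc_rel G H K) (RBX R G (H \<times>\<times> K) x (RBX R H K y z))"
proof (rule RB_bilinear_eq[OF R RB_module[OF R, of "(G \<times>\<times> H) \<times>\<times> K"] _ _ _ _ _ x(1,2)])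
  note intros = RBX_linear_left RBX_linear_right RBT_linear linear_map_id fgroup_prod f grel_assoc x(3) RBX_closed[OF R]
  fix X Y assume "X \<in> fin_gsets G" "Y \<in> fin_gsets H"
  hence X: "fin_gset G X" "fin_gset H Y" by (simp_all add: fin_gsets_iff)
  note XY = RB_class_closed[OF R X(1)] RB_class_closed[OF R X(2)]
  show "RBX R (G \<times>\<times> H) K (RBX R G H (RB_class R G X) (RB_class R H Y)) z =
    RBT R ((G \<times>\<times> H) \<times>\<times> K) (G \<times>\<times> (H \<times>\<times> K)) (assoc_rel G H K)
      (RBX R G (H \<times>\<times> K) (RB_class R G X) (RBX R H K (RB_class R H Y) z))"
  proof (rule RB_ext_eq[OF R RB_module[OF R, of "(G \<times>\<times> H) \<times>\<times> K"] _ _ _ x(3)])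
    fix Z assume "Z \<in> fin_gsets K"
    hence Z: "fin_gset K Z" by (simp add: fin_gsets_iff)
    have "RBT R ((G \<times>\<times> H) \<times>\<times> K) (G \<times>\<times> (H \<times>\<times> K)) (assoc_rel G H K)
        (RB_class R (G \<times>\<times> (H \<times>\<times> K)) (gprod X (gprod Y Z))) =
      RB_class R ((G \<times>\<times> H) \<times>\<times> K) (gprod (gprod X Y) Z)"
    proof (rule RBT_res_class[OF _ _ grel_assoc[OF f], where f = "\<lambda>(x, y, z). ((x, y), z)" and p = "\<lambda>((g, h), k). (g, h, k)"])
      show "bij_betw (\<lambda>(x, y, z). ((x, y), z)) (fst (gprod X (gprod Y Z))) (fst (gprod (gprod X Y) Z))"
        by (rule bij_betw_byWitness[where f' = "\<lambda>((x, y), z). (x, y, z)"]) (auto simp: gprod_simps)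
    qed (use X Z f in \<open>auto simp: gprod_simps assoc_rel_def act_closed intro!: fin_gset_gprod\<close>)
    thus "RBX R (G \<times>\<times> H) K (RBX R G H (RB_class R G X) (RB_class R H Y)) (RB_class R K Z) =
      RBT R ((G \<times>\<times> H) \<times>\<times> K) (G \<times>\<times> (H \<times>\<times> K)) (assoc_rel G H K)
        (RBX R G (H \<times>\<times> K) (RB_class R G X) (RBX R H K (RB_class R H Y) (RB_class R K Z)))"
      using X Z f by (simp add: RBX_class[OF R] fin_gset_gprod fgroup_prod)
  qed (intro intros XY)+
qed (intro RBX_linear_left RBX_linear_right RBT_linear linear_map_id fgroup_prod f grel_assoc x(3) RBX_closed[OF R]; assumption)+

lemma RBX_swap:
  fixes G :: "'g monoid" and H :: "'h monoid"
  assumes f: "fgroup G" "fgroup H"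
    and x: "x \<in> carrier (RB R G)" "y \<in> carrier (RB R H)"
  shows "RBX R H G y x = RBT R (H \<times>\<times> G) (G \<times>\<times> H) (swap_rel G H) (RBX R G H x y)"
proof (rule RB_bilinear_eq[OF R RB_module[OF R, of "H \<times>\<times> G"] _ _ _ _ _ x(1,2)])
  note intros = RBX_linear_left RBX_linear_right RBT_linear linear_map_id fgroup_prod f grel_swap RBX_closed[OF R]
  fix X Y assume "X \<in> fin_gsets G" "Y \<in> fin_gsets H"
  hence X: "fin_gset G X" "fin_gset H Y" by (simp_all add: fin_gsets_iff)
  have "RBT R (H \<times>\<times> G) (G \<times>\<times> H) (swap_rel G H) (RB_class R (G \<times>\<times> H) (gprod X Y)) =
    RB_class R (H \<times>\<times> G) (gprod Y X)"
  proof (rule RBT_res_class[OF _ _ grel_swap[OF f], where f = "\<lambda>(x, y). (y, x)" and p = "\<lambda>(h, g). (g, h)"])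
    show "bij_betw (\<lambda>(x, y). (y, x)) (fst (gprod X Y)) (fst (gprod Y X))"
      by (rule bij_betw_byWitness[where f' = "\<lambda>(x, y). (y, x)"]) (auto simp: gprod_simps)
  qed (use X f in \<open>auto simp: gprod_simps swap_rel_def act_closed intro!: fin_gset_gprod\<close>)
  thus "RBX R H G (RB_class R H Y) (RB_class R G X) =
    RBT R (H \<times>\<times> G) (G \<times>\<times> H) (swap_rel G H) (RBX R G H (RB_class R G X) (RB_class R H Y))"
    using X f by (simp add: RBX_class[OF R])
qed (intro RBX_linear_left RBX_linear_right RBT_linear linear_map_id fgroup_prod f grel_swap RBX_closed[OF R]; assumption)+

lemma RBX_pt:
  fixes G :: "'g monoid"
  assumes f: "fgroup G" and x: "x \<in> carrier (RB R G)"
  shows "RBX R triv G (RB_class R triv pt_gset) x = RBT R (triv \<times>\<times> G) G (unit_rel G) x"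
proof (rule RB_ext_eq[OF R RB_module[OF R] _ _ _ x])
  have p: "fin_gset triv pt_gset" by (rule fin_gset_pt[OF fgroupD(1)[OF fgroup_triv]])
  show "linear_map R (RB R G) (RB R (triv \<times>\<times> G)) (RBX R triv G (RB_class R triv pt_gset))"
    by (rule RBX_linear(2)[OF R fgroup_triv f RB_class_closed[OF R p]])
  show "linear_map R (RB R G) (RB R (triv \<times>\<times> G)) (RBT R (triv \<times>\<times> G) G (unit_rel G))"
    by (rule RBT_spec(1)[OF R grel_unit[OF f]])
  fix X assume "X \<in> fin_gsets G"
  hence X: "fin_gset G X" by (simp add: fin_gsets_iff)
  have "RBT R (triv \<times>\<times> G) G (unit_rel G) (RB_class R G X) = RB_class R (triv \<times>\<times> G) (gprod pt_gset X)"
  proof (rule RBT_res_class[OF fin_gset_gprod[OF p X] X grel_unit[OF f], where f = "\<lambda>x. ((), x)" and p = "snd"])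
    show "bij_betw (Pair ()) (fst X) (fst (gprod pt_gset X))"
      by (rule bij_betw_byWitness[where f' = snd]) (auto simp: gprod_simps pt_gset_def)
  qed (auto simp: gprod_def pt_gset_def unit_rel_def)
  thus "RBX R triv G (RB_class R triv pt_gset) (RB_class R G X) = RBT R (triv \<times>\<times> G) G (unit_rel G) (RB_class R G X)"
    using X f p fgroup_triv by (simp add: RBX_class[OF R])
qed

end

section \<open>Composition and products of morphisms\<close>

text \<open>Composition of correspondences with the middle group recorded, so that the side conditions
  of the rules below have no free variables and can be discharged by rewriting.\<close>

definition rcomp :: "'h monoid \<Rightarrow> ('k \<times> 'h) set \<Rightarrow> ('h \<times> 'g) set \<Rightarrow> ('k \<times> 'g) set" where
  "rcomp H L M = L O M"

definition gid :: "'g monoid \<Rightarrow> ('g \<times> 'g) set" where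
  "gid G = Id_on (carrier G)"

lemma grel_gid: "fgroup G \<Longrightarrow> grel G G (gid G)"
  unfolding gid_def by (rule grel_Id)

definition lsurj :: "'k monoid \<Rightarrow> ('k \<times> 'h) set \<Rightarrow> bool" where
  "lsurj K L \<longleftrightarrow> carrier K \<subseteq> Domain L"

lemma grel_rcomp: "grel K H L \<Longrightarrow> grel H G M \<Longrightarrow> grel K G (rcomp H L M)"
  unfolding rcomp_def by (rule grel_comp)

lemma lsurj_rcomp: "grel K H L \<Longrightarrow> lsurj K L \<Longrightarrow> lsurj H M \<Longrightarrow> lsurj K (rcomp H L M)"
  unfolding rcomp_def lsurj_def by (rule Domain_relcomp)

lemma lsurj_prel: "lsurj G M \<Longrightarrow> lsurj H N \<Longrightarrow> lsurj (G \<times>\<times> H) (prel M N)"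
  unfolding lsurj_def by (rule Domain_prel)

lemma lsurj_gid: "lsurj G (gid G)"
  unfolding lsurj_def gid_def by (rule Domain_Id)

definition hom_rel :: "'g monoid \<Rightarrow> ('g \<Rightarrow> 'h) \<Rightarrow> ('h \<times> 'g) set" where
  "hom_rel G f = {(f g, g) | g. g \<in> carrier G}"

text \<open>The graph of \<open>f\<close> is the stabilizer of the identity element in the
  transitive biset \<open>hom_biset H f\<close>; the second component is the trivial group because
  that biset is induced from a point.\<close>

definition hom_pt_rel :: "'g monoid \<Rightarrow> ('g \<Rightarrow> 'h) \<Rightarrow> (('h \<times> 'g) \<times> unit) set" where
  "hom_pt_rel G f = {((f g, g), ()) | g. g \<in> carrier G}"

definition res_rel :: "'g monoid \<Rightarrow> ('g \<Rightarrow> 'h) \<Rightarrow> ('g \<times> 'h) set" where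
  "res_rel G f = {(g, f g) | g. g \<in> carrier G}"

lemma grel_hom_rels:
  assumes "fgroup G" "fgroup H" "f \<in> hom G H"
  shows "grel H G (hom_rel G f)" "grel (H \<times>\<times> G) triv (hom_pt_rel G f)" "grel G H (res_rel G f)"
proof -
  interpret G: group G using fgroupD[OF assms(1)] by simp
  interpret H: group H using fgroupD[OF assms(2)] by simp
  interpret group_hom G H f using assms(3) by unfold_locales
  show "grel H G (hom_rel G f)"
    by (rule grel_finiteI) (auto simp: hom_rel_def intro!: assms exI[of _ "\<one>\<^bsub>G\<^esub>"])
  show "grel (H \<times>\<times> G) triv (hom_pt_rel G f)"
    by (rule grel_finiteI) (auto simp: hom_pt_rel_def intro!: assms fgroup_prod fgroup_triv)
  show "grel G H (res_rel G f)"
    by (rule grel_finiteI) (auto simp: res_rel_def intro!: assms)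
qed

lemma fin_gset_hom_biset:
  assumes "fgroup G" "fgroup H" "f \<in> hom G H"
  shows "fin_gset (H \<times>\<times> G) (hom_biset H f)"
    and "corr (H \<times>\<times> G) (hom_pt_rel G f) pt_gset (hom_biset H f) (\<lambda>_. \<one>\<^bsub>H\<^esub>)"
proof -
  interpret G: group G using fgroupD[OF assms(1)] by simp
  interpret H: group H using fgroupD[OF assms(2)] by simp
  interpret group_hom G H f using assms(3) by unfold_locales
  show "fin_gset (H \<times>\<times> G) (hom_biset H f)"
    by (rule fin_gsetI[OF DirProd_group[OF H.is_group G.is_group]])
       (auto simp: hom_biset_def fgroupD[OF assms(2)] H.m_assoc H.inv_mult_group)
  show "corr (H \<times>\<times> G) (hom_pt_rel G f) pt_gset (hom_biset H f) (\<lambda>_. \<one>\<^bsub>H\<^esub>)"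
  proof (rule corrI)
    fix y assume "y \<in> fst (hom_biset H f)"
    thus "\<exists>k\<in>carrier (H \<times>\<times> G). \<exists>x\<in>fst pt_gset. y = snd (hom_biset H f) k \<one>\<^bsub>H\<^esub>"
      by (intro bexI[of _ "(y, \<one>\<^bsub>G\<^esub>)"]) (auto simp: hom_biset_def pt_gset_def)
  next
    fix k x x' assume "k \<in> carrier (H \<times>\<times> G)"
    then obtain h g where k: "k = (h, g)" "h \<in> carrier H" "g \<in> carrier G" by auto
    have "h \<otimes>\<^bsub>H\<^esub> inv\<^bsub>H\<^esub> f g = \<one>\<^bsub>H\<^esub> \<longleftrightarrow> h = f g"
      using k H.inv_solve_right'[of "\<one>\<^bsub>H\<^esub>" h "f g"] by auto
    thus "snd (hom_biset H f) k \<one>\<^bsub>H\<^esub> = \<one>\<^bsub>H\<^esub> \<longleftrightarrow> (\<exists>h. (k, h) \<in> hom_pt_rel G f \<and> snd pt_gset h x = x')"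
      using k by (auto simp: hom_biset_def hom_pt_rel_def pt_gset_def)
  qed (auto simp: hom_biset_def)
qed

definition pq_rel ::
    "obj \<Rightarrow> obj \<Rightarrow> 'g monoid \<Rightarrow> ((nat \<times> ('g \<times> 'g)) \<times> ((nat \<times> 'g) \<times> (nat \<times> 'g))) set" where
  "pq_rel P Q G = {((prod_encode (p, q), (g, g')), ((p, g), (q, g'))) | p q g g'.
    p \<in> carrier P \<and> q \<in> carrier Q \<and> g \<in> carrier G \<and> g' \<in> carrier G}"

definition lact_rel ::
    "obj \<Rightarrow> obj \<Rightarrow> 'g monoid \<Rightarrow> ((nat \<times> ('g \<times> 'g)) \<times> ((nat \<times> 'g) \<times> (nat \<times> ('g \<times> 'g)))) set" where
  "lact_rel L K G = {((prod_encode (l, k), (g, g')), ((l, g), (k, (g, g')))) | l k g g'.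
    l \<in> carrier L \<and> k \<in> carrier K \<and> g \<in> carrier G \<and> g' \<in> carrier G}"

definition ract_rel ::
    "obj \<Rightarrow> obj \<Rightarrow> 'g monoid \<Rightarrow> ((nat \<times> ('g \<times> 'g)) \<times> ((nat \<times> ('g \<times> 'g)) \<times> (nat \<times> 'g))) set" where
  "ract_rel K L G = {((prod_encode (k, l), (g, g')), ((k, (g, g')), (l, g'))) | l k g g'.
    l \<in> carrier L \<and> k \<in> carrier K \<and> g \<in> carrier G \<and> g' \<in> carrier G}"

definition diag_rel :: "'g monoid \<Rightarrow> ('g \<times> ('g \<times> 'g)) set" where
  "diag_rel G = {(g, (g, g)) | g. g \<in> carrier G}"

text \<open>Two steps in one: restriction to the diagonal of the two copies of \<open>G\<close> in
  the source, which multiplies, and induction along the diagonal into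
  \<open>G \<times> G\<close>.\<close>

definition ind_rel :: "'k monoid \<Rightarrow> 'g monoid \<Rightarrow> (('k \<times> ('g \<times> 'g)) \<times> (('k \<times> 'g) \<times> 'g)) set" where
  "ind_rel K G = {((k, (g, g)), ((k, g), g)) | k g. k \<in> carrier K \<and> g \<in> carrier G}"

definition mid_rel ::
    "'a monoid \<Rightarrow> 'b monoid \<Rightarrow> 'c monoid \<Rightarrow> 'd monoid \<Rightarrow>
      ((('a \<times> 'b) \<times> ('c \<times> 'd)) \<times> (('a \<times> 'c) \<times> ('b \<times> 'd))) set" where
  "mid_rel A B C D = {(((a, b), (c, d)), ((a, c), (b, d))) | a b c d.
    a \<in> carrier A \<and> b \<in> carrier B \<and> c \<in> carrier C \<and> d \<in> carrier D}"

definition lcomm_rel ::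
    "'a monoid \<Rightarrow> 'b monoid \<Rightarrow> 'c monoid \<Rightarrow> (('b \<times> ('a \<times> 'c)) \<times> ('a \<times> ('b \<times> 'c))) set" where
  "lcomm_rel A B C = {((b, (a, c)), (a, (b, c))) | a b c. a \<in> carrier A \<and> b \<in> carrier B \<and> c \<in> carrier C}"

lemma grel_pq:
  assumes "fgroup P" "fgroup Q" "fgroup G"
  shows "grel ((P \<boxtimes> Q) \<times>\<times> (G \<times>\<times> G)) ((P \<times>\<times> G) \<times>\<times> (Q \<times>\<times> G)) (pq_rel P Q G)"
    and "grel ((P \<boxtimes> Q) \<times>\<times> (G \<times>\<times> G)) ((P \<times>\<times> G) \<times>\<times> (Q \<times>\<times> (G \<times>\<times> G))) (lact_rel P Q G)"
    and "grel ((P \<boxtimes> Q) \<times>\<times> (G \<times>\<times> G)) ((P \<times>\<times> (G \<times>\<times> G)) \<times>\<times> (Q \<times>\<times> G)) (ract_rel P Q G)"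
proof -
  interpret P: group P using fgroupD[OF assms(1)] by simp
  interpret Q: group Q using fgroupD[OF assms(2)] by simp
  interpret G: group G using fgroupD[OF assms(3)] by simp
  show "grel ((P \<boxtimes> Q) \<times>\<times> (G \<times>\<times> G)) ((P \<times>\<times> G) \<times>\<times> (Q \<times>\<times> G)) (pq_rel P Q G)"
    by (rule grel_finiteI) (auto simp: pq_rel_def obj_times_simps(2,3) intro!: fgroup_prod fgroup_box assms)
  show "grel ((P \<boxtimes> Q) \<times>\<times> (G \<times>\<times> G)) ((P \<times>\<times> G) \<times>\<times> (Q \<times>\<times> (G \<times>\<times> G))) (lact_rel P Q G)"
    by (rule grel_finiteI) (auto simp: lact_rel_def obj_times_simps(2,3) intro!: fgroup_prod fgroup_box assms)
  show "grel ((P \<boxtimes> Q) \<times>\<times> (G \<times>\<times> G)) ((P \<times>\<times> (G \<times>\<times> G)) \<times>\<times> (Q \<times>\<times> G)) (ract_rel P Q G)"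
    by (rule grel_finiteI) (auto simp: ract_rel_def obj_times_simps(2,3) intro!: fgroup_prod fgroup_box assms)
qed

lemma grel_diag:
  assumes "fgroup G"
  shows "grel G (G \<times>\<times> G) (diag_rel G)"
proof -
  interpret G: group G using fgroupD[OF assms(1)] by simp
  show ?thesis by (rule grel_finiteI) (auto simp: diag_rel_def intro!: fgroup_prod assms)
qed

lemma grel_ind:
  assumes "fgroup K" "fgroup G"
  shows "grel (K \<times>\<times> (G \<times>\<times> G)) ((K \<times>\<times> G) \<times>\<times> G) (ind_rel K G)"
proof -
  interpret K: group K using fgroupD[OF assms(1)] by simp
  interpret G: group G using fgroupD[OF assms(2)] by simp
  show ?thesis by (rule grel_finiteI) (auto simp: ind_rel_def intro!: fgroup_prod assms)
qed

lemma grel_mid: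
  assumes "fgroup A" "fgroup B" "fgroup C" "fgroup D"
  shows "grel ((A \<times>\<times> B) \<times>\<times> (C \<times>\<times> D)) ((A \<times>\<times> C) \<times>\<times> (B \<times>\<times> D)) (mid_rel A B C D)"
proof -
  interpret A: group A using fgroupD[OF assms(1)] by simp
  interpret B: group B using fgroupD[OF assms(2)] by simp
  interpret C: group C using fgroupD[OF assms(3)] by simp
  interpret D: group D using fgroupD[OF assms(4)] by simp
  show ?thesis by (rule grel_finiteI) (auto simp: mid_rel_def intro!: fgroup_prod assms)
qed

lemma grel_lcomm:
  assumes "fgroup A" "fgroup B" "fgroup C"
  shows "grel (B \<times>\<times> (A \<times>\<times> C)) (A \<times>\<times> (B \<times>\<times> C)) (lcomm_rel A B C)"
proof -
  interpret A: group A using fgroupD[OF assms(1)] by simp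
  interpret B: group B using fgroupD[OF assms(2)] by simp
  interpret C: group C using fgroupD[OF assms(3)] by simp
  show ?thesis by (rule grel_finiteI) (auto simp: lcomm_rel_def intro!: fgroup_prod assms)
qed

lemmas fgroups = fgroup_prod fgroup_box fgroup_triv fgroup_unit

lemmas grels = grel_rcomp grel_prel grel_gid grel_comp_rel grel_times grel_mor_times grel_shift grel_assoc
  grel_swap grel_unit grel_pq grel_diag grel_ind grel_mid grel_lcomm gset_opD(1)[OF gset_op_apply]

lemma lsurj_comp:
  "lsurj (K \<times>\<times> G) (comp_rel K H G)" if "fgroup H"
  using group.is_monoid[OF fgroupD(1)[OF that]] monoid.one_closed by (auto simp: lsurj_def comp_rel_def) blast

lemma lsurj_rels:
  "lsurj ((H \<times>\<times> H') \<times>\<times> (G \<times>\<times> G')) (times_rel G H G' H')"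
  "lsurj ((P \<boxtimes> P') \<times>\<times> (Q \<boxtimes> Q')) (mor_times_rel Q P Q' P')"
  "lsurj ((P \<boxtimes> Q) \<times>\<times> G) (shift_rel P Q G)"
  "lsurj ((G \<times>\<times> H) \<times>\<times> K) (assoc_rel G H K)"
  "lsurj (H \<times>\<times> G) (swap_rel G H)"
  "lsurj (triv \<times>\<times> G) (unit_rel G)"
  "lsurj ((P \<boxtimes> Q) \<times>\<times> (G \<times>\<times> G)) (pq_rel P Q G)"
  "lsurj ((P \<boxtimes> Q) \<times>\<times> (G \<times>\<times> G)) (lact_rel P Q G)"
  "lsurj ((P \<boxtimes> Q) \<times>\<times> (G \<times>\<times> G)) (ract_rel P Q G)"
  "lsurj G (diag_rel G)"
  "lsurj ((A \<times>\<times> B) \<times>\<times> (C \<times>\<times> D)) (mid_rel A B C D)"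
  "lsurj (B \<times>\<times> (A \<times>\<times> C)) (lcomm_rel A B C)"
  "lsurj G (res_rel G f)"
  by (auto simp: lsurj_def times_rel_def mor_times_rel_def shift_rel_def assoc_rel_def swap_rel_def unit_rel_def
      pq_rel_def lact_rel_def ract_rel_def diag_rel_def mid_rel_def lcomm_rel_def res_rel_def obj_times_simps(1)
      Domain_iff)

lemmas domains = lsurj_comp lsurj_rels lsurj_rcomp lsurj_prel lsurj_gid

lemmas rel_defs = gid_def Id_on_iff rcomp_def prel_def relcomp_unfold comp_rel_def apply_rel_def times_rel_def mor_times_rel_def
  shift_rel_def assoc_rel_def swap_rel_def unit_rel_def pq_rel_def lact_rel_def ract_rel_def diag_rel_def
  ind_rel_def mid_rel_def lcomm_rel_def hom_rel_def hom_pt_rel_def res_rel_def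

text \<open>The last step of the calculus: with both sides written as \<open>RBT\<close> of one
  external product, what remains is an equality of subgroups, computed elementwise.\<close>

lemma RBT_cong: "L = L' \<Longrightarrow> RBT R K H L x = RBT R K H L' x"
  by simp

context
  fixes R :: "('r, 'q) ring_scheme"
  assumes R: "cring R"
begin

lemma pt_closed: "RB_class R triv pt_gset \<in> carrier (RB R triv)"
  by (rule RB_class_closed[OF R fin_gset_pt[OF fgroupD(1)[OF fgroup_triv]]])

lemma RBT_RBT_left:
  "grel K H L \<Longrightarrow> grel H G M \<Longrightarrow> x \<in> carrier (RB R G) \<Longrightarrow> lsurj H M \<Longrightarrow>
    RBT R K H L (RBT R H G M x) = RBT R K G (rcomp H L M) x"
  unfolding rcomp_def lsurj_def by (rule RBT_RBT[OF R _ _ gfull_left])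

lemma RBT_RBT_right:
  "grel K H L \<Longrightarrow> grel H G M \<Longrightarrow> x \<in> carrier (RB R G) \<Longrightarrow> carrier H \<subseteq> Range L \<Longrightarrow>
    RBT R K H L (RBT R H G M x) = RBT R K G (rcomp H L M) x"
  unfolding rcomp_def by (rule RBT_RBT[OF R _ _ gfull_right])

lemma RBT_RBT_full:
  "grel K H L \<Longrightarrow> grel H G M \<Longrightarrow> x \<in> carrier (RB R G) \<Longrightarrow> gfull H L M \<Longrightarrow>
    RBT R K H L (RBT R H G M x) = RBT R K G (rcomp H L M) x"
  unfolding rcomp_def by (rule RBT_RBT[OF R])

lemma RBT_gid: "fgroup H \<Longrightarrow> x \<in> carrier (RB R H) \<Longrightarrow> RBT R H H (gid H) x = x"
  unfolding gid_def by (rule RBT_Id[OF R])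

lemma RBX_RBT_left:
  assumes "grel K G L" "fgroup H" "x \<in> carrier (RB R G)" "y \<in> carrier (RB R H)"
  shows "RBX R K H (RBT R K G L x) y = RBT R (K \<times>\<times> H) (G \<times>\<times> H) (prel L (gid H)) (RBX R G H x y)"
  unfolding gid_def using RBX_RBT[OF R assms(1) grel_Id[OF assms(2)] assms(3,4)] RBT_Id[OF R assms(2,4)] by simp

lemma RBX_RBT_right:
  assumes "grel K G L" "fgroup H" "x \<in> carrier (RB R G)" "y \<in> carrier (RB R H)"
  shows "RBX R H K y (RBT R K G L x) = RBT R (H \<times>\<times> K) (H \<times>\<times> G) (prel (gid H) L) (RBX R H G y x)"
  unfolding gid_def using RBX_RBT[OF R grel_Id[OF assms(2)] assms(1) assms(4,3)] RBT_Id[OF R assms(2,4)] by simp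

lemmas RB_op_closed = RBT_closed[OF R] RBX_closed[OF R] pt_closed

text \<open>Rewriting to normal form: maps are pulled out of external products, and successive maps
  are merged when the inner relation reaches the whole middle group. Inductions such as
  \<open>hom_pt_rel\<close> and \<open>ind_rel\<close> in general do not, and are merged separately
  by \<open>gfull\<close> arguments.\<close>

lemmas rel_norm = RBT_RBT_left RBX_RBT[OF R] RBX_RBT_left RBX_RBT_right RB_op_closed fgroups grels domains

lemma RBX_lcomm:
  fixes A :: "'a monoid" and B :: "'b monoid" and C :: "'c monoid"
  assumes f: "fgroup A" "fgroup B" "fgroup C"
    and x: "x \<in> carrier (RB R A)" "y \<in> carrier (RB R B)" "z \<in> carrier (RB R C)"
  shows "RBX R B (A \<times>\<times> C) y (RBX R A C x z) =
    RBT R (B \<times>\<times> (A \<times>\<times> C)) (A \<times>\<times> (B \<times>\<times> C)) (lcomm_rel A B C) (RBX R A (B \<times>\<times> C) x (RBX R B C y z))"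
proof (rule RB_bilinear_eq[OF R RB_module[OF R, of "B \<times>\<times> (A \<times>\<times> C)"] _ _ _ _ _ x(1,2)])
  fix X Y assume "X \<in> fin_gsets A" "Y \<in> fin_gsets B"
  hence X: "fin_gset A X" "fin_gset B Y" by (simp_all add: fin_gsets_iff)
  note XY = RB_class_closed[OF R X(1)] RB_class_closed[OF R X(2)]
  show "RBX R B (A \<times>\<times> C) (RB_class R B Y) (RBX R A C (RB_class R A X) z) =
    RBT R (B \<times>\<times> (A \<times>\<times> C)) (A \<times>\<times> (B \<times>\<times> C)) (lcomm_rel A B C)
      (RBX R A (B \<times>\<times> C) (RB_class R A X) (RBX R B C (RB_class R B Y) z))"
  proof (rule RB_ext_eq[OF R RB_module[OF R, of "B \<times>\<times> (A \<times>\<times> C)"] _ _ _ x(3)])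
    fix Z assume "Z \<in> fin_gsets C"
    hence Z: "fin_gset C Z" by (simp add: fin_gsets_iff)
    have "RBT R (B \<times>\<times> (A \<times>\<times> C)) (A \<times>\<times> (B \<times>\<times> C)) (lcomm_rel A B C)
        (RB_class R (A \<times>\<times> (B \<times>\<times> C)) (gprod X (gprod Y Z))) =
      RB_class R (B \<times>\<times> (A \<times>\<times> C)) (gprod Y (gprod X Z))"
    proof (rule RBT_res_class[OF R _ _ grel_lcomm[OF f], where f = "\<lambda>(x, y, z). (y, x, z)" and p = "\<lambda>(g, h, k). (h, g, k)"])
      show "bij_betw (\<lambda>(x, y, z). (y, x, z)) (fst (gprod X (gprod Y Z))) (fst (gprod Y (gprod X Z)))"
        by (rule bij_betw_byWitness[where f' = "\<lambda>(x, y, z). (y, x, z)"]) (auto simp: gprod_simps)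
    qed (use X Z f in \<open>auto simp: gprod_simps lcomm_rel_def act_closed intro!: fin_gset_gprod\<close>)
    thus "RBX R B (A \<times>\<times> C) (RB_class R B Y) (RBX R A C (RB_class R A X) (RB_class R C Z)) =
      RBT R (B \<times>\<times> (A \<times>\<times> C)) (A \<times>\<times> (B \<times>\<times> C)) (lcomm_rel A B C)
        (RBX R A (B \<times>\<times> C) (RB_class R A X) (RBX R B C (RB_class R B Y) (RB_class R C Z)))"
      using X Z f by (simp add: RBX_class[OF R] fin_gset_gprod fgroup_prod)
  qed (intro R RBX_linear_left[OF R] RBX_linear_right[OF R] RBT_linear[OF R] linear_map_id f fgroup_prod grel_lcomm RBX_closed[OF R] XY)+
qed (intro R RBX_linear_left[OF R] RBX_linear_right[OF R] RBT_linear[OF R] linear_map_id f fgroup_prod grel_lcomm RBX_closed[OF R] x(3); assumption)+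

text \<open>The interchange is assembled from associativity on both sides and one exchange of the
  inner factors, without going back to sets.\<close>

lemma RBX_mid:
  fixes A :: "'a monoid" and B :: "'b monoid" and C :: "'c monoid" and D :: "'d monoid"
  assumes f: "fgroup A" "fgroup B" "fgroup C" "fgroup D"
    and x: "w \<in> carrier (RB R A)" "x \<in> carrier (RB R B)" "y \<in> carrier (RB R C)" "z \<in> carrier (RB R D)"
  shows "RBX R (A \<times>\<times> B) (C \<times>\<times> D) (RBX R A B w x) (RBX R C D y z) =
    RBT R ((A \<times>\<times> B) \<times>\<times> (C \<times>\<times> D)) ((A \<times>\<times> C) \<times>\<times> (B \<times>\<times> D)) (mid_rel A B C D)
      (RBX R (A \<times>\<times> C) (B \<times>\<times> D) (RBX R A C w y) (RBX R B D x z))"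
proof -
  have yz: "RBX R B (C \<times>\<times> D) x (RBX R C D y z) \<in> carrier (RB R (B \<times>\<times> (C \<times>\<times> D)))"
    "RBX R C (B \<times>\<times> D) y (RBX R B D x z) \<in> carrier (RB R (C \<times>\<times> (B \<times>\<times> D)))"
    using f x by (simp_all add: RB_op_closed fgroups)
  have 1: "RBX R (A \<times>\<times> B) (C \<times>\<times> D) (RBX R A B w x) (RBX R C D y z) =
    RBT R ((A \<times>\<times> B) \<times>\<times> (C \<times>\<times> D)) (A \<times>\<times> (B \<times>\<times> (C \<times>\<times> D))) (assoc_rel A B (C \<times>\<times> D))
      (RBX R A (B \<times>\<times> (C \<times>\<times> D)) w (RBX R B (C \<times>\<times> D) x (RBX R C D y z)))"
    by (rule RBX_assoc[OF R]) (use f x in \<open>simp_all add: RB_op_closed fgroups\<close>)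
  have 2: "RBX R (A \<times>\<times> C) (B \<times>\<times> D) (RBX R A C w y) (RBX R B D x z) =
    RBT R ((A \<times>\<times> C) \<times>\<times> (B \<times>\<times> D)) (A \<times>\<times> (C \<times>\<times> (B \<times>\<times> D))) (assoc_rel A C (B \<times>\<times> D))
      (RBX R A (C \<times>\<times> (B \<times>\<times> D)) w (RBX R C (B \<times>\<times> D) y (RBX R B D x z)))"
    by (rule RBX_assoc[OF R]) (use f x in \<open>simp_all add: RB_op_closed fgroups\<close>)
  have 3: "RBX R B (C \<times>\<times> D) x (RBX R C D y z) =
    RBT R (B \<times>\<times> (C \<times>\<times> D)) (C \<times>\<times> (B \<times>\<times> D)) (lcomm_rel C B D) (RBX R C (B \<times>\<times> D) y (RBX R B D x z))"
    by (rule RBX_lcomm) (use f x in simp_all)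
  show ?thesis
    unfolding 1 2 3 using f x yz
    by (simp add: rel_norm) (rule RBT_cong, auto simp: rel_defs)
qed

end

text \<open>Under the isomorphism \<open>RB\<^sub>G \<otimes> RB\<^sub>G \<cong> RB\<close> shifted by \<open>G \<times> G\<close>, \<open>pq\<close> is the universal pairing, and \<open>la\<close> and
  \<open>ra\<close> are the left and the right action, through the first and the second factor of \<open>G \<times> G\<close>.
  \<open>dot m y\<close> is \<open>m y\<close> induced along the diagonal \<open>G \<rightarrow> G \<times> G\<close>.\<close>

definition pq ::
    "('r, 'q) ring_scheme \<Rightarrow> 'g monoid \<Rightarrow> obj \<Rightarrow> obj \<Rightarrow> ('r, nat \<times> 'g) rb_elt \<Rightarrow> ('r, nat \<times> 'g) rb_elt \<Rightarrow>
      ('r, nat \<times> ('g \<times> 'g)) rb_elt" where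
  "pq R G P Q m n =
    RBT R ((P \<boxtimes> Q) \<times>\<times> (G \<times>\<times> G)) ((P \<times>\<times> G) \<times>\<times> (Q \<times>\<times> G)) (pq_rel P Q G) (RBX R (P \<times>\<times> G) (Q \<times>\<times> G) m n)"

definition la ::
    "('r, 'q) ring_scheme \<Rightarrow> 'g monoid \<Rightarrow> obj \<Rightarrow> obj \<Rightarrow> ('r, nat \<times> 'g) rb_elt \<Rightarrow>
      ('r, nat \<times> ('g \<times> 'g)) rb_elt \<Rightarrow> ('r, nat \<times> ('g \<times> 'g)) rb_elt" where
  "la R G L K a w = RBT R ((L \<boxtimes> K) \<times>\<times> (G \<times>\<times> G)) ((L \<times>\<times> G) \<times>\<times> (K \<times>\<times> (G \<times>\<times> G))) (lact_rel L K G)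
    (RBX R (L \<times>\<times> G) (K \<times>\<times> (G \<times>\<times> G)) a w)"

definition ra ::
    "('r, 'q) ring_scheme \<Rightarrow> 'g monoid \<Rightarrow> obj \<Rightarrow> obj \<Rightarrow> ('r, nat \<times> ('g \<times> 'g)) rb_elt \<Rightarrow>
      ('r, nat \<times> 'g) rb_elt \<Rightarrow> ('r, nat \<times> ('g \<times> 'g)) rb_elt" where
  "ra R G K L w a = RBT R ((K \<boxtimes> L) \<times>\<times> (G \<times>\<times> G)) ((K \<times>\<times> (G \<times>\<times> G)) \<times>\<times> (L \<times>\<times> G)) (ract_rel K L G)
    (RBX R (K \<times>\<times> (G \<times>\<times> G)) (L \<times>\<times> G) w a)"

text \<open>Changes the parameter group by \<open>N\<close> and leaves the object \<open>K\<close>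
  alone: with \<open>diag_rel\<close> it is restriction to the diagonal of
  \<open>G \<times> G\<close>, with the graph of an isomorphism it is transport of the
  parameter.\<close>

definition Tr ::
    "('r, 'q) ring_scheme \<Rightarrow> 'k monoid \<Rightarrow> 'g monoid \<Rightarrow> 'h monoid \<Rightarrow> ('g \<times> 'h) set \<Rightarrow>
      ('r, 'k \<times> 'h) rb_elt \<Rightarrow> ('r, 'k \<times> 'g) rb_elt" where
  "Tr R K G H N w = RBT R (K \<times>\<times> G) (K \<times>\<times> H) (prel (gid K) N) w"

definition dot ::
    "('r, 'q) ring_scheme \<Rightarrow> 'k monoid \<Rightarrow> 'g monoid \<Rightarrow> ('r, 'k \<times> 'g) rb_elt \<Rightarrow> ('r, 'g) rb_elt \<Rightarrow>
      ('r, 'k \<times> ('g \<times> 'g)) rb_elt" where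
  "dot R K G m y = RBT R (K \<times>\<times> (G \<times>\<times> G)) ((K \<times>\<times> G) \<times>\<times> G) (ind_rel K G) (RBX R (K \<times>\<times> G) G m y)"

section \<open>Composition, products of morphisms and the shifted functor in the calculus\<close>

context
  fixes R :: "('r, 'q) ring_scheme"
  assumes R: "cring R"
begin

lemmas normR = rel_norm[OF R] RBX_assoc[OF R]

lemma RB_comp_eq:
  assumes "fgroup K" "fgroup H" "fgroup G"
    "\<beta> \<in> carrier (RB R (K \<times>\<times> H))" "\<alpha> \<in> carrier (RB R (H \<times>\<times> G))"
  shows "RB_comp R K H G \<beta> \<alpha> = RBT R (K \<times>\<times> G) ((K \<times>\<times> H) \<times>\<times> (H \<times>\<times> G)) (comp_rel K H G)
    (RBX R (K \<times>\<times> H) (H \<times>\<times> G) \<beta> \<alpha>)"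
  unfolding RB_comp_def
  by (rule RB_bilin_eq[OF R gset_op_comp]) (use assms in \<open>auto intro: fgroup_prod\<close>)

lemma RB_comp_closed:
  assumes "fgroup K" "fgroup H" "fgroup G"
    "\<beta> \<in> carrier (RB R (K \<times>\<times> H))" "\<alpha> \<in> carrier (RB R (H \<times>\<times> G))"
  shows "RB_comp R K H G \<beta> \<alpha> \<in> carrier (RB R (K \<times>\<times> G))"
  using assms by (simp add: RB_comp_eq normR)

lemma RB_comp_linear:
  assumes "fgroup K" "fgroup H" "fgroup G"
  shows "\<alpha> \<in> carrier (RB R (H \<times>\<times> G)) \<Longrightarrow>
      linear_map R (RB R (K \<times>\<times> H)) (RB R (K \<times>\<times> G)) (\<lambda>\<beta>. RB_comp R K H G \<beta> \<alpha>)"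
    and "\<beta> \<in> carrier (RB R (K \<times>\<times> H)) \<Longrightarrow>
      linear_map R (RB R (H \<times>\<times> G)) (RB R (K \<times>\<times> G)) (\<lambda>\<alpha>. RB_comp R K H G \<beta> \<alpha>)"
  unfolding RB_comp_def using RB_bilin_op[OF R gset_op_comp[OF assms]] by blast+

lemma mor_times_eq:
  assumes "fgroup G" "fgroup H" "fgroup G'" "fgroup H'"
    "\<alpha> \<in> carrier (RB R (H \<times>\<times> G))" "\<beta> \<in> carrier (RB R (H' \<times>\<times> G'))"
  shows "mor_times R G H G' H' \<alpha> \<beta> =
    RBT R ((H \<boxtimes> H') \<times>\<times> (G \<boxtimes> G')) ((H \<times>\<times> G) \<times>\<times> (H' \<times>\<times> G')) (mor_times_rel G H G' H')
      (RBX R (H \<times>\<times> G) (H' \<times>\<times> G') \<alpha> \<beta>)"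
  unfolding mor_times_def mor_times_op_def[abs_def, symmetric]
  by (rule RB_bilin_eq[OF R gset_op_mor_times]) (use assms in \<open>auto intro: fgroup_prod\<close>)

lemma mor_times_closed:
  assumes "fgroup G" "fgroup H" "fgroup G'" "fgroup H'"
    "\<alpha> \<in> carrier (RB R (H \<times>\<times> G))" "\<beta> \<in> carrier (RB R (H' \<times>\<times> G'))"
  shows "mor_times R G H G' H' \<alpha> \<beta> \<in> carrier (RB R ((H \<boxtimes> H') \<times>\<times> (G \<boxtimes> G')))"
  using assms by (simp add: mor_times_eq normR)

lemma shift_eq:
  assumes "fgroup H" "fgroup K" "fgroup G" "a \<in> carrier (RB R (H \<times>\<times> G))" "b \<in> carrier (RB R (K \<times>\<times> G))"
  shows "gmult (RB_shift R G) H K a b =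
    RBT R ((H \<boxtimes> K) \<times>\<times> G) ((H \<times>\<times> G) \<times>\<times> (K \<times>\<times> G)) (shift_rel H K G) (RBX R (H \<times>\<times> G) (K \<times>\<times> G) a b)"
  unfolding RB_shift_def green_fun.simps
  by (rule RB_bilin_eq[OF R gset_op_shift]) (use assms in \<open>auto intro: fgroup_prod\<close>)

lemma shift_closed:
  assumes "fgroup H" "fgroup K" "fgroup G" "a \<in> carrier (RB R (H \<times>\<times> G))" "b \<in> carrier (RB R (K \<times>\<times> G))"
  shows "gmult (RB_shift R G) H K a b \<in> carrier (RB R ((H \<boxtimes> K) \<times>\<times> G))"
  using assms by (simp add: shift_eq normR)

lemma shift_linear:
  assumes "fgroup H" "fgroup K" "fgroup G"
  shows "b \<in> carrier (RB R (K \<times>\<times> G)) \<Longrightarrow>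
      linear_map R (RB R (H \<times>\<times> G)) (RB R ((H \<boxtimes> K) \<times>\<times> G)) (\<lambda>a. gmult (RB_shift R G) H K a b)"
    and "a \<in> carrier (RB R (H \<times>\<times> G)) \<Longrightarrow>
      linear_map R (RB R (K \<times>\<times> G)) (RB R ((H \<boxtimes> K) \<times>\<times> G)) (\<lambda>b. gmult (RB_shift R G) H K a b)"
  unfolding RB_shift_def green_fun.simps using RB_bilin_op[OF R gset_op_shift[OF assms]] by blast+

lemma RB_hom_eq:
  assumes "fgroup G" "fgroup H" "f \<in> hom G H"
  shows "RB_hom R G H f = RBT R (H \<times>\<times> G) triv (hom_pt_rel G f) (RB_class R triv pt_gset)"
  unfolding RB_hom_def
  by (rule RBT_class[OF R fin_gset_hom_biset(2)[OF assms] grel_hom_rels(2)[OF assms] _ fin_gset_hom_biset(1)[OF assms], symmetric])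
     (rule fin_gset_pt[OF fgroupD(1)[OF fgroup_triv]])

lemma RB_hom_closed:
  "fgroup G \<Longrightarrow> fgroup H \<Longrightarrow> f \<in> hom G H \<Longrightarrow> RB_hom R G H f \<in> carrier (RB R (H \<times>\<times> G))"
  by (simp add: RB_hom_eq RB_op_closed[OF R] grel_hom_rels)

lemma RBX_pt_right:
  assumes "fgroup G" "x \<in> carrier (RB R G)"
  shows "RBX R G triv x (RB_class R triv pt_gset) = RBT R (G \<times>\<times> triv) G (rcomp (triv \<times>\<times> G) (swap_rel triv G) (unit_rel G)) x"
  using assms RBX_swap[OF R fgroup_triv assms(1) pt_closed[OF R] assms(2)]
  by (simp add: RBX_pt[OF R] normR)

text \<open>\<open>comp_rel\<close> projects onto all of \<open>K \<times> H\<close> and onto all of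
  \<open>H \<times> G\<close>, so replacing one factor of a composite by the image of any transitive
  biset keeps a single double coset.\<close>

lemma gfull_comp:
  assumes "fgroup K" "fgroup H" "fgroup G"
  shows "grel (K \<times>\<times> H) J N \<Longrightarrow>
      gfull ((K \<times>\<times> H) \<times>\<times> (H \<times>\<times> G)) (comp_rel K H G) (prel N (gid (H \<times>\<times> G)))"
    and "grel (H \<times>\<times> G) J' N' \<Longrightarrow>
      gfull ((K \<times>\<times> H) \<times>\<times> (H \<times>\<times> G)) (comp_rel K H G) (prel (gid (K \<times>\<times> H)) N')"
proof -
  have o: "\<one>\<^bsub>K\<^esub> \<in> carrier K" "\<one>\<^bsub>G\<^esub> \<in> carrier G"
    using fgroupD(1)[OF assms(1)] fgroupD(1)[OF assms(3)] by (simp_all add: group.is_monoid monoid.one_closed)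
  show "grel (K \<times>\<times> H) J N \<Longrightarrow>
      gfull ((K \<times>\<times> H) \<times>\<times> (H \<times>\<times> G)) (comp_rel K H G) (prel N (gid (H \<times>\<times> G)))"
    unfolding gid_def by (rule gfull_prel_Id_right[OF grel_comp_rel[OF assms] _ fgroup_prod[OF assms(2,3)]])
       (use o in \<open>auto simp: comp_rel_def\<close>)
  show "grel (H \<times>\<times> G) J' N' \<Longrightarrow>
      gfull ((K \<times>\<times> H) \<times>\<times> (H \<times>\<times> G)) (comp_rel K H G) (prel (gid (K \<times>\<times> H)) N')"
    unfolding gid_def by (rule gfull_prel_Id_left[OF grel_comp_rel[OF assms] _ fgroup_prod[OF assms(1,2)]])
       (use o in \<open>auto simp: comp_rel_def\<close>)
qed

text \<open>For factors that are themselves images of a transitive biset, as identities and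
  homomorphisms are: \<open>N\<close> need not be left-surjective, so \<open>rel_norm\<close> does
  not merge it.\<close>

lemma RB_comp_RBT_left:
  assumes "fgroup K" "fgroup H" "fgroup G" "grel (K \<times>\<times> H) J N" "x \<in> carrier (RB R J)"
    "\<alpha> \<in> carrier (RB R (H \<times>\<times> G))"
  shows "RB_comp R K H G (RBT R (K \<times>\<times> H) J N x) \<alpha> =
    RBT R (K \<times>\<times> G) (J \<times>\<times> (H \<times>\<times> G))
      (rcomp ((K \<times>\<times> H) \<times>\<times> (H \<times>\<times> G)) (comp_rel K H G) (prel N (gid (H \<times>\<times> G))))
      (RBX R J (H \<times>\<times> G) x \<alpha>)"
proof -
  have J: "fgroup J" using grel_fgroup(2)[OF assms(4)] .
  show ?thesis using assms J
    by (simp add: RB_comp_eq RB_op_closed[OF R] RBX_RBT_left[OF R] fgroups RBT_RBT_full[OF R] grels gfull_comp(1) )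
qed

lemma RB_comp_RBT_right:
  assumes "fgroup K" "fgroup H" "fgroup G" "grel (H \<times>\<times> G) J N" "\<beta> \<in> carrier (RB R (K \<times>\<times> H))"
    "x \<in> carrier (RB R J)"
  shows "RB_comp R K H G \<beta> (RBT R (H \<times>\<times> G) J N x) =
    RBT R (K \<times>\<times> G) ((K \<times>\<times> H) \<times>\<times> J)
      (rcomp ((K \<times>\<times> H) \<times>\<times> (H \<times>\<times> G)) (comp_rel K H G) (prel (gid (K \<times>\<times> H)) N))
      (RBX R (K \<times>\<times> H) J \<beta> x)"
proof -
  have J: "fgroup J" using grel_fgroup(2)[OF assms(4)] .
  show ?thesis using assms J
    by (simp add: RB_comp_eq RB_op_closed[OF R] RBX_RBT_right[OF R] fgroups RBT_RBT_full[OF R] grels gfull_comp(2))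
qed

lemma RB_comp_assoc:
  assumes "fgroup L" "fgroup K" "fgroup H" "fgroup G"
    "\<gamma> \<in> carrier (RB R (L \<times>\<times> K))" "\<beta> \<in> carrier (RB R (K \<times>\<times> H))" "\<alpha> \<in> carrier (RB R (H \<times>\<times> G))"
  shows "RB_comp R L H G (RB_comp R L K H \<gamma> \<beta>) \<alpha> = RB_comp R L K G \<gamma> (RB_comp R K H G \<beta> \<alpha>)"
  using assms by (simp add: RB_comp_eq normR) (rule RBT_cong, auto simp: rel_defs)

text \<open>On the left of a morphism a homomorphism acts by its graph; on the right, in
  \<open>RB_comp_hom_right\<close>, by the converse, that is by restriction of the
  parameter.\<close>

lemma RB_comp_hom:
  assumes "fgroup G" "fgroup H" "fgroup C" "f \<in> hom G H" "z \<in> carrier (RB R (G \<times>\<times> C))"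
  shows "RB_comp R H G C (RB_hom R G H f) z =
    RBT R (H \<times>\<times> C) (G \<times>\<times> C) (prel (hom_rel G f) (gid C)) z"
proof -
  have f: "f g \<in> carrier H" if "g \<in> carrier G" for g using assms(4) that by (auto simp: hom_def)
  show ?thesis
    using assms
    by (simp add: RB_hom_eq RB_comp_RBT_left grel_hom_rels RBX_pt[OF R] normR)
       (rule RBT_cong, auto simp: rel_defs f)
qed

lemma RB_comp_hom_right:
  assumes "fgroup G" "fgroup H" "fgroup K" "f \<in> hom G H" "z \<in> carrier (RB R (K \<times>\<times> H))"
  shows "RB_comp R K H G z (RB_hom R G H f) = Tr R K G H (res_rel G f) z"
proof -
  have f: "f g \<in> carrier H" if "g \<in> carrier G" for g using assms(4) that by (auto simp: hom_def)
  show ?thesis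
    using assms
    by (simp add: RB_hom_eq RB_comp_RBT_right grel_hom_rels RBX_pt_right normR Tr_def)
       (rule RBT_cong, auto simp: rel_defs f)
qed

lemma RB_id_comp:
  assumes "fgroup H" "fgroup G" "z \<in> carrier (RB R (H \<times>\<times> G))"
  shows "RB_comp R H H G (RB_id R H) z = z"
proof -
  have "prel (hom_rel H id) (gid G) = gid (H \<times>\<times> G)"
    by (auto simp: rel_defs)
  thus ?thesis
    using assms by (simp add: RB_id_def RB_comp_hom RBT_gid[OF R] fgroups hom_def)
qed

text \<open>An element of \<open>RB(H \<times> G)\<close> is a morphism from \<open>G\<close> to
  \<open>H\<close>, and the identity biset in \<open>\<alpha> \<times> G\<close> only relabels the
  parameter, so \<open>RB(\<alpha> \<times> G)\<close> is composition with \<open>\<alpha>\<close>.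
  All of \<open>RB_G\<close> thus lives inside the calculus of composition.\<close>

lemma RB_shift_fmor:
  assumes "fgroup K" "fgroup H" "fgroup G" "\<alpha> \<in> carrier (RB R (K \<times>\<times> H))" "m \<in> carrier (RB R (H \<times>\<times> G))"
  shows "fmor (RB_shift R G) H K \<alpha> m = RB_comp R K H G \<alpha> m"
proof -
  let ?N = "rcomp ((K \<times>\<times> H) \<times>\<times> (G \<times>\<times> G)) (times_rel H K G G) (prel (gid (K \<times>\<times> H)) (hom_pt_rel G id))"
  let ?N' = "rcomp ((K \<times>\<times> H) \<times>\<times> triv) ?N (rcomp (triv \<times>\<times> (K \<times>\<times> H)) (swap_rel triv (K \<times>\<times> H)) (unit_rel (K \<times>\<times> H)))"
  have id: "id \<in> hom G G" by (auto simp: hom_def)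
  note g = grel_hom_rels(2)[OF assms(3,3) id]
  \<comment> \<open>The inner relation comes from the identity biset, an induction, and is in
    general not left-surjective. Instead \<open>times_rel\<close>, being a regrouping, reaches the
    whole middle group from the other side.\<close>
  have surj: "carrier ((K \<times>\<times> H) \<times>\<times> (G \<times>\<times> G)) \<subseteq> Range (times_rel H K G G)"
    by (auto simp: times_rel_def Range_iff)
  have 1: "RB_times R H K G G \<alpha> (RB_id R G) =
    RBT R ((K \<times>\<times> G) \<times>\<times> (H \<times>\<times> G)) (K \<times>\<times> H) ?N' \<alpha>"
  proof -
    have "RB_times R H K G G \<alpha> (RB_id R G) = RBT R ((K \<times>\<times> G) \<times>\<times> (H \<times>\<times> G)) ((K \<times>\<times> H) \<times>\<times> (G \<times>\<times> G)) (times_rel H K G G)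
        (RBX R (K \<times>\<times> H) (G \<times>\<times> G) \<alpha> (RB_id R G))"
      unfolding RB_times_def
      by (rule RB_bilin_eq[OF R gset_op_times]) (use assms id in \<open>auto simp: RB_id_def RB_hom_closed intro: fgroup_prod\<close>)
    also have "\<dots> = RBT R ((K \<times>\<times> G) \<times>\<times> (H \<times>\<times> G)) ((K \<times>\<times> H) \<times>\<times> triv) ?N (RBX R (K \<times>\<times> H) triv \<alpha> (RB_class R triv pt_gset))"
      using assms id g by (simp add: RB_id_def RB_hom_eq RBX_RBT_right[OF R] RB_op_closed[OF R] fgroups
          RBT_RBT_right[OF R _ _ _ surj] grels)
    also have "\<dots> = RBT R ((K \<times>\<times> G) \<times>\<times> (H \<times>\<times> G)) (K \<times>\<times> H) ?N' \<alpha>"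
      using assms g by (simp add: RBX_pt_right normR)
    finally show ?thesis .
  qed
  have gN: "grel ((K \<times>\<times> G) \<times>\<times> (H \<times>\<times> G)) (K \<times>\<times> H) ?N'"
    using assms g by (simp add: fgroups grels)
  have full: "gfull (((K \<times>\<times> G) \<times>\<times> (H \<times>\<times> G)) \<times>\<times> (H \<times>\<times> G)) (apply_rel (K \<times>\<times> G) (H \<times>\<times> G))
      (prel ?N' (gid (H \<times>\<times> G)))"
    unfolding gid_def[of "H \<times>\<times> G"]
  proof (rule gfull_prel_Id_right[OF _ gN])
    show "grel (K \<times>\<times> G) (((K \<times>\<times> G) \<times>\<times> (H \<times>\<times> G)) \<times>\<times> (H \<times>\<times> G)) (apply_rel (K \<times>\<times> G) (H \<times>\<times> G))"
      "fgroup (H \<times>\<times> G)"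
      using assms by (simp_all add: fgroups grels)
  qed (auto simp: apply_rel_def)
  have "fmor (RB_shift R G) H K \<alpha> m = RB_apply R (H \<times>\<times> G) (K \<times>\<times> G) (RB_times R H K G G \<alpha> (RB_id R G)) m"
    by (simp add: RB_shift_def)
  also have "\<dots> = RBT R (K \<times>\<times> G) (((K \<times>\<times> G) \<times>\<times> (H \<times>\<times> G)) \<times>\<times> (H \<times>\<times> G)) (apply_rel (K \<times>\<times> G) (H \<times>\<times> G))
      (RBX R ((K \<times>\<times> G) \<times>\<times> (H \<times>\<times> G)) (H \<times>\<times> G) (RB_times R H K G G \<alpha> (RB_id R G)) m)"
    unfolding RB_apply_def
    by (rule RB_bilin_eq[OF R gset_op_apply]) (use assms gN in \<open>auto simp: 1 RB_op_closed[OF R] intro: fgroup_prod\<close>)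
  also have "\<dots> = RB_comp R K H G \<alpha> m"
    unfolding 1 using assms gN
    by (simp add: RBX_RBT_left[OF R] RBT_RBT_full[OF R _ _ _ full] RB_comp_eq RB_op_closed[OF R] fgroups grels)
       (rule RBT_cong, auto simp: rel_defs)
  finally show ?thesis .
qed

end

section \<open>Coherence morphisms, the universal pairing and the Green functor axioms\<close>

lemma assoc_hom:
  "assoc_fwd \<in> hom ((H \<boxtimes> K) \<boxtimes> L) (H \<boxtimes> (K \<boxtimes> L))"
  "assoc_bwd \<in> hom (H \<boxtimes> (K \<boxtimes> L)) ((H \<boxtimes> K) \<boxtimes> L)"
  by (auto simp: hom_def assoc_fwd_def assoc_bwd_def obj_times_simps)

lemma unit_homs:
  "snd \<circ> prod_decode \<in> hom (obj_unit \<boxtimes> H) H"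
  "fst \<circ> prod_decode \<in> hom (H \<boxtimes> obj_unit) H"
  by (auto simp: hom_def obj_times_simps)

lemma lsurj_assoc_hom:
  "lsurj (H \<boxtimes> (K \<boxtimes> L)) (hom_rel ((H \<boxtimes> K) \<boxtimes> L) assoc_fwd)"
  "lsurj ((H \<boxtimes> K) \<boxtimes> L) (hom_rel (H \<boxtimes> (K \<boxtimes> L)) assoc_bwd)"
proof -
  have "(prod_encode (a, prod_encode (b, c)), prod_encode (prod_encode (a, b), c)) \<in> hom_rel ((H \<boxtimes> K) \<boxtimes> L) assoc_fwd"
    "(prod_encode (prod_encode (a, b), c), prod_encode (a, prod_encode (b, c))) \<in> hom_rel (H \<boxtimes> (K \<boxtimes> L)) assoc_bwd"
    if "a \<in> carrier H" "b \<in> carrier K" "c \<in> carrier L" for a b c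
    using that by (auto simp: hom_rel_def assoc_fwd_def assoc_bwd_def)
  thus "lsurj (H \<boxtimes> (K \<boxtimes> L)) (hom_rel ((H \<boxtimes> K) \<boxtimes> L) assoc_fwd)"
    "lsurj ((H \<boxtimes> K) \<boxtimes> L) (hom_rel (H \<boxtimes> (K \<boxtimes> L)) assoc_bwd)"
    unfolding lsurj_def obj_times_simps(1) by blast+
qed

lemma RB_shift_simps:
  "fobj (RB_shift R G) H = RB R (H \<times>\<times> G)"
  by (simp add: RB_shift_def)

context
  fixes R :: "('r, 'q) ring_scheme"
  assumes R: "cring R"
begin

lemmas rb = rel_norm[OF R] RBX_assoc[OF R] RB_comp_eq[OF R] mor_times_eq[OF R] shift_eq[OF R]
  RB_comp_closed[OF R] mor_times_closed[OF R] shift_closed[OF R]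

lemma pq_closed:
  assumes "fgroup P" "fgroup Q" "fgroup G" "m \<in> carrier (RB R (P \<times>\<times> G))" "n \<in> carrier (RB R (Q \<times>\<times> G))"
  shows "pq R G P Q m n \<in> carrier (RB R ((P \<boxtimes> Q) \<times>\<times> (G \<times>\<times> G)))"
  using assms by (simp add: pq_def rb)

lemma Tr_closed:
  assumes "fgroup K" "grel G H N" "w \<in> carrier (RB R (K \<times>\<times> H))"
  shows "Tr R K G H N w \<in> carrier (RB R (K \<times>\<times> G))"
  using assms by (simp add: Tr_def rb)

lemma Tr_linear:
  assumes "fgroup K" "grel G H N"
  shows "linear_map R (RB R (K \<times>\<times> H)) (RB R (K \<times>\<times> G)) (Tr R K G H N)"
proof -
  have "linear_map R (RB R (K \<times>\<times> H)) (RB R (K \<times>\<times> G)) (\<lambda>w. Tr R K G H N w)"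
    unfolding Tr_def by (intro R RBT_linear[OF R] linear_map_id grel_prel grel_gid assms)
  thus ?thesis by simp
qed

text \<open>The object side and the parameter side of a morphism do not interact. As
  \<open>N\<close> may be an induction, the fullness form of composition is used first.\<close>

lemma comp_Tr:
  assumes "fgroup K" "fgroup H" "fgroup G" "fgroup G'" "grel G G' N"
    "\<beta> \<in> carrier (RB R (K \<times>\<times> H))" "w \<in> carrier (RB R (H \<times>\<times> G'))"
  shows "RB_comp R K H G \<beta> (Tr R H G G' N w) = Tr R K G G' N (RB_comp R K H G' \<beta> w)"
proof -
  have N: "g \<in> carrier G" "g' \<in> carrier G'" if "(g, g') \<in> N" for g g'
    using grelD(5,6)[OF assms(5) that] .
  show ?thesis
    unfolding Tr_def RB_comp_RBT_right[OF R assms(1-3) grel_prel[OF grel_gid[OF assms(2)] assms(5)] assms(6,7)]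
    using assms by (simp add: rb) (rule RBT_cong, auto simp: rel_defs dest: N)
qed

text \<open>Naturality of the universal pairing; it is the coend relation seen on the other side of
  the Yoneda isomorphism.\<close>

lemma comp_mor_times_pq:
  assumes "fgroup P" "fgroup P'" "fgroup Q" "fgroup Q'" "fgroup G"
    "\<alpha> \<in> carrier (RB R (P' \<times>\<times> P))" "\<beta> \<in> carrier (RB R (Q' \<times>\<times> Q))"
    "m \<in> carrier (RB R (P \<times>\<times> G))" "n \<in> carrier (RB R (Q \<times>\<times> G))"
  shows "RB_comp R (P' \<boxtimes> Q') (P \<boxtimes> Q) (G \<times>\<times> G) (mor_times R P P' Q Q' \<alpha> \<beta>) (pq R G P Q m n) =
    pq R G P' Q' (RB_comp R P' P G \<alpha> m) (RB_comp R Q' Q G \<beta> n)"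
proof -
  let ?A = "P' \<times>\<times> P" and ?B = "Q' \<times>\<times> Q" and ?C = "P \<times>\<times> G" and ?D = "Q \<times>\<times> G"
  have 3: "RBX R (?A \<times>\<times> ?C) (?B \<times>\<times> ?D) (RBX R ?A ?C \<alpha> m) (RBX R ?B ?D \<beta> n) =
    RBT R ((?A \<times>\<times> ?C) \<times>\<times> (?B \<times>\<times> ?D)) ((?A \<times>\<times> ?B) \<times>\<times> (?C \<times>\<times> ?D)) (mid_rel ?A ?C ?B ?D)
      (RBX R (?A \<times>\<times> ?B) (?C \<times>\<times> ?D) (RBX R ?A ?B \<alpha> \<beta>) (RBX R ?C ?D m n))"
    by (rule RBX_mid[OF R]) (use assms in \<open>simp_all add: fgroups\<close>)
  show ?thesis
    using assms
    by (simp add: pq_def rel_norm[OF R] RB_comp_eq[OF R] mor_times_eq[OF R] 3) (rule RBT_cong, auto simp: rel_defs)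
qed

text \<open>Reduces the product of \<open>RB_G\<close> to the universal pairing, from which its
  naturality and the description of the product morphism are inherited.\<close>

lemma Tr_diag_pq:
  assumes "fgroup P" "fgroup Q" "fgroup G" "m \<in> carrier (RB R (P \<times>\<times> G))" "n \<in> carrier (RB R (Q \<times>\<times> G))"
  shows "Tr R (P \<boxtimes> Q) G (G \<times>\<times> G) (diag_rel G) (pq R G P Q m n) = gmult (RB_shift R G) P Q m n"
  using assms by (simp add: Tr_def pq_def rb) (rule RBT_cong, auto simp: rel_defs)

lemma shift_natural:
  assumes "fgroup P" "fgroup P'" "fgroup Q" "fgroup Q'" "fgroup G"
    "\<alpha> \<in> carrier (RB R (P' \<times>\<times> P))" "\<beta> \<in> carrier (RB R (Q' \<times>\<times> Q))"
    "m \<in> carrier (RB R (P \<times>\<times> G))" "n \<in> carrier (RB R (Q \<times>\<times> G))"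
  shows "RB_comp R (P' \<boxtimes> Q') (P \<boxtimes> Q) G (mor_times R P P' Q Q' \<alpha> \<beta>) (gmult (RB_shift R G) P Q m n) =
    gmult (RB_shift R G) P' Q' (RB_comp R P' P G \<alpha> m) (RB_comp R Q' Q G \<beta> n)"
  using assms comp_mor_times_pq[OF assms]
  by (simp add: Tr_diag_pq[symmetric] comp_Tr grels fgroups pq_closed mor_times_closed[OF R] RB_comp_closed[OF R])

lemma assoc_closed:
  assumes "fgroup H" "fgroup K" "fgroup L"
  shows "assoc_mor R H K L \<in> carrier (RB R ((H \<boxtimes> (K \<boxtimes> L)) \<times>\<times> ((H \<boxtimes> K) \<boxtimes> L)))"
    "assoc_inv_mor R H K L \<in> carrier (RB R (((H \<boxtimes> K) \<boxtimes> L) \<times>\<times> (H \<boxtimes> (K \<boxtimes> L))))"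
  unfolding assoc_mor_def assoc_inv_mor_def
  by (rule RB_hom_closed[OF R _ _ assoc_hom(1)] RB_hom_closed[OF R _ _ assoc_hom(2)]; simp add: fgroups assms)+

lemma unit_mor_closed:
  assumes "fgroup H"
  shows "left_unit_mor R H \<in> carrier (RB R (H \<times>\<times> (obj_unit \<boxtimes> H)))"
    "right_unit_mor R H \<in> carrier (RB R (H \<times>\<times> (H \<boxtimes> obj_unit)))"
  unfolding left_unit_mor_def right_unit_mor_def
  by (rule RB_hom_closed[OF R _ _ unit_homs(1)] RB_hom_closed[OF R _ _ unit_homs(2)]; simp add: fgroups assms)+

lemma shift_assoc:
  assumes "fgroup H" "fgroup K" "fgroup L" "fgroup G"
    "a \<in> carrier (RB R (H \<times>\<times> G))" "b \<in> carrier (RB R (K \<times>\<times> G))" "c \<in> carrier (RB R (L \<times>\<times> G))"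
  shows "RB_comp R (H \<boxtimes> (K \<boxtimes> L)) ((H \<boxtimes> K) \<boxtimes> L) G (assoc_mor R H K L)
      (gmult (RB_shift R G) (H \<boxtimes> K) L (gmult (RB_shift R G) H K a b) c) =
    gmult (RB_shift R G) H (K \<boxtimes> L) a (gmult (RB_shift R G) K L b c)"
  using assms
  by (simp add: assoc_mor_def RB_comp_hom[OF R] assoc_hom grel_hom_rels fgroups shift_eq[OF R] rel_norm[OF R] RBX_assoc[OF R])
     (rule RBT_cong, auto simp: rel_defs assoc_fwd_def)

lemma gunit_eq:
  assumes "fgroup G"
  shows "gunit (RB_shift R G) =
    RBT R (obj_unit \<times>\<times> G) triv {(x, ()) | x. x \<in> carrier (obj_unit \<times>\<times> G)} (RB_class R triv pt_gset)"
    "gunit (RB_shift R G) \<in> carrier (RB R (obj_unit \<times>\<times> G))"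
    "grel (obj_unit \<times>\<times> G) triv {(x, ()) | x. x \<in> carrier (obj_unit \<times>\<times> G)}"
proof -
  let ?K = "obj_unit \<times>\<times> G" and ?L = "{(x, ()) | x. x \<in> carrier (obj_unit \<times>\<times> G)}"
  have K: "fgroup ?K" using assms by (simp add: fgroups)
  interpret K: group ?K using fgroupD(1)[OF K] .
  show L: "grel ?K triv ?L"
    by (rule grel_finiteI[OF K fgroup_triv]) (use K.m_closed K.one_closed in \<open>auto simp: triv_def\<close>)
  have p: "fin_gset ?K pt_gset" "fin_gset triv pt_gset"
    using fin_gset_pt fgroupD(1)[OF fgroup_triv] K.is_group by auto
  have "corr ?K ?L pt_gset pt_gset (\<lambda>x. x)"
    by (rule corr_res[OF p(1), where p = "\<lambda>_. ()"]) (auto simp: pt_gset_def)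
  from RBT_class[OF R this L p(2,1)]
  have 1: "RB_class R ?K pt_gset = RBT R ?K triv ?L (RB_class R triv pt_gset)" by simp
  show "gunit (RB_shift R G) = RBT R ?K triv ?L (RB_class R triv pt_gset)"
    unfolding 1[symmetric] by (simp add: RB_shift_def pt_gset_def)
  thus "gunit (RB_shift R G) \<in> carrier (RB R ?K)"
    using 1 RB_class_closed[OF R p(1)] by simp
qed

lemma shift_unit:
  assumes "fgroup H" "fgroup G" "a \<in> carrier (RB R (H \<times>\<times> G))"
  shows "RB_comp R H (obj_unit \<boxtimes> H) G (left_unit_mor R H) (gmult (RB_shift R G) obj_unit H (gunit (RB_shift R G)) a) = a"
    and "RB_comp R H (H \<boxtimes> obj_unit) G (right_unit_mor R H) (gmult (RB_shift R G) H obj_unit a (gunit (RB_shift R G))) = a"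
proof -
  note gu = gunit_eq[OF assms(2)]
  have l: "lsurj (obj_unit \<times>\<times> G) {(x, ()) | x. x \<in> carrier (obj_unit \<times>\<times> G)}" by (auto simp: lsurj_def)
  have u: "carrier obj_unit = {0}" by (simp add: obj_unit_def)
  show "RB_comp R H (obj_unit \<boxtimes> H) G (left_unit_mor R H) (gmult (RB_shift R G) obj_unit H (gunit (RB_shift R G)) a) = a"
    using assms gu(2)
    apply (simp add: left_unit_mor_def RB_comp_hom[OF R] unit_homs grel_hom_rels shift_eq[OF R] RB_op_closed[OF R] fgroups grels del: DirProd_def)
    apply (subst gu(1))
    using gu(3) l
    apply (simp add: rel_norm[OF R] RBX_pt[OF R] unit_homs grel_hom_rels)
    apply (rule trans[OF RBT_cong RBT_gid[OF R]])
      apply (auto simp: rel_defs u fgroups)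
    done
  show "RB_comp R H (H \<boxtimes> obj_unit) G (right_unit_mor R H) (gmult (RB_shift R G) H obj_unit a (gunit (RB_shift R G))) = a"
    using assms gu(2)
    apply (simp add: right_unit_mor_def RB_comp_hom[OF R] unit_homs grel_hom_rels shift_eq[OF R] RB_op_closed[OF R] fgroups grels)
    apply (subst gu(1))
    using gu(3) l
    apply (simp add: rel_norm[OF R] RBX_pt_right[OF R] unit_homs grel_hom_rels)
    apply (rule trans[OF RBT_cong RBT_gid[OF R]])
      apply (auto simp: rel_defs u fgroups)
    done
qed

lemma green_RB_shift:
  assumes "fgroup G"
  shows "green_biset_functor R (RB_shift R G)"
proof -
  have id: "RB_id R H \<in> carrier (RB R (H \<times>\<times> H))" if "fgroup H" for H :: obj
    unfolding RB_id_def using RB_hom_closed[OF R that that] by (auto simp: hom_def)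
  have lin: "linear_map R (RB R (K \<times>\<times> G)) (RB R (H \<times>\<times> G)) (fmor (RB_shift R G) K H \<alpha>)"
    if "fgroup H" "fgroup K" "\<alpha> \<in> carrier (RB R (H \<times>\<times> K))" for H K \<alpha>
    by (rule linear_map_cong[OF RB_module[OF R] RB_comp_linear(2)[OF R that(1,2) assms that(3)]])
       (use that assms in \<open>simp add: RB_shift_fmor[OF R]\<close>)
  have lin': "linear_map R (RB R (H \<times>\<times> K)) (RB R (H \<times>\<times> G)) (\<lambda>\<alpha>. fmor (RB_shift R G) K H \<alpha> m)"
    if "fgroup H" "fgroup K" "m \<in> carrier (RB R (K \<times>\<times> G))" for H K m
    by (rule linear_map_cong[OF RB_module[OF R] RB_comp_linear(1)[OF R that(1,2) assms that(3)]])
       (use that assms in \<open>simp add: RB_shift_fmor[OF R]\<close>)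
  have "biset_functor R (RB_shift R G)"
    unfolding biset_functor_def RB_shift_simps fin_groups_iff
  proof (intro conjI ballI allI; (unfold fin_groups_iff)?)
  qed (use assms lin lin' RB_module[OF R] in \<open>auto simp: fin_groups_iff RB_shift_fmor[OF R] RB_id_comp[OF R] id RB_comp_closed[OF R] RB_comp_assoc[OF R]\<close>)
  thus ?thesis
    unfolding green_biset_functor_def RB_shift_simps
    using assms shift_linear[OF R] gunit_eq(2)[OF assms]
    by (auto simp: fin_groups_iff RB_shift_fmor[OF R] shift_natural shift_assoc shift_unit mor_times_closed[OF R]
        RB_comp_closed[OF R] fgroups shift_closed[OF R] assoc_closed
        unit_mor_closed)
qed

end

section \<open>The two actions and induction along the diagonal\<close>

definition box_left_rel :: "obj \<Rightarrow> obj \<Rightarrow> obj \<Rightarrow> ((nat \<times> nat) \<times> (nat \<times> nat)) set" where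
  "box_left_rel L K X = {((prod_encode (l, k), prod_encode (l, x)), (k, x)) | l k x.
    l \<in> carrier L \<and> k \<in> carrier K \<and> x \<in> carrier X}"

definition box_right_rel :: "obj \<Rightarrow> obj \<Rightarrow> obj \<Rightarrow> ((nat \<times> nat) \<times> (nat \<times> nat)) set" where
  "box_right_rel L K X = {((prod_encode (k, l), prod_encode (x, l)), (k, x)) | l k x.
    l \<in> carrier L \<and> k \<in> carrier K \<and> x \<in> carrier X}"

lemma grel_box:
  assumes "fgroup L" "fgroup K" "fgroup X"
  shows "grel ((L \<boxtimes> K) \<times>\<times> (L \<boxtimes> X)) (K \<times>\<times> X) (box_left_rel L K X)"
    and "grel ((K \<boxtimes> L) \<times>\<times> (X \<boxtimes> L)) (K \<times>\<times> X) (box_right_rel L K X)"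
proof -
  interpret L: group L using fgroupD[OF assms(1)] by simp
  interpret K: group K using fgroupD[OF assms(2)] by simp
  interpret X: group X using fgroupD[OF assms(3)] by simp
  show "grel ((L \<boxtimes> K) \<times>\<times> (L \<boxtimes> X)) (K \<times>\<times> X) (box_left_rel L K X)"
    by (rule grel_finiteI) (auto simp: box_left_rel_def obj_times_simps(2,3) intro!: fgroup_prod fgroup_box assms)
  show "grel ((K \<boxtimes> L) \<times>\<times> (X \<boxtimes> L)) (K \<times>\<times> X) (box_right_rel L K X)"
    by (rule grel_finiteI) (auto simp: box_right_rel_def obj_times_simps(2,3) intro!: fgroup_prod fgroup_box assms)
qed

lemma lsurj_hom: "bij_betw f (carrier G) (carrier H) \<Longrightarrow> lsurj H (hom_rel G f)"
  unfolding lsurj_def hom_rel_def bij_betw_def by blast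

context
  fixes R :: "('r, 'q) ring_scheme"
  assumes R: "cring R"
begin

text \<open>The identity biset of \<open>L\<close> is a point induced from the diagonal. Absorbing
  it into the relation writes \<open>L \<times> \<phi>\<close> as one map applied to
  \<open>\<phi>\<close> and removes the constant factor from the computations with the
  actions.\<close>

lemma mor_times_id:
  assumes "fgroup L" "fgroup K" "fgroup X" "\<phi> \<in> carrier (RB R (K \<times>\<times> X))"
  shows "mor_times R L L X K (RB_id R L) \<phi> =
      RBT R ((L \<boxtimes> K) \<times>\<times> (L \<boxtimes> X)) (K \<times>\<times> X) (box_left_rel L K X) \<phi>"
    and "mor_times R X K L L \<phi> (RB_id R L) =
      RBT R ((K \<boxtimes> L) \<times>\<times> (X \<boxtimes> L)) (K \<times>\<times> X) (box_right_rel L K X) \<phi>"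
proof -
  have id: "id \<in> hom L L" by (auto simp: hom_def)
  note g = grel_hom_rels(2)[OF assms(1,1) id]
  have idc: "RB_id R L \<in> carrier (RB R (L \<times>\<times> L))" unfolding RB_id_def by (rule RB_hom_closed[OF R assms(1,1) id])
  have surj: "carrier ((H \<times>\<times> G) \<times>\<times> (H' \<times>\<times> G')) \<subseteq> Range (mor_times_rel G H G' H')" for H G H' G' :: obj
    by (auto simp: mor_times_rel_def Range_iff)
  note RBT_mor = RBT_RBT_right[OF R _ _ _ surj]
  have idT: "RB_id R L = RBT R (L \<times>\<times> L) triv (hom_pt_rel L id) (RB_class R triv pt_gset)"
    unfolding RB_id_def by (rule RB_hom_eq[OF R assms(1,1) id])
  have "mor_times R L L X K (RB_id R L) \<phi> = RBT R ((L \<boxtimes> K) \<times>\<times> (L \<boxtimes> X)) ((L \<times>\<times> L) \<times>\<times> (K \<times>\<times> X))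
      (mor_times_rel L L X K) (RBX R (L \<times>\<times> L) (K \<times>\<times> X) (RB_id R L) \<phi>)"
    by (rule mor_times_eq[OF R]) (use assms idc in auto)
  also have "\<dots> = RBT R ((L \<boxtimes> K) \<times>\<times> (L \<boxtimes> X)) (K \<times>\<times> X) (box_left_rel L K X) \<phi>"
    unfolding idT using assms g
    by (simp add: RBX_RBT_left[OF R] RB_op_closed[OF R] fgroups RBT_mor grels RBX_pt[OF R])
       (simp add: rel_norm[OF R] RBX_pt[OF R], rule RBT_cong, auto simp: rel_defs box_left_rel_def)
  finally show "mor_times R L L X K (RB_id R L) \<phi> =
      RBT R ((L \<boxtimes> K) \<times>\<times> (L \<boxtimes> X)) (K \<times>\<times> X) (box_left_rel L K X) \<phi>" .
  have "mor_times R X K L L \<phi> (RB_id R L) = RBT R ((K \<boxtimes> L) \<times>\<times> (X \<boxtimes> L)) ((K \<times>\<times> X) \<times>\<times> (L \<times>\<times> L))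
      (mor_times_rel X K L L) (RBX R (K \<times>\<times> X) (L \<times>\<times> L) \<phi> (RB_id R L))"
    by (rule mor_times_eq[OF R]) (use assms idc in auto)
  also have "\<dots> = RBT R ((K \<boxtimes> L) \<times>\<times> (X \<boxtimes> L)) (K \<times>\<times> X) (box_right_rel L K X) \<phi>"
    unfolding idT using assms g
    by (simp add: RBX_RBT_right[OF R] RB_op_closed[OF R] fgroups RBT_mor grels RBX_pt_right[OF R])
       (simp add: rel_norm[OF R] RBX_pt_right[OF R], rule RBT_cong, auto simp: rel_defs box_right_rel_def)
  finally show "mor_times R X K L L \<phi> (RB_id R L) =
      RBT R ((K \<boxtimes> L) \<times>\<times> (X \<boxtimes> L)) (K \<times>\<times> X) (box_right_rel L K X) \<phi>" .
qed

text \<open>The computation on generators behind \<open>day_map_lact\<close>: a generator is read as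
  the composite of its morphism with the pairing of its two elements, and under this reading the
  left action of the tensor square becomes \<open>la\<close>.\<close>

lemma comp_lact:
  assumes "fgroup L" "fgroup K" "fgroup P" "fgroup Q" "fgroup G" "\<phi> \<in> carrier (RB R (K \<times>\<times> (P \<boxtimes> Q)))"
    "a \<in> carrier (RB R (L \<times>\<times> G))" "m \<in> carrier (RB R (P \<times>\<times> G))" "n \<in> carrier (RB R (Q \<times>\<times> G))"
  shows "RB_comp R (L \<boxtimes> K) ((L \<boxtimes> P) \<boxtimes> Q) (G \<times>\<times> G)
      (RB_comp R (L \<boxtimes> K) (L \<boxtimes> (P \<boxtimes> Q)) ((L \<boxtimes> P) \<boxtimes> Q)
        (mor_times R L L (P \<boxtimes> Q) K (RB_id R L) \<phi>) (assoc_mor R L P Q))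
      (pq R G (L \<boxtimes> P) Q (gmult (RB_shift R G) L P a m) n) =
    la R G L K a (RB_comp R K (P \<boxtimes> Q) (G \<times>\<times> G) \<phi> (pq R G P Q m n))"
proof -
  let ?A = "assoc_mor R L P Q" and ?mn = "pq R G (L \<boxtimes> P) Q (gmult (RB_shift R G) L P a m) n"
  let ?M = "RBT R ((L \<boxtimes> K) \<times>\<times> (L \<boxtimes> (P \<boxtimes> Q))) (K \<times>\<times> (P \<boxtimes> Q)) (box_left_rel L K (P \<boxtimes> Q)) \<phi>"
  note f = assms(1-5) fgroup_box[OF assms(3,4)] fgroup_box[OF assms(1,2)] fgroup_box[OF assms(1,3)]
  note g = grel_box(1)[OF f(1,2,6)]
  have mn: "?mn \<in> carrier (RB R (((L \<boxtimes> P) \<boxtimes> Q) \<times>\<times> (G \<times>\<times> G)))"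
    using assms by (simp add: pq_closed[OF R] fgroups shift_closed[OF R])
  have c: "?M \<in> carrier (RB R ((L \<boxtimes> K) \<times>\<times> (L \<boxtimes> (P \<boxtimes> Q))))"
    using g assms(6) by (simp add: RB_op_closed[OF R])
  \<comment> \<open>Normalizing puts \<open>\<phi>\<close> before \<open>a\<close> on one side and
    after it on the other; this exchange brings both to the same order of factors.\<close>
  have 3: "RBX R (K \<times>\<times> (P \<boxtimes> Q)) ((L \<times>\<times> G) \<times>\<times> ((P \<times>\<times> G) \<times>\<times> (Q \<times>\<times> G))) \<phi>
      (RBX R (L \<times>\<times> G) ((P \<times>\<times> G) \<times>\<times> (Q \<times>\<times> G)) a x) =
    RBT R ((K \<times>\<times> (P \<boxtimes> Q)) \<times>\<times> ((L \<times>\<times> G) \<times>\<times> ((P \<times>\<times> G) \<times>\<times> (Q \<times>\<times> G))))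
      ((L \<times>\<times> G) \<times>\<times> ((K \<times>\<times> (P \<boxtimes> Q)) \<times>\<times> ((P \<times>\<times> G) \<times>\<times> (Q \<times>\<times> G))))
      (lcomm_rel (L \<times>\<times> G) (K \<times>\<times> (P \<boxtimes> Q)) ((P \<times>\<times> G) \<times>\<times> (Q \<times>\<times> G)))
      (RBX R (L \<times>\<times> G) ((K \<times>\<times> (P \<boxtimes> Q)) \<times>\<times> ((P \<times>\<times> G) \<times>\<times> (Q \<times>\<times> G))) a
        (RBX R (K \<times>\<times> (P \<boxtimes> Q)) ((P \<times>\<times> G) \<times>\<times> (Q \<times>\<times> G)) \<phi> x))"
    if "x \<in> carrier (RB R ((P \<times>\<times> G) \<times>\<times> (Q \<times>\<times> G)))" for x
    by (rule RBX_lcomm[OF R]) (use assms that in \<open>simp_all add: fgroups\<close>)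
  have A: "RB_comp R (L \<boxtimes> (P \<boxtimes> Q)) ((L \<boxtimes> P) \<boxtimes> Q) (G \<times>\<times> G) ?A ?mn \<in> carrier (RB R ((L \<boxtimes> (P \<boxtimes> Q)) \<times>\<times> (G \<times>\<times> G)))"
    by (rule RB_comp_closed[OF R]) (use assms mn in \<open>simp_all add: fgroups assoc_closed[OF R]\<close>)
  have A': "RB_comp R (L \<boxtimes> (P \<boxtimes> Q)) ((L \<boxtimes> P) \<boxtimes> Q) (G \<times>\<times> G) ?A ?mn =
    RBT R ((L \<boxtimes> (P \<boxtimes> Q)) \<times>\<times> (G \<times>\<times> G)) (((L \<boxtimes> P) \<boxtimes> Q) \<times>\<times> (G \<times>\<times> G))
      (prel (hom_rel ((L \<boxtimes> P) \<boxtimes> Q) assoc_fwd) (gid (G \<times>\<times> G))) ?mn"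
    unfolding assoc_mor_def by (rule RB_comp_hom[OF R _ _ _ assoc_hom(1)]) (use f mn in \<open>simp_all add: fgroups\<close>)
  have "RB_comp R (L \<boxtimes> K) ((L \<boxtimes> P) \<boxtimes> Q) (G \<times>\<times> G)
      (RB_comp R (L \<boxtimes> K) (L \<boxtimes> (P \<boxtimes> Q)) ((L \<boxtimes> P) \<boxtimes> Q) ?M ?A) ?mn =
    RB_comp R (L \<boxtimes> K) (L \<boxtimes> (P \<boxtimes> Q)) (G \<times>\<times> G) ?M
      (RB_comp R (L \<boxtimes> (P \<boxtimes> Q)) ((L \<boxtimes> P) \<boxtimes> Q) (G \<times>\<times> G) ?A ?mn)"
    by (rule RB_comp_assoc[OF R]) (use assms c mn in \<open>simp_all add: fgroups assoc_closed[OF R]\<close>)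
  also have "\<dots> = la R G L K a (RB_comp R K (P \<boxtimes> Q) (G \<times>\<times> G) \<phi> (pq R G P Q m n))"
    unfolding RB_comp_RBT_left[OF R f(7) fgroup_box[OF f(1,6)] fgroup_prod[OF f(5,5)] g assms(6) A]
    unfolding A'
    using assms g mn
    apply (simp add: pq_def shift_eq[OF R] la_def RB_comp_eq[OF R] rel_norm[OF R] RBX_assoc[OF R]
      lsurj_assoc_hom grel_hom_rels assoc_hom 3)
    apply (rule RBT_cong, auto simp: rel_defs assoc_fwd_def box_left_rel_def)
    done
  finally show ?thesis
    by (simp add: mor_times_id(1)[OF f(1,2,6) assms(6)])
qed

lemma comp_ract:
  assumes "fgroup L" "fgroup K" "fgroup P" "fgroup Q" "fgroup G" "\<phi> \<in> carrier (RB R (K \<times>\<times> (P \<boxtimes> Q)))"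
    "a \<in> carrier (RB R (L \<times>\<times> G))" "m \<in> carrier (RB R (P \<times>\<times> G))" "n \<in> carrier (RB R (Q \<times>\<times> G))"
  shows "RB_comp R (K \<boxtimes> L) (P \<boxtimes> (Q \<boxtimes> L)) (G \<times>\<times> G)
      (RB_comp R (K \<boxtimes> L) ((P \<boxtimes> Q) \<boxtimes> L) (P \<boxtimes> (Q \<boxtimes> L))
        (mor_times R (P \<boxtimes> Q) K L L \<phi> (RB_id R L)) (assoc_inv_mor R P Q L))
      (pq R G P (Q \<boxtimes> L) m (gmult (RB_shift R G) Q L n a)) =
    ra R G K L (RB_comp R K (P \<boxtimes> Q) (G \<times>\<times> G) \<phi> (pq R G P Q m n)) a"
proof -
  let ?A = "assoc_inv_mor R P Q L" and ?mn = "pq R G P (Q \<boxtimes> L) m (gmult (RB_shift R G) Q L n a)"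
  let ?M = "RBT R ((K \<boxtimes> L) \<times>\<times> ((P \<boxtimes> Q) \<boxtimes> L)) (K \<times>\<times> (P \<boxtimes> Q)) (box_right_rel L K (P \<boxtimes> Q)) \<phi>"
  note f = assms(1-5) fgroup_box[OF assms(3,4)] fgroup_box[OF assms(2,1)] fgroup_box[OF assms(4,1)]
  note g = grel_box(2)[OF f(1,2,6)]
  have mn: "?mn \<in> carrier (RB R ((P \<boxtimes> (Q \<boxtimes> L)) \<times>\<times> (G \<times>\<times> G)))"
    using assms by (simp add: pq_closed[OF R] fgroups shift_closed[OF R])
  have c: "?M \<in> carrier (RB R ((K \<boxtimes> L) \<times>\<times> ((P \<boxtimes> Q) \<boxtimes> L)))"
    using g assms(6) by (simp add: RB_op_closed[OF R])
  have A: "RB_comp R ((P \<boxtimes> Q) \<boxtimes> L) (P \<boxtimes> (Q \<boxtimes> L)) (G \<times>\<times> G) ?A ?mn \<in> carrier (RB R (((P \<boxtimes> Q) \<boxtimes> L) \<times>\<times> (G \<times>\<times> G)))"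
    by (rule RB_comp_closed[OF R]) (use assms mn in \<open>simp_all add: fgroups assoc_closed[OF R]\<close>)
  have A': "RB_comp R ((P \<boxtimes> Q) \<boxtimes> L) (P \<boxtimes> (Q \<boxtimes> L)) (G \<times>\<times> G) ?A ?mn =
    RBT R (((P \<boxtimes> Q) \<boxtimes> L) \<times>\<times> (G \<times>\<times> G)) ((P \<boxtimes> (Q \<boxtimes> L)) \<times>\<times> (G \<times>\<times> G))
      (prel (hom_rel (P \<boxtimes> (Q \<boxtimes> L)) assoc_bwd) (gid (G \<times>\<times> G))) ?mn"
    unfolding assoc_inv_mor_def by (rule RB_comp_hom[OF R _ _ _ assoc_hom(2)]) (use f mn in \<open>simp_all add: fgroups\<close>)
  have "RB_comp R (K \<boxtimes> L) (P \<boxtimes> (Q \<boxtimes> L)) (G \<times>\<times> G)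
      (RB_comp R (K \<boxtimes> L) ((P \<boxtimes> Q) \<boxtimes> L) (P \<boxtimes> (Q \<boxtimes> L)) ?M ?A) ?mn =
    RB_comp R (K \<boxtimes> L) ((P \<boxtimes> Q) \<boxtimes> L) (G \<times>\<times> G) ?M
      (RB_comp R ((P \<boxtimes> Q) \<boxtimes> L) (P \<boxtimes> (Q \<boxtimes> L)) (G \<times>\<times> G) ?A ?mn)"
    by (rule RB_comp_assoc[OF R]) (use assms c mn in \<open>simp_all add: fgroups assoc_closed[OF R]\<close>)
  also have "\<dots> = ra R G K L (RB_comp R K (P \<boxtimes> Q) (G \<times>\<times> G) \<phi> (pq R G P Q m n)) a"
    unfolding RB_comp_RBT_left[OF R f(7) fgroup_box[OF f(6,1)] fgroup_prod[OF f(5,5)] g assms(6) A]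
    unfolding A'
    using assms g mn
    apply (simp add: pq_def shift_eq[OF R] ra_def RB_comp_eq[OF R] rel_norm[OF R] RBX_assoc[OF R]
      lsurj_assoc_hom grel_hom_rels assoc_hom)
    apply (rule RBT_cong, auto simp: rel_defs assoc_bwd_def box_right_rel_def)
    done
  finally show ?thesis
    by (simp add: mor_times_id(2)[OF f(1,2,6) assms(6)])
qed

lemma Tr_diag_la:
  assumes "fgroup L" "fgroup K" "fgroup G" "a \<in> carrier (RB R (L \<times>\<times> G))" "w \<in> carrier (RB R (K \<times>\<times> (G \<times>\<times> G)))"
  shows "Tr R (L \<boxtimes> K) G (G \<times>\<times> G) (diag_rel G) (la R G L K a w) =
      gmult (RB_shift R G) L K a (Tr R K G (G \<times>\<times> G) (diag_rel G) w)"
    and "Tr R (K \<boxtimes> L) G (G \<times>\<times> G) (diag_rel G) (ra R G K L w a) =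
      gmult (RB_shift R G) K L (Tr R K G (G \<times>\<times> G) (diag_rel G) w) a"
  using assms by (simp add: Tr_def la_def ra_def rb[OF R]; intro RBT_cong; auto simp: rel_defs)+

lemma la_linear:
  assumes "fgroup L" "fgroup K" "fgroup G" "a \<in> carrier (RB R (L \<times>\<times> G))"
  shows "linear_map R (RB R (K \<times>\<times> (G \<times>\<times> G))) (RB R ((L \<boxtimes> K) \<times>\<times> (G \<times>\<times> G))) (\<lambda>w. la R G L K a w)"
    and "linear_map R (RB R (K \<times>\<times> (G \<times>\<times> G))) (RB R ((K \<boxtimes> L) \<times>\<times> (G \<times>\<times> G))) (\<lambda>w. ra R G K L w a)"
  unfolding la_def ra_def
  by (intro R RBX_linear_left[OF R] RBX_linear_right[OF R] RBT_linear[OF R] linear_map_id grel_pq fgroup_prod assms)+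

lemma dot_linear:
  assumes "fgroup K" "fgroup G" "y \<in> carrier (RB R G)"
  shows "linear_map R (RB R (K \<times>\<times> G)) (RB R (K \<times>\<times> (G \<times>\<times> G))) (\<lambda>m. dot R K G m y)"
  unfolding dot_def
  by (intro R RBX_linear_left[OF R] RBT_linear[OF R] linear_map_id grel_ind fgroup_prod assms)

lemma dot_comp:
  assumes "fgroup K" "fgroup H" "fgroup G" "y \<in> carrier (RB R G)"
    "\<alpha> \<in> carrier (RB R (K \<times>\<times> H))" "m \<in> carrier (RB R (H \<times>\<times> G))"
  shows "dot R K G (RB_comp R K H G \<alpha> m) y = RB_comp R K H (G \<times>\<times> G) \<alpha> (dot R H G m y)"
proof -
  have x: "RBX R (H \<times>\<times> G) G m y \<in> carrier (RB R ((H \<times>\<times> G) \<times>\<times> G))" using assms by (simp add: RB_op_closed[OF R] fgroups)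
  show ?thesis
    unfolding dot_def RB_comp_RBT_right[OF R assms(1,2) fgroup_prod[OF assms(3,3)] grel_ind[OF assms(2,3)] assms(5) x]
    using assms by (simp add: rb[OF R]) (rule RBT_cong, auto simp: rel_defs)
qed

text \<open>The projection formula: the action of \<open>a\<close> through one factor of
  \<open>G \<times> G\<close> becomes multiplication by \<open>a\<close> on the diagonal, so it
  commutes with induction from there. As \<open>ind_rel\<close> is an induction, fullness is
  supplied by hand; on the right, \<open>a\<close> and \<open>y\<close> also have to be
  exchanged.\<close>

lemma dot_la:
  assumes "fgroup L" "fgroup K" "fgroup G" "y \<in> carrier (RB R G)"
    "a \<in> carrier (RB R (L \<times>\<times> G))" "m \<in> carrier (RB R (K \<times>\<times> G))"
  shows "dot R (L \<boxtimes> K) G (gmult (RB_shift R G) L K a m) y = la R G L K a (dot R K G m y)"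
    and "dot R (K \<boxtimes> L) G (gmult (RB_shift R G) K L m a) y = ra R G K L (dot R K G m y) a"
proof -
  have o: "\<one>\<^bsub>L\<^esub> \<in> carrier L" using fgroupD(1)[OF assms(1)] by (simp add: group.is_monoid monoid.one_closed)
  have full: "gfull ((L \<times>\<times> G) \<times>\<times> (K \<times>\<times> (G \<times>\<times> G))) (lact_rel L K G) (prel (gid (L \<times>\<times> G)) (ind_rel K G))"
    unfolding gid_def
    by (rule gfull_prel_Id_left[OF grel_pq(2) grel_ind]) (use assms o in \<open>auto simp: lact_rel_def fgroups\<close>)
  have full': "gfull ((K \<times>\<times> (G \<times>\<times> G)) \<times>\<times> (L \<times>\<times> G)) (ract_rel K L G) (prel (ind_rel K G) (gid (L \<times>\<times> G)))"
    unfolding gid_def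
    by (rule gfull_prel_Id_right[OF grel_pq(3) grel_ind]) (use assms o in \<open>auto simp: ract_rel_def fgroups\<close>)
  have x: "RBX R (K \<times>\<times> G) G m y \<in> carrier (RB R ((K \<times>\<times> G) \<times>\<times> G))" using assms by (simp add: RB_op_closed[OF R] fgroups)
  have 1: "la R G L K a (dot R K G m y) = RBT R ((L \<boxtimes> K) \<times>\<times> (G \<times>\<times> G)) ((L \<times>\<times> G) \<times>\<times> ((K \<times>\<times> G) \<times>\<times> G))
      (rcomp ((L \<times>\<times> G) \<times>\<times> (K \<times>\<times> (G \<times>\<times> G))) (lact_rel L K G) (prel (gid (L \<times>\<times> G)) (ind_rel K G)))
      (RBX R (L \<times>\<times> G) ((K \<times>\<times> G) \<times>\<times> G) a (RBX R (K \<times>\<times> G) G m y))"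
    using assms x by (simp add: la_def dot_def RBX_RBT_right[OF R] RBT_RBT_full[OF R _ _ _ full] RB_op_closed[OF R] grels fgroups)
  show "dot R (L \<boxtimes> K) G (gmult (RB_shift R G) L K a m) y = la R G L K a (dot R K G m y)"
    unfolding 1 using assms by (simp add: dot_def rb[OF R]) (rule RBT_cong, auto simp: rel_defs)
  have 2: "ra R G K L (dot R K G m y) a = RBT R ((K \<boxtimes> L) \<times>\<times> (G \<times>\<times> G)) (((K \<times>\<times> G) \<times>\<times> G) \<times>\<times> (L \<times>\<times> G))
      (rcomp ((K \<times>\<times> (G \<times>\<times> G)) \<times>\<times> (L \<times>\<times> G)) (ract_rel K L G) (prel (ind_rel K G) (gid (L \<times>\<times> G))))
      (RBX R ((K \<times>\<times> G) \<times>\<times> G) (L \<times>\<times> G) (RBX R (K \<times>\<times> G) G m y) a)"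
    using assms x by (simp add: ra_def dot_def RBX_RBT_left[OF R] RBT_RBT_full[OF R _ _ _ full'] RB_op_closed[OF R] grels fgroups)
  have 3: "RBX R G (L \<times>\<times> G) y a =
    RBT R (G \<times>\<times> (L \<times>\<times> G)) ((L \<times>\<times> G) \<times>\<times> G) (swap_rel (L \<times>\<times> G) G) (RBX R (L \<times>\<times> G) G a y)"
    by (rule RBX_swap[OF R]) (use assms in \<open>simp_all add: fgroups\<close>)
  show "dot R (K \<boxtimes> L) G (gmult (RB_shift R G) K L m a) y = ra R G K L (dot R K G m y) a"
    unfolding 2 using assms by (simp add: dot_def rb[OF R] 3) (rule RBT_cong, auto simp: rel_defs)
qed

subsection \<open>Transport along an isomorphism of groups\<close>

text \<open>Since \<open>f\<close> is bijective, transporting the parameter along \<open>f\<close>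
  and composing with its biset cancel. This writes any \<open>m\<close> in
  \<open>RB(P \<times> G)\<close> as \<open>\<alpha> u\<close> with \<open>\<alpha>\<close> a
  morphism from \<open>\<Gamma>\<close> to \<open>P\<close> and \<open>u\<close> the class of the
  isomorphism.\<close>

lemma comp_Tr_hom:
  assumes "fgroup K" "fgroup H" "fgroup G" "f \<in> hom G H" "bij_betw f (carrier G) (carrier H)"
    "w \<in> carrier (RB R (K \<times>\<times> G))"
  shows "RB_comp R K H G (Tr R K H G (hom_rel G f) w) (RB_hom R G H f) = w"
proof -
  note surj = lsurj_hom[OF assms(5)]
  have inj: "f g = f g' \<longleftrightarrow> g = g'" if "g \<in> carrier G" "g' \<in> carrier G" for g g'
    using assms(5) that by (auto simp: bij_betw_def inj_on_eq_iff)
  note g = grel_hom_rels[OF assms(3,2,4)]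
  show ?thesis
    unfolding RB_comp_hom_right[OF R assms(3,2,1,4) Tr_closed[OF R assms(1) g(1) assms(6)]]
    using assms(1-3,6) g surj
    by (simp add: Tr_def rel_norm[OF R])
       (rule trans[OF RBT_cong RBT_gid[OF R]], auto simp: rel_defs fgroups inj)
qed

context
  fixes G :: "'g monoid" and \<Gamma> :: obj and \<iota>
  assumes G: "fgroup G" and \<Gamma>: "fgroup \<Gamma>" and \<iota>: "\<iota> \<in> hom G \<Gamma>" "bij_betw \<iota> (carrier G) (carrier \<Gamma>)"
begin

definition \<iota>2 :: "'g \<times> 'g \<Rightarrow> nat" where
  "\<iota>2 = (\<lambda>(g, g'). prod_encode (\<iota> g, \<iota> g'))"

lemma \<iota>2: "\<iota>2 \<in> hom (G \<times>\<times> G) (\<Gamma> \<boxtimes> \<Gamma>)" "bij_betw \<iota>2 (carrier (G \<times>\<times> G)) (carrier (\<Gamma> \<boxtimes> \<Gamma>))"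
proof -
  show "\<iota>2 \<in> hom (G \<times>\<times> G) (\<Gamma> \<boxtimes> \<Gamma>)"
    using \<iota>(1) by (auto simp: hom_def \<iota>2_def obj_times_simps)
  have "bij_betw (prod_encode \<circ> map_prod \<iota> \<iota>) (carrier G \<times> carrier G) (prod_encode ` (carrier \<Gamma> \<times> carrier \<Gamma>))"
    by (rule bij_betw_trans[OF bij_betw_map_prod[OF \<iota>(2,2)]]) (simp add: bij_betw_def inj_prod_encode)
  moreover have "prod_encode \<circ> map_prod \<iota> \<iota> = \<iota>2" by (auto simp: \<iota>2_def)
  ultimately show "bij_betw \<iota>2 (carrier (G \<times>\<times> G)) (carrier (\<Gamma> \<boxtimes> \<Gamma>))"
    by (simp add: obj_times_simps)
qed

text \<open>The pairing of the class of \<open>\<iota>\<close> with itself is the corresponding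
  class for \<open>G \<times> G\<close> and its copy \<open>\<Gamma> \<boxtimes> \<Gamma>\<close>;
  this is why a single pair of elements generates the whole tensor square.\<close>

lemma pq_hom:
  "pq R G \<Gamma> \<Gamma> (RB_hom R G \<Gamma> \<iota>) (RB_hom R G \<Gamma> \<iota>) = RB_hom R (G \<times>\<times> G) (\<Gamma> \<boxtimes> \<Gamma>) \<iota>2"
proof -
  note g = grel_hom_rels(2)[OF G \<Gamma> \<iota>(1)]
  have surj: "carrier ((\<Gamma> \<times>\<times> G) \<times>\<times> (\<Gamma> \<times>\<times> G)) \<subseteq> Range (pq_rel \<Gamma> \<Gamma> G)"
    by (auto simp: pq_rel_def Range_iff)
  note RBT_pq = RBT_RBT_right[OF R _ _ _ surj]
  have h: "\<iota> g \<in> carrier \<Gamma>" if "g \<in> carrier G" for g using \<iota>(1) that by (auto simp: hom_def)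
  show ?thesis
    unfolding RB_hom_eq[OF R fgroup_prod[OF G G] fgroup_box[OF \<Gamma> \<Gamma>] \<iota>2(1)]
    using g G \<Gamma>
    by (simp add: pq_def RB_hom_eq[OF R G \<Gamma> \<iota>(1)] RBX_RBT[OF R] RB_op_closed[OF R] grels fgroups RBT_pq RBX_pt[OF R])
       (simp add: rel_norm[OF R], rule RBT_cong, auto simp: rel_defs \<iota>2_def h)
qed

text \<open>Matches the product of the morphisms built from \<open>m\<close> and \<open>n\<close>
  with the transport of their pairing; with it the coend relation rewrites any generator over
  \<open>(\<Gamma>, \<Gamma>)\<close>.\<close>

lemma mor_times_hom:
  assumes "fgroup P" "fgroup Q" "m \<in> carrier (RB R (P \<times>\<times> G))" "n \<in> carrier (RB R (Q \<times>\<times> G))"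
  shows "mor_times R \<Gamma> P \<Gamma> Q (Tr R P \<Gamma> G (hom_rel G \<iota>) m) (Tr R Q \<Gamma> G (hom_rel G \<iota>) n) =
    Tr R (P \<boxtimes> Q) (\<Gamma> \<boxtimes> \<Gamma>) (G \<times>\<times> G) (hom_rel (G \<times>\<times> G) \<iota>2) (pq R G P Q m n)"
proof -
  note surj = lsurj_hom[OF \<iota>(2)] lsurj_hom[OF \<iota>2(2)]
  note g = grel_hom_rels(1)[OF G \<Gamma> \<iota>(1)] grel_hom_rels(1)[OF fgroup_prod[OF G G] fgroup_box[OF \<Gamma> \<Gamma>] \<iota>2(1)]
  have h: "\<iota> g \<in> carrier \<Gamma>" if "g \<in> carrier G" for g using \<iota>(1) that by (auto simp: hom_def)
  show ?thesis
    using assms surj g G \<Gamma>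
    by (simp add: Tr_def pq_def rel_norm[OF R] mor_times_eq[OF R])
       (rule RBT_cong, auto simp: rel_defs \<iota>2_def h)
qed

end

end

section \<open>Inverting the conjugation action\<close>

definition conj_gset :: "'g monoid \<Rightarrow> ('g, 'g) gset" where
  "conj_gset G = (carrier G, \<lambda>g. \<lambda>a\<in>carrier G. g \<otimes>\<^bsub>G\<^esub> a \<otimes>\<^bsub>G\<^esub> inv\<^bsub>G\<^esub> g)"

lemma fin_gset_conj:
  assumes "fgroup G"
  shows "fin_gset G (conj_gset G)"
proof -
  interpret group G using fgroupD(1)[OF assms] .
  show ?thesis
    by (rule fin_gsetI) (auto simp: conj_gset_def fgroupD(2)[OF assms] m_assoc inv_mult_group)
qed

definition res_gset :: "'k monoid \<Rightarrow> ('k \<Rightarrow> 'h) \<Rightarrow> ('h, 'x) gset \<Rightarrow> ('k, 'x) gset" where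
  "res_gset K p X = (fst X, \<lambda>k. if k \<in> carrier K then snd X (p k) else undefined)"

lemma fin_gset_res:
  assumes "group K" "p \<in> hom K H" "fin_gset H X"
  shows "fin_gset K (res_gset K p X)"
proof -
  interpret K: group K by fact
  interpret H: group H using fin_gset_group[OF assms(3)] .
  interpret group_hom K H p using assms(2) by unfold_locales
  have "snd X h \<in> extensional (fst X)" if "h \<in> carrier H" for h
    using assms(3) group_action.bij_prop0[of H "fst X" "snd X" h] that by (auto simp: fin_gset_def Bij_def)
  thus ?thesis
    by (intro fin_gsetI) (use assms(3) in \<open>auto simp: res_gset_def fin_gset_finite act_closed act_one act_mult\<close>)
qed

text \<open>Restriction to the common diagonal of three copies of \<open>G\<close>: it multiplies an
  element of \<open>RB(K \<times> G)\<close> by two elements of \<open>RB(G)\<close> in succession,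
  and \<open>act1_rel\<close> by one.\<close>

definition act2_rel :: "'k monoid \<Rightarrow> 'g monoid \<Rightarrow> (('k \<times> 'g) \<times> ((('k \<times> 'g) \<times> 'g) \<times> 'g)) set" where
  "act2_rel K G = {((k, g), (((k, g), g), g)) | k g. k \<in> carrier K \<and> g \<in> carrier G}"

definition act1_rel :: "'k monoid \<Rightarrow> 'g monoid \<Rightarrow> (('k \<times> 'g) \<times> (('k \<times> 'g) \<times> 'g)) set" where
  "act1_rel K G = {((k, g), ((k, g), g)) | k g. k \<in> carrier K \<and> g \<in> carrier G}"

lemma grel_act:
  assumes "fgroup K" "fgroup G"
  shows "grel (K \<times>\<times> G) (((K \<times>\<times> G) \<times>\<times> G) \<times>\<times> G) (act2_rel K G)"
    and "grel (K \<times>\<times> G) ((K \<times>\<times> G) \<times>\<times> G) (act1_rel K G)"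
proof -
  interpret K: group K using fgroupD[OF assms(1)] by simp
  interpret G: group G using fgroupD[OF assms(2)] by simp
  show "grel (K \<times>\<times> G) (((K \<times>\<times> G) \<times>\<times> G) \<times>\<times> G) (act2_rel K G)"
    by (rule grel_finiteI) (auto simp: act2_rel_def intro!: fgroup_prod assms)
  show "grel (K \<times>\<times> G) ((K \<times>\<times> G) \<times>\<times> G) (act1_rel K G)"
    by (rule grel_finiteI) (auto simp: act1_rel_def intro!: fgroup_prod assms)
qed

text \<open>If \<open>Y\<close> is induced from \<open>Z\<close> along the diagonal of \<open>G \<times> G\<close>, then its restriction to the
  diagonal is \<open>Z \<times> G\<close> with \<open>G\<close> acting on itself by conjugation: the point \<open>(z, a)\<close> corresponds to
  \<open>(a, 1) z\<close>.\<close>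

lemma res_ind_corr:
  assumes K: "fgroup K" and G: "fgroup G" and Z: "fin_gset ((K \<times>\<times> G) \<times>\<times> G) Z"
    and Y: "fin_gset (K \<times>\<times> (G \<times>\<times> G)) Y" and j: "corr (K \<times>\<times> (G \<times>\<times> G)) (ind_rel K G) Z Y j"
  shows "corr (K \<times>\<times> G) (act2_rel K G) (gprod Z (conj_gset G)) (res_gset (K \<times>\<times> G) (\<lambda>(k, g). (k, (g, g))) Y)
    (\<lambda>(z, a). snd Y (\<one>\<^bsub>K\<^esub>, (a, \<one>\<^bsub>G\<^esub>)) (j z))"
proof -
  interpret K: group K using fgroupD(1)[OF K] .
  interpret G: group G using fgroupD(1)[OF G] .
  note D = corrD[OF j] and am = act_mult[OF Y]
  let ?p = "\<lambda>(k, g). (k, (g, g))" and ?J = "\<lambda>(z, a). snd Y (\<one>\<^bsub>K\<^esub>, (a, \<one>\<^bsub>G\<^esub>)) (j z)"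
  have ph: "?p \<in> hom (K \<times>\<times> G) (K \<times>\<times> (G \<times>\<times> G))" by (auto simp: hom_def)
  have Yc: "snd Y (k, (g, g')) y \<in> fst Y" if "k \<in> carrier K" "g \<in> carrier G" "g' \<in> carrier G" "y \<in> fst Y" for k g g' y
    using act_closed[OF Y] that by simp
  have Zc: "snd Z ((k, g), g') z \<in> fst Z" if "k \<in> carrier K" "g \<in> carrier G" "g' \<in> carrier G" "z \<in> fst Z" for k g g' z
    using act_closed[OF Z] that by simp
  have Ym: "snd Y (k, (g, g')) (snd Y (l, (h, h')) y) = snd Y (k \<otimes>\<^bsub>K\<^esub> l, (g \<otimes>\<^bsub>G\<^esub> h, g' \<otimes>\<^bsub>G\<^esub> h')) y"
    if "k \<in> carrier K" "g \<in> carrier G" "g' \<in> carrier G" "l \<in> carrier K" "h \<in> carrier G" "h' \<in> carrier G" "y \<in> fst Y"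
    for k g g' l h h' y
    using am[of "(k, (g, g'))" "(l, (h, h'))" y] that by simp
  have jd: "snd Y (k, (g, g)) (j z) = j (snd Z ((k, g), g) z)" if "k \<in> carrier K" "g \<in> carrier G" "z \<in> fst Z" for k g z
    using D(3)[OF that(3) Zc[OF that(1,2,2,3)], of "(k, (g, g))"] that by (auto simp: ind_rel_def)
  \<comment> \<open>Only elements occurring in \<open>ind_rel\<close> carry the image of
    \<open>j\<close> into itself, and these are diagonal; \<open>(a, 1)\<close> is diagonal only for
    \<open>a = 1\<close>.\<close>
  have j1: "snd Y (\<one>\<^bsub>K\<^esub>, (a, \<one>\<^bsub>G\<^esub>)) (j z) = j z' \<Longrightarrow> a = \<one>\<^bsub>G\<^esub> \<and> z = z'"
    if "a \<in> carrier G" "z \<in> fst Z" "z' \<in> fst Z" for a z z'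
    using D(3)[OF that(2,3), of "(\<one>\<^bsub>K\<^esub>, (a, \<one>\<^bsub>G\<^esub>))"] that act_one[OF Z that(2)] by (auto simp: ind_rel_def)
  have G2: "fst (gprod Z (conj_gset G)) = fst Z \<times> carrier G" by (simp add: gprod_simps conj_gset_def)
  have pair: "snd (gprod Z (conj_gset G)) (((k, g), g), g) (z, a) =
      (snd Z ((k, g), g) z, g \<otimes>\<^bsub>G\<^esub> a \<otimes>\<^bsub>G\<^esub> inv\<^bsub>G\<^esub> g)" if "z \<in> fst Z" "a \<in> carrier G" for k g z a
    using that by (simp add: gprod_def conj_gset_def)
  have inj: "inj_on ?J (fst Z \<times> carrier G)"
  proof (rule inj_onI, clarsimp)
    fix z a z' a' assume c: "z \<in> fst Z" "a \<in> carrier G" "z' \<in> fst Z" "a' \<in> carrier G"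
      and eq: "snd Y (\<one>\<^bsub>K\<^esub>, (a, \<one>\<^bsub>G\<^esub>)) (j z) = snd Y (\<one>\<^bsub>K\<^esub>, (a', \<one>\<^bsub>G\<^esub>)) (j z')"
    have "snd Y (\<one>\<^bsub>K\<^esub>, (inv\<^bsub>G\<^esub> a', \<one>\<^bsub>G\<^esub>)) (snd Y (\<one>\<^bsub>K\<^esub>, (a, \<one>\<^bsub>G\<^esub>)) (j z)) = snd Y (\<one>\<^bsub>K\<^esub>, (\<one>\<^bsub>G\<^esub>, \<one>\<^bsub>G\<^esub>)) (j z')"
      unfolding eq using c D(1) by (subst Ym) auto
    hence "snd Y (\<one>\<^bsub>K\<^esub>, (inv\<^bsub>G\<^esub> a' \<otimes>\<^bsub>G\<^esub> a, \<one>\<^bsub>G\<^esub>)) (j z) = j z'"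
      using c D(1) act_one[OF Y D(1)[OF c(3)]] by (subst (asm) Ym) auto
    from j1[OF _ c(1,3) this] c have "inv\<^bsub>G\<^esub> a' \<otimes>\<^bsub>G\<^esub> a = \<one>\<^bsub>G\<^esub>" "z = z'" by auto
    thus "z = z' \<and> a = a'" using c G.inv_solve_left'[of "\<one>\<^bsub>G\<^esub>" a' a] by auto
  qed
  have "?J ` (fst Z \<times> carrier G) = fst Y"
  proof
    show "?J ` (fst Z \<times> carrier G) \<subseteq> fst Y" using Yc D(1) by auto
    show "fst Y \<subseteq> ?J ` (fst Z \<times> carrier G)"
    proof
      fix y assume "y \<in> fst Y"
      from D(2)[OF this] obtain q z where q: "q \<in> carrier (K \<times>\<times> (G \<times>\<times> G))" "z \<in> fst Z" "y = snd Y q (j z)" by blast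
      obtain k g g' where "q = (k, (g, g'))" by (metis surj_pair)
      with q have c: "k \<in> carrier K" "g \<in> carrier G" "g' \<in> carrier G" "z \<in> fst Z"
        "y = snd Y (k, (g, g')) (j z)" by auto
      \<comment> \<open>An arbitrary \<open>(k, (g, g'))\<close> is
        \<open>(1, (g inv g', 1))\<close> times the diagonal element \<open>(k, (g', g'))\<close>;
        the latter is absorbed into \<open>z\<close>, the former supplies the coordinate
        \<open>a\<close>.\<close>
      have "?J (snd Z ((k, g'), g') z, g \<otimes>\<^bsub>G\<^esub> inv\<^bsub>G\<^esub> g') = snd Y (\<one>\<^bsub>K\<^esub>, (g \<otimes>\<^bsub>G\<^esub> inv\<^bsub>G\<^esub> g', \<one>\<^bsub>G\<^esub>)) (snd Y (k, (g', g')) (j z))"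
        using jd c by simp
      also have "\<dots> = y" using c D(1) by (subst Ym) (auto simp: G.m_assoc)
      finally show "y \<in> ?J ` (fst Z \<times> carrier G)"
        by (rule image_eqI[OF sym]) (use c Zc in simp)
    qed
  qed
  hence bij: "bij_betw ?J (fst (gprod Z (conj_gset G))) (fst (res_gset (K \<times>\<times> G) ?p Y))"
    using inj by (simp add: bij_betw_def G2 res_gset_def)
  show ?thesis
  proof (rule corr_res[OF fin_gset_res[OF _ ph Y] bij, where p = "\<lambda>(k, g). (((k, g), g), g)"])
    fix kg za assume "kg \<in> carrier (K \<times>\<times> G)" "za \<in> fst (gprod Z (conj_gset G))"
    then obtain k g z a where c: "kg = (k, g)" "za = (z, a)" "k \<in> carrier K" "g \<in> carrier G" "z \<in> fst Z" "a \<in> carrier G"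
      using G2 by auto
    show "snd (gprod Z (conj_gset G)) (case kg of (k, g) \<Rightarrow> (((k, g), g), g)) za \<in> fst (gprod Z (conj_gset G))"
      using c Zc by (simp add: pair G2)
    have "?J (snd Z ((k, g), g) z, g \<otimes>\<^bsub>G\<^esub> a \<otimes>\<^bsub>G\<^esub> inv\<^bsub>G\<^esub> g) =
      snd Y (\<one>\<^bsub>K\<^esub>, (g \<otimes>\<^bsub>G\<^esub> a \<otimes>\<^bsub>G\<^esub> inv\<^bsub>G\<^esub> g, \<one>\<^bsub>G\<^esub>)) (snd Y (k, (g, g)) (j z))" using jd c by simp
    also have "\<dots> = snd Y (k, (g, g)) (snd Y (\<one>\<^bsub>K\<^esub>, (a, \<one>\<^bsub>G\<^esub>)) (j z))"
      using c D(1) by (simp add: Ym G.m_assoc)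
    finally show "?J (snd (gprod Z (conj_gset G)) (case kg of (k, g) \<Rightarrow> (((k, g), g), g)) za) =
      snd (res_gset (K \<times>\<times> G) ?p Y) kg (?J za)"
      using c by (simp add: pair res_gset_def)
  qed (auto simp: act2_rel_def intro!: DirProd_group K.is_group G.is_group)
qed

context
  fixes R :: "('r, 'q) ring_scheme"
  assumes R: "cring R"
begin

text \<open>The Mackey formula here has one double coset for each conjugacy class of
  \<open>G\<close>, so \<open>RBT_RBT\<close> does not apply in general; the composite is identified
  on sets instead.\<close>

lemma Tr_diag_ind:
  fixes K :: "'k monoid" and G :: "'g monoid"
  assumes K: "fgroup K" and G: "fgroup G" and z: "z \<in> carrier (RB R ((K \<times>\<times> G) \<times>\<times> G))"
  shows "Tr R K G (G \<times>\<times> G) (diag_rel G) (RBT R (K \<times>\<times> (G \<times>\<times> G)) ((K \<times>\<times> G) \<times>\<times> G) (ind_rel K G) z) =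
    RBT R (K \<times>\<times> G) (((K \<times>\<times> G) \<times>\<times> G) \<times>\<times> G) (act2_rel K G)
      (RBX R ((K \<times>\<times> G) \<times>\<times> G) G z (RB_class R G (conj_gset G)))"
proof (rule RB_ext_eq[OF R RB_module[OF R, of "K \<times>\<times> G"] _ _ _ z])
  note f = K G fgroup_prod[OF K G] fgroup_prod[OF fgroup_prod[OF K G] G] fgroup_prod[OF G G]
  note c = fin_gset_conj[OF G] RB_class_closed[OF R fin_gset_conj[OF G]]
  show "linear_map R (RB R ((K \<times>\<times> G) \<times>\<times> G)) (RB R (K \<times>\<times> G))
    (\<lambda>z. Tr R K G (G \<times>\<times> G) (diag_rel G) (RBT R (K \<times>\<times> (G \<times>\<times> G)) ((K \<times>\<times> G) \<times>\<times> G) (ind_rel K G) z))"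
    unfolding Tr_def by (intro R RBT_linear[OF R] linear_map_id grel_prel grel_gid grel_diag grel_ind K G)
  show "linear_map R (RB R ((K \<times>\<times> G) \<times>\<times> G)) (RB R (K \<times>\<times> G))
    (\<lambda>z. RBT R (K \<times>\<times> G) (((K \<times>\<times> G) \<times>\<times> G) \<times>\<times> G) (act2_rel K G)
      (RBX R ((K \<times>\<times> G) \<times>\<times> G) G z (RB_class R G (conj_gset G))))"
    by (intro R RBT_linear[OF R] RBX_linear_left[OF R] linear_map_id grel_act f c)
  fix Z assume "Z \<in> fin_gsets ((K \<times>\<times> G) \<times>\<times> G)"
  hence Z: "fin_gset ((K \<times>\<times> G) \<times>\<times> G) Z" by (simp add: fin_gsets_iff)
  define Y where "Y = gT (K \<times>\<times> (G \<times>\<times> G)) (ind_rel K G) Z"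
  note i = grel_ind[OF K G]
  have Y: "fin_gset (K \<times>\<times> (G \<times>\<times> G)) Y" unfolding Y_def by (rule fin_gset_gT[OF i Z])
  obtain j where j: "corr (K \<times>\<times> (G \<times>\<times> G)) (ind_rel K G) Z Y j" using corr_gT[OF i Z] by (auto simp: Y_def)
  let ?p = "\<lambda>(k, g). (k, (g, g))"
  let ?Y' = "res_gset (K \<times>\<times> G) ?p Y"
  have Y': "fin_gset (K \<times>\<times> G) ?Y'"
    by (rule fin_gset_res[OF fgroupD(1)[OF f(3)] _ Y]) (auto simp: hom_def)
  have "Tr R K G (G \<times>\<times> G) (diag_rel G) (RB_class R (K \<times>\<times> (G \<times>\<times> G)) Y) = RB_class R (K \<times>\<times> G) ?Y'"
    unfolding Tr_def
    by (rule RBT_res_class[OF R Y' Y grel_prel[OF grel_gid[OF K] grel_diag[OF G]], where f = "\<lambda>x. x" and p = ?p])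
       (auto simp: res_gset_def rel_defs bij_betw_def)
  moreover have "RBT R (K \<times>\<times> G) (((K \<times>\<times> G) \<times>\<times> G) \<times>\<times> G) (act2_rel K G)
      (RB_class R (((K \<times>\<times> G) \<times>\<times> G) \<times>\<times> G) (gprod Z (conj_gset G))) = RB_class R (K \<times>\<times> G) ?Y'"
    by (rule RBT_class[OF R res_ind_corr[OF K G Z Y j] grel_act(1)[OF K G] fin_gset_gprod[OF Z c(1)] Y'])
  ultimately show "Tr R K G (G \<times>\<times> G) (diag_rel G) (RBT R (K \<times>\<times> (G \<times>\<times> G)) ((K \<times>\<times> G) \<times>\<times> G) (ind_rel K G)
      (RB_class R ((K \<times>\<times> G) \<times>\<times> G) Z)) =
    RBT R (K \<times>\<times> G) (((K \<times>\<times> G) \<times>\<times> G) \<times>\<times> G) (act2_rel K G)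
      (RBX R ((K \<times>\<times> G) \<times>\<times> G) G (RB_class R ((K \<times>\<times> G) \<times>\<times> G) Z) (RB_class R G (conj_gset G)))"
    by (simp add: RBT_class[OF R j i Z Y] RBX_class[OF R f(4) G Z c(1)])
qed

lemma act1_pt:
  fixes K :: "'k monoid" and G :: "'g monoid"
  assumes K: "fgroup K" and G: "fgroup G" and m: "m \<in> carrier (RB R (K \<times>\<times> G))"
  shows "RBT R (K \<times>\<times> G) ((K \<times>\<times> G) \<times>\<times> G) (act1_rel K G) (RBX R (K \<times>\<times> G) G m (RB_class R G pt_gset)) = m"
proof (rule RB_ext_eq[OF R RB_module[OF R, of "K \<times>\<times> G"] _ linear_map_id _ m])
  note f = K G fgroup_prod[OF K G]
  have p: "fin_gset G pt_gset" by (rule fin_gset_pt[OF fgroupD(1)[OF G]])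
  show "linear_map R (RB R (K \<times>\<times> G)) (RB R (K \<times>\<times> G))
    (\<lambda>m. RBT R (K \<times>\<times> G) ((K \<times>\<times> G) \<times>\<times> G) (act1_rel K G) (RBX R (K \<times>\<times> G) G m (RB_class R G pt_gset)))"
    by (intro R RBT_linear[OF R] RBX_linear_left[OF R] linear_map_id grel_act f RB_class_closed[OF R p])
  fix X assume "X \<in> fin_gsets (K \<times>\<times> G)"
  hence X: "fin_gset (K \<times>\<times> G) X" by (simp add: fin_gsets_iff)
  have "RBT R (K \<times>\<times> G) ((K \<times>\<times> G) \<times>\<times> G) (act1_rel K G) (RB_class R ((K \<times>\<times> G) \<times>\<times> G) (gprod X pt_gset)) =
    RB_class R (K \<times>\<times> G) X"
  proof (rule RBT_res_class[OF R X fin_gset_gprod[OF X p] grel_act(2)[OF K G], where f = fst and p = "\<lambda>(k, g). ((k, g), g)"])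
    show "bij_betw fst (fst (gprod X pt_gset)) (fst X)"
      by (rule bij_betw_byWitness[where f' = "\<lambda>x. (x, ())"]) (auto simp: gprod_simps pt_gset_def)
  qed (auto simp: gprod_def pt_gset_def act1_rel_def)
  thus "RBT R (K \<times>\<times> G) ((K \<times>\<times> G) \<times>\<times> G) (act1_rel K G)
    (RBX R (K \<times>\<times> G) G (RB_class R (K \<times>\<times> G) X) (RB_class R G pt_gset)) = RB_class R (K \<times>\<times> G) X"
    by (simp add: RBX_class[OF R f(3) G X p])
qed

text \<open>The multiplication of the Burnside algebra \<open>RB(G)\<close>, induced by cartesian
  products of \<open>G\<close>-sets with the diagonal action.\<close>

definition mulG :: "'g monoid \<Rightarrow> ('r, 'g) rb_elt \<Rightarrow> ('r, 'g) rb_elt \<Rightarrow> ('r, 'g) rb_elt" where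
  "mulG G x y = RBT R G (G \<times>\<times> G) (diag_rel G) (RBX R G G x y)"

lemma Tr_diag_dot:
  assumes K: "fgroup K" and G: "fgroup G" and y: "y \<in> carrier (RB R G)"
    and inv: "mulG G y (RB_class R G (conj_gset G)) = RB_class R G pt_gset"
    and m: "m \<in> carrier (RB R (K \<times>\<times> G))"
  shows "Tr R K G (G \<times>\<times> G) (diag_rel G) (dot R K G m y) = m"
proof -
  let ?c = "RB_class R G (conj_gset G)"
  have c: "?c \<in> carrier (RB R G)" by (rule RB_class_closed[OF R fin_gset_conj[OF G]])
  have x: "RBX R (K \<times>\<times> G) G m y \<in> carrier (RB R ((K \<times>\<times> G) \<times>\<times> G))" using K G m y by (simp add: RB_op_closed[OF R] fgroups)
  have "Tr R K G (G \<times>\<times> G) (diag_rel G) (dot R K G m y) =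
    RBT R (K \<times>\<times> G) (((K \<times>\<times> G) \<times>\<times> G) \<times>\<times> G) (act2_rel K G) (RBX R ((K \<times>\<times> G) \<times>\<times> G) G (RBX R (K \<times>\<times> G) G m y) ?c)"
    unfolding dot_def by (rule Tr_diag_ind[OF K G x])
  also have "\<dots> = RBT R (K \<times>\<times> G) ((K \<times>\<times> G) \<times>\<times> G) (act1_rel K G)
      (RBX R (K \<times>\<times> G) G m (mulG G y ?c))"
    unfolding mulG_def using K G m y c
    by (simp add: rb[OF R] grel_act) (rule RBT_cong, auto simp: rel_defs act2_rel_def act1_rel_def)
  also have "\<dots> = m" unfolding inv by (rule act1_pt[OF K G m])
  finally show ?thesis .
qed

end

subsection \<open>Decomposition into orbits\<close>

definition gsub :: "('g, 'x) gset \<Rightarrow> 'x set \<Rightarrow> ('g, 'x) gset" where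
  "gsub X A = (A, \<lambda>g. restrict (snd X g) A)"

definition gstab :: "'g monoid \<Rightarrow> ('g, 'x) gset \<Rightarrow> 'x \<Rightarrow> 'g set" where
  "gstab G X x = {g \<in> carrier G. snd X g x = x}"

definition ginv :: "'g monoid \<Rightarrow> ('g, 'x) gset \<Rightarrow> 'x set \<Rightarrow> bool" where
  "ginv G X A \<longleftrightarrow> A \<subseteq> fst X \<and> (\<forall>g\<in>carrier G. \<forall>x\<in>A. snd X g x \<in> A)"

lemma gsub_simps: "fst (gsub X A) = A" "x \<in> A \<Longrightarrow> snd (gsub X A) g x = snd X g x"
  by (simp_all add: gsub_def)

lemma fin_gset_gsub:
  assumes "fin_gset G X" "ginv G X A"
  shows "fin_gset G (gsub X A)"
proof (rule fin_gsetI[OF fin_gset_group[OF assms(1)]])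
  have A: "A \<subseteq> fst X" using assms(2) by (simp add: ginv_def)
  show "finite (fst (gsub X A))" using finite_subset[OF A fin_gset_finite[OF assms(1)]] by (simp add: gsub_def)
qed (use assms in \<open>auto simp: gsub_def ginv_def act_one act_mult subset_iff\<close>)

lemma ginv_Diff:
  assumes "fin_gset G X" "ginv G X A"
  shows "ginv G X (fst X - A)"
proof -
  interpret group G using fin_gset_group[OF assms(1)] .
  have "snd X g x \<notin> A" if "g \<in> carrier G" "x \<in> fst X" "x \<notin> A" for g x
  proof
    assume "snd X g x \<in> A"
    hence "snd X (inv\<^bsub>G\<^esub> g) (snd X g x) \<in> A" using assms(2) that(1) by (simp add: ginv_def)
    thus False using act_inv_cancel(1)[OF assms(1) that(1,2)] that(3) by simp
  qed
  thus ?thesis using act_closed[OF assms(1)] by (auto simp: ginv_def)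
qed

lemma gset_iso_gsub_sum:
  assumes "ginv G X A"
  shows "gset_iso G (gset_sum (gsub X A) (gsub X (fst X - A))) X"
proof -
  have A: "A \<subseteq> fst X" using assms by (simp add: ginv_def)
  have "bij_betw (case_sum (\<lambda>x. x) (\<lambda>x. x)) (A <+> (fst X - A)) (fst X)"
    by (rule bij_betw_byWitness[where f' = "\<lambda>x. if x \<in> A then Inl x else Inr x"]) (use A in auto)
  thus ?thesis
    unfolding gset_iso_def
    by (intro exI[of _ "case_sum (\<lambda>x. x) (\<lambda>x. x)"]) (auto simp: gset_sum_def gsub_def)
qed

lemma ginv_orbit:
  assumes "fin_gset G X" "x \<in> fst X"
  shows "ginv G X {snd X g x | g. g \<in> carrier G}"
proof -
  interpret group G using fin_gset_group[OF assms(1)] .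
  show ?thesis
    using assms act_mult[OF assms(1), symmetric] by (fastforce simp: ginv_def act_closed)
qed

lemma gstab_iso:
  assumes "\<And>g x. g \<in> carrier G \<Longrightarrow> x \<in> fst X \<Longrightarrow> f (snd X g x) = snd Y g (f x)" "inj_on f (fst X)"
    "fin_gset G X" "x \<in> fst X"
  shows "gstab G Y (f x) = gstab G X x"
  using assms by (auto simp: gstab_def inj_on_eq_iff act_closed simp flip: assms(1))

lemma finite_gstab: "finite (carrier G) \<Longrightarrow> finite (gstab G X x)"
  by (simp add: gstab_def)

context
  fixes R :: "('r, 'q) ring_scheme"
  assumes R: "cring R"
begin

interpretation R: cring R by (rule R)

lemma RB_class_empty:
  assumes "group G" "fst X = {}" "fin_gset G X"
  shows "RB_class R G X = \<zero>\<^bsub>RB R G\<^esub>"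
proof -
  interpret M: module R "RB R G" by (rule RB_module[OF R])
  have iso: "gset_iso G (gset_sum X X) X"
    using assms(2) by (auto simp: gset_iso_def gset_sum_def bij_betw_def Plus_def)
  have "RB_class R G X \<oplus>\<^bsub>RB R G\<^esub> RB_class R G X = RB_class R G X"
    using RB_class_sum[OF R assms(3,3)] RB_class_iso[OF R fin_gset_sum[OF assms(3,3)] assms(3) iso] by simp
  thus ?thesis using RB_class_closed[OF R assms(3)] by simp
qed

lemma RB_class_gsub:
  assumes "fin_gset G X" "ginv G X A"
  shows "RB_class R G X = RB_class R G (gsub X A) \<oplus>\<^bsub>RB R G\<^esub> RB_class R G (gsub X (fst X - A))"
proof -
  note f = fin_gset_gsub[OF assms] fin_gset_gsub[OF assms(1) ginv_Diff[OF assms]]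
  show ?thesis
    using RB_class_sum[OF R f] RB_class_iso[OF R fin_gset_sum[OF f] assms(1) gset_iso_gsub_sum[OF assms(2)]] by simp
qed

text \<open>Membership in an additively closed \<open>I\<close> is reduced to transitive sets by
  splitting off one orbit at a time. Points keep their stabilizers in an invariant subset, so the
  bound \<open>n\<close> passes to both pieces.\<close>

lemma RB_class_orbits:
  fixes X :: "('g, nat) gset"
  assumes I: "\<zero>\<^bsub>RB R G\<^esub> \<in> I" "\<And>x y. x \<in> I \<Longrightarrow> y \<in> I \<Longrightarrow> x \<oplus>\<^bsub>RB R G\<^esub> y \<in> I"
    and orb: "\<And>Y :: ('g, nat) gset. fin_gset G Y \<Longrightarrow> (\<forall>y\<in>fst Y. card (gstab G Y y) \<le> n) \<Longrightarrow>
      (\<And>y y'. y \<in> fst Y \<Longrightarrow> y' \<in> fst Y \<Longrightarrow> \<exists>g\<in>carrier G. snd Y g y = y') \<Longrightarrow> fst Y \<noteq> {} \<Longrightarrow> RB_class R G Y \<in> I"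
    and X: "fin_gset G X" "\<forall>x\<in>fst X. card (gstab G X x) \<le> n"
  shows "RB_class R G X \<in> I"
  using X
proof (induction "card (fst X)" arbitrary: X rule: less_induct)
  case less
  note X = less.prems(1)
  interpret group G using fin_gset_group[OF X] .
  show ?case
  proof (cases "fst X = {}")
    case True
    thus ?thesis using RB_class_empty[OF is_group True X] I(1) by simp
  next
    case False
    then obtain x where x: "x \<in> fst X" by blast
    let ?O = "{snd X g x | g. g \<in> carrier G}"
    note O = ginv_orbit[OF X x]
    have xO: "x \<in> ?O" using act_one[OF X x] by force
    have Osub: "?O \<subseteq> fst X" using O by (simp add: ginv_def)
    have stab: "gstab G (gsub X A) y = gstab G X y" if "y \<in> A" for y A
      using that by (simp add: gstab_def gsub_simps)
    have "RB_class R G (gsub X ?O) \<in> I"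
    proof (rule orb[OF fin_gset_gsub[OF X O]])
      show "\<forall>y\<in>fst (gsub X ?O). card (gstab G (gsub X ?O) y) \<le> n"
        using less.prems(2) Osub stab by (auto simp: gsub_simps)
      fix y y' assume "y \<in> fst (gsub X ?O)" "y' \<in> fst (gsub X ?O)"
      then obtain g g' where g: "g \<in> carrier G" "y = snd X g x" "g' \<in> carrier G" "y' = snd X g' x" "y \<in> ?O"
        by (auto simp: gsub_simps)
      have "snd X (g' \<otimes>\<^bsub>G\<^esub> inv\<^bsub>G\<^esub> g) y = y'"
        using g X x by (simp add: act_mult act_closed act_inv_cancel)
      thus "\<exists>g\<in>carrier G. snd (gsub X ?O) g y = y'"
        using g(1,3,5) by (intro bexI[of _ "g' \<otimes>\<^bsub>G\<^esub> inv\<^bsub>G\<^esub> g"]) (simp_all only: gsub_simps m_closed inv_closed)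
    qed (use xO in \<open>auto simp: gsub_simps\<close>)
    moreover have "RB_class R G (gsub X (fst X - ?O)) \<in> I"
    proof (rule less.hyps[OF _ fin_gset_gsub[OF X ginv_Diff[OF X O]]])
      show "card (fst (gsub X (fst X - ?O))) < card (fst X)"
        unfolding gsub_simps(1) using fin_gset_finite[OF X] x xO by (intro psubset_card_mono) auto
      show "\<forall>y\<in>fst (gsub X (fst X - ?O)). card (gstab G (gsub X (fst X - ?O)) y) \<le> n"
        using less.prems(2) stab by (auto simp: gsub_simps)
    qed
    ultimately show ?thesis using RB_class_gsub[OF X O] I(2) by simp
  qed
qed

lemma RB_class_copies:
  fixes C :: "'c set"
  assumes X: "fin_gset G X" and "finite C"
  shows "RB_class R G (C \<times> fst X, \<lambda>g. \<lambda>(c, x)\<in>C \<times> fst X. (c, snd X g x)) =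
    ([card C] \<cdot>\<^bsub>R\<^esub> \<one>\<^bsub>R\<^esub>) \<odot>\<^bsub>RB R G\<^esub> RB_class R G X"
  using assms(2)
proof (induction C rule: finite_induct)
  interpret M: module R "RB R G" by (rule RB_module[OF R])
  note g = fin_gset_group[OF X] and cl = RB_class_closed[OF R X]
  let ?c = "\<lambda>C :: 'c set. (C \<times> fst X, \<lambda>g. \<lambda>(c, x)\<in>C \<times> fst X. (c, snd X g x))"
  have fin: "fin_gset G (?c C)" if "finite C" for C :: "'c set"
    by (rule fin_gsetI[OF g]) (auto simp: that fin_gset_finite[OF X] act_closed[OF X] act_one[OF X] act_mult[OF X])
  {
    case empty
    have "RB_class R G (?c {}) = \<zero>\<^bsub>RB R G\<^esub>" by (rule RB_class_empty[OF g _ fin]) auto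
    thus ?case unfolding \<open>RB_class R G (?c {}) = \<zero>\<^bsub>RB R G\<^esub>\<close> using cl by simp
  next
    case (insert a C)
    have "bij_betw (case_sum (\<lambda>x. (a, x)) (\<lambda>y. y)) (fst X <+> C \<times> fst X) (insert a C \<times> fst X)"
      by (rule bij_betw_byWitness[where f' = "\<lambda>(c, x). if c = a then Inl x else Inr (c, x)"])
         (use insert.hyps(2) in auto)
    hence "gset_iso G (gset_sum X (?c C)) (?c (insert a C))"
      unfolding gset_iso_def
      by (intro exI[of _ "case_sum (\<lambda>x. (a, x)) (\<lambda>y. y)"]) (auto simp: gset_sum_def act_closed[OF X])
    from RB_class_iso[OF R fin_gset_sum[OF X fin[OF insert.hyps(1)]] fin[OF finite.insertI[OF insert.hyps(1)]] this]
    have eq: "RB_class R G (?c (insert a C)) = RB_class R G X \<oplus>\<^bsub>RB R G\<^esub> RB_class R G (?c C)"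
      using RB_class_sum[OF R X fin[OF insert.hyps(1)]] by simp
    show ?case
      unfolding eq insert.IH using insert.hyps cl by (simp add: M.smult_l_distr M.M.a_comm)
  }
qed

text \<open>Multiplication by \<open>[conj_gset G]\<close> is triangular for the filtration by the orders of the
  stabilizers, with the orders of the centralizers of subgroups on the diagonal.\<close>

lemma conj_gset_invertible:
  fixes G :: "'g monoid"
  assumes G: "fgroup G" and unit: "[order G] \<cdot>\<^bsub>R\<^esub> \<one>\<^bsub>R\<^esub> \<in> Units R"
  shows "\<exists>y\<in>carrier (RB R G). mulG R G y (RB_class R G (conj_gset G)) = RB_class R G pt_gset"
proof -
  interpret G: group G using fgroupD(1)[OF G] .
  interpret M: module R "RB R G" by (rule RB_module[OF R])
  let ?c = "RB_class R G (conj_gset G)" and ?Z = "\<lambda>Y. res_gset G (\<lambda>g. (g, g)) (gprod Y (conj_gset G))"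
  note cf = fin_gset_conj[OF G]
  have cc: "?c \<in> carrier (RB R G)" by (rule RB_class_closed[OF R cf])
  have lin: "linear_map R (RB R G) (RB R G) (\<lambda>y. mulG R G y ?c)"
    unfolding mulG_def[OF R] by (intro R RBT_linear[OF R] RBX_linear_left[OF R] linear_map_id grel_diag G cc)
  note l = linear_mapD[OF lin]
  \<comment> \<open>The image of multiplication by the class of \<open>conj_gset G\<close>, an
    \<open>R\<close>-submodule; the aim is that it contains the class of the point.\<close>
  define I where "I = (\<lambda>y. mulG R G y ?c) ` carrier (RB R G)"
  have I0: "\<zero>\<^bsub>RB R G\<^esub> \<in> I"
    unfolding I_def
    using linear_map_zero[OF RB_module[OF R] RB_module[OF R] lin] M.M.zero_closed
    by (intro image_eqI[where x = "\<zero>\<^bsub>RB R G\<^esub>"]) simp_all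
  have Iadd: "x \<oplus>\<^bsub>RB R G\<^esub> y \<in> I" if xy: "x \<in> I" "y \<in> I" for x y
  proof -
    obtain a b where ab: "a \<in> carrier (RB R G)" "x = mulG R G a ?c" "b \<in> carrier (RB R G)" "y = mulG R G b ?c"
      using xy by (auto simp: I_def)
    show ?thesis
      unfolding I_def ab l(2)[OF ab(1,3), symmetric] by (rule imageI[OF M.M.a_closed[OF ab(1,3)]])
  qed
  have Ismult: "r \<odot>\<^bsub>RB R G\<^esub> y \<in> I" if ry: "r \<in> carrier R" "y \<in> I" for r y
  proof -
    obtain b where b: "b \<in> carrier (RB R G)" "y = mulG R G b ?c" using ry by (auto simp: I_def)
    show ?thesis
      unfolding I_def b l(3)[OF ry(1) b(1), symmetric] by (rule imageI[OF M.smult_closed[OF ry(1) b(1)]])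
  qed
  have Isub: "x \<in> carrier (RB R G)" if "x \<in> I" for x using that l(1) by (auto simp: I_def)
  have fZ: "fin_gset G (?Z Y)" if "fin_gset G Y" for Y :: "('g, 'y) gset"
    by (rule fin_gset_res[OF G.is_group _ fin_gset_gprod[OF that cf]]) (auto simp: hom_def)
  have mul: "mulG R G (RB_class R G Y) ?c = RB_class R G (?Z Y)" if Y: "fin_gset G Y" for Y :: "('g, nat) gset"
    unfolding mulG_def[OF R] RBX_class[OF R G G Y cf]
    by (rule RBT_res_class[OF R fZ[OF Y] fin_gset_gprod[OF Y cf] grel_diag[OF G], where f = "\<lambda>x. x" and p = "\<lambda>g. (g, g)"])
       (auto simp: res_gset_def diag_rel_def bij_betw_def)
  have Zfst: "fst (?Z Y) = fst Y \<times> carrier G" for Y :: "('g, 'y) gset"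
    by (simp add: res_gset_def gprod_simps conj_gset_def)
  have Zact: "snd (?Z Y) g (y, a) = (snd Y g y, g \<otimes>\<^bsub>G\<^esub> a \<otimes>\<^bsub>G\<^esub> inv\<^bsub>G\<^esub> g)"
    if "y \<in> fst Y" "a \<in> carrier G" "g \<in> carrier G" for Y :: "('g, 'y) gset" and y a g
    using that by (simp add: res_gset_def gprod_def conj_gset_def)
  \<comment> \<open>Induction on a bound for the orders of the stabilizers. With bound zero only the
    empty set is left, because stabilizers contain the identity.\<close>
  have main: "RB_class R G Y \<in> I" if "fin_gset G Y" "\<forall>y\<in>fst Y. card (gstab G Y y) \<le> n" for Y :: "('g, nat) gset" and n
    using that
  proof (induction n arbitrary: Y)
    case 0
    have "fst Y = {}"
    proof (rule ccontr)
      assume "fst Y \<noteq> {}"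
      then obtain y where y: "y \<in> fst Y" by blast
      have "\<one>\<^bsub>G\<^esub> \<in> gstab G Y y" using act_one[OF 0(1) y] by (simp add: gstab_def)
      moreover have "gstab G Y y = {}" using 0(2) y finite_gstab[OF fgroupD(2)[OF G]] by (metis card_0_eq le_zero_eq)
      ultimately show False by simp
    qed
    thus ?case using RB_class_empty[OF G.is_group _ 0(1)] I0 by simp
  next
    case (Suc n)
    show ?case
    proof (rule RB_class_orbits[OF I0 Iadd _ Suc.prems])
      fix Y :: "('g, nat) gset"
      assume Y: "fin_gset G Y" "\<forall>y\<in>fst Y. card (gstab G Y y) \<le> Suc n" and ne: "fst Y \<noteq> {}"
        and trans: "\<And>y y'. y \<in> fst Y \<Longrightarrow> y' \<in> fst Y \<Longrightarrow> \<exists>g\<in>carrier G. snd Y g y = y'"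
      obtain y0 where y0: "y0 \<in> fst Y" using ne by blast
      let ?S = "gstab G Y y0"
      have Sc: "s \<in> carrier G" if "s \<in> ?S" for s using that by (simp add: gstab_def)
      \<comment> \<open>The points \<open>(y, a)\<close> that still have the full stabilizer of
        \<open>y\<close>, namely those with \<open>a\<close> centralizing it. \<open>C\<close> is
        the centralizer of the stabilizer of the base point \<open>y0\<close>.\<close>
      define A where "A = {(y, a) \<in> fst Y \<times> carrier G. \<forall>g\<in>gstab G Y y. g \<otimes>\<^bsub>G\<^esub> a \<otimes>\<^bsub>G\<^esub> inv\<^bsub>G\<^esub> g = a}"
      define C where "C = {a \<in> carrier G. \<forall>g\<in>?S. g \<otimes>\<^bsub>G\<^esub> a = a \<otimes>\<^bsub>G\<^esub> g}"
      have conj_iff: "g \<otimes>\<^bsub>G\<^esub> a \<otimes>\<^bsub>G\<^esub> inv\<^bsub>G\<^esub> g = a \<longleftrightarrow> g \<otimes>\<^bsub>G\<^esub> a = a \<otimes>\<^bsub>G\<^esub> g"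
        if "g \<in> carrier G" "a \<in> carrier G" for g a
        using that G.inv_solve_right'[of a "g \<otimes>\<^bsub>G\<^esub> a" g] by auto
      have "subgroup C G"
      proof (rule G.subgroupI)
        show "inv\<^bsub>G\<^esub> a \<in> C" if "a \<in> C" for a
        proof -
          have "g \<otimes>\<^bsub>G\<^esub> inv\<^bsub>G\<^esub> a = inv\<^bsub>G\<^esub> a \<otimes>\<^bsub>G\<^esub> g" if g: "g \<in> ?S" for g
          proof -
            have "a \<in> carrier G" "g \<in> carrier G" "g \<otimes>\<^bsub>G\<^esub> a = a \<otimes>\<^bsub>G\<^esub> g" using \<open>a \<in> C\<close> g Sc by (auto simp: C_def)
            thus ?thesis by (metis G.inv_closed G.inv_solve_left' G.inv_solve_right' G.m_assoc G.m_closed)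
          qed
          thus ?thesis using that by (auto simp: C_def)
        qed
        show "a \<otimes>\<^bsub>G\<^esub> b \<in> C" if "a \<in> C" "b \<in> C" for a b
          using that Sc by (auto simp: C_def) (metis G.m_assoc)
        have "\<one>\<^bsub>G\<^esub> \<in> C" using Sc by (auto simp: C_def)
        thus "C \<noteq> {}" by blast
      qed (auto simp: C_def)
      \<comment> \<open>The order of \<open>C\<close> divides that of \<open>G\<close>, so its image
        in \<open>R\<close> is invertible too; \<open>u\<close> is the inverse.\<close>
      from G.lagrange[OF this] have "card (rcosets\<^bsub>G\<^esub> C) * card C = order G" .
      hence "([card (rcosets\<^bsub>G\<^esub> C)] \<cdot>\<^bsub>R\<^esub> \<one>\<^bsub>R\<^esub>) \<otimes>\<^bsub>R\<^esub> ([card C] \<cdot>\<^bsub>R\<^esub> \<one>\<^bsub>R\<^esub>) = [order G] \<cdot>\<^bsub>R\<^esub> \<one>\<^bsub>R\<^esub>"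
        using R.add.nat_pow_pow[of "\<one>\<^bsub>R\<^esub>" "card (rcosets\<^bsub>G\<^esub> C)" "card C"]
        by (simp add: R.add_pow_ldistr mult.commute)
      moreover obtain v where v: "v \<in> carrier R" "v \<otimes>\<^bsub>R\<^esub> ([order G] \<cdot>\<^bsub>R\<^esub> \<one>\<^bsub>R\<^esub>) = \<one>\<^bsub>R\<^esub>"
        using unit by (auto simp: Units_def)
      moreover define u where "u = v \<otimes>\<^bsub>R\<^esub> ([card (rcosets\<^bsub>G\<^esub> C)] \<cdot>\<^bsub>R\<^esub> \<one>\<^bsub>R\<^esub>)"
      ultimately have u: "u \<in> carrier R" "u \<otimes>\<^bsub>R\<^esub> ([card C] \<cdot>\<^bsub>R\<^esub> \<one>\<^bsub>R\<^esub>) = \<one>\<^bsub>R\<^esub>"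
        by (simp_all add: R.m_assoc)
      have stabg: "h \<in> gstab G Y (snd Y g y) \<longleftrightarrow> inv\<^bsub>G\<^esub> g \<otimes>\<^bsub>G\<^esub> h \<otimes>\<^bsub>G\<^esub> g \<in> gstab G Y y"
        if "g \<in> carrier G" "h \<in> carrier G" "y \<in> fst Y" for g h y
      proof -
        have "snd Y (inv\<^bsub>G\<^esub> g \<otimes>\<^bsub>G\<^esub> h \<otimes>\<^bsub>G\<^esub> g) y = y \<longleftrightarrow> snd Y (inv\<^bsub>G\<^esub> g) (snd Y h (snd Y g y)) = y"
          using that Y(1) by (simp add: act_mult act_closed)
        also have "\<dots> \<longleftrightarrow> snd Y h (snd Y g y) = snd Y g y"
          using that by (subst act_eq_iff[OF Y(1)]) (auto simp: act_closed[OF Y(1)])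
        finally show ?thesis using that by (simp add: gstab_def)
      qed
      have conj2: "g \<otimes>\<^bsub>G\<^esub> (h \<otimes>\<^bsub>G\<^esub> a \<otimes>\<^bsub>G\<^esub> inv\<^bsub>G\<^esub> h) \<otimes>\<^bsub>G\<^esub> inv\<^bsub>G\<^esub> g = (g \<otimes>\<^bsub>G\<^esub> h) \<otimes>\<^bsub>G\<^esub> a \<otimes>\<^bsub>G\<^esub> inv\<^bsub>G\<^esub> (g \<otimes>\<^bsub>G\<^esub> h)"
        if "g \<in> carrier G" "h \<in> carrier G" "a \<in> carrier G" for g h a
        using that by (simp add: G.m_assoc G.inv_mult_group)
      have Ainv: "ginv G (?Z Y) A"
        unfolding ginv_def
      proof (intro conjI ballI)
        show "A \<subseteq> fst (?Z Y)" by (auto simp: A_def Zfst)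
        fix g p assume g: "g \<in> carrier G" and "p \<in> A"
        then obtain y a where p: "p = (y, a)" "y \<in> fst Y" "a \<in> carrier G"
          "\<And>h. h \<in> gstab G Y y \<Longrightarrow> h \<otimes>\<^bsub>G\<^esub> a \<otimes>\<^bsub>G\<^esub> inv\<^bsub>G\<^esub> h = a" by (auto simp: A_def)
        have "h \<otimes>\<^bsub>G\<^esub> (g \<otimes>\<^bsub>G\<^esub> a \<otimes>\<^bsub>G\<^esub> inv\<^bsub>G\<^esub> g) \<otimes>\<^bsub>G\<^esub> inv\<^bsub>G\<^esub> h = g \<otimes>\<^bsub>G\<^esub> a \<otimes>\<^bsub>G\<^esub> inv\<^bsub>G\<^esub> g"
          if h: "h \<in> gstab G Y (snd Y g y)" for h
        proof -
          have hc: "h \<in> carrier G" using h by (simp add: gstab_def)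
          let ?k = "inv\<^bsub>G\<^esub> g \<otimes>\<^bsub>G\<^esub> h \<otimes>\<^bsub>G\<^esub> g"
          have "?k \<otimes>\<^bsub>G\<^esub> a \<otimes>\<^bsub>G\<^esub> inv\<^bsub>G\<^esub> ?k = a" using p(4) stabg[OF g hc p(2)] h by blast
          moreover have "g \<otimes>\<^bsub>G\<^esub> ?k = h \<otimes>\<^bsub>G\<^esub> g" using g hc by (simp add: G.m_assoc[symmetric])
          ultimately show ?thesis
            using conj2[OF hc g p(3)] conj2[OF g _ p(3), of ?k] g hc by simp
        qed
        thus "snd (?Z Y) g p \<in> A" using p g by (simp add: Zact A_def act_closed[OF Y(1)])
      qed
      \<comment> \<open>Off \<open>A\<close> some element fixing \<open>y\<close> moves
        \<open>a\<close>, so the stabilizer of the point is strictly smaller and the induction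
        hypothesis applies.\<close>
      have B: "RB_class R G (gsub (?Z Y) (fst (?Z Y) - A)) \<in> I"
      proof -
        let ?B = "gsub (?Z Y) (fst (?Z Y) - A)"
        have fB: "fin_gset G ?B" by (rule fin_gset_gsub[OF fZ[OF Y(1)] ginv_Diff[OF fZ[OF Y(1)] Ainv]])
        obtain B' :: "('g, nat) gset" where B': "B' \<in> fin_gsets G" "gset_iso G ?B B'" using gset_iso_nat[OF fB] by blast
        have fB': "fin_gset G B'" using B'(1) by (simp add: fin_gsets_iff)
        obtain f where f: "bij_betw f (fst ?B) (fst B')"
          "\<And>g x. g \<in> carrier G \<Longrightarrow> x \<in> fst ?B \<Longrightarrow> f (snd ?B g x) = snd B' g (f x)"
          using B'(2) by (auto simp: gset_iso_def)
        have "card (gstab G B' x) \<le> n" if "x \<in> fst B'" for x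
        proof -
          have "x \<in> f ` fst ?B" using f(1) that by (simp add: bij_betw_def)
          then obtain p where p: "x = f p" "p \<in> fst ?B" by (rule imageE)
          obtain y a where ya: "p = (y, a)" by (cases p)
          have c: "y \<in> fst Y" "a \<in> carrier G" "(y, a) \<notin> A" "(y, a) \<in> fst (?Z Y) - A"
            using p(2) ya by (auto simp: gsub_simps Zfst)
          then obtain h where h: "h \<in> gstab G Y y" "h \<otimes>\<^bsub>G\<^esub> a \<otimes>\<^bsub>G\<^esub> inv\<^bsub>G\<^esub> h \<noteq> a" by (auto simp: A_def)
          have "gstab G B' x = gstab G ?B (y, a)"
            unfolding p(1) ya[symmetric] using f(1) by (intro gstab_iso[OF f(2) _ fB p(2)]) (auto simp: bij_betw_def)
          also have "\<dots> \<subset> gstab G Y y"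
          proof
            show "gstab G ?B (y, a) \<subseteq> gstab G Y y"
              using c(1,2) by (auto simp: gstab_def gsub_simps(2)[OF c(4)] Zact)
            have "h \<notin> gstab G ?B (y, a)"
              using h c(1,2) by (auto simp: gstab_def gsub_simps(2)[OF c(4)] Zact)
            thus "gstab G ?B (y, a) \<noteq> gstab G Y y" using h(1) by blast
          qed
          finally have "card (gstab G B' x) < card (gstab G Y y)"
            by (rule psubset_card_mono[OF finite_gstab[OF fgroupD(2)[OF G]]])
          thus ?thesis using Y(2) c(1) by fastforce
        qed
        from Suc.IH[OF fB'] this RB_class_iso[OF R fB fB' B'(2)] show ?thesis by simp
      qed
      have "RB_class R G (gsub (?Z Y) A) = ([card C] \<cdot>\<^bsub>R\<^esub> \<one>\<^bsub>R\<^esub>) \<odot>\<^bsub>RB R G\<^esub> RB_class R G Y"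
      proof -
        \<comment> \<open>\<open>t y\<close> carries \<open>y0\<close> to \<open>y\<close>.
          Conjugation by it identifies \<open>C\<close> with the fibre of \<open>A\<close> over
          \<open>y\<close>, which makes \<open>A\<close> a sum of \<open>card C\<close> copies of
          \<open>Y\<close>.\<close>
        obtain t where t: "\<And>y. y \<in> fst Y \<Longrightarrow> t y \<in> carrier G" "\<And>y. y \<in> fst Y \<Longrightarrow> snd Y (t y) y0 = y"
          using trans[OF y0] by metis
        let ?f = "\<lambda>(c, y). (y, t y \<otimes>\<^bsub>G\<^esub> c \<otimes>\<^bsub>G\<^esub> inv\<^bsub>G\<^esub> (t y))"
        let ?c = "(C \<times> fst Y, \<lambda>g. \<lambda>(c, y)\<in>C \<times> fst Y. (c, snd Y g y))"
        have cC: "c \<in> carrier G" "\<And>s. s \<in> ?S \<Longrightarrow> s \<otimes>\<^bsub>G\<^esub> c \<otimes>\<^bsub>G\<^esub> inv\<^bsub>G\<^esub> s = c" if "c \<in> C" for c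
          using that conj_iff[OF Sc, of _ c] by (simp_all add: C_def)
        \<comment> \<open>The two ways of reaching \<open>g y\<close> from \<open>y0\<close> differ
          by an element of the base stabilizer, which commutes with \<open>C\<close>; hence the
          identification is equivariant despite the arbitrary choice of \<open>t\<close>.\<close>
        have ts: "inv\<^bsub>G\<^esub> (t (snd Y g y)) \<otimes>\<^bsub>G\<^esub> (g \<otimes>\<^bsub>G\<^esub> t y) \<in> ?S" if "g \<in> carrier G" "y \<in> fst Y" for g y
        proof -
          have y': "snd Y g y \<in> fst Y" using act_closed[OF Y(1) that] .
          have "snd Y (inv\<^bsub>G\<^esub> (t (snd Y g y)) \<otimes>\<^bsub>G\<^esub> (g \<otimes>\<^bsub>G\<^esub> t y)) y0 = snd Y (inv\<^bsub>G\<^esub> (t (snd Y g y))) (snd Y g y)"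
            using that t y0 y' Y(1) by (simp add: act_mult act_closed)
          also have "\<dots> = y0" using act_inv_cancel(1)[OF Y(1) t(1)[OF y'] y0] t(2)[OF y'] by simp
          finally show ?thesis using t(1)[OF y'] t(1)[OF that(2)] that(1) by (simp add: gstab_def)
        qed
        have equiv: "?f (snd ?c g p) = snd (gsub (?Z Y) A) g (?f p)" and fA: "?f p \<in> A"
          if g: "g \<in> carrier G" and p: "p \<in> C \<times> fst Y" for g p
        proof -
          obtain c y where cy: "p = (c, y)" "c \<in> C" "y \<in> fst Y" using p by auto
          note ty = t(1)[OF cy(3)]
          have y': "snd Y g y \<in> fst Y" using act_closed[OF Y(1) g cy(3)] .
          note ty' = t(1)[OF y']
          show fA: "?f p \<in> A"
          proof -
            have "h \<otimes>\<^bsub>G\<^esub> (t y \<otimes>\<^bsub>G\<^esub> c \<otimes>\<^bsub>G\<^esub> inv\<^bsub>G\<^esub> t y) \<otimes>\<^bsub>G\<^esub> inv\<^bsub>G\<^esub> h = t y \<otimes>\<^bsub>G\<^esub> c \<otimes>\<^bsub>G\<^esub> inv\<^bsub>G\<^esub> t y"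
              if h: "h \<in> gstab G Y y" for h
            proof -
              have hc: "h \<in> carrier G" "snd Y h y = y" using h by (auto simp: gstab_def)
              let ?s = "inv\<^bsub>G\<^esub> (t y) \<otimes>\<^bsub>G\<^esub> (h \<otimes>\<^bsub>G\<^esub> t y)"
              have s: "?s \<in> ?S" using ts[OF hc(1) cy(3)] hc(2) by simp
              have "h \<otimes>\<^bsub>G\<^esub> t y = t y \<otimes>\<^bsub>G\<^esub> ?s" using hc(1) ty by (simp add: G.m_assoc[symmetric])
              thus ?thesis
                using conj2[OF hc(1) ty cC(1)[OF cy(2)]] conj2[OF ty Sc[OF s] cC(1)[OF cy(2)]] cC(2)[OF cy(2) s] by simp
            qed
            thus ?thesis using cy ty cC(1) by (auto simp: A_def)
          qed
          let ?s = "inv\<^bsub>G\<^esub> (t (snd Y g y)) \<otimes>\<^bsub>G\<^esub> (g \<otimes>\<^bsub>G\<^esub> t y)"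
          have s: "?s \<in> ?S" by (rule ts[OF g cy(3)])
          have "g \<otimes>\<^bsub>G\<^esub> t y = t (snd Y g y) \<otimes>\<^bsub>G\<^esub> ?s" using g ty ty' by (simp add: G.m_assoc[symmetric])
          hence "g \<otimes>\<^bsub>G\<^esub> (t y \<otimes>\<^bsub>G\<^esub> c \<otimes>\<^bsub>G\<^esub> inv\<^bsub>G\<^esub> t y) \<otimes>\<^bsub>G\<^esub> inv\<^bsub>G\<^esub> g =
            t (snd Y g y) \<otimes>\<^bsub>G\<^esub> c \<otimes>\<^bsub>G\<^esub> inv\<^bsub>G\<^esub> t (snd Y g y)"
            using conj2[OF g ty cC(1)[OF cy(2)]] conj2[OF ty' Sc[OF s] cC(1)[OF cy(2)]] cC(2)[OF cy(2) s] by simp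
          thus "?f (snd ?c g p) = snd (gsub (?Z Y) A) g (?f p)"
            using fA g cy ty cC(1)[OF cy(2)] by (simp add: gsub_simps Zact)
        qed
        have "bij_betw ?f (C \<times> fst Y) A"
        proof (rule bij_betw_byWitness[where f' = "\<lambda>(y, a). (inv\<^bsub>G\<^esub> (t y) \<otimes>\<^bsub>G\<^esub> a \<otimes>\<^bsub>G\<^esub> t y, y)"])
          show "\<forall>p\<in>C \<times> fst Y. (\<lambda>(y, a). (inv\<^bsub>G\<^esub> (t y) \<otimes>\<^bsub>G\<^esub> a \<otimes>\<^bsub>G\<^esub> t y, y)) (?f p) = p"
            using cC(1) t(1) by (auto simp: G.m_assoc) (simp add: G.m_assoc[symmetric])
          show "\<forall>p\<in>A. ?f ((\<lambda>(y, a). (inv\<^bsub>G\<^esub> (t y) \<otimes>\<^bsub>G\<^esub> a \<otimes>\<^bsub>G\<^esub> t y, y)) p) = p"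
            using t(1) by (auto simp: A_def G.m_assoc) (simp add: G.m_assoc[symmetric])
          show "?f ` (C \<times> fst Y) \<subseteq> A" using fA[OF G.one_closed] by blast
          show "(\<lambda>(y, a). (inv\<^bsub>G\<^esub> (t y) \<otimes>\<^bsub>G\<^esub> a \<otimes>\<^bsub>G\<^esub> t y, y)) ` A \<subseteq> C \<times> fst Y"
          proof clarify
            fix y a assume "(y, a) \<in> A"
            hence ya: "y \<in> fst Y" "a \<in> carrier G"
              "\<And>h. h \<in> gstab G Y y \<Longrightarrow> h \<otimes>\<^bsub>G\<^esub> a \<otimes>\<^bsub>G\<^esub> inv\<^bsub>G\<^esub> h = a" by (auto simp: A_def)
            note ty = t(1)[OF ya(1)]
            let ?c = "inv\<^bsub>G\<^esub> (t y) \<otimes>\<^bsub>G\<^esub> a \<otimes>\<^bsub>G\<^esub> t y"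
            have "s \<otimes>\<^bsub>G\<^esub> ?c = ?c \<otimes>\<^bsub>G\<^esub> s" if s: "s \<in> ?S" for s
            proof -
              note sc = Sc[OF s]
              let ?h = "t y \<otimes>\<^bsub>G\<^esub> s \<otimes>\<^bsub>G\<^esub> inv\<^bsub>G\<^esub> (t y)"
              have "?h \<in> gstab G Y (snd Y (t y) y0)"
                using stabg[OF ty _ y0, of ?h] sc ty s by (simp add: G.m_assoc) (simp add: G.m_assoc[symmetric])
              hence "?h \<in> gstab G Y y" using t(2)[OF ya(1)] by simp
              hence "?h \<otimes>\<^bsub>G\<^esub> a = a \<otimes>\<^bsub>G\<^esub> ?h" using ya(3) conj_iff[of ?h a] sc ty ya(2) by simp
              hence "inv\<^bsub>G\<^esub> (t y) \<otimes>\<^bsub>G\<^esub> (?h \<otimes>\<^bsub>G\<^esub> a) \<otimes>\<^bsub>G\<^esub> t y = inv\<^bsub>G\<^esub> (t y) \<otimes>\<^bsub>G\<^esub> (a \<otimes>\<^bsub>G\<^esub> ?h) \<otimes>\<^bsub>G\<^esub> t y" by simp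
              moreover have "inv\<^bsub>G\<^esub> (t y) \<otimes>\<^bsub>G\<^esub> (t y \<otimes>\<^bsub>G\<^esub> z) = z" if "z \<in> carrier G" for z
                using that ty by (simp add: G.m_assoc[symmetric])
              ultimately show ?thesis using sc ty ya(2) by (simp add: G.m_assoc)
            qed
            thus "?c \<in> C \<and> y \<in> fst Y" using ya ty by (simp add: C_def)
          qed
        qed
        hence "gset_iso G ?c (gsub (?Z Y) A)"
          unfolding gset_iso_def using equiv by (intro exI[of _ ?f]) (simp add: gsub_simps)
        moreover have "fin_gset G ?c"
          by (rule fin_gsetI[OF G.is_group])
             (use fgroupD(2)[OF G] in \<open>auto simp: C_def fin_gset_finite[OF Y(1)] act_closed[OF Y(1)] act_one[OF Y(1)] act_mult[OF Y(1)]\<close>)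
        ultimately have "RB_class R G ?c = RB_class R G (gsub (?Z Y) A)"
          by (intro RB_class_iso[OF R _ fin_gset_gsub[OF fZ[OF Y(1)] Ainv]])
        moreover have "finite C" using fgroupD(2)[OF G] by (simp add: C_def)
        ultimately show ?thesis using RB_class_copies[OF Y(1), of C] by simp
      qed
      hence eq: "mulG R G (RB_class R G Y) (RB_class R G (conj_gset G)) =
          ([card C] \<cdot>\<^bsub>R\<^esub> \<one>\<^bsub>R\<^esub>) \<odot>\<^bsub>RB R G\<^esub> RB_class R G Y \<oplus>\<^bsub>RB R G\<^esub> RB_class R G (gsub (?Z Y) (fst (?Z Y) - A))"
        using RB_class_gsub[OF fZ[OF Y(1)] Ainv] mul[OF Y(1)] by simp
      let ?y = "RB_class R G Y" and ?b = "RB_class R G (gsub (?Z Y) (fst (?Z Y) - A))"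
      let ?n = "[card C] \<cdot>\<^bsub>R\<^esub> \<one>\<^bsub>R\<^esub>"
      have yc: "?y \<in> carrier (RB R G)" by (rule RB_class_closed[OF R Y(1)])
      have "mulG R G ?y (RB_class R G (conj_gset G)) \<in> I" using yc by (simp add: I_def)
      moreover have "(\<ominus>\<^bsub>R\<^esub> \<one>\<^bsub>R\<^esub>) \<odot>\<^bsub>RB R G\<^esub> ?b \<in> I" by (rule Ismult[OF _ B]) simp
      \<comment> \<open>The product of \<open>?y\<close> with the conjugation class is
        \<open>card C\<close> times \<open>?y\<close>, plus \<open>?b\<close>. Subtracting
        \<open>?b\<close>, which lies in the image by induction, and multiplying by \<open>u\<close>
        isolates \<open>?y\<close>.\<close>
      ultimately have "u \<odot>\<^bsub>RB R G\<^esub> (mulG R G ?y (RB_class R G (conj_gset G)) \<oplus>\<^bsub>RB R G\<^esub> (\<ominus>\<^bsub>R\<^esub> \<one>\<^bsub>R\<^esub>) \<odot>\<^bsub>RB R G\<^esub> ?b) \<in> I"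
        by (intro Ismult[OF u(1)] Iadd)
      moreover have "mulG R G ?y (RB_class R G (conj_gset G)) \<oplus>\<^bsub>RB R G\<^esub> (\<ominus>\<^bsub>R\<^esub> \<one>\<^bsub>R\<^esub>) \<odot>\<^bsub>RB R G\<^esub> ?b = ?n \<odot>\<^bsub>RB R G\<^esub> ?y"
        unfolding eq using yc Isub[OF B] by (simp add: M.smult_l_minus M.M.a_assoc M.M.r_neg)
      moreover have "u \<odot>\<^bsub>RB R G\<^esub> (?n \<odot>\<^bsub>RB R G\<^esub> ?y) = ?y"
        using u yc by (simp add: M.smult_assoc1[symmetric])
      ultimately show "?y \<in> I" by simp
    qed
  qed
  obtain P :: "('g, nat) gset" where P: "P \<in> fin_gsets G" "gset_iso G (pt_gset :: ('g, unit) gset) P"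
    using gset_iso_nat[OF fin_gset_pt[OF G.is_group]] by blast
  have "card (gstab G P y) \<le> card (carrier G)" for y
    by (rule card_mono[OF fgroupD(2)[OF G]]) (auto simp: gstab_def)
  hence "RB_class R G P \<in> I" using main[of P "card (carrier G)"] P(1) by (simp add: fin_gsets_iff)
  moreover have "RB_class R G P = RB_class R G (pt_gset :: ('g, unit) gset)"
    using RB_class_iso[OF R fin_gset_pt[OF G.is_group] _ P(2)] P(1) by (simp add: fin_gsets_iff)
  ultimately show ?thesis by (auto simp: I_def)
qed

end

section \<open>Functionals detecting the order of the group\<close>

text \<open>\<open>R\<close> as a module over itself, the target of the counting
  functionals.\<close>

definition ring_mod :: "('r, 'q) ring_scheme \<Rightarrow> ('r, 'r) module" where
  "ring_mod R = \<lparr>carrier = carrier R, monoid.mult = undefined, one = undefined,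
    zero = zero R, add = add R, smult = monoid.mult R\<rparr>"

lemma ring_mod_simps:
  "carrier (ring_mod R) = carrier R" "zero (ring_mod R) = zero R" "add (ring_mod R) = add R"
  "r \<odot>\<^bsub>ring_mod R\<^esub> x = r \<otimes>\<^bsub>R\<^esub> x"
  by (simp_all add: ring_mod_def)

lemma ring_mod_module:
  assumes "cring R"
  shows "module R (ring_mod R)"
proof -
  interpret R: cring R by fact
  show ?thesis
  proof (rule moduleI[OF assms])
    show "abelian_group (ring_mod R)"
    proof (rule abelian_groupI)
      fix x assume "x \<in> carrier (ring_mod R)"
      thus "\<exists>y\<in>carrier (ring_mod R). y \<oplus>\<^bsub>ring_mod R\<^esub> x = \<zero>\<^bsub>ring_mod R\<^esub>"
        by (intro bexI[of _ "\<ominus>\<^bsub>R\<^esub> x"]) (simp_all add: ring_mod_simps R.l_neg)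
    qed (simp_all add: ring_mod_simps R.a_ac)
  qed (simp_all add: ring_mod_simps R.l_distr R.r_distr R.m_assoc)
qed

text \<open>Every orbit has \<open>order G\<close> elements and is removed in turn. The action is a
  bare map \<open>a\<close> because the lemma is applied to the copy \<open>G \<times> 1\<close>
  inside a larger acting group.\<close>

lemma free_action_dvd:
  assumes "group G" "finite (carrier G)" "finite A"
    and "\<And>g x. g \<in> carrier G \<Longrightarrow> x \<in> A \<Longrightarrow> a g x \<in> A"
    and one: "\<And>x. x \<in> A \<Longrightarrow> a \<one>\<^bsub>G\<^esub> x = x"
    and mult: "\<And>g h x. g \<in> carrier G \<Longrightarrow> h \<in> carrier G \<Longrightarrow> x \<in> A \<Longrightarrow> a (g \<otimes>\<^bsub>G\<^esub> h) x = a g (a h x)"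
    and free: "\<And>g x. g \<in> carrier G \<Longrightarrow> x \<in> A \<Longrightarrow> a g x = x \<Longrightarrow> g = \<one>\<^bsub>G\<^esub>"
  shows "order G dvd card A"
  using assms(3-)
proof (induction A rule: finite_psubset_induct)
  case (psubset A)
  interpret group G by fact
  note closed = psubset.prems(1) and one = psubset.prems(2) and mult = psubset.prems(3) and free = psubset.prems(4)
  have cancel: "a (inv\<^bsub>G\<^esub> g) (a g x) = x" if "g \<in> carrier G" "x \<in> A" for g x
    using mult[of "inv\<^bsub>G\<^esub> g" g x] one[of x] that by simp
  show ?case
  proof (cases "A = {}")
    case False
    then obtain x where x: "x \<in> A" by blast
    let ?O = "(\<lambda>g. a g x) ` carrier G"
    have O: "?O \<subseteq> A" using closed x by blast
    have "inj_on (\<lambda>g. a g x) (carrier G)"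
    proof (rule inj_onI)
      fix g h assume gh: "g \<in> carrier G" "h \<in> carrier G" "a g x = a h x"
      have "a (inv\<^bsub>G\<^esub> h \<otimes>\<^bsub>G\<^esub> g) x = x" using gh x cancel[OF gh(2) x] by (simp add: mult)
      hence "inv\<^bsub>G\<^esub> h \<otimes>\<^bsub>G\<^esub> g = \<one>\<^bsub>G\<^esub>" using free gh x by simp
      thus "g = h" using gh inv_solve_left'[of "\<one>\<^bsub>G\<^esub>" h g] by simp
    qed
    hence cO: "card ?O = order G" by (simp add: card_image order_def)
    have "\<one>\<^bsub>G\<^esub> \<in> carrier G" by simp
    hence xO: "x \<in> ?O" using one[OF x] by (metis image_eqI)
    have "order G dvd card (A - ?O)"
    proof (rule psubset.IH)
      show "A - ?O \<subset> A" using x xO by blast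
      fix g y assume g: "g \<in> carrier G" and y: "y \<in> A - ?O"
      have "a g y \<notin> ?O"
      proof
        assume "a g y \<in> ?O"
        then obtain h where h: "h \<in> carrier G" "a g y = a h x" by blast
        have "y = a (inv\<^bsub>G\<^esub> g \<otimes>\<^bsub>G\<^esub> h) x" using cancel[OF g, of y] h g y x by (simp add: mult)
        thus False using y g h(1) by simp
      qed
      thus "a g y \<in> A - ?O" using closed g y by blast
    qed (use one mult free in auto)
    moreover have "card A = card ?O + card (A - ?O)"
      using card_Diff_subset[OF finite_subset[OF O psubset.hyps] O] card_mono[OF psubset.hyps O] by simp
    ultimately show ?thesis using cO by simp
  qed simp
qed

text \<open>Selects points by a property of their stabilizers. When the property is invariant under
  conjugation (\<open>pconj\<close>), the selection is an invariant subset and additive in the set,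
  so it extends to a linear operator on \<open>RB\<close>.\<close>

definition psub :: "'h monoid \<Rightarrow> ('h set \<Rightarrow> bool) \<Rightarrow> ('h, 'x) gset \<Rightarrow> ('h, 'x) gset" where
  "psub H P X = gsub X {x \<in> fst X. P (gstab H X x)}"

definition pconj :: "'h monoid \<Rightarrow> ('h set \<Rightarrow> bool) \<Rightarrow> bool" where
  "pconj H P \<longleftrightarrow> (\<forall>A h. A \<subseteq> carrier H \<longrightarrow> h \<in> carrier H \<longrightarrow> P A \<longrightarrow>
    P ((\<lambda>a. h \<otimes>\<^bsub>H\<^esub> a \<otimes>\<^bsub>H\<^esub> inv\<^bsub>H\<^esub> h) ` A))"

lemma gstab_act:
  assumes "fin_gset H X" "h \<in> carrier H" "x \<in> fst X"
  shows "gstab H X (snd X h x) = (\<lambda>a. h \<otimes>\<^bsub>H\<^esub> a \<otimes>\<^bsub>H\<^esub> inv\<^bsub>H\<^esub> h) ` gstab H X x"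
proof -
  interpret group H using fin_gset_group[OF assms(1)] .
  have 1: "h \<otimes>\<^bsub>H\<^esub> a \<otimes>\<^bsub>H\<^esub> inv\<^bsub>H\<^esub> h \<in> gstab H X (snd X h x)"
    if "a \<in> gstab H X x" "h \<in> carrier H" "x \<in> fst X" for a h x
    using that assms(1) act_inv_cancel[OF assms(1) that(2,3)]
    by (auto simp: gstab_def act_mult act_closed)
  show ?thesis
  proof
    show "(\<lambda>a. h \<otimes>\<^bsub>H\<^esub> a \<otimes>\<^bsub>H\<^esub> inv\<^bsub>H\<^esub> h) ` gstab H X x \<subseteq> gstab H X (snd X h x)" using 1 assms(2,3) by blast
    show "gstab H X (snd X h x) \<subseteq> (\<lambda>a. h \<otimes>\<^bsub>H\<^esub> a \<otimes>\<^bsub>H\<^esub> inv\<^bsub>H\<^esub> h) ` gstab H X x"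
    proof
      fix b assume b: "b \<in> gstab H X (snd X h x)"
      have bc: "b \<in> carrier H" using b by (simp add: gstab_def)
      have "inv\<^bsub>H\<^esub> h \<otimes>\<^bsub>H\<^esub> b \<otimes>\<^bsub>H\<^esub> h \<in> gstab H X x"
        using 1[OF b inv_closed[OF assms(2)] act_closed[OF assms]] assms by (simp add: act_inv_cancel)
      moreover have "b = h \<otimes>\<^bsub>H\<^esub> (inv\<^bsub>H\<^esub> h \<otimes>\<^bsub>H\<^esub> b \<otimes>\<^bsub>H\<^esub> h) \<otimes>\<^bsub>H\<^esub> inv\<^bsub>H\<^esub> h"
        using bc assms(2) by (simp add: m_assoc) (simp add: m_assoc[symmetric])
      ultimately show "b \<in> (\<lambda>a. h \<otimes>\<^bsub>H\<^esub> a \<otimes>\<^bsub>H\<^esub> inv\<^bsub>H\<^esub> h) ` gstab H X x" by blast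
    qed
  qed
qed

lemma ginv_psub:
  assumes "fin_gset H X" "pconj H P"
  shows "ginv H X {x \<in> fst X. P (gstab H X x)}"
proof -
  have "gstab H X x \<subseteq> carrier H" for x by (auto simp: gstab_def)
  thus ?thesis
    using assms(2) act_closed[OF assms(1)] by (auto simp: ginv_def gstab_act[OF assms(1)] pconj_def)
qed

lemma fin_gset_psub: "fin_gset H X \<Longrightarrow> pconj H P \<Longrightarrow> fin_gset H (psub H P X)"
  unfolding psub_def by (rule fin_gset_gsub[OF _ ginv_psub])

lemma gset_iso_psub:
  assumes "gset_iso H X Y" "fin_gset H X" "pconj H P"
  shows "gset_iso H (psub H P X) (psub H P Y)"
proof -
  obtain f where f: "bij_betw f (fst X) (fst Y)" "\<And>g x. g \<in> carrier H \<Longrightarrow> x \<in> fst X \<Longrightarrow> f (snd X g x) = snd Y g (f x)"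
    using assms(1) by (auto simp: gset_iso_def)
  have inj: "inj_on f (fst X)" and im: "f ` fst X = fst Y" using f(1) by (auto simp: bij_betw_def)
  have s: "gstab H Y (f x) = gstab H X x" if "x \<in> fst X" for x by (rule gstab_iso[OF f(2) inj assms(2) that])
  have fs: "f x \<in> fst Y" if "x \<in> fst X" for x using im that by blast
  have "bij_betw f {x \<in> fst X. P (gstab H X x)} {y \<in> fst Y. P (gstab H Y y)}"
    unfolding bij_betw_def
  proof
    show "inj_on f {x \<in> fst X. P (gstab H X x)}" by (rule inj_on_subset[OF inj]) blast
    show "f ` {x \<in> fst X. P (gstab H X x)} = {y \<in> fst Y. P (gstab H Y y)}"
      unfolding im[symmetric] using s by auto
  qed
  moreover have "snd X g x \<in> {x \<in> fst X. P (gstab H X x)}"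
    if "g \<in> carrier H" "x \<in> {x \<in> fst X. P (gstab H X x)}" for g x
    using ginv_psub[OF assms(2,3)] that by (simp add: ginv_def)
  ultimately show ?thesis
    unfolding gset_iso_def psub_def
    by (intro exI[of _ f]) (use f(2) s fs in \<open>auto simp: gsub_def\<close>)
qed

lemma gset_iso_psub_sum: "gset_iso H (psub H P (gset_sum X Y)) (gset_sum (psub H P X) (psub H P Y))"
proof -
  have s: "x \<in> fst X \<Longrightarrow> gstab H (gset_sum X Y) (Inl x) = gstab H X x"
    "y \<in> fst Y \<Longrightarrow> gstab H (gset_sum X Y) (Inr y) = gstab H Y y" for x y
    by (auto simp: gstab_def gset_sum_def)
  show ?thesis
    unfolding gset_iso_def
    by (rule exI[of _ "\<lambda>x. x"]) (auto simp: psub_def gsub_def s bij_betw_def, auto simp: gset_sum_def s[unfolded gset_sum_def])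
qed

text \<open>Matching the two subsets along \<open>j\<close> suffices, because every point of
  \<open>Y\<close> is a translate of a point in the image of \<open>j\<close> and \<open>B\<close>
  is invariant.\<close>

lemma corr_gsub:
  assumes "corr K L X Y j" "ginv H X A" "ginv K Y B" "\<And>x. x \<in> fst X \<Longrightarrow> j x \<in> B \<longleftrightarrow> x \<in> A"
    "grel K H L" "fin_gset K Y"
  shows "corr K L (gsub X A) (gsub Y B) j"
proof (rule corrI)
  note D = corrD[OF assms(1)]
  interpret group K using fin_gset_group[OF assms(6)] .
  have A: "A \<subseteq> fst X" and B: "B \<subseteq> fst Y" using assms(2,3) by (auto simp: ginv_def)
  show "j x \<in> fst (gsub Y B)" if "x \<in> fst (gsub X A)" for x using that A assms(4) by (auto simp: gsub_simps)
  fix y assume "y \<in> fst (gsub Y B)"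
  hence y: "y \<in> B" by (simp add: gsub_simps)
  then obtain k x where kx: "k \<in> carrier K" "x \<in> fst X" "y = snd Y k (j x)" using D(2) B by blast
  have "snd Y (inv\<^bsub>K\<^esub> k) y \<in> B" using assms(3) y kx(1) by (simp add: ginv_def)
  hence jx: "j x \<in> B" using kx act_inv_cancel(1)[OF assms(6) kx(1) D(1)[OF kx(2)]] by simp
  hence "x \<in> A" using assms(4) kx(2) by blast
  thus "\<exists>k\<in>carrier K. \<exists>x\<in>fst (gsub X A). y = snd (gsub Y B) k (j x)"
    using kx jx by (intro bexI[of _ k] bexI[of _ x]) (auto simp: gsub_simps)
next
  note D = corrD[OF assms(1)]
  fix x x' k assume "x \<in> fst (gsub X A)" "x' \<in> fst (gsub X A)" and k: "k \<in> carrier K"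
  hence x: "x \<in> A" "x' \<in> A" "x \<in> fst X" "x' \<in> fst X" using assms(2) by (auto simp: gsub_simps ginv_def)
  thus "snd (gsub Y B) k (j x) = j x' \<longleftrightarrow> (\<exists>h. (k, h) \<in> L \<and> snd (gsub X A) h x = x')"
    using D(3)[OF x(3,4) k] assms(4) by (simp add: gsub_simps)
qed

context
  fixes R :: "('r, 'q) ring_scheme"
  assumes R: "cring R"
begin

interpretation R: cring R by (rule R)

lemma psub_exists:
  fixes H :: "'h monoid"
  assumes "pconj H P"
  obtains S where "linear_map R (RB R H) (RB R H) S"
    "\<And>X :: ('h, nat) gset. fin_gset H X \<Longrightarrow> S (RB_class R H X) = RB_class R H (psub H P X)"
proof -
  have "gset_additive H (RB R H) (\<lambda>X. RB_class R H (psub H P X))"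
    unfolding gset_additive_def fin_gsets_iff
  proof (intro conjI ballI allI impI)
    fix X :: "('h, nat) gset" assume "X \<in> fin_gsets H"
    thus "RB_class R H (psub H P X) \<in> carrier (RB R H)"
      using RB_class_closed[OF R fin_gset_psub[OF _ assms]] by (simp add: fin_gsets_iff)
  next
    fix X Y Z :: "('h, nat) gset"
    assume "X \<in> fin_gsets H" "Y \<in> fin_gsets H" "Z \<in> fin_gsets H" and iso: "gset_iso H Z (gset_sum X Y)"
    hence f: "fin_gset H X" "fin_gset H Y" "fin_gset H Z" by (simp_all add: fin_gsets_iff)
    note p = fin_gset_psub[OF f(1) assms] fin_gset_psub[OF f(2) assms] fin_gset_psub[OF f(3) assms]
    have "gset_iso H (psub H P Z) (gset_sum (psub H P X) (psub H P Y))"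
      by (rule gset_iso_trans[OF gset_iso_psub[OF iso f(3) assms] gset_iso_psub_sum])
    from RB_class_iso[OF R p(3) fin_gset_sum[OF p(1,2)] this] RB_class_sum[OF R p(1,2)]
    show "RB_class R H (psub H P Z) = RB_class R H (psub H P X) \<oplus>\<^bsub>RB R H\<^esub> RB_class R H (psub H P Y)" by simp
  qed
  from RB_ext_exists[OF R RB_module[OF R] this] show ?thesis using that by (auto simp: fin_gsets_iff)
qed

text \<open>The invariant is natural-valued and enters \<open>R\<close> only at the end; this leaves
  room for an exact division beforehand.\<close>

lemma functional_exists:
  fixes H :: "'h monoid" and f :: "('h, nat) gset \<Rightarrow> nat"
  assumes "\<And>X Y Z. fin_gset H X \<Longrightarrow> fin_gset H Y \<Longrightarrow> fin_gset H Z \<Longrightarrow> gset_iso H Z (gset_sum X Y) \<Longrightarrow> f Z = f X + f Y"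
  obtains h where "linear_map R (RB R H) (ring_mod R) h"
    "\<And>X :: ('h, nat) gset. fin_gset H X \<Longrightarrow> h (RB_class R H X) = [f X] \<cdot>\<^bsub>R\<^esub> \<one>\<^bsub>R\<^esub>"
proof -
  have "gset_additive H (ring_mod R) (\<lambda>X. [f X] \<cdot>\<^bsub>R\<^esub> \<one>\<^bsub>R\<^esub>)"
    using assms unfolding gset_additive_def fin_gsets_iff
    by (auto simp: ring_mod_simps fin_gsets_iff R.add.nat_pow_mult[symmetric] simp del: R.add.nat_pow_mult)
  from RB_ext_exists[OF R ring_mod_module[OF R] this] show ?thesis using that by (auto simp: fin_gsets_iff)
qed

lemma gset_iso_card: "gset_iso H X Y \<Longrightarrow> card (fst X) = card (fst Y)"
  by (auto simp: gset_iso_def bij_betw_same_card)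

lemma card_gset_sum: "finite (fst X) \<Longrightarrow> finite (fst Y) \<Longrightarrow> card (fst (gset_sum X Y)) = card (fst X) + card (fst Y)"
  by (simp add: gset_sum_def card_Plus)

text \<open>The heart of the converse, for the element \<open>e\<close> alone. \<open>i1\<close> and
  \<open>i2\<close> are inductions along \<open>(g, g') \<mapsto> (\<iota> g, g, g')\<close> and
  \<open>(g, g') \<mapsto> (\<iota> g', g, g')\<close>. Points fixed by some
  \<open>(l, g, 1)\<close> with \<open>l \<noteq> 1\<close> can occur only in sets induced along
  \<open>i1\<close>, so \<open>eq\<close> makes their contribution vanish.\<close>

lemma forward_unit:
  fixes G :: "'g monoid" and \<Gamma> :: obj
  assumes G: "fgroup G" and \<Gamma>: "fgroup \<Gamma>" and \<iota>: "\<iota> \<in> hom G \<Gamma>" "bij_betw \<iota> (carrier G) (carrier \<Gamma>)"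
    and e: "e \<in> carrier (RB R (obj_unit \<times>\<times> (G \<times>\<times> G)))"
    and i1: "i1 = {((\<iota> g, (g, g')), (k, (g, g'))) | k g g'. k \<in> carrier obj_unit \<and> g \<in> carrier G \<and> g' \<in> carrier G}"
    and i2: "i2 = {((\<iota> g', (g, g')), (k, (g, g'))) | k g g'. k \<in> carrier obj_unit \<and> g \<in> carrier G \<and> g' \<in> carrier G}"
    and eq: "RBT R (\<Gamma> \<times>\<times> (G \<times>\<times> G)) (obj_unit \<times>\<times> (G \<times>\<times> G)) i1 e =
      RBT R (\<Gamma> \<times>\<times> (G \<times>\<times> G)) (obj_unit \<times>\<times> (G \<times>\<times> G)) i2 e"
    and unit: "Tr R obj_unit G (G \<times>\<times> G) (diag_rel G) e = gunit (RB_shift R G)"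
  shows "[order G] \<cdot>\<^bsub>R\<^esub> \<one>\<^bsub>R\<^esub> \<in> Units R"
proof -
  interpret G: group G using fgroupD(1)[OF G] .
  interpret \<Gamma>: group \<Gamma> using fgroupD(1)[OF \<Gamma>] .
  interpret \<iota>: group_hom G \<Gamma> \<iota> using \<iota>(1) by unfold_locales
  let ?D = "obj_unit \<times>\<times> (G \<times>\<times> G)" and ?E = "\<Gamma> \<times>\<times> (G \<times>\<times> G)"
  have u: "carrier obj_unit = {0}" "\<one>\<^bsub>obj_unit\<^esub> = 0" "x \<otimes>\<^bsub>obj_unit\<^esub> y = 0" for x y by (simp_all add: obj_unit_def)
  have D: "fgroup ?D" and E: "fgroup ?E" using G \<Gamma> by (simp_all add: fgroups)
  interpret D: group ?D using fgroupD(1)[OF D] .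
  interpret E: group ?E using fgroupD(1)[OF E] .
  have inj: "\<iota> g = \<iota> g' \<longleftrightarrow> g = g'" if "g \<in> carrier G" "g' \<in> carrier G" for g g'
    using \<iota>(2) that by (auto simp: bij_betw_def inj_on_eq_iff)
  have g1: "grel ?E ?D i1" unfolding i1 by (rule grel_finiteI[OF E D]) (auto simp: u)
  have g2: "grel ?E ?D i2" unfolding i2 by (rule grel_finiteI[OF E D]) (auto simp: u)
  \<comment> \<open>\<open>P\<close> is tested on stabilizers after the inductions, \<open>N\<close>
    on stabilizers in the sets that make up \<open>e\<close>, where it says that
    \<open>G \<times> 1\<close> does not act freely at the point.\<close>
  define P where "P A \<longleftrightarrow> (\<exists>l g. l \<noteq> \<one>\<^bsub>\<Gamma>\<^esub> \<and> (l, (g, \<one>\<^bsub>G\<^esub>)) \<in> A)" for A :: "(nat \<times> ('g \<times> 'g)) set"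
  define N where "N A \<longleftrightarrow> (\<exists>k g. g \<noteq> \<one>\<^bsub>G\<^esub> \<and> (k, (g, \<one>\<^bsub>G\<^esub>)) \<in> A)" for A :: "(nat \<times> ('g \<times> 'g)) set"
  have conj_one: "h \<otimes>\<^bsub>M\<^esub> l \<otimes>\<^bsub>M\<^esub> inv\<^bsub>M\<^esub> h \<noteq> \<one>\<^bsub>M\<^esub>" if M: "group M" "l \<noteq> \<one>\<^bsub>M\<^esub>" "l \<in> carrier M" "h \<in> carrier M"
    for M :: "'z monoid" and h l
  proof
    interpret M: group M by fact
    assume "h \<otimes>\<^bsub>M\<^esub> l \<otimes>\<^bsub>M\<^esub> inv\<^bsub>M\<^esub> h = \<one>\<^bsub>M\<^esub>"
    hence "h \<otimes>\<^bsub>M\<^esub> l = h" using M.inv_solve_right'[of "\<one>\<^bsub>M\<^esub>" "h \<otimes>\<^bsub>M\<^esub> l" h] that by simp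
    thus False using that by simp
  qed
  have PP: "pconj ?E P"
    unfolding pconj_def
  proof (intro allI impI)
    fix A h assume A: "A \<subseteq> carrier ?E" and "h \<in> carrier ?E" and "P A"
    then obtain a b c l g where h: "h = (a, (b, c))" "a \<in> carrier \<Gamma>" "b \<in> carrier G" "c \<in> carrier G"
      and l: "l \<noteq> \<one>\<^bsub>\<Gamma>\<^esub>" "(l, (g, \<one>\<^bsub>G\<^esub>)) \<in> A" by (auto simp: P_def)
    have lc: "l \<in> carrier \<Gamma>" "g \<in> carrier G" using A l(2) by auto
    have "h \<otimes>\<^bsub>?E\<^esub> (l, (g, \<one>\<^bsub>G\<^esub>)) \<otimes>\<^bsub>?E\<^esub> inv\<^bsub>?E\<^esub> h =
      (a \<otimes>\<^bsub>\<Gamma>\<^esub> l \<otimes>\<^bsub>\<Gamma>\<^esub> inv\<^bsub>\<Gamma>\<^esub> a, (b \<otimes>\<^bsub>G\<^esub> g \<otimes>\<^bsub>G\<^esub> inv\<^bsub>G\<^esub> b, \<one>\<^bsub>G\<^esub>))"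
      using h by (simp add: inv_DirProd G.is_group \<Gamma>.is_group DirProd_group)
    hence "(a \<otimes>\<^bsub>\<Gamma>\<^esub> l \<otimes>\<^bsub>\<Gamma>\<^esub> inv\<^bsub>\<Gamma>\<^esub> a, (b \<otimes>\<^bsub>G\<^esub> g \<otimes>\<^bsub>G\<^esub> inv\<^bsub>G\<^esub> b, \<one>\<^bsub>G\<^esub>)) \<in> (\<lambda>a. h \<otimes>\<^bsub>?E\<^esub> a \<otimes>\<^bsub>?E\<^esub> inv\<^bsub>?E\<^esub> h) ` A"
      using imageI[OF l(2), of "\<lambda>a. h \<otimes>\<^bsub>?E\<^esub> a \<otimes>\<^bsub>?E\<^esub> inv\<^bsub>?E\<^esub> h"] by (simp only:)
    thus "P ((\<lambda>a. h \<otimes>\<^bsub>?E\<^esub> a \<otimes>\<^bsub>?E\<^esub> inv\<^bsub>?E\<^esub> h) ` A)"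
      using conj_one[OF \<Gamma>.is_group l(1) lc(1) h(2)] unfolding P_def by blast
  qed
  have NN: "pconj ?D N"
    unfolding pconj_def
  proof (intro allI impI)
    fix A h assume A: "A \<subseteq> carrier ?D" and "h \<in> carrier ?D" and "N A"
    then obtain a b c l g where h: "h = (a, (b, c))" "a \<in> carrier obj_unit" "b \<in> carrier G" "c \<in> carrier G"
      and l: "g \<noteq> \<one>\<^bsub>G\<^esub>" "(l, (g, \<one>\<^bsub>G\<^esub>)) \<in> A" by (auto simp: N_def)
    have lc: "l \<in> carrier obj_unit" "g \<in> carrier G" using A l(2) by auto
    have "h \<otimes>\<^bsub>?D\<^esub> (l, (g, \<one>\<^bsub>G\<^esub>)) \<otimes>\<^bsub>?D\<^esub> inv\<^bsub>?D\<^esub> h =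
      (a \<otimes>\<^bsub>obj_unit\<^esub> l \<otimes>\<^bsub>obj_unit\<^esub> inv\<^bsub>obj_unit\<^esub> a, (b \<otimes>\<^bsub>G\<^esub> g \<otimes>\<^bsub>G\<^esub> inv\<^bsub>G\<^esub> b, \<one>\<^bsub>G\<^esub>))"
      using h by (simp add: inv_DirProd G.is_group fgroupD(1)[OF fgroup_unit] DirProd_group)
    hence "(a \<otimes>\<^bsub>obj_unit\<^esub> l \<otimes>\<^bsub>obj_unit\<^esub> inv\<^bsub>obj_unit\<^esub> a, (b \<otimes>\<^bsub>G\<^esub> g \<otimes>\<^bsub>G\<^esub> inv\<^bsub>G\<^esub> b, \<one>\<^bsub>G\<^esub>)) \<in> (\<lambda>a. h \<otimes>\<^bsub>?D\<^esub> a \<otimes>\<^bsub>?D\<^esub> inv\<^bsub>?D\<^esub> h) ` A"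
      using imageI[OF l(2), of "\<lambda>a. h \<otimes>\<^bsub>?D\<^esub> a \<otimes>\<^bsub>?D\<^esub> inv\<^bsub>?D\<^esub> h"] by (simp only:)
    thus "N ((\<lambda>a. h \<otimes>\<^bsub>?D\<^esub> a \<otimes>\<^bsub>?D\<^esub> inv\<^bsub>?D\<^esub> h) ` A)"
      using conj_one[OF G.is_group l(1) lc(2) h(3)] unfolding N_def by blast
  qed
  obtain SP where SP: "linear_map R (RB R ?E) (RB R ?E) SP"
    "\<And>X :: (nat \<times> ('g \<times> 'g), nat) gset. fin_gset ?E X \<Longrightarrow> SP (RB_class R ?E X) = RB_class R ?E (psub ?E P X)"
    using psub_exists[OF PP] by blast
  obtain SN where SN: "linear_map R (RB R ?D) (RB R ?D) SN"
    "\<And>X :: (nat \<times> ('g \<times> 'g), nat) gset. fin_gset ?D X \<Longrightarrow> SN (RB_class R ?D X) = RB_class R ?D (psub ?D N X)"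
    using psub_exists[OF NN] by blast
  \<comment> \<open>\<open>psub_exists\<close> speaks of sets of natural numbers, while the sets
    produced by \<open>gT\<close> have points of another type.\<close>
  have SP': "SP (RB_class R ?E Y) = RB_class R ?E (psub ?E P Y)" if Y: "fin_gset ?E Y"
    for Y :: "(nat \<times> ('g \<times> 'g), 'y) gset"
  proof -
    obtain X :: "(nat \<times> ('g \<times> 'g), nat) gset" where X: "X \<in> fin_gsets ?E" "gset_iso ?E Y X" using gset_iso_nat[OF Y] by blast
    have f: "fin_gset ?E X" using X(1) by (simp add: fin_gsets_iff)
    show ?thesis
      using RB_class_iso[OF R Y f X(2)] SP(2)[OF f]
        RB_class_iso[OF R fin_gset_psub[OF Y PP] fin_gset_psub[OF f PP] gset_iso_psub[OF X(2) Y PP]] by simp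
  qed
  note T1 = RBT_spec(1)[OF R g1] and T2 = RBT_spec(1)[OF R g2]
  \<comment> \<open>An element of \<open>i1\<close> over \<open>(g, 1)\<close> has first coordinate
    \<open>\<iota> g\<close>, which is nontrivial exactly when \<open>g\<close> is; so on the image
    of \<open>?j\<close> the properties \<open>P\<close> and \<open>N\<close> agree.\<close>
  have 1: "SP (RBT R ?E ?D i1 e) = RBT R ?E ?D i1 (SN e)"
  proof (rule RB_ext_eq[OF R RB_module[OF R] linear_map_comp[OF T1 SP(1)] linear_map_comp[OF SN(1) T1] _ e])
    fix X assume "X \<in> fin_gsets ?D"
    hence X: "fin_gset ?D X" by (simp add: fin_gsets_iff)
    note Y = fin_gset_gT[OF g1 X] and c = corr_gT[OF g1 X]
    let ?Y = "gT ?E i1 X" and ?j = "\<lambda>x. gT_orbit ?E i1 X (\<one>\<^bsub>?E\<^esub>, x)"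
    have iff: "P (gstab ?E ?Y (?j x)) \<longleftrightarrow> N (gstab ?D X x)" if x: "x \<in> fst X" for x
    proof -
      have "P (gstab ?E ?Y (?j x)) \<longleftrightarrow> (\<exists>l g. l \<noteq> \<one>\<^bsub>\<Gamma>\<^esub> \<and> l \<in> carrier \<Gamma> \<and> g \<in> carrier G \<and>
          snd ?Y (l, (g, \<one>\<^bsub>G\<^esub>)) (?j x) = ?j x)"
        by (auto simp: P_def gstab_def)
      also have "\<dots> \<longleftrightarrow> (\<exists>l g. l \<noteq> \<one>\<^bsub>\<Gamma>\<^esub> \<and> l \<in> carrier \<Gamma> \<and> g \<in> carrier G \<and>
          (\<exists>h. ((l, (g, \<one>\<^bsub>G\<^esub>)), h) \<in> i1 \<and> snd X h x = x))"
        using corrD(3)[OF c x x] by (simp cong: conj_cong)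
      also have "\<dots> \<longleftrightarrow> (\<exists>k g. g \<noteq> \<one>\<^bsub>G\<^esub> \<and> k \<in> carrier obj_unit \<and> g \<in> carrier G \<and> snd X (k, (g, \<one>\<^bsub>G\<^esub>)) x = x)"
        unfolding i1 using inj[OF _ G.one_closed] \<iota>.hom_closed by (auto; blast)
      also have "\<dots> \<longleftrightarrow> N (gstab ?D X x)" by (auto simp: N_def gstab_def)
      finally show ?thesis .
    qed
    have "corr ?E i1 (psub ?D N X) (psub ?E P ?Y) ?j"
      unfolding psub_def
      by (intro corr_gsub[OF c ginv_psub[OF X NN] ginv_psub[OF Y PP] _ g1 Y]) (simp only: mem_Collect_eq corrD(1)[OF c] iff simp_thms)
    from RBT_class[OF R this g1 fin_gset_psub[OF X NN] fin_gset_psub[OF Y PP]]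
    show "SP (RBT R ?E ?D i1 (RB_class R ?D X)) = RBT R ?E ?D i1 (SN (RB_class R ?D X))"
      using RBT_class[OF R c g1 X Y] SP'[OF Y] SN(2)[OF X] by simp
  qed
  have zl: "linear_map R (RB R ?D) (RB R ?E) (\<lambda>_. \<zero>\<^bsub>RB R ?E\<^esub>)"
  proof -
    interpret M: module R "RB R ?E" by (rule RB_module[OF R])
    show ?thesis by (rule linear_mapI) auto
  qed
  \<comment> \<open>An element of \<open>i2\<close> over \<open>(g, 1)\<close> has first coordinate
    \<open>\<iota> 1 = 1\<close>, so \<open>P\<close> fails on the image of \<open>?j\<close> and,
    by invariance, everywhere.\<close>
  have 2: "SP (RBT R ?E ?D i2 e) = \<zero>\<^bsub>RB R ?E\<^esub>"
  proof (rule RB_ext_eq[OF R RB_module[OF R] linear_map_comp[OF T2 SP(1)] zl _ e])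
    fix X assume "X \<in> fin_gsets ?D"
    hence X: "fin_gset ?D X" by (simp add: fin_gsets_iff)
    note Y = fin_gset_gT[OF g2 X] and c = corr_gT[OF g2 X]
    let ?Y = "gT ?E i2 X" and ?j = "\<lambda>x. gT_orbit ?E i2 X (\<one>\<^bsub>?E\<^esub>, x)"
    let ?B = "{y \<in> fst ?Y. P (gstab ?E ?Y y)}"
    have nP: "\<not> P (gstab ?E ?Y (?j x))" if x: "x \<in> fst X" for x
    proof
      assume "P (gstab ?E ?Y (?j x))"
      then obtain l g where l: "l \<noteq> \<one>\<^bsub>\<Gamma>\<^esub>" "(l, (g, \<one>\<^bsub>G\<^esub>)) \<in> carrier ?E" "snd ?Y (l, (g, \<one>\<^bsub>G\<^esub>)) (?j x) = ?j x"
        by (auto simp: P_def gstab_def)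
      then obtain h where "((l, (g, \<one>\<^bsub>G\<^esub>)), h) \<in> i2" using corrD(3)[OF c x x l(2)] by blast
      thus False using l(1) by (auto simp: i2)
    qed
    have "?B = {}"
    proof (rule ccontr)
      assume "?B \<noteq> {}"
      then obtain y where y: "y \<in> ?B" by blast
      then obtain k x where kx: "k \<in> carrier ?E" "x \<in> fst X" "y = snd ?Y k (?j x)" using corrD(2)[OF c] by blast
      have "snd ?Y (inv\<^bsub>?E\<^esub> k) y \<in> ?B" using ginv_psub[OF Y PP] y kx(1) by (simp only: ginv_def E.inv_closed)
      moreover have "snd ?Y (inv\<^bsub>?E\<^esub> k) y = ?j x"
        using act_inv_cancel(1)[OF Y kx(1) corrD(1)[OF c kx(2)]] kx(3) by simp
      ultimately show False using nP[OF kx(2)] by simp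
    qed
    hence "RB_class R ?E (psub ?E P ?Y) = \<zero>\<^bsub>RB R ?E\<^esub>"
      using RB_class_empty[OF R E.is_group _ fin_gset_psub[OF Y PP]] by (simp add: psub_def gsub_simps)
    thus "SP (RBT R ?E ?D i2 (RB_class R ?D X)) = \<zero>\<^bsub>RB R ?E\<^esub>"
      using RBT_class[OF R c g2 X Y] SP'[OF Y] by simp
  qed
  have SNe: "SN e \<in> carrier (RB R ?D)" using linear_mapD(1)[OF SN(1) e] .
  have 3: "SN e = \<zero>\<^bsub>RB R ?D\<^esub>"
  proof -
    \<comment> \<open>Passing to \<open>\<Gamma>\<close>-orbits undoes the induction along
      \<open>i1\<close>; hence \<open>SN e\<close> itself vanishes, not only its image.\<close>
    let ?q = "{((k, gg), (l, gg)) | k l gg. k \<in> carrier obj_unit \<and> l \<in> carrier \<Gamma> \<and> gg \<in> carrier (G \<times>\<times> G)}"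
    have q: "grel ?D ?E ?q" by (rule grel_finiteI[OF D E]) (auto simp: u)
    have "gfull ?E ?q i1" by (rule gfull_right[OF g1]) (auto simp: Range_iff u)
    moreover have "?q O i1 = Id_on (carrier ?D)"
    proof (intro subset_antisym subsetI)
      fix z assume "z \<in> Id_on (carrier ?D)"
      then obtain a b where z: "z = ((0, (a, b)), (0, (a, b)))" "a \<in> carrier G" "b \<in> carrier G" by (auto simp: u)
      have "((0, (a, b)), (\<iota> a, (a, b))) \<in> ?q" "((\<iota> a, (a, b)), (0, (a, b))) \<in> i1" using z by (auto simp: i1 u)
      thus "z \<in> ?q O i1" unfolding z(1) by (rule relcompI)
    qed (auto simp: i1 u)
    ultimately have "RBT R ?D ?E ?q (RBT R ?E ?D i1 (SN e)) = SN e"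
      using RBT_RBT[OF R q g1 _ SNe] RBT_Id[OF R D SNe] by simp
    moreover have "RBT R ?E ?D i1 (SN e) = \<zero>\<^bsub>RB R ?E\<^esub>" using 1 2 eq by simp
    ultimately show ?thesis
      using linear_map_zero[OF RB_module[OF R] RB_module[OF R] RBT_spec(1)[OF R q]] by simp
  qed
  \<comment> \<open>The number of points on which \<open>G \<times> 1\<close> acts freely.\<close>
  let ?nN = "\<lambda>X :: (nat \<times> ('g \<times> 'g), nat) gset. card (fst X - {x \<in> fst X. N (gstab ?D X x)})"
  have dvd: "order G dvd ?nN X" if X: "fin_gset ?D X" for X :: "(nat \<times> ('g \<times> 'g), nat) gset"
  proof (rule free_action_dvd[OF G.is_group fgroupD(2)[OF G], where a = "\<lambda>g. snd X (0, (g, \<one>\<^bsub>G\<^esub>))"])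
    let ?A = "fst X - {x \<in> fst X. N (gstab ?D X x)}"
    show "finite ?A" using fin_gset_finite[OF X] by simp
    show "snd X (0, (g, \<one>\<^bsub>G\<^esub>)) x \<in> ?A" if "g \<in> carrier G" "x \<in> ?A" for g x
      using ginv_Diff[OF X ginv_psub[OF X NN]] that by (simp add: ginv_def u)
    show "snd X (0, (\<one>\<^bsub>G\<^esub>, \<one>\<^bsub>G\<^esub>)) x = x" if "x \<in> ?A" for x using act_one[OF X, of x] that by (simp add: u)
    show "snd X (0, (g \<otimes>\<^bsub>G\<^esub> h, \<one>\<^bsub>G\<^esub>)) x = snd X (0, (g, \<one>\<^bsub>G\<^esub>)) (snd X (0, (h, \<one>\<^bsub>G\<^esub>)) x)"
      if "g \<in> carrier G" "h \<in> carrier G" "x \<in> ?A" for g h x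
      using act_mult[OF X, of "(0, (g, \<one>\<^bsub>G\<^esub>))" "(0, (h, \<one>\<^bsub>G\<^esub>))" x] that by (simp add: u)
    show "g = \<one>\<^bsub>G\<^esub>" if "g \<in> carrier G" "x \<in> ?A" "snd X (0, (g, \<one>\<^bsub>G\<^esub>)) x = x" for g x
      using that by (auto simp: N_def gstab_def u)
  qed
  have card_split: "card (fst X) = card (fst (psub ?D N X)) + ?nN X" if "fin_gset ?D X" for X
    using fin_gset_finite[OF that] by (simp add: psub_def gsub_simps card_Diff_subset card_mono)
  have addc: "card (fst Z) = card (fst X) + card (fst Y)"
    if "fin_gset H X" "fin_gset H Y" "gset_iso H Z (gset_sum X Y)" for H :: "'z monoid" and X :: "('z, 'x) gset" and Y :: "('z, 'y) gset" and Z :: "('z, 'w) gset"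
    using gset_iso_card[OF that(3)] card_gset_sum fin_gset_finite that(1,2) by metis
  have addN: "?nN Z = ?nN X + ?nN Y"
    if "fin_gset ?D X" "fin_gset ?D Y" "fin_gset ?D Z" "gset_iso ?D Z (gset_sum X Y)" for X Y Z
  proof -
    have "card (fst (psub ?D N Z)) = card (fst (psub ?D N X)) + card (fst (psub ?D N Y))"
      by (rule addc[OF fin_gset_psub[OF that(1) NN] fin_gset_psub[OF that(2) NN]
            gset_iso_trans[OF gset_iso_psub[OF that(4,3) NN] gset_iso_psub_sum]])
    thus ?thesis using addc[OF that(1,2,4)] card_split[OF that(1)] card_split[OF that(2)] card_split[OF that(3)] by linarith
  qed
  obtain \<kappa> where \<kappa>: "linear_map R (RB R ?D) (ring_mod R) \<kappa>"
    "\<And>X :: (nat \<times> ('g \<times> 'g), nat) gset. fin_gset ?D X \<Longrightarrow> \<kappa> (RB_class R ?D X) = [card (fst X)] \<cdot>\<^bsub>R\<^esub> \<one>\<^bsub>R\<^esub>"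
    using functional_exists[of ?D "\<lambda>X. card (fst X)"] addc by metis
  obtain \<kappa>' where \<kappa>': "linear_map R (RB R (obj_unit \<times>\<times> G)) (ring_mod R) \<kappa>'"
    "\<And>X :: (nat \<times> 'g, nat) gset. fin_gset (obj_unit \<times>\<times> G) X \<Longrightarrow> \<kappa>' (RB_class R (obj_unit \<times>\<times> G) X) = [card (fst X)] \<cdot>\<^bsub>R\<^esub> \<one>\<^bsub>R\<^esub>"
    using functional_exists[of "obj_unit \<times>\<times> G" "\<lambda>X. card (fst X)"] addc by metis
  \<comment> \<open>The quotient by the order is taken in the natural numbers, where it is exact and
    additive; this is what makes \<open>\<phi>\<close> a functional over any
    \<open>R\<close>.\<close>
  have "?nN Z div order G = ?nN X div order G + ?nN Y div order G"
    if "fin_gset ?D X" "fin_gset ?D Y" "fin_gset ?D Z" "gset_iso ?D Z (gset_sum X Y)" for X Y Z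
    unfolding addN[OF that] by (rule div_plus_div_distrib_dvd_left[OF dvd[OF that(1)]])
  then obtain \<phi> where \<phi>: "linear_map R (RB R ?D) (ring_mod R) \<phi>"
    "\<And>X :: (nat \<times> ('g \<times> 'g), nat) gset. fin_gset ?D X \<Longrightarrow> \<phi> (RB_class R ?D X) = [(?nN X div order G)] \<cdot>\<^bsub>R\<^esub> \<one>\<^bsub>R\<^esub>"
    using functional_exists[of ?D "\<lambda>X. ?nN X div order G"] by blast
  let ?n = "[order G] \<cdot>\<^bsub>R\<^esub> \<one>\<^bsub>R\<^esub>"
  have \<kappa>n: "\<kappa> (RB_class R ?D X) = [card (fst X)] \<cdot>\<^bsub>R\<^esub> \<one>\<^bsub>R\<^esub>" if X: "fin_gset ?D X"
    for X :: "(nat \<times> ('g \<times> 'g), 'y) gset"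
  proof -
    obtain Y :: "(nat \<times> ('g \<times> 'g), nat) gset" where Y: "Y \<in> fin_gsets ?D" "gset_iso ?D X Y" using gset_iso_nat[OF X] by blast
    have f: "fin_gset ?D Y" using Y(1) by (simp add: fin_gsets_iff)
    show ?thesis using RB_class_iso[OF R X f Y(2)] \<kappa>(2)[OF f] gset_iso_card[OF Y(2)] by simp
  qed
  have \<kappa>'n: "\<kappa>' (RB_class R (obj_unit \<times>\<times> G) X) = [card (fst X)] \<cdot>\<^bsub>R\<^esub> \<one>\<^bsub>R\<^esub>" if X: "fin_gset (obj_unit \<times>\<times> G) X"
    for X :: "(nat \<times> 'g, 'y) gset"
  proof -
    obtain Y :: "(nat \<times> 'g, nat) gset" where Y: "Y \<in> fin_gsets (obj_unit \<times>\<times> G)" "gset_iso (obj_unit \<times>\<times> G) X Y" using gset_iso_nat[OF X] by blast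
    have f: "fin_gset (obj_unit \<times>\<times> G) Y" using Y(1) by (simp add: fin_gsets_iff)
    show ?thesis using RB_class_iso[OF R X f Y(2)] \<kappa>'(2)[OF f] gset_iso_card[OF Y(2)] by simp
  qed
  have rm: "module R (ring_mod R)" by (rule ring_mod_module[OF R])
  have nR: "?n \<in> carrier R" by simp
  \<comment> \<open>Cardinality is the number of selected points plus the number of free ones, the
    latter being \<open>order G\<close> times \<open>\<phi>\<close>. By linearity the splitting
    passes from sets to \<open>e\<close>.\<close>
  have "\<kappa> e = \<kappa> (SN e) \<oplus>\<^bsub>ring_mod R\<^esub> ?n \<odot>\<^bsub>ring_mod R\<^esub> \<phi> e"
  proof (rule RB_ext_eq[OF R rm \<kappa>(1) linear_map_add[OF rm linear_map_comp[OF SN(1) \<kappa>(1)] linear_map_smult[OF rm \<phi>(1) nR]] _ e])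
    fix X assume "X \<in> fin_gsets ?D"
    hence X: "fin_gset ?D X" by (simp add: fin_gsets_iff)
    have "?n \<otimes>\<^bsub>R\<^esub> ([(?nN X div order G)] \<cdot>\<^bsub>R\<^esub> \<one>\<^bsub>R\<^esub>) = [?nN X] \<cdot>\<^bsub>R\<^esub> \<one>\<^bsub>R\<^esub>"
      using R.add.nat_pow_pow[of "\<one>\<^bsub>R\<^esub>" "?nN X div order G" "order G"] dvd[OF X]
      by (simp add: R.add_pow_ldistr R.add.nat_pow_pow)
    thus "\<kappa> (RB_class R ?D X) = \<kappa> (SN (RB_class R ?D X)) \<oplus>\<^bsub>ring_mod R\<^esub> ?n \<odot>\<^bsub>ring_mod R\<^esub> \<phi> (RB_class R ?D X)"
      using card_split[OF X] by (simp add: SN(2)[OF X] \<kappa>n[OF fin_gset_psub[OF X NN]] \<kappa>(2)[OF X] \<phi>(2)[OF X] ring_mod_simps R.add.nat_pow_mult)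
  qed
  moreover have "\<kappa> (SN e) = \<zero>\<^bsub>R\<^esub>"
    unfolding 3 using linear_map_zero[OF RB_module[OF R] rm \<kappa>(1)] by (simp add: ring_mod_simps)
  moreover have "\<phi> e \<in> carrier R" using linear_mapD(1)[OF \<phi>(1) e] by (simp add: ring_mod_simps)
  ultimately have ke: "\<kappa> e = ?n \<otimes>\<^bsub>R\<^esub> \<phi> e" by (simp add: ring_mod_simps)
  \<comment> \<open>Restriction to the diagonal does not change the number of points.\<close>
  have "\<kappa>' (Tr R obj_unit G (G \<times>\<times> G) (diag_rel G) e) = \<kappa> e"
  proof (rule RB_ext_eq[OF R rm linear_map_comp[OF Tr_linear[OF R fgroup_unit grel_diag[OF G]] \<kappa>'(1)] \<kappa>(1) _ e])
    fix X assume "X \<in> fin_gsets ?D"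
    hence X: "fin_gset ?D X" by (simp add: fin_gsets_iff)
    let ?p = "\<lambda>(k, g). (k, (g, g))" let ?Y = "res_gset (obj_unit \<times>\<times> G) ?p X"
    have Y: "fin_gset (obj_unit \<times>\<times> G) ?Y"
      by (rule fin_gset_res[OF fgroupD(1)[OF fgroup_prod[OF fgroup_unit G]] _ X]) (auto simp: hom_def)
    have "Tr R obj_unit G (G \<times>\<times> G) (diag_rel G) (RB_class R ?D X) = RB_class R (obj_unit \<times>\<times> G) ?Y"
      unfolding Tr_def
      by (rule RBT_res_class[OF R Y X grel_prel[OF grel_gid[OF fgroup_unit] grel_diag[OF G]], where f = "\<lambda>x. x" and p = ?p])
         (auto simp: res_gset_def rel_defs bij_betw_def)
    thus "\<kappa>' (Tr R obj_unit G (G \<times>\<times> G) (diag_rel G) (RB_class R ?D X)) = \<kappa> (RB_class R ?D X)"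
      using \<kappa>'n[OF Y] \<kappa>(2)[OF X] by (simp add: res_gset_def)
  qed
  moreover have "\<kappa>' (gunit (RB_shift R G)) = \<one>\<^bsub>R\<^esub>"
  proof -
    have "gunit (RB_shift R G) = RB_class R (obj_unit \<times>\<times> G) pt_gset" by (simp add: RB_shift_def pt_gset_def)
    thus ?thesis
      using \<kappa>'n[OF fin_gset_pt[OF fgroupD(1)[OF fgroup_prod[OF fgroup_unit G]]]] by (simp add: pt_gset_def)
  qed
  ultimately have "?n \<otimes>\<^bsub>R\<^esub> \<phi> e = \<one>\<^bsub>R\<^esub>" using ke unit by simp
  thus ?thesis
    using \<open>\<phi> e \<in> carrier R\<close> nR by (auto simp: Units_def R.m_comm intro!: bexI[of _ "\<phi> e"])
qed

end

section \<open>The tensor square of the shifted Burnside functor\<close>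

context
  fixes R :: "('r, 'q) ring_scheme" and G :: "'g monoid"
  assumes R: "cring R" and G: "fgroup G"
begin

private abbreviation (input) "\<S> \<equiv> RB_shift R G"
private abbreviation (input) "GG \<equiv> G \<times>\<times> G"

lemma GG: "fgroup GG" by (rule fgroup_prod[OF G G])

lemma RB_add_smult_closed:
  "x \<in> carrier (RB R H) \<Longrightarrow> y \<in> carrier (RB R H) \<Longrightarrow> x \<oplus>\<^bsub>RB R H\<^esub> y \<in> carrier (RB R H)"
  "r \<in> carrier R \<Longrightarrow> x \<in> carrier (RB R H) \<Longrightarrow> r \<odot>\<^bsub>RB R H\<^esub> x \<in> carrier (RB R H)"
proof -
  interpret M: module R "RB R H" by (rule RB_module[OF R])
  show "x \<in> carrier (RB R H) \<Longrightarrow> y \<in> carrier (RB R H) \<Longrightarrow> x \<oplus>\<^bsub>RB R H\<^esub> y \<in> carrier (RB R H)"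
    "r \<in> carrier R \<Longrightarrow> x \<in> carrier (RB R H) \<Longrightarrow> r \<odot>\<^bsub>RB R H\<^esub> x \<in> carrier (RB R H)" by simp_all
qed

lemma day_gens_iff:
  "(P, Q, \<phi>, m, n) \<in> day_gens R \<S> \<S> K \<longleftrightarrow> fgroup P \<and> fgroup Q \<and> \<phi> \<in> carrier (RB R (K \<times>\<times> (P \<boxtimes> Q))) \<and>
    m \<in> carrier (RB R (P \<times>\<times> G)) \<and> n \<in> carrier (RB R (Q \<times>\<times> G))"
  by (simp add: day_gens_def fin_groups_iff RB_shift_simps)

lemma fmor_shift:
  assumes "fgroup P" "fgroup Q" "\<alpha> \<in> carrier (RB R (Q \<times>\<times> P))" "m \<in> carrier (RB R (P \<times>\<times> G))"
  shows "fmor \<S> P Q \<alpha> m = RB_comp R Q P G \<alpha> m" "RB_comp R Q P G \<alpha> m \<in> carrier (RB R (Q \<times>\<times> G))"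
  using RB_shift_fmor[OF R] RB_comp_closed[OF R] assms G by blast+

private abbreviation (input) "F K \<equiv> free_module R (day_gens R \<S> \<S> K)"

text \<open>Case analysis over the seven families of relations, made once, with \<open>fmor\<close>
  already replaced by composition.\<close>

lemma day_rels_cases:
  assumes "(x, y) \<in> day_rels R \<S> \<S> K"
    and "\<And>P Q \<phi> \<psi> m n. (P, Q, \<phi>, m, n) \<in> day_gens R \<S> \<S> K \<Longrightarrow> \<psi> \<in> carrier (RB R (K \<times>\<times> (P \<boxtimes> Q))) \<Longrightarrow>
      T (free_gen R (P, Q, \<phi> \<oplus>\<^bsub>RB R (K \<times>\<times> (P \<boxtimes> Q))\<^esub> \<psi>, m, n))
        (free_gen R (P, Q, \<phi>, m, n) \<oplus>\<^bsub>F K\<^esub> free_gen R (P, Q, \<psi>, m, n))"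
    and "\<And>P Q \<phi> m m' n. (P, Q, \<phi>, m, n) \<in> day_gens R \<S> \<S> K \<Longrightarrow> m' \<in> carrier (RB R (P \<times>\<times> G)) \<Longrightarrow>
      T (free_gen R (P, Q, \<phi>, m \<oplus>\<^bsub>RB R (P \<times>\<times> G)\<^esub> m', n))
        (free_gen R (P, Q, \<phi>, m, n) \<oplus>\<^bsub>F K\<^esub> free_gen R (P, Q, \<phi>, m', n))"
    and "\<And>P Q \<phi> m n n'. (P, Q, \<phi>, m, n) \<in> day_gens R \<S> \<S> K \<Longrightarrow> n' \<in> carrier (RB R (Q \<times>\<times> G)) \<Longrightarrow>
      T (free_gen R (P, Q, \<phi>, m, n \<oplus>\<^bsub>RB R (Q \<times>\<times> G)\<^esub> n'))
        (free_gen R (P, Q, \<phi>, m, n) \<oplus>\<^bsub>F K\<^esub> free_gen R (P, Q, \<phi>, m, n'))"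
    and "\<And>P Q r \<phi> m n. (P, Q, \<phi>, m, n) \<in> day_gens R \<S> \<S> K \<Longrightarrow> r \<in> carrier R \<Longrightarrow>
      T (free_gen R (P, Q, r \<odot>\<^bsub>RB R (K \<times>\<times> (P \<boxtimes> Q))\<^esub> \<phi>, m, n)) (r \<odot>\<^bsub>F K\<^esub> free_gen R (P, Q, \<phi>, m, n))"
    and "\<And>P Q r \<phi> m n. (P, Q, \<phi>, m, n) \<in> day_gens R \<S> \<S> K \<Longrightarrow> r \<in> carrier R \<Longrightarrow>
      T (free_gen R (P, Q, \<phi>, r \<odot>\<^bsub>RB R (P \<times>\<times> G)\<^esub> m, n)) (r \<odot>\<^bsub>F K\<^esub> free_gen R (P, Q, \<phi>, m, n))"
    and "\<And>P Q r \<phi> m n. (P, Q, \<phi>, m, n) \<in> day_gens R \<S> \<S> K \<Longrightarrow> r \<in> carrier R \<Longrightarrow>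
      T (free_gen R (P, Q, \<phi>, m, r \<odot>\<^bsub>RB R (Q \<times>\<times> G)\<^esub> n)) (r \<odot>\<^bsub>F K\<^esub> free_gen R (P, Q, \<phi>, m, n))"
    and "\<And>P Q P' Q' \<phi> \<alpha> \<beta> m n. fgroup P \<Longrightarrow> fgroup Q \<Longrightarrow> fgroup P' \<Longrightarrow> fgroup Q' \<Longrightarrow>
      \<phi> \<in> carrier (RB R (K \<times>\<times> (P' \<boxtimes> Q'))) \<Longrightarrow> \<alpha> \<in> carrier (RB R (P' \<times>\<times> P)) \<Longrightarrow> \<beta> \<in> carrier (RB R (Q' \<times>\<times> Q)) \<Longrightarrow>
      m \<in> carrier (RB R (P \<times>\<times> G)) \<Longrightarrow> n \<in> carrier (RB R (Q \<times>\<times> G)) \<Longrightarrow>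
      T (free_gen R (P, Q, RB_comp R K (P' \<boxtimes> Q') (P \<boxtimes> Q) \<phi> (mor_times R P P' Q Q' \<alpha> \<beta>), m, n))
        (free_gen R (P', Q', \<phi>, RB_comp R P' P G \<alpha> m, RB_comp R Q' Q G \<beta> n))"
  shows "T x y"
  using assms(1) unfolding day_rels_def Let_def RB_shift_simps fin_groups_iff
proof (elim UnE CollectE exE conjE)
  fix P Q P' Q' \<phi> \<alpha> \<beta> m n
  assume xy: "(x, y) = (free_gen R (P, Q, RB_comp R K (P' \<boxtimes> Q') (P \<boxtimes> Q) \<phi> (mor_times R P P' Q Q' \<alpha> \<beta>), m, n),
      free_gen R (P', Q', \<phi>, fmor \<S> P P' \<alpha> m, fmor \<S> Q Q' \<beta> n))"
    and a: "fgroup P" "fgroup Q" "fgroup P'" "fgroup Q'" "\<phi> \<in> carrier (RB R (K \<times>\<times> (P' \<boxtimes> Q')))"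
      "\<alpha> \<in> carrier (RB R (P' \<times>\<times> P))" "\<beta> \<in> carrier (RB R (Q' \<times>\<times> Q))"
      "m \<in> carrier (RB R (P \<times>\<times> G))" "n \<in> carrier (RB R (Q \<times>\<times> G))"
  show "T x y" using assms(8)[OF a] xy fmor_shift(1)[OF a(1,3,6,8)] fmor_shift(1)[OF a(2,4,7,9)] by simp
qed (use assms(2-7) in simp_all)

lemma day_rels_carrier:
  assumes K: "fgroup K"
  shows "day_rels R \<S> \<S> K \<subseteq> carrier (F K) \<times> carrier (F K)"
proof (rule subrelI)
  fix x y assume xy: "(x, y) \<in> day_rels R \<S> \<S> K"
  interpret F: module R "F K" by (rule free_module_module[OF R])
  note g = free_gen_carrier[OF R]
  have "x \<in> carrier (F K) \<and> y \<in> carrier (F K)"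
    using xy
    by (rule day_rels_cases)
      (simp_all add: F.a_closed F.smult_closed g day_gens_iff RB_add_smult_closed
        RB_comp_closed[OF R] mor_times_closed[OF R] fgroups K G)
  thus "(x, y) \<in> carrier (F K) \<times> carrier (F K)" by simp
qed

lemma day_compatible:
  assumes K: "fgroup K" and N: "module R N" and f: "f \<in> day_gens R \<S> \<S> K \<rightarrow> carrier N"
    and l: "\<And>P Q m n. fgroup P \<Longrightarrow> fgroup Q \<Longrightarrow> m \<in> carrier (RB R (P \<times>\<times> G)) \<Longrightarrow> n \<in> carrier (RB R (Q \<times>\<times> G)) \<Longrightarrow>
        linear_map R (RB R (K \<times>\<times> (P \<boxtimes> Q))) N (\<lambda>\<phi>. f (P, Q, \<phi>, m, n))"
      "\<And>P Q \<phi> n. fgroup P \<Longrightarrow> fgroup Q \<Longrightarrow> \<phi> \<in> carrier (RB R (K \<times>\<times> (P \<boxtimes> Q))) \<Longrightarrow> n \<in> carrier (RB R (Q \<times>\<times> G)) \<Longrightarrow>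
        linear_map R (RB R (P \<times>\<times> G)) N (\<lambda>m. f (P, Q, \<phi>, m, n))"
      "\<And>P Q \<phi> m. fgroup P \<Longrightarrow> fgroup Q \<Longrightarrow> \<phi> \<in> carrier (RB R (K \<times>\<times> (P \<boxtimes> Q))) \<Longrightarrow> m \<in> carrier (RB R (P \<times>\<times> G)) \<Longrightarrow>
        linear_map R (RB R (Q \<times>\<times> G)) N (\<lambda>n. f (P, Q, \<phi>, m, n))"
    and c: "\<And>P Q P' Q' \<phi> \<alpha> \<beta> m n. fgroup P \<Longrightarrow> fgroup Q \<Longrightarrow> fgroup P' \<Longrightarrow> fgroup Q' \<Longrightarrow>
      \<phi> \<in> carrier (RB R (K \<times>\<times> (P' \<boxtimes> Q'))) \<Longrightarrow> \<alpha> \<in> carrier (RB R (P' \<times>\<times> P)) \<Longrightarrow> \<beta> \<in> carrier (RB R (Q' \<times>\<times> Q)) \<Longrightarrow>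
      m \<in> carrier (RB R (P \<times>\<times> G)) \<Longrightarrow> n \<in> carrier (RB R (Q \<times>\<times> G)) \<Longrightarrow>
      f (P, Q, RB_comp R K (P' \<boxtimes> Q') (P \<boxtimes> Q) \<phi> (mor_times R P P' Q Q' \<alpha> \<beta>), m, n) =
      f (P', Q', \<phi>, RB_comp R P' P G \<alpha> m, RB_comp R Q' Q G \<beta> n)"
  shows "compatible R (day_gens R \<S> \<S> K) (day_rels R \<S> \<S> K) N f"
proof -
  note lin = comb_linear[OF R N f]
  note cg = comb_gen[OF R N f] and ca = linear_mapD(2)[OF lin] and cs = linear_mapD(3)[OF lin]
  note g = free_gen_carrier[OF R]
  have "comb R N f x = comb R N f y" if xy: "(x, y) \<in> day_rels R \<S> \<S> K" for x y
    using xy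
  proof (rule day_rels_cases)
  qed (simp_all add: cg ca cs g day_gens_iff RB_add_smult_closed RB_comp_closed[OF R] mor_times_closed[OF R] fgroups K G
    linear_mapD(2,3)[OF l(1)] linear_mapD(2,3)[OF l(2)] linear_mapD(2,3)[OF l(3)] c)
  thus ?thesis unfolding compatible_def[OF R day_rels_carrier[OF K]] using f by blast
qed

lemma day_obj_module: "fgroup K \<Longrightarrow> module R (day_obj R \<S> \<S> K)"
  unfolding day_obj_def by (rule presented_module_module[OF R day_rels_carrier])

lemma day_class_closed: "fgroup K \<Longrightarrow> s \<in> day_gens R \<S> \<S> K \<Longrightarrow> day_class R \<S> \<S> K s \<in> carrier (day_obj R \<S> \<S> K)"
  unfolding day_obj_def day_class_def by (rule presented_gen_closed[OF R day_rels_carrier])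

lemma pq_linear:
  assumes "fgroup P" "fgroup Q"
  shows "n \<in> carrier (RB R (Q \<times>\<times> G)) \<Longrightarrow>
      linear_map R (RB R (P \<times>\<times> G)) (RB R ((P \<boxtimes> Q) \<times>\<times> GG)) (\<lambda>m. pq R G P Q m n)"
    and "m \<in> carrier (RB R (P \<times>\<times> G)) \<Longrightarrow>
      linear_map R (RB R (Q \<times>\<times> G)) (RB R ((P \<boxtimes> Q) \<times>\<times> GG)) (\<lambda>n. pq R G P Q m n)"
  unfolding pq_def
  by (rule RBT_linear[OF R grel_pq(1)[OF assms G] RBX_linear_left[OF R fgroup_prod[OF assms(1) G] fgroup_prod[OF assms(2) G] linear_map_id]];
      assumption)
    (rule RBT_linear[OF R grel_pq(1)[OF assms G] RBX_linear_right[OF R fgroup_prod[OF assms(1) G] fgroup_prod[OF assms(2) G] linear_map_id]];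
      assumption)

text \<open>\<open>RB_G\<close> is represented by \<open>G\<close>, so its Day convolution square is
  represented by \<open>G \<times> G\<close>; this is the comparison map on generators.\<close>

definition day_gen_map :: "obj \<Rightarrow> ('r, ('r, nat \<times> 'g) rb_elt, ('r, nat \<times> 'g) rb_elt) day_gen \<Rightarrow> ('r, nat \<times> ('g \<times> 'g)) rb_elt" where
  "day_gen_map K = (\<lambda>(P, Q, \<phi>, m, n). RB_comp R K (P \<boxtimes> Q) GG \<phi> (pq R G P Q m n))"

definition day_map :: "obj \<Rightarrow> ('r, ('r, nat \<times> 'g) rb_elt, ('r, nat \<times> 'g) rb_elt) day_elt \<Rightarrow> ('r, nat \<times> ('g \<times> 'g)) rb_elt" where
  "day_map K = lin_ext R (RB R (K \<times>\<times> GG)) (day_gen_map K)"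

lemma day_gen_map_compatible:
  assumes K: "fgroup K"
  shows "compatible R (day_gens R \<S> \<S> K) (day_rels R \<S> \<S> K) (RB R (K \<times>\<times> GG)) (day_gen_map K)"
proof (rule day_compatible[OF K RB_module[OF R]])
  show "day_gen_map K \<in> day_gens R \<S> \<S> K \<rightarrow> carrier (RB R (K \<times>\<times> GG))"
    by (auto simp: day_gen_map_def day_gens_iff RB_comp_closed[OF R] pq_closed[OF R] fgroups K G)
next
  fix P Q :: obj and m n assume "fgroup P" "fgroup Q" "m \<in> carrier (RB R (P \<times>\<times> G))" "n \<in> carrier (RB R (Q \<times>\<times> G))"
  thus "linear_map R (RB R (K \<times>\<times> (P \<boxtimes> Q))) (RB R (K \<times>\<times> GG)) (\<lambda>\<phi>. day_gen_map K (P, Q, \<phi>, m, n))"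
    unfolding day_gen_map_def prod.case
    by (intro RB_comp_linear(1)[OF R K] pq_closed[OF R] fgroups G GG)
next
  fix P Q \<phi> n assume a: "fgroup P" "fgroup Q" "\<phi> \<in> carrier (RB R (K \<times>\<times> (P \<boxtimes> Q)))" "n \<in> carrier (RB R (Q \<times>\<times> G))"
  show "linear_map R (RB R (P \<times>\<times> G)) (RB R (K \<times>\<times> GG)) (\<lambda>m. day_gen_map K (P, Q, \<phi>, m, n))"
    unfolding day_gen_map_def prod.case
    by (rule linear_map_comp[OF pq_linear(1)[OF a(1,2,4)] RB_comp_linear(2)[OF R K fgroup_box[OF a(1,2)] GG a(3)]])
next
  fix P Q \<phi> m assume a: "fgroup P" "fgroup Q" "\<phi> \<in> carrier (RB R (K \<times>\<times> (P \<boxtimes> Q)))" "m \<in> carrier (RB R (P \<times>\<times> G))"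
  show "linear_map R (RB R (Q \<times>\<times> G)) (RB R (K \<times>\<times> GG)) (\<lambda>n. day_gen_map K (P, Q, \<phi>, m, n))"
    unfolding day_gen_map_def prod.case
    by (rule linear_map_comp[OF pq_linear(2)[OF a(1,2,4)] RB_comp_linear(2)[OF R K fgroup_box[OF a(1,2)] GG a(3)]])
next
  fix P Q P' Q' :: obj and \<phi> \<alpha> \<beta> m n
  assume a: "fgroup P" "fgroup Q" "fgroup P'" "fgroup Q'" "\<phi> \<in> carrier (RB R (K \<times>\<times> (P' \<boxtimes> Q')))"
      "\<alpha> \<in> carrier (RB R (P' \<times>\<times> P))" "\<beta> \<in> carrier (RB R (Q' \<times>\<times> Q))"
      "m \<in> carrier (RB R (P \<times>\<times> G))" "n \<in> carrier (RB R (Q \<times>\<times> G))"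
  show "day_gen_map K (P, Q, RB_comp R K (P' \<boxtimes> Q') (P \<boxtimes> Q) \<phi> (mor_times R P P' Q Q' \<alpha> \<beta>), m, n) =
      day_gen_map K (P', Q', \<phi>, RB_comp R P' P G \<alpha> m, RB_comp R Q' Q G \<beta> n)"
    using a unfolding day_gen_map_def prod.case
    by (simp add: RB_comp_assoc[OF R] mor_times_closed[OF R] pq_closed[OF R] comp_mor_times_pq[OF R] fgroups K G)
qed

lemma day_map_linear: "fgroup K \<Longrightarrow> linear_map R (day_obj R \<S> \<S> K) (RB R (K \<times>\<times> GG)) (day_map K)"
  unfolding day_obj_def day_map_def
  by (rule lin_ext_linear[OF R day_rels_carrier RB_module[OF R] day_gen_map_compatible])

lemmas day_map_closed = linear_mapD(1)[OF day_map_linear]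

lemma day_map_class:
  "fgroup K \<Longrightarrow> (P, Q, \<phi>, m, n) \<in> day_gens R \<S> \<S> K \<Longrightarrow>
    day_map K (day_class R \<S> \<S> K (P, Q, \<phi>, m, n)) = RB_comp R K (P \<boxtimes> Q) GG \<phi> (pq R G P Q m n)"
  unfolding day_class_def day_map_def
  using lin_ext_gen[OF R day_rels_carrier RB_module[OF R] day_gen_map_compatible, of K "(P, Q, \<phi>, m, n)"]
  by (simp add: day_gen_map_def)

lemmas day_transport = lin_ext_transport[OF R day_rels_carrier, folded day_obj_def day_class_def]

text \<open>With the identity as \<open>k\<close>, \<open>lin_ext_transport\<close> yields the value
  of the product morphism together with its independence of the representative; the coend relations
  enter only through \<open>day_map\<close>.\<close>

lemma product_mor_eq:
  assumes K: "fgroup K" and C: "C \<in> carrier (day_obj R \<S> \<S> K)"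
  shows "product_mor R \<S> K C = Tr R K G GG (diag_rel G) (day_map K C)"
  unfolding product_mor_def RB_shift_simps
proof (rule day_transport(1)[OF K RB_module[OF R] RB_module[OF R] _ linear_map_id
      linear_map_comp[OF day_map_linear[OF K] Tr_linear[OF R K grel_diag[OF G]]] _ C])
  show "(\<lambda>(P, Q, \<phi>, a, b). fmor \<S> (P \<boxtimes> Q) K \<phi> (gmult \<S> P Q a b)) \<in> day_gens R \<S> \<S> K \<rightarrow> carrier (RB R (K \<times>\<times> G))"
    by (auto simp: day_gens_iff fmor_shift shift_closed[OF R] fgroups K G)
  fix s assume s: "s \<in> day_gens R \<S> \<S> K"
  obtain P Q \<phi> a b where [simp]: "s = (P, Q, \<phi>, a, b)" by (cases s) auto
  have *: "fgroup P" "fgroup Q" "\<phi> \<in> carrier (RB R (K \<times>\<times> (P \<boxtimes> Q)))" "a \<in> carrier (RB R (P \<times>\<times> G))"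
    "b \<in> carrier (RB R (Q \<times>\<times> G))" using s by (simp_all add: day_gens_iff)
  have "RB_comp R K (P \<boxtimes> Q) G \<phi> (gmult \<S> P Q a b) =
      RB_comp R K (P \<boxtimes> Q) G \<phi> (Tr R (P \<boxtimes> Q) G GG (diag_rel G) (pq R G P Q a b))"
    using Tr_diag_pq[OF R *(1,2) G *(4,5)] by simp
  also have "\<dots> = Tr R K G GG (diag_rel G) (RB_comp R K (P \<boxtimes> Q) GG \<phi> (pq R G P Q a b))"
    by (rule comp_Tr[OF R K fgroup_box[OF *(1,2)] G GG grel_diag[OF G] *(3) pq_closed[OF R *(1,2) G *(4,5)]])
  finally show "(case s of (P, Q, \<phi>, a, b) \<Rightarrow> fmor \<S> (P \<boxtimes> Q) K \<phi> (gmult \<S> P Q a b)) =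
      Tr R K G GG (diag_rel G) (day_map K (day_class R \<S> \<S> K s))"
    using s * by (simp add: day_map_class K fmor_shift fgroup_box shift_closed[OF R] G)
qed

text \<open>Well-definedness of \<open>day_mor\<close> is not examined directly: the image of its
  value under \<open>day_map\<close> is determined whatever representative was chosen. The two
  actions are treated in the same way.\<close>

lemma day_map_mor:
  assumes K: "fgroup K" and L: "fgroup L" and \<psi>: "\<psi> \<in> carrier (RB R (L \<times>\<times> K))" and C: "C \<in> carrier (day_obj R \<S> \<S> K)"
  shows "day_map L (day_mor R \<S> \<S> K L \<psi> C) = RB_comp R L K GG \<psi> (day_map K C)"
    and "day_mor R \<S> \<S> K L \<psi> C \<in> carrier (day_obj R \<S> \<S> L)"
proof -
  let ?f = "\<lambda>(P, Q, \<phi>, m, n). day_class R \<S> \<S> L (P, Q, RB_comp R L K (P \<boxtimes> Q) \<psi> \<phi>, m, n)"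
  have f: "?f \<in> day_gens R \<S> \<S> K \<rightarrow> carrier (day_obj R \<S> \<S> L)"
    by (auto simp: day_gens_iff RB_comp_closed[OF R] fgroups K L \<psi> intro!: day_class_closed)
  have g: "day_map L (?f s) = RB_comp R L K GG \<psi> (day_map K (day_class R \<S> \<S> K s))" if "s \<in> day_gens R \<S> \<S> K" for s
    using that
    by (cases s) (simp add: day_gens_iff day_map_class RB_comp_closed[OF R] RB_comp_assoc[OF R] pq_closed[OF R] fgroups K L G \<psi>)
  note t = day_transport[OF K day_obj_module[OF L] RB_module[OF R] f day_map_linear[OF L]
    linear_map_comp[OF day_map_linear[OF K] RB_comp_linear(2)[OF R L K GG \<psi>]] g C]
  show "day_map L (day_mor R \<S> \<S> K L \<psi> C) = RB_comp R L K GG \<psi> (day_map K C)"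
    "day_mor R \<S> \<S> K L \<psi> C \<in> carrier (day_obj R \<S> \<S> L)"
    unfolding day_mor_def by (rule t; assumption)+
qed

lemma day_map_lact:
  assumes L: "fgroup L" and K: "fgroup K" and a: "a \<in> carrier (RB R (L \<times>\<times> G))" and C: "C \<in> carrier (day_obj R \<S> \<S> K)"
  shows "day_map (L \<boxtimes> K) (lact (tensor_square R \<S>) L K a C) = la R G L K a (day_map K C)"
    and "lact (tensor_square R \<S>) L K a C \<in> carrier (day_obj R \<S> \<S> (L \<boxtimes> K))"
proof -
  let ?\<phi> = "\<lambda>P Q \<phi>. RB_comp R (L \<boxtimes> K) (L \<boxtimes> (P \<boxtimes> Q)) ((L \<boxtimes> P) \<boxtimes> Q)
            (mor_times R L L (P \<boxtimes> Q) K (RB_id R L) \<phi>) (assoc_mor R L P Q)"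
  let ?f = "\<lambda>(P, Q, \<phi>, m, n). day_class R \<S> \<S> (L \<boxtimes> K) (L \<boxtimes> P, Q, ?\<phi> P Q \<phi>, gmult \<S> L P a m, n)"
  have LK: "fgroup (L \<boxtimes> K)" using L K by (rule fgroup_box)
  have m: "(L \<boxtimes> P, Q, ?\<phi> P Q \<phi>, gmult \<S> L P a m, n) \<in> day_gens R \<S> \<S> (L \<boxtimes> K)"
    if "(P, Q, \<phi>, m, n) \<in> day_gens R \<S> \<S> K" for P Q \<phi> m n
    using that RB_hom_closed[OF R L L, of id]
    by (simp add: day_gens_iff RB_comp_closed[OF R] mor_times_closed[OF R] assoc_closed[OF R] shift_closed[OF R]
        fgroups L K G a RB_id_def hom_def)
  have f: "?f \<in> day_gens R \<S> \<S> K \<rightarrow> carrier (day_obj R \<S> \<S> (L \<boxtimes> K))"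
    using day_class_closed[OF LK m] by auto
  have g: "day_map (L \<boxtimes> K) (?f s) = la R G L K a (day_map K (day_class R \<S> \<S> K s))" if "s \<in> day_gens R \<S> \<S> K" for s
  proof -
    obtain P Q \<phi> m n where s: "s = (P, Q, \<phi>, m, n)" by (cases s) auto
    show ?thesis
      using that comp_lact[OF R L K _ _ G _ a] unfolding s
      by (simp add: day_map_class[OF LK m] day_map_class[OF K]) (simp add: day_gens_iff)
  qed
  note t = day_transport[where f = ?f and k = "day_map (L \<boxtimes> K)" and h = "\<lambda>C. la R G L K a (day_map K C)" and C = C,
    OF K day_obj_module[OF LK] RB_module[OF R] f day_map_linear[OF LK]
    linear_map_comp[OF day_map_linear[OF K] la_linear(1)[OF R L K G a]] g C]
  show "day_map (L \<boxtimes> K) (lact (tensor_square R \<S>) L K a C) = la R G L K a (day_map K C)"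
    "lact (tensor_square R \<S>) L K a C \<in> carrier (day_obj R \<S> \<S> (L \<boxtimes> K))"
    unfolding tensor_square_def bimod.simps by (rule t; assumption)+
qed

lemma day_map_ract:
  assumes L: "fgroup L" and K: "fgroup K" and a: "a \<in> carrier (RB R (L \<times>\<times> G))" and C: "C \<in> carrier (day_obj R \<S> \<S> K)"
  shows "day_map (K \<boxtimes> L) (ract (tensor_square R \<S>) K L C a) = ra R G K L (day_map K C) a"
    and "ract (tensor_square R \<S>) K L C a \<in> carrier (day_obj R \<S> \<S> (K \<boxtimes> L))"
proof -
  let ?\<phi> = "\<lambda>P Q \<phi>. RB_comp R (K \<boxtimes> L) ((P \<boxtimes> Q) \<boxtimes> L) (P \<boxtimes> (Q \<boxtimes> L))
            (mor_times R (P \<boxtimes> Q) K L L \<phi> (RB_id R L)) (assoc_inv_mor R P Q L)"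
  let ?f = "\<lambda>(P, Q, \<phi>, m, n). day_class R \<S> \<S> (K \<boxtimes> L) (P, Q \<boxtimes> L, ?\<phi> P Q \<phi>, m, gmult \<S> Q L n a)"
  have KL: "fgroup (K \<boxtimes> L)" using K L by (rule fgroup_box)
  have m: "(P, Q \<boxtimes> L, ?\<phi> P Q \<phi>, m, gmult \<S> Q L n a) \<in> day_gens R \<S> \<S> (K \<boxtimes> L)"
    if "(P, Q, \<phi>, m, n) \<in> day_gens R \<S> \<S> K" for P Q \<phi> m n
    using that RB_hom_closed[OF R L L, of id]
    by (simp add: day_gens_iff RB_comp_closed[OF R] mor_times_closed[OF R] assoc_closed[OF R] shift_closed[OF R]
        fgroups L K G a RB_id_def hom_def)
  have f: "?f \<in> day_gens R \<S> \<S> K \<rightarrow> carrier (day_obj R \<S> \<S> (K \<boxtimes> L))"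
    using day_class_closed[OF KL m] by auto
  have g: "day_map (K \<boxtimes> L) (?f s) = ra R G K L (day_map K (day_class R \<S> \<S> K s)) a" if "s \<in> day_gens R \<S> \<S> K" for s
  proof -
    obtain P Q \<phi> m n where s: "s = (P, Q, \<phi>, m, n)" by (cases s) auto
    show ?thesis
      using that comp_ract[OF R L K _ _ G _ a] unfolding s
      by (simp add: day_map_class[OF KL m] day_map_class[OF K]) (simp add: day_gens_iff)
  qed
  note t = day_transport[where f = ?f and k = "day_map (K \<boxtimes> L)" and h = "\<lambda>C. ra R G K L (day_map K C) a" and C = C,
    OF K day_obj_module[OF KL] RB_module[OF R] f day_map_linear[OF KL]
    linear_map_comp[OF day_map_linear[OF K] la_linear(2)[OF R L K G a]] g C]
  show "day_map (K \<boxtimes> L) (ract (tensor_square R \<S>) K L C a) = ra R G K L (day_map K C) a"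
    "ract (tensor_square R \<S>) K L C a \<in> carrier (day_obj R \<S> \<S> (K \<boxtimes> L))"
    unfolding tensor_square_def bimod.simps by (rule t; assumption)+
qed

text \<open>Read through \<open>day_map\<close>, the product morphism is restriction to the
  diagonal, which commutes with composition (\<open>comp_Tr\<close>) and with both actions
  (\<open>Tr_diag_la\<close>).\<close>

lemma product_bimod_hom:
  "bimod_hom R \<S> (tensor_square R \<S>) (regular_bimod \<S>) (product_mor R \<S>)"
proof -
  have t: "fobj (tensor_square R \<S>) = day_obj R \<S> \<S>" "fmor (tensor_square R \<S>) = day_mor R \<S> \<S>"
    by (simp_all add: tensor_square_def)
  note d = grel_diag[OF G]
  show ?thesis
    unfolding bimod_hom_def fin_groups_iff regular_bimod_def bimod.simps biset_fun.simps t RB_shift_simps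
  proof (intro conjI ballI)
    fix H assume "H \<in> fin_groups"
    hence H: "fgroup H" by (simp add: fin_groups_iff)
    show "linear_map R (day_obj R \<S> \<S> H) (RB R (H \<times>\<times> G)) (product_mor R \<S> H)"
      by (rule linear_map_cong[OF day_obj_module[OF H] linear_map_comp[OF day_map_linear[OF H] Tr_linear[OF R H d]]])
         (simp add: product_mor_eq[OF H])
  next
    fix H K \<alpha> m assume "H \<in> fin_groups" "K \<in> fin_groups"
      and \<alpha>: "\<alpha> \<in> carrier (RB R (K \<times>\<times> H))" and m: "m \<in> carrier (day_obj R \<S> \<S> H)"
    hence H: "fgroup H" and K: "fgroup K" by (simp_all add: fin_groups_iff)
    show "product_mor R \<S> K (day_mor R \<S> \<S> H K \<alpha> m) = fmor \<S> H K \<alpha> (product_mor R \<S> H m)"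
      using comp_Tr[OF R K H G GG d \<alpha> day_map_closed[OF H m]]
      by (simp add: product_mor_eq H K m day_map_mor[OF H K \<alpha> m] fmor_shift(1)[OF H K \<alpha>] Tr_closed[OF R H d] day_map_closed)
  next
    fix L K a m assume "L \<in> fin_groups" "K \<in> fin_groups"
      and a: "a \<in> carrier (RB R (L \<times>\<times> G))" and m: "m \<in> carrier (day_obj R \<S> \<S> K)"
    hence L: "fgroup L" and K: "fgroup K" by (simp_all add: fin_groups_iff)
    show "product_mor R \<S> (L \<boxtimes> K) (lact (tensor_square R \<S>) L K a m) = gmult \<S> L K a (product_mor R \<S> K m)"
      using day_map_lact[OF L K a m] Tr_diag_la(1)[OF R L K G a day_map_closed[OF K m]]
      by (simp add: product_mor_eq fgroup_box L K m)
    show "product_mor R \<S> (K \<boxtimes> L) (ract (tensor_square R \<S>) K L m a) = gmult \<S> K L (product_mor R \<S> K m) a"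
      using day_map_ract[OF L K a m] Tr_diag_la(2)[OF R L K G a day_map_closed[OF K m]]
      by (simp add: product_mor_eq fgroup_box L K m)
  qed
qed

section \<open>The inverse Yoneda map, based on a copy of \<open>G\<close> among the objects, and
  the two directions\<close>

context
  fixes \<Gamma> :: obj and \<iota>
  assumes \<Gamma>: "fgroup \<Gamma>" and \<iota>: "\<iota> \<in> hom G \<Gamma>" "bij_betw \<iota> (carrier G) (carrier \<Gamma>)"
begin

private abbreviation (input) "u \<equiv> RB_hom R G \<Gamma> \<iota>"

lemma u_closed: "u \<in> carrier (RB R (\<Gamma> \<times>\<times> G))" by (rule RB_hom_closed[OF R G \<Gamma> \<iota>(1)])

lemmas \<iota>2_hom = \<iota>2[OF R G \<Gamma> \<iota>]

text \<open>\<open>u\<close>, the isomorphism of \<open>G\<close> with its copy, is the universal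
  element. The pairing of \<open>u\<close> with itself is the universal element for
  \<open>G \<times> G\<close>, so every \<open>w\<close> is obtained from it by a morphism out of
  \<open>\<Gamma> \<boxtimes> \<Gamma>\<close>.\<close>

definition day_inv :: "obj \<Rightarrow> ('r, nat \<times> ('g \<times> 'g)) rb_elt \<Rightarrow> ('r, ('r, nat \<times> 'g) rb_elt, ('r, nat \<times> 'g) rb_elt) day_elt" where
  "day_inv K w = day_class R \<S> \<S> K (\<Gamma>, \<Gamma>, Tr R K (\<Gamma> \<boxtimes> \<Gamma>) GG (hom_rel GG (\<iota>2 \<iota>)) w, u, u)"

lemma grel_\<iota>2: "grel (\<Gamma> \<boxtimes> \<Gamma>) GG (hom_rel GG (\<iota>2 \<iota>))"
  by (rule grel_hom_rels(1)[OF GG fgroup_box[OF \<Gamma> \<Gamma>] \<iota>2_hom(1)])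

lemma day_inv_gen:
  assumes "fgroup K" "w \<in> carrier (RB R (K \<times>\<times> GG))"
  shows "(\<Gamma>, \<Gamma>, Tr R K (\<Gamma> \<boxtimes> \<Gamma>) GG (hom_rel GG (\<iota>2 \<iota>)) w, u, u) \<in> day_gens R \<S> \<S> K"
  by (simp add: day_gens_iff \<Gamma> u_closed Tr_closed[OF R assms(1) grel_\<iota>2 assms(2)])

lemma day_inv_closed:
  "fgroup K \<Longrightarrow> w \<in> carrier (RB R (K \<times>\<times> GG)) \<Longrightarrow> day_inv K w \<in> carrier (day_obj R \<S> \<S> K)"
  unfolding day_inv_def by (intro day_class_closed day_inv_gen)

lemma day_class_add:
  assumes K: "fgroup K" and s: "(P, Q, \<phi>, m, n) \<in> day_gens R \<S> \<S> K" and \<psi>: "\<psi> \<in> carrier (RB R (K \<times>\<times> (P \<boxtimes> Q)))"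
  shows "day_class R \<S> \<S> K (P, Q, \<phi> \<oplus>\<^bsub>RB R (K \<times>\<times> (P \<boxtimes> Q))\<^esub> \<psi>, m, n) =
    day_class R \<S> \<S> K (P, Q, \<phi>, m, n) \<oplus>\<^bsub>day_obj R \<S> \<S> K\<^esub> day_class R \<S> \<S> K (P, Q, \<psi>, m, n)"
proof -
  note E = day_rels_carrier[OF K]
  have t: "(P, Q, \<psi>, m, n) \<in> day_gens R \<S> \<S> K" using s \<psi> by (simp add: day_gens_iff)
  have "(free_gen R (P, Q, \<phi> \<oplus>\<^bsub>RB R (K \<times>\<times> (P \<boxtimes> Q))\<^esub> \<psi>, m, n),
      free_gen R (P, Q, \<phi>, m, n) \<oplus>\<^bsub>F K\<^esub> free_gen R (P, Q, \<psi>, m, n)) \<in> day_rels R \<S> \<S> K"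
    unfolding day_rels_def Let_def
    by (rule UnI1, rule UnI1, rule UnI1, rule UnI1, rule UnI1, rule UnI1, intro CollectI exI conjI, rule refl) (fact s, fact \<psi>)
  from presented_rel[OF R E this] show ?thesis
    unfolding day_class_def day_obj_def presented_gen_eq_proj[OF R E]
    by (simp add: linear_mapD(2)[OF presented_proj_linear[OF R E]] free_gen_carrier[OF R] s t)
qed

lemma day_class_smult:
  assumes K: "fgroup K" and s: "(P, Q, \<phi>, m, n) \<in> day_gens R \<S> \<S> K" and r: "r \<in> carrier R"
  shows "day_class R \<S> \<S> K (P, Q, r \<odot>\<^bsub>RB R (K \<times>\<times> (P \<boxtimes> Q))\<^esub> \<phi>, m, n) =
    r \<odot>\<^bsub>day_obj R \<S> \<S> K\<^esub> day_class R \<S> \<S> K (P, Q, \<phi>, m, n)"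
proof -
  note E = day_rels_carrier[OF K]
  have "(free_gen R (P, Q, r \<odot>\<^bsub>RB R (K \<times>\<times> (P \<boxtimes> Q))\<^esub> \<phi>, m, n),
      r \<odot>\<^bsub>F K\<^esub> free_gen R (P, Q, \<phi>, m, n)) \<in> day_rels R \<S> \<S> K"
    unfolding day_rels_def Let_def
    by (rule UnI1, rule UnI1, rule UnI1, rule UnI2, intro CollectI exI conjI, rule refl) (fact s, fact r)
  from presented_rel[OF R E this] show ?thesis
    unfolding day_class_def day_obj_def presented_gen_eq_proj[OF R E]
    by (simp add: linear_mapD(3)[OF presented_proj_linear[OF R E]] free_gen_carrier[OF R] s r)
qed

lemma day_class_coend:
  assumes K: "fgroup K" and a: "fgroup P" "fgroup Q" "fgroup P'" "fgroup Q'" "\<phi> \<in> carrier (RB R (K \<times>\<times> (P' \<boxtimes> Q')))"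
      "\<alpha> \<in> carrier (RB R (P' \<times>\<times> P))" "\<beta> \<in> carrier (RB R (Q' \<times>\<times> Q))"
      "m \<in> carrier (RB R (P \<times>\<times> G))" "n \<in> carrier (RB R (Q \<times>\<times> G))"
  shows "day_class R \<S> \<S> K (P, Q, RB_comp R K (P' \<boxtimes> Q') (P \<boxtimes> Q) \<phi> (mor_times R P P' Q Q' \<alpha> \<beta>), m, n) =
    day_class R \<S> \<S> K (P', Q', \<phi>, RB_comp R P' P G \<alpha> m, RB_comp R Q' Q G \<beta> n)"
proof -
  note E = day_rels_carrier[OF K]
  have "(free_gen R (P, Q, RB_comp R K (P' \<boxtimes> Q') (P \<boxtimes> Q) \<phi> (mor_times R P P' Q Q' \<alpha> \<beta>), m, n),
      free_gen R (P', Q', \<phi>, fmor \<S> P P' \<alpha> m, fmor \<S> Q Q' \<beta> n)) \<in> day_rels R \<S> \<S> K"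
    unfolding day_rels_def Let_def
    by (rule UnI2, intro CollectI exI conjI, rule refl) (use a in \<open>simp_all add: fin_groups_iff RB_shift_simps\<close>)
  from presented_rel[OF R E this] show ?thesis
    unfolding day_class_def presented_gen_eq_proj[OF R E]
    using fmor_shift(1)[OF a(1,3,6,8)] fmor_shift(1)[OF a(2,4,7,9)] by simp
qed

lemma day_inv_linear:
  assumes K: "fgroup K"
  shows "linear_map R (RB R (K \<times>\<times> GG)) (day_obj R \<S> \<S> K) (day_inv K)"
proof -
  note l = Tr_linear[OF R K grel_\<iota>2]
  show ?thesis
    by (rule linear_mapI)
      (simp_all add: day_class_closed day_inv_gen K day_inv_def linear_mapD(2,3)[OF l] day_class_add[OF K day_inv_gen[OF K]]
        day_class_smult[OF K day_inv_gen[OF K]] linear_mapD(1)[OF l])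
qed

lemma day_map_inv:
  assumes K: "fgroup K" and w: "w \<in> carrier (RB R (K \<times>\<times> GG))"
  shows "day_map K (day_inv K w) = w"
  unfolding day_inv_def day_map_class[OF K day_inv_gen[OF K w]] pq_hom[OF R G \<Gamma> \<iota>]
  by (rule comp_Tr_hom[OF R K fgroup_box[OF \<Gamma> \<Gamma>] GG \<iota>2_hom w])

text \<open>By the coend relation \<open>\<phi> \<otimes> m \<otimes> n\<close> is moved to \<open>\<Gamma> \<cong> G\<close>, since \<open>m = \<alpha> u\<close> for the morphism
  \<open>\<alpha> : \<Gamma> \<rightarrow> P\<close> which \<open>m \<in> RB(P \<times> G)\<close> itself represents.\<close>

lemma day_inv_map:
  assumes K: "fgroup K" and C: "C \<in> carrier (day_obj R \<S> \<S> K)"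
  shows "day_inv K (day_map K C) = C"
proof (rule presented_ext[OF R day_rels_carrier[OF K], folded day_obj_def day_class_def])
  show "module R (day_obj R \<S> \<S> K)" by (rule day_obj_module[OF K])
  show "linear_map R (day_obj R \<S> \<S> K) (day_obj R \<S> \<S> K) (\<lambda>C. day_inv K (day_map K C))"
    by (rule linear_map_comp[OF day_map_linear[OF K] day_inv_linear[OF K]])
  show "linear_map R (day_obj R \<S> \<S> K) (day_obj R \<S> \<S> K) (\<lambda>C. C)" by (rule linear_map_id)
  show "C \<in> carrier (day_obj R \<S> \<S> K)" by (rule C)
  fix s assume s: "s \<in> day_gens R \<S> \<S> K"
  obtain P Q \<phi> m n where [simp]: "s = (P, Q, \<phi>, m, n)" by (cases s) auto
  have P: "fgroup P" and Q: "fgroup Q" and \<phi>: "\<phi> \<in> carrier (RB R (K \<times>\<times> (P \<boxtimes> Q)))" and m: "m \<in> carrier (RB R (P \<times>\<times> G))"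
    and n: "n \<in> carrier (RB R (Q \<times>\<times> G))" using s by (simp_all add: day_gens_iff)
  note g = grel_hom_rels(1)[OF G \<Gamma> \<iota>(1)]
  let ?\<alpha> = "Tr R P \<Gamma> G (hom_rel G \<iota>) m" and ?\<beta> = "Tr R Q \<Gamma> G (hom_rel G \<iota>) n"
  have "Tr R K (\<Gamma> \<boxtimes> \<Gamma>) GG (hom_rel GG (\<iota>2 \<iota>)) (RB_comp R K (P \<boxtimes> Q) GG \<phi> (pq R G P Q m n)) =
      RB_comp R K (P \<boxtimes> Q) (\<Gamma> \<boxtimes> \<Gamma>) \<phi> (mor_times R \<Gamma> P \<Gamma> Q ?\<alpha> ?\<beta>)"
    unfolding mor_times_hom[OF R G \<Gamma> \<iota> P Q m n]
    by (rule comp_Tr[OF R K fgroup_box[OF P Q] fgroup_box[OF \<Gamma> \<Gamma>] GG grel_\<iota>2 \<phi> pq_closed[OF R P Q G m n], symmetric])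
  hence "day_inv K (day_map K (day_class R \<S> \<S> K s)) =
      day_class R \<S> \<S> K (\<Gamma>, \<Gamma>, RB_comp R K (P \<boxtimes> Q) (\<Gamma> \<boxtimes> \<Gamma>) \<phi> (mor_times R \<Gamma> P \<Gamma> Q ?\<alpha> ?\<beta>), u, u)"
    using s by (simp add: day_map_class[OF K] day_inv_def)
  also have "\<dots> = day_class R \<S> \<S> K (P, Q, \<phi>, RB_comp R P \<Gamma> G ?\<alpha> u, RB_comp R Q \<Gamma> G ?\<beta> u)"
    by (rule day_class_coend[OF K \<Gamma> \<Gamma> P Q \<phi> Tr_closed[OF R P g m] Tr_closed[OF R Q g n] u_closed u_closed])
  also have "\<dots> = day_class R \<S> \<S> K s"
    by (simp add: comp_Tr_hom[OF R P \<Gamma> G \<iota> m] comp_Tr_hom[OF R Q \<Gamma> G \<iota> n])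
  finally show "day_inv K (day_map K (day_class R \<S> \<S> K s)) = day_class R \<S> \<S> K s" .
qed

text \<open>Equalities in the tensor square, whose elements are cosets, may be checked in
  \<open>RB(K \<times> G \<times> G)\<close>; the section is shown to be a bimodule morphism in this
  way.\<close>

lemma day_map_inj:
  assumes "fgroup K" "C \<in> carrier (day_obj R \<S> \<S> K)" "D \<in> carrier (day_obj R \<S> \<S> K)" "day_map K C = day_map K D"
  shows "C = D"
  using day_inv_map[OF assms(1,2)] unfolding assms(4) day_inv_map[OF assms(1,3)] by (rule sym)

lemma section_bimod_hom:
  assumes y: "y \<in> carrier (RB R G)"
  shows "bimod_hom R \<S> (regular_bimod \<S>) (tensor_square R \<S>) (\<lambda>K m. day_inv K (dot R K G m y))"
proof -
  have t: "fobj (tensor_square R \<S>) = day_obj R \<S> \<S>" "fmor (tensor_square R \<S>) = day_mor R \<S> \<S>"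
    by (simp_all add: tensor_square_def)
  note dc = linear_mapD(1)[OF dot_linear[OF R _ G y]]
  note ic = day_inv_closed[OF _ dc] and mi = day_map_inv[OF _ dc]
  show ?thesis
    unfolding bimod_hom_def fin_groups_iff regular_bimod_def bimod.simps biset_fun.simps t RB_shift_simps
  proof (intro conjI ballI)
    fix H assume "H \<in> fin_groups"
    hence H: "fgroup H" by (simp add: fin_groups_iff)
    show "linear_map R (RB R (H \<times>\<times> G)) (day_obj R \<S> \<S> H) (\<lambda>m. day_inv H (dot R H G m y))"
      by (rule linear_map_comp[OF dot_linear[OF R H G y] day_inv_linear[OF H]])
  next
    fix H K \<alpha> m assume "H \<in> fin_groups" "K \<in> fin_groups"
      and \<alpha>: "\<alpha> \<in> carrier (RB R (K \<times>\<times> H))" and m: "m \<in> carrier (RB R (H \<times>\<times> G))"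
    hence H: "fgroup H" and K: "fgroup K" by (simp_all add: fin_groups_iff)
    note f = fmor_shift[OF H K \<alpha> m]
    show "day_inv K (dot R K G (fmor \<S> H K \<alpha> m) y) = day_mor R \<S> \<S> H K \<alpha> (day_inv H (dot R H G m y))"
      unfolding f(1) using day_map_mor[OF H K \<alpha> ic[OF H H m]] dot_comp[OF R K H G y \<alpha> m]
        ic[OF K K f(2)] mi[OF K K f(2)]
      by (intro day_map_inj[OF K]) (simp_all add: mi[OF H H m])
  next
    fix L K a m assume "L \<in> fin_groups" "K \<in> fin_groups"
      and a: "a \<in> carrier (RB R (L \<times>\<times> G))" and m: "m \<in> carrier (RB R (K \<times>\<times> G))"
    hence L: "fgroup L" and K: "fgroup K" and LK: "fgroup (L \<boxtimes> K)" and KL: "fgroup (K \<boxtimes> L)"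
      by (simp_all add: fin_groups_iff fgroup_box)
    note s1 = shift_closed[OF R L K G a m] and s2 = shift_closed[OF R K L G m a]
    show "day_inv (L \<boxtimes> K) (dot R (L \<boxtimes> K) G (gmult \<S> L K a m) y) =
        lact (tensor_square R \<S>) L K a (day_inv K (dot R K G m y))"
      using day_map_lact[OF L K a ic[OF K K m]] dot_la(1)[OF R L K G y a m]
        ic[OF LK LK s1] mi[OF LK LK s1]
      by (intro day_map_inj[OF LK]) (simp_all add: mi[OF K K m])
    show "day_inv (K \<boxtimes> L) (dot R (K \<boxtimes> L) G (gmult \<S> K L m a) y) =
        ract (tensor_square R \<S>) K L (day_inv K (dot R K G m y)) a"
      using day_map_ract[OF L K a ic[OF K K m]] dot_la(2)[OF R L K G y a m]
        ic[OF KL KL s2] mi[OF KL KL s2]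
      by (intro day_map_inj[OF KL]) (simp_all add: mi[OF K K m])
  qed
qed

lemma separable_if_unit:
  assumes "[order G] \<cdot>\<^bsub>R\<^esub> \<one>\<^bsub>R\<^esub> \<in> Units R"
  shows "separable R \<S>"
proof -
  obtain y where y: "y \<in> carrier (RB R G)" and inv: "mulG R G y (RB_class R G (conj_gset G)) = RB_class R G pt_gset"
    using conj_gset_invertible[OF R G assms] by blast
  have "product_mor R \<S> K (day_inv K (dot R K G m y)) = m" if K: "fgroup K" and m: "m \<in> carrier (RB R (K \<times>\<times> G))" for K m
  proof -
    note dc = linear_mapD(1)[OF dot_linear[OF R K G y] m]
    show ?thesis
      using Tr_diag_dot[OF R K G y inv m] by (simp add: product_mor_eq K day_inv_closed dc day_map_inv)
  qed
  thus ?thesis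
    unfolding separable_def bimod_split_epi_def
    using green_RB_shift[OF R G] product_bimod_hom section_bimod_hom[OF y]
    by (intro conjI exI[of _ "\<lambda>K m. day_inv K (dot R K G m y)"]) (simp_all add: fin_groups_iff regular_bimod_def RB_shift_simps)
qed

lemma u_eq: "u = RBT R (\<Gamma> \<times>\<times> G) triv (hom_pt_rel G \<iota>) (RB_class R triv pt_gset)"
  by (rule RB_hom_eq[OF R G \<Gamma> \<iota>(1)])

text \<open>\<open>u\<close> is a point induced from the graph of \<open>\<iota>\<close>, and the
  left action ties its parameter to the first factor of \<open>G \<times> G\<close>; so multiplying
  by \<open>u\<close> induces \<open>e\<close> along
  \<open>(g, g') \<mapsto> (\<iota> g, g, g')\<close>. In \<open>unit_mor_ra\<close> the second
  factor is used.\<close>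

lemma unit_mor_la:
  assumes e: "e \<in> carrier (RB R (obj_unit \<times>\<times> GG))"
  shows "RB_comp R \<Gamma> (\<Gamma> \<boxtimes> obj_unit) GG (right_unit_mor R \<Gamma>) (la R G \<Gamma> obj_unit u e) =
    RBT R (\<Gamma> \<times>\<times> GG) (obj_unit \<times>\<times> GG)
      {((\<iota> g, (g, g')), (k, (g, g'))) | k g g'. k \<in> carrier obj_unit \<and> g \<in> carrier G \<and> g' \<in> carrier G} e"
    (is "?l = RBT R ?K ?D ?i e")
proof -
  let ?L = "(\<Gamma> \<boxtimes> obj_unit) \<times>\<times> GG" and ?A = "\<Gamma> \<times>\<times> G"
  let ?pt = "RB_class R triv pt_gset"
  have D: "fgroup ?D" and A: "fgroup ?A" and U: "fgroup (\<Gamma> \<boxtimes> obj_unit)" using G \<Gamma> by (simp_all add: fgroups)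
  note pt = pt_closed[OF R]
  note h = grel_hom_rels(2)[OF G \<Gamma> \<iota>(1)]
  note gl = grel_pq(2)[OF \<Gamma> fgroup_unit G] and gu = grel_unit[OF D]
  note gh = grel_prel[OF h grel_gid[OF D]]
  have g1: "grel ?K ?L (prel (hom_rel (\<Gamma> \<boxtimes> obj_unit) (fst \<circ> prod_decode)) (gid GG))"
    by (rule grel_prel[OF grel_hom_rels(1)[OF U \<Gamma> unit_homs(2)] grel_gid[OF GG]])
  \<comment> \<open>\<open>u\<close> enters through an induction, so the two maps are merged by
    fullness: \<open>lact_rel\<close> reaches every element of
    \<open>\<Gamma> \<times> G\<close>.\<close>
  have full: "gfull (?A \<times>\<times> ?D) (lact_rel \<Gamma> obj_unit G) (prel (hom_pt_rel G \<iota>) (gid ?D))"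
    unfolding gid_def
    by (rule gfull_prel_Id_right[OF gl h D]) (force simp: lact_rel_def obj_unit_def)
  let ?M = "rcomp (triv \<times>\<times> ?D) (rcomp (?A \<times>\<times> ?D) (lact_rel \<Gamma> obj_unit G) (prel (hom_pt_rel G \<iota>) (gid ?D))) (unit_rel ?D)"
  have "la R G \<Gamma> obj_unit u e =
      RBT R ?L (?A \<times>\<times> ?D) (lact_rel \<Gamma> obj_unit G)
        (RBT R (?A \<times>\<times> ?D) (triv \<times>\<times> ?D) (prel (hom_pt_rel G \<iota>) (gid ?D)) (RBT R (triv \<times>\<times> ?D) ?D (unit_rel ?D) e))"
    unfolding la_def u_eq RBX_RBT_left[OF R h D pt e] RBX_pt[OF R D e] ..
  also have "\<dots> = RBT R ?L (triv \<times>\<times> ?D) (rcomp (?A \<times>\<times> ?D) (lact_rel \<Gamma> obj_unit G) (prel (hom_pt_rel G \<iota>) (gid ?D)))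
      (RBT R (triv \<times>\<times> ?D) ?D (unit_rel ?D) e)"
    by (rule RBT_RBT_full[OF R gl gh RBT_closed[OF R gu e] full])
  also have "\<dots> = RBT R ?L ?D ?M e"
    by (rule RBT_RBT_left[OF R grel_rcomp[OF gl gh] gu e lsurj_rels(6)])
  finally have la: "la R G \<Gamma> obj_unit u e = RBT R ?L ?D ?M e" .
  have gM: "grel ?L ?D ?M" by (rule grel_rcomp[OF grel_rcomp[OF gl gh] gu])
  have "?l = RBT R ?K ?L (prel (hom_rel (\<Gamma> \<boxtimes> obj_unit) (fst \<circ> prod_decode)) (gid GG)) (RBT R ?L ?D ?M e)"
    unfolding right_unit_mor_def la
    by (rule RB_comp_hom[OF R U \<Gamma> GG unit_homs(2) RBT_closed[OF R gM e]])
  also have "\<dots> = RBT R ?K ?D (rcomp ?L (prel (hom_rel (\<Gamma> \<boxtimes> obj_unit) (fst \<circ> prod_decode)) (gid GG)) ?M) e"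
    by (rule RBT_RBT_right[OF R g1 gM e]) (auto simp: rel_defs Range_iff)
  also have "rcomp ?L (prel (hom_rel (\<Gamma> \<boxtimes> obj_unit) (fst \<circ> prod_decode)) (gid GG)) ?M = ?i"
    using hom_in_carrier[OF \<iota>(1)] by (auto simp: rel_defs obj_times_simps)
  finally show ?thesis .
qed

lemma unit_mor_ra:
  assumes e: "e \<in> carrier (RB R (obj_unit \<times>\<times> GG))"
  shows "RB_comp R \<Gamma> (obj_unit \<boxtimes> \<Gamma>) GG (left_unit_mor R \<Gamma>) (ra R G obj_unit \<Gamma> e u) =
    RBT R (\<Gamma> \<times>\<times> GG) (obj_unit \<times>\<times> GG)
      {((\<iota> g', (g, g')), (k, (g, g'))) | k g g'. k \<in> carrier obj_unit \<and> g \<in> carrier G \<and> g' \<in> carrier G} e"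
    (is "?l = RBT R ?K ?D ?i e")
proof -
  let ?L = "(obj_unit \<boxtimes> \<Gamma>) \<times>\<times> GG" and ?A = "\<Gamma> \<times>\<times> G"
  let ?pt = "RB_class R triv pt_gset"
  have D: "fgroup ?D" and A: "fgroup ?A" and U: "fgroup (obj_unit \<boxtimes> \<Gamma>)" using G \<Gamma> by (simp_all add: fgroups)
  note pt = pt_closed[OF R]
  note h = grel_hom_rels(2)[OF G \<Gamma> \<iota>(1)]
  note gl = grel_pq(3)[OF fgroup_unit \<Gamma> G] and gu = grel_rcomp[OF grel_swap[OF fgroup_triv D] grel_unit[OF D]]
  note gh = grel_prel[OF grel_gid[OF D] h]
  let ?U = "rcomp (triv \<times>\<times> ?D) (swap_rel triv ?D) (unit_rel ?D)"
  have sU: "lsurj (?D \<times>\<times> triv) ?U"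
    by (rule lsurj_rcomp[OF grel_swap[OF fgroup_triv D] lsurj_rels(5) lsurj_rels(6)])
  have g1: "grel ?K ?L (prel (hom_rel (obj_unit \<boxtimes> \<Gamma>) (snd \<circ> prod_decode)) (gid GG))"
    by (rule grel_prel[OF grel_hom_rels(1)[OF U \<Gamma> unit_homs(1)] grel_gid[OF GG]])
  have full: "gfull (?D \<times>\<times> ?A) (ract_rel obj_unit \<Gamma> G) (prel (gid ?D) (hom_pt_rel G \<iota>))"
    unfolding gid_def
    by (rule gfull_prel_Id_left[OF gl h D]) (force simp: ract_rel_def obj_unit_def)
  let ?M = "rcomp (?D \<times>\<times> triv) (rcomp (?D \<times>\<times> ?A) (ract_rel obj_unit \<Gamma> G) (prel (gid ?D) (hom_pt_rel G \<iota>))) ?U"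
  have "ra R G obj_unit \<Gamma> e u =
      RBT R ?L (?D \<times>\<times> ?A) (ract_rel obj_unit \<Gamma> G)
        (RBT R (?D \<times>\<times> ?A) (?D \<times>\<times> triv) (prel (gid ?D) (hom_pt_rel G \<iota>)) (RBT R (?D \<times>\<times> triv) ?D ?U e))"
    unfolding ra_def u_eq RBX_RBT_right[OF R h D pt e] RBX_pt_right[OF R D e] ..
  also have "\<dots> = RBT R ?L (?D \<times>\<times> triv) (rcomp (?D \<times>\<times> ?A) (ract_rel obj_unit \<Gamma> G) (prel (gid ?D) (hom_pt_rel G \<iota>)))
      (RBT R (?D \<times>\<times> triv) ?D ?U e)"
    by (rule RBT_RBT_full[OF R gl gh RBT_closed[OF R gu e] full])
  also have "\<dots> = RBT R ?L ?D ?M e"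
    by (rule RBT_RBT_left[OF R grel_rcomp[OF gl gh] gu e sU])
  finally have ra: "ra R G obj_unit \<Gamma> e u = RBT R ?L ?D ?M e" .
  have gM: "grel ?L ?D ?M" by (rule grel_rcomp[OF grel_rcomp[OF gl gh] gu])
  have "?l = RBT R ?K ?L (prel (hom_rel (obj_unit \<boxtimes> \<Gamma>) (snd \<circ> prod_decode)) (gid GG)) (RBT R ?L ?D ?M e)"
    unfolding left_unit_mor_def ra
    by (rule RB_comp_hom[OF R U \<Gamma> GG unit_homs(1) RBT_closed[OF R gM e]])
  also have "\<dots> = RBT R ?K ?D (rcomp ?L (prel (hom_rel (obj_unit \<boxtimes> \<Gamma>) (snd \<circ> prod_decode)) (gid GG)) ?M) e"
    by (rule RBT_RBT_right[OF R g1 gM e]) (auto simp: rel_defs Range_iff)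
  also have "rcomp ?L (prel (hom_rel (obj_unit \<boxtimes> \<Gamma>) (snd \<circ> prod_decode)) (gid GG)) ?M = ?i"
    using hom_in_carrier[OF \<iota>(1)] by (auto simp: rel_defs obj_times_simps)
  finally show ?thesis .
qed

text \<open>Up to the unit isomorphisms \<open>u\<close> is both \<open>u 1\<close> and
  \<open>1 u\<close>, so a section sends it to the left and to the right multiple of the same
  element, the image of the unit. Equating the two gives the hypothesis \<open>eq\<close> of
  \<open>forward_unit\<close>.\<close>

lemma unit_if_separable:
  assumes "separable R \<S>"
  shows "[order G] \<cdot>\<^bsub>R\<^esub> \<one>\<^bsub>R\<^esub> \<in> Units R"
proof -
  obtain s where s: "bimod_hom R \<S> (regular_bimod \<S>) (tensor_square R \<S>) s"
    and \<mu>: "\<And>H n. H \<in> fin_groups \<Longrightarrow> n \<in> carrier (fobj (regular_bimod \<S>) H) \<Longrightarrow> product_mor R \<S> H (s H n) = n"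
    using assms unfolding separable_def bimod_split_epi_def by blast
  have t: "fobj (tensor_square R \<S>) = day_obj R \<S> \<S>" "fmor (tensor_square R \<S>) = day_mor R \<S> \<S>"
    by (simp_all add: tensor_square_def)
  note s' = s[unfolded bimod_hom_def regular_bimod_def bimod.simps biset_fun.simps t RB_shift_simps]
  have sc: "s H n \<in> carrier (day_obj R \<S> \<S> H)" if "fgroup H" "n \<in> carrier (RB R (H \<times>\<times> G))" for H n
    using bspec[OF conjunct1[OF s'], of H] that by (simp add: fin_groups_iff linear_mapD(1))
  have sm: "s K (fmor \<S> H K \<alpha> m) = day_mor R \<S> \<S> H K \<alpha> (s H m)"
    if "fgroup H" "fgroup K" "\<alpha> \<in> carrier (RB R (K \<times>\<times> H))" "m \<in> carrier (RB R (H \<times>\<times> G))" for H K \<alpha> m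
    using conjunct1[OF conjunct2[OF s']] that by (simp add: fin_groups_iff)
  have sa: "s (L \<boxtimes> K) (gmult \<S> L K a m) = lact (tensor_square R \<S>) L K a (s K m)"
    "s (K \<boxtimes> L) (gmult \<S> K L m a) = ract (tensor_square R \<S>) K L (s K m) a"
    if "fgroup L" "fgroup K" "a \<in> carrier (RB R (L \<times>\<times> G))" "m \<in> carrier (RB R (K \<times>\<times> G))" for L K a m
    using bspec[OF bspec[OF bspec[OF bspec[OF conjunct2[OF conjunct2[OF s']]]]], of L K a m] that
    by (simp_all only: fin_groups_iff)
  note one = gunit_eq(2)[OF R G]
  define e where "e = day_map obj_unit (s obj_unit (gunit \<S>))"
  note sone = sc[OF fgroup_unit one]
  have e: "e \<in> carrier (RB R (obj_unit \<times>\<times> GG))" unfolding e_def by (rule day_map_closed[OF fgroup_unit sone])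
  have unit: "Tr R obj_unit G GG (diag_rel G) e = gunit \<S>"
    using \<mu>[of obj_unit "gunit \<S>"] one
    by (simp add: e_def fin_groups_iff fgroup_unit regular_bimod_def RB_shift_simps product_mor_eq[OF fgroup_unit sone])
  have U: "fgroup (\<Gamma> \<boxtimes> obj_unit)" "fgroup (obj_unit \<boxtimes> \<Gamma>)" by (simp_all add: fgroups \<Gamma>)
  note x1 = shift_closed[OF R \<Gamma> fgroup_unit G u_closed one] and x2 = shift_closed[OF R fgroup_unit \<Gamma> G one u_closed]
  note m1 = unit_mor_closed(2)[OF R \<Gamma>] and m2 = unit_mor_closed(1)[OF R \<Gamma>]
  have "day_map \<Gamma> (s \<Gamma> u) = RB_comp R \<Gamma> (\<Gamma> \<boxtimes> obj_unit) GG (right_unit_mor R \<Gamma>) (la R G \<Gamma> obj_unit u e)"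
    unfolding sm[OF U(1) \<Gamma> m1 x1, unfolded fmor_shift(1)[OF U(1) \<Gamma> m1 x1] shift_unit(2)[OF R \<Gamma> G u_closed]]
    unfolding day_map_mor(1)[OF U(1) \<Gamma> m1 sc[OF U(1) x1]]
    unfolding sa(1)[OF \<Gamma> fgroup_unit u_closed one]
      day_map_lact(1)[OF \<Gamma> fgroup_unit u_closed sone] e_def ..
  moreover have "day_map \<Gamma> (s \<Gamma> u) = RB_comp R \<Gamma> (obj_unit \<boxtimes> \<Gamma>) GG (left_unit_mor R \<Gamma>) (ra R G obj_unit \<Gamma> e u)"
    unfolding sm[OF U(2) \<Gamma> m2 x2, unfolded fmor_shift(1)[OF U(2) \<Gamma> m2 x2] shift_unit(1)[OF R \<Gamma> G u_closed]]
    unfolding day_map_mor(1)[OF U(2) \<Gamma> m2 sc[OF U(2) x2]]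
    unfolding sa(2)[OF \<Gamma> fgroup_unit u_closed one]
      day_map_ract(1)[OF \<Gamma> fgroup_unit u_closed sone] e_def ..
  ultimately show ?thesis
    by (intro forward_unit[OF R G \<Gamma> \<iota> e refl refl _ unit]) (simp add: unit_mor_la[OF e] unit_mor_ra[OF e])
qed

end

end

theorem theorem3p10:
  fixes R :: "'r ring" and G :: "'g monoid"
  assumes "cring R" and "group G" and "finite (carrier G)"
  shows "separable R (RB_shift R G) \<longleftrightarrow> [order G] \<cdot>\<^bsub>R\<^esub> \<one>\<^bsub>R\<^esub> \<in> Units R"
proof -
  have G: "fgroup G" using assms(2,3) by (simp add: fgroup_def)
  obtain \<Gamma> :: obj and \<iota> where "fgroup \<Gamma>" "\<iota> \<in> hom G \<Gamma>" "bij_betw \<iota> (carrier G) (carrier \<Gamma>)"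
    by (rule obj_of_group[OF G])
  note i = assms(1) G this
  show ?thesis by (rule iffI) (erule unit_if_separable[OF i], erule separable_if_unit[OF i])
qed

end
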